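(* Let $\bar u$ be a strongly stable solution of the problem of minimising $\mathcal E$ locally over $\dot{\mathcal W}^{1,2}$, i.e. $\bar u\in\dot{\mathcal W}^{1,2}$, $\delta\mathcal E(\bar u)=0$, and there is $c_0>0$ with $\langle\delta^2\mathcal E(\bar u)v,v\rangle\ge c_0\|\nabla v\|_{L^2}^2$ for all $v\in\dot{\mathcal W}^{\rm c}$. Then there exist $C,R_0>0$ such that, for all domains $\Omega_R\subset\Lambda$ with $B_R\cap\Lambda\subset\Omega_R$ and $R\ge R_0$, there exists a strongly stable solution $u_R^{\rm lin}$ of $$u^{\rm lin}_R\in\arg\min\{\mathcal E_R^{\rm lin}(u):u\in\dot{\mathcal W}^{1,2}\}$$ ($\arg\min$ denoting local minimisers) satisfying $$\|\nabla u_R^{\rm lin}-\nabla\bar u\|_{L^2}\le CR^{-3d/2}\qquad\text{and}\qquad|\mathcal E(u_R^{\rm lin})-\mathcal E(\bar u)|\le CR^{-2d}.$$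
   Context: Setting (point defect). Let $d\in\{2,3\}$, $A\in\mathbb R^{d\times d}$ nonsingular, $B_r$ the ball of radius $r$ centred at $0$. The reference configuration $\Lambda\subset\mathbb R^d$ satisfies, for some $R_{\rm def}>0$, $\Lambda\setminus B_{R_{\rm def}}=A\mathbb Z^d\setminus B_{R_{\rm def}}$ and $\Lambda\cap B_{R_{\rm def}}$ is finite. $\mathcal T_\Lambda$ is a regular partition of $\mathbb R^d$ into triangles ($d=2$) or tetrahedra ($d=3$) with node set $\Lambda$, homogeneous outside $B_{R_{\rm def}}$: if $T\in\mathcal T_\Lambda$, $\rho\in A\mathbb Z^d$ and $T,\rho+T\subset\mathbb R^d\setminus B_{R_{\rm def}}$, then $\rho+T\in\mathcal T_\Lambda$. For $u:\Lambda\to\mathbb R^d$, $Iu$ is its continuous piecewise affine interpolant with respect to $\mathcal T_\Lambda$ and $\nabla u:=\nabla Iu$. Define $\dot{\mathcal W}^{\rm c}:=\{u:\Lambda\to\mathbb R^d:\ \mathrm{supp}(\nabla u)\text{ compact}\}$ and $\dot{\mathcal W}^{1,2}:=\{u:\Lambda\to\mathbb R^d:\ \nabla u\in L^2\}$ (with semi-norm $\|\nabla u\|_{L^2}$). Stencils: for each $\ell\in\Lambda$ a set $\mathcal R_\ell\subset(B_{r_{\rm cut}}\cap(\Lambda-\ell))\setminus\{0\}$ is given, $r_{\rm cut}>0$ fixed; $D_\rho u(\ell):=u(\ell+\rho)-u(\ell)$, $Du(\ell):=(D_\rho u(\ell))_{\rho\in\mathcal R_\ell}$. If $(\ell,\ell+\rho)$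 is an edge of $\mathcal T_\Lambda$ then $\rho\in\mathcal R_\ell$. Energy: $V_\ell\in C^k((\mathbb R^d)^{\mathcal R_\ell})$, $k\ge4$, with $V_\ell(0)=0$. For $|\ell|\ge R_{\rm def}$: $\mathcal R_\ell\equiv\mathcal R$, $V_\ell\equiv V$, and point symmetry holds: $-\mathcal R=\mathcal R$ and $V((-g_{-\rho})_{\rho\in\mathcal R})=V(g)$ for all $g\in(\mathbb R^d)^{\mathcal R}$. Moreover $Ae_n\in\mathcal R$, $n=1,\dots,d$. $\mathcal E(u):=\sum_{\ell\in\Lambda}V_\ell(Du(\ell))$ for $u\in\dot{\mathcal W}^{\rm c}$; $\mathcal E$ has a unique continuous extension to $\dot{\mathcal W}^{1,2}$, also denoted $\mathcal E$, which is of class $C^k$. Linearised far field: for $R\ge R_{\rm def}$ and $B_R\cap\Lambda\subset\Omega_R\subset\Lambda$, let $V^{\rm lin}(g):=V(0)+\langle\delta V(0),g\rangle+\tfrac12\langle\delta^2V(0)g,g\rangle$ and $$\mathcal E_R^{\rm lin}(u):=\sum_{\ell\in\Omega_R}V_\ell(Du(\ell))+\sum_{\ell\in\Lambda\setminus\Omega_R}V^{\rm lin}(Du(\ell)),$$ defined for $u\in\dot{\mathcal W}^{\rm c}$ and extended by continuity to $\dot{\mathcal W}^{1,2}$ (the extension is of class $C^k$). "Strongly stable solution" $u_R^{\rm lin}$ means $\delta\mathcal E_R^{\rm lin}(u_R^{\rm lin})=0$ and $\langle\delta^2\mathcal E_R^{\rm lin}(u_R^{\rm lin})v,v\rangle\ge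 c\|\nabla v\|_{L^2}^2$ for all $v\in\dot{\mathcal W}^{\rm c}$, for some $c>0$. *)

theory Defs
  imports "HOL-Analysis.Analysis"
begin

section \<open>Reference configuration and mesh\<close>

definition bravais_lattice :: "real^'d^'d \<Rightarrow> (real^'d) set" where
  "bravais_lattice A = {A *v z | z. \<forall>i. z $ i \<in> \<int>}"

definition reference_configuration :: "real^'d^'d \<Rightarrow> real \<Rightarrow> (real^'d) set \<Rightarrow> bool" where
  "reference_configuration A Rdef \<Lambda> \<longleftrightarrow>
     \<Lambda> - ball 0 Rdef = bravais_lattice A - ball 0 Rdef \<and> finite (\<Lambda> \<inter> ball 0 Rdef)"

text \<open>Regular (i.e. conforming) partition of the whole space into \<open>d\<close>-simplices with node set
  \<open>\<Lambda>\<close>. The library notion \<open>triangulation\<close> is not applicable, as it is restricted to finite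
  families.\<close>

definition regular_partition :: "(real^'d) set set \<Rightarrow> (real^'d) set \<Rightarrow> bool" where
  "regular_partition \<T> \<Lambda> \<longleftrightarrow>
     (\<forall>T\<in>\<T>. int CARD('d) simplex T) \<and>
     \<Union>\<T> = UNIV \<and>
     (\<forall>T\<in>\<T>. \<forall>T'\<in>\<T>. (T \<inter> T') face_of T \<and> (T \<inter> T') face_of T') \<and>
     {x. \<exists>T\<in>\<T>. x extreme_point_of T} = \<Lambda>"

definition homogeneous_outside :: "real^'d^'d \<Rightarrow> real \<Rightarrow> (real^'d) set set \<Rightarrow> bool" where
  "homogeneous_outside A Rdef \<T> \<longleftrightarrow>
     (\<forall>T\<in>\<T>. \<forall>\<rho>\<in>bravais_lattice A.
        T \<subseteq> - ball 0 Rdef \<and> (+) \<rho> ` T \<subseteq> - ball 0 Rdef \<longrightarrow> (+) \<rho> ` T \<in> \<T>)"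


section \<open>Lattice functions and their energy spaces\<close>

text \<open>A lattice function \<open>\<Lambda> \<rightarrow> \<real>\<^sup>d\<close> is represented by a total function of which only the values on
  \<open>\<Lambda>\<close> are ever used.\<close>

type_synonym 'd vfun = "real^'d \<Rightarrow> real^'d"

definition interpolant :: "(real^'d) set set \<Rightarrow> (real^'d) set \<Rightarrow> 'd vfun \<Rightarrow> 'd vfun" where
  "interpolant \<T> \<Lambda> u =
     (THE f. continuous_on UNIV f \<and>
             (\<forall>T\<in>\<T>. \<exists>M b. \<forall>x\<in>T. f x = M *v x + b) \<and>
             (\<forall>l\<in>\<Lambda>. f l = u l))"

text \<open>The interpolant is differentiable off a null set (contained in the union of the simplex
  boundaries); at the exceptional points the gradient is set to zero.\<close>

definition grad :: "(real^'d) set set \<Rightarrow> (real^'d) set \<Rightarrow> 'd vfun \<Rightarrow> real^'d \<Rightarrow> real^'d^'d" where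
  "grad \<T> \<Lambda> u x =
     (if interpolant \<T> \<Lambda> u differentiable (at x)
      then jacobian (interpolant \<T> \<Lambda> u) (at x) else 0)"

definition L2_norm :: "(real^'d \<Rightarrow> real^'d^'d) \<Rightarrow> real" where
  "L2_norm G = sqrt (LINT x|lebesgue. (norm (G x))\<^sup>2)"

definition W_c :: "(real^'d) set set \<Rightarrow> (real^'d) set \<Rightarrow> 'd vfun set" where
  "W_c \<T> \<Lambda> = {u. compact (closure {x. grad \<T> \<Lambda> u x \<noteq> 0})}"

definition W_12 :: "(real^'d) set set \<Rightarrow> (real^'d) set \<Rightarrow> 'd vfun set" where
  "W_12 \<T> \<Lambda> = {u. grad \<T> \<Lambda> u \<in> borel_measurable lebesgue \<and>
                    integrable lebesgue (\<lambda>x. (norm (grad \<T> \<Lambda> u x))\<^sup>2)}"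

definition W_norm :: "(real^'d) set set \<Rightarrow> (real^'d) set \<Rightarrow> 'd vfun \<Rightarrow> real" where
  "W_norm \<T> \<Lambda> u = L2_norm (grad \<T> \<Lambda> u)"


section \<open>Calculus on a semi-normed space of lattice functions\<close>

text \<open>Throughout, \<open>W\<close> is a linear space of lattice functions and \<open>p\<close> a semi-norm on it.\<close>

definition continuous_wrt :: "('d::finite) vfun set \<Rightarrow> ('d vfun \<Rightarrow> real) \<Rightarrow> ('d vfun \<Rightarrow> real) \<Rightarrow> bool" where
  "continuous_wrt W p F \<longleftrightarrow>
     (\<forall>u\<in>W. \<forall>\<epsilon>>0. \<exists>\<delta>>0. \<forall>v\<in>W. p (\<lambda>x. v x - u x) < \<delta> \<longrightarrow> \<bar>F v - F u\<bar> < \<epsilon>)"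

definition bounded_linear_form ::
    "('d::finite) vfun set \<Rightarrow> ('d vfun \<Rightarrow> real) \<Rightarrow> ('d vfun \<Rightarrow> real) \<Rightarrow> bool" where
  "bounded_linear_form W p L \<longleftrightarrow>
     (\<forall>v\<in>W. \<forall>w\<in>W. \<forall>a b. L (\<lambda>x. a *\<^sub>R v x + b *\<^sub>R w x) = a * L v + b * L w) \<and>
     (\<exists>K. \<forall>v\<in>W. \<bar>L v\<bar> \<le> K * p v)"

text \<open>\<open>L\<close> is the (Frechet) first variation of \<open>F\<close> at \<open>u\<close>.\<close>

definition has_first_variation ::
    "('d::finite) vfun set \<Rightarrow> ('d vfun \<Rightarrow> real) \<Rightarrow> ('d vfun \<Rightarrow> real) \<Rightarrow> 'd vfun \<Rightarrow> ('d vfun \<Rightarrow> real) \<Rightarrow> bool"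
  where
  "has_first_variation W p F u L \<longleftrightarrow>
     bounded_linear_form W p L \<and>
     (\<forall>\<epsilon>>0. \<exists>\<delta>>0. \<forall>v\<in>W. p v < \<delta> \<longrightarrow>
        \<bar>F (\<lambda>x. u x + v x) - F u - L v\<bar> \<le> \<epsilon> * p v)"

text \<open>\<open>B\<close> is the second variation of \<open>F\<close> at \<open>u\<close>: the Frechet derivative at \<open>u\<close>, in the dual norm, of
  the first variation \<open>L\<close>, which has to exist near \<open>u\<close>.\<close>

definition has_second_variation ::
    "('d::finite) vfun set \<Rightarrow> ('d vfun \<Rightarrow> real) \<Rightarrow> ('d vfun \<Rightarrow> real) \<Rightarrow> 'd vfun \<Rightarrow>
     ('d vfun \<Rightarrow> 'd vfun \<Rightarrow> real) \<Rightarrow> bool" where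
  "has_second_variation W p F u B \<longleftrightarrow>
     (\<forall>v\<in>W. bounded_linear_form W p (B v)) \<and>
     (\<forall>w\<in>W. bounded_linear_form W p (\<lambda>v. B v w)) \<and>
     (\<exists>K. \<forall>v\<in>W. \<forall>w\<in>W. \<bar>B v w\<bar> \<le> K * p v * p w) \<and>
     (\<exists>r>0. \<exists>L.
        (\<forall>w\<in>W. p (\<lambda>x. w x - u x) < r \<longrightarrow> has_first_variation W p F w (L w)) \<and>
        (\<forall>\<epsilon>>0. \<exists>\<delta>>0. \<forall>v\<in>W. p v < \<delta> \<longrightarrow>
           (\<forall>w\<in>W. \<bar>L (\<lambda>x. u x + v x) w - L u w - B v w\<bar> \<le> \<epsilon> * p v * p w)))"

definition continuous_extension ::
    "(real^'d) set set \<Rightarrow> (real^'d) set \<Rightarrow> ('d vfun \<Rightarrow> real) \<Rightarrow> ('d vfun \<Rightarrow> real)" where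
  "continuous_extension \<T> \<Lambda> F =
     (THE G. G \<in> extensional (W_12 \<T> \<Lambda>) \<and>
             continuous_wrt (W_12 \<T> \<Lambda>) (W_norm \<T> \<Lambda>) G \<and>
             (\<forall>u\<in>W_c \<T> \<Lambda>. G u = F u))"

definition strongly_stable ::
    "(real^'d) set set \<Rightarrow> (real^'d) set \<Rightarrow> ('d vfun \<Rightarrow> real) \<Rightarrow> 'd vfun \<Rightarrow> bool" where
  "strongly_stable \<T> \<Lambda> F u \<longleftrightarrow>
     u \<in> W_12 \<T> \<Lambda> \<and>
     has_first_variation (W_12 \<T> \<Lambda>) (W_norm \<T> \<Lambda>) F u (\<lambda>_. 0) \<and>
     (\<exists>B. has_second_variation (W_12 \<T> \<Lambda>) (W_norm \<T> \<Lambda>) F u B \<and>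
          (\<exists>c>0. \<forall>v\<in>W_c \<T> \<Lambda>. B v v \<ge> c * (W_norm \<T> \<Lambda> v)\<^sup>2))"

definition local_minimiser ::
    "(real^'d) set set \<Rightarrow> (real^'d) set \<Rightarrow> ('d vfun \<Rightarrow> real) \<Rightarrow> 'd vfun \<Rightarrow> bool" where
  "local_minimiser \<T> \<Lambda> F u \<longleftrightarrow>
     u \<in> W_12 \<T> \<Lambda> \<and>
     (\<exists>r>0. \<forall>v\<in>W_12 \<T> \<Lambda>. W_norm \<T> \<Lambda> (\<lambda>x. v x - u x) < r \<longrightarrow> F u \<le> F v)"


section \<open>Stencils and site potentials\<close>

text \<open>\<open>(\<real>\<^sup>d)\<^sup>S\<close> for a stencil \<open>S\<close> is represented by the functions vanishing off \<open>S\<close>. For finite \<open>S\<close>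
  the product topology of the function type induces the Euclidean topology on it.\<close>

definition stencil_space :: "(real^'d) set \<Rightarrow> 'd vfun set" where
  "stencil_space S = {g. \<forall>\<rho>. \<rho> \<notin> S \<longrightarrow> g \<rho> = 0}"

definition stencil_diff :: "(real^'d) set \<Rightarrow> 'd vfun \<Rightarrow> real^'d \<Rightarrow> 'd vfun" where
  "stencil_diff S u l = (\<lambda>\<rho>. if \<rho> \<in> S then u (l + \<rho>) - u l else 0)"

text \<open>\<open>dir_deriv f g h\<close> is \<open>\<langle>\<delta>f(g), h\<rangle>\<close>.\<close>

definition dir_deriv :: "(('d::finite) vfun \<Rightarrow> real) \<Rightarrow> 'd vfun \<Rightarrow> 'd vfun \<Rightarrow> real" where
  "dir_deriv f g h = deriv (\<lambda>t. f (\<lambda>\<rho>. g \<rho> + t *\<^sub>R h \<rho>)) 0"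

text \<open>\<open>f \<in> C\<^sup>k((\<real>\<^sup>d)\<^sup>S)\<close> for finite \<open>S\<close>: all iterated directional derivatives up to order \<open>k\<close> exist and
  are continuous.\<close>

primrec C_k :: "nat \<Rightarrow> (real^'d) set \<Rightarrow> ('d vfun \<Rightarrow> real) \<Rightarrow> bool" where
  "C_k 0 S f \<longleftrightarrow> continuous_on (stencil_space S) f"
| "C_k (Suc k) S f \<longleftrightarrow>
     continuous_on (stencil_space S) f \<and>
     (\<forall>h\<in>stencil_space S.
        (\<forall>g\<in>stencil_space S. (\<lambda>t. f (\<lambda>\<rho>. g \<rho> + t *\<^sub>R h \<rho>)) differentiable (at (0::real))) \<and>
        C_k k S (\<lambda>g. dir_deriv f g h))"

definition linearised_potential :: "(('d::finite) vfun \<Rightarrow> real) \<Rightarrow> 'd vfun \<Rightarrow> real" where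
  "linearised_potential V g =
     V (\<lambda>_. 0) + dir_deriv V (\<lambda>_. 0) g
     + 1/2 * dir_deriv (\<lambda>g'. dir_deriv V g' g) (\<lambda>_. 0) g"


section \<open>Energies\<close>

text \<open>On \<open>W_c\<close> the sums below have only finitely many nonzero terms.\<close>

definition energy_c ::
    "(real^'d) set \<Rightarrow> (real^'d \<Rightarrow> (real^'d) set) \<Rightarrow> (real^'d \<Rightarrow> 'd vfun \<Rightarrow> real) \<Rightarrow>
     'd vfun \<Rightarrow> real" where
  "energy_c \<Lambda> St V u = (\<Sum>\<^sub>\<infinity>l\<in>\<Lambda>. V l (stencil_diff (St l) u l))"

definition energy_lin_c ::
    "(real^'d) set \<Rightarrow> (real^'d \<Rightarrow> (real^'d) set) \<Rightarrow> (real^'d \<Rightarrow> 'd vfun \<Rightarrow> real) \<Rightarrow>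
     ('d vfun \<Rightarrow> real) \<Rightarrow> (real^'d) set \<Rightarrow> 'd vfun \<Rightarrow> real" where
  "energy_lin_c \<Lambda> St V Vhom \<Omega> u =
     (\<Sum>\<^sub>\<infinity>l\<in>\<Omega>. V l (stencil_diff (St l) u l))
     + (\<Sum>\<^sub>\<infinity>l\<in>\<Lambda> - \<Omega>. linearised_potential Vhom (stencil_diff (St l) u l))"

definition energy ::
    "(real^'d) set set \<Rightarrow> (real^'d) set \<Rightarrow> (real^'d \<Rightarrow> (real^'d) set) \<Rightarrow>
     (real^'d \<Rightarrow> 'd vfun \<Rightarrow> real) \<Rightarrow> 'd vfun \<Rightarrow> real" where
  "energy \<T> \<Lambda> St V = continuous_extension \<T> \<Lambda> (energy_c \<Lambda> St V)"

definition energy_lin ::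
    "(real^'d) set set \<Rightarrow> (real^'d) set \<Rightarrow> (real^'d \<Rightarrow> (real^'d) set) \<Rightarrow>
     (real^'d \<Rightarrow> 'd vfun \<Rightarrow> real) \<Rightarrow> ('d vfun \<Rightarrow> real) \<Rightarrow> (real^'d) set \<Rightarrow> 'd vfun \<Rightarrow> real" where
  "energy_lin \<T> \<Lambda> St V Vhom \<Omega> = continuous_extension \<T> \<Lambda> (energy_lin_c \<Lambda> St V Vhom \<Omega>)"

end

theory Submission
  imports Defs
begin

text \<open>
  Up to equivalence of norms everything takes place in the space of lattice functions with
  square-summable stencil differences. The sum of the linear parts \<open>\<langle>\<delta>V\<^sub>l(0), Du(l)\<rangle>\<close> reduces to finitely
  many sites near the defect, because on the homogeneous lattice it telescopes to zero; this extends
  the energies to functions of finite energy.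

  Translating test functions to infinity turns the strong stability of the equilibrium into
  coercivity of the Hessian \<open>Q\<close> of the homogeneous lattice. The Caccioppoli inequality, iterated on
  difference quotients, gives interior gradient estimates for \<open>Q\<close>-harmonic functions, hence (by
  duality) a kernel whose gradient decays like \<open>|l|\<^sup>-\<^sup>d\<close>. Testing the equilibrium with this kernel
  bounds \<open>Du(l)\<close> by \<open>|l|\<^sup>-\<^sup>d\<close> plus a sum over \<open>|Du|\<^sup>2\<close> times the kernel gradient, and comparing the suprema
  outside balls of radius \<open>r\<close> and \<open>r/2\<close> yields \<open>|Du(l)| \<le> C |l|\<^sup>-\<^sup>d\<close>.

  Consequently the residual of the equilibrium in the linearised problem is a tail sum over \<open>|Du|\<^sup>2\<close>, of
  order \<open>R\<^sup>-\<^sup>3\<^sup>d\<^sup>/\<^sup>2\<close>, and the Hessian is perturbed by at most \<open>C R\<^sup>-\<^sup>d\<close>. Minimising over a small ball around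
  the equilibrium, where the energy is uniformly convex, gives the solution; the energy error is
  quadratic in its distance to the equilibrium.
\<close>

text \<open>The interpolant and the extended energies are given by definite descriptions, and strong
  stability speaks of an unspecified second variation. Each is first identified with a concrete
  lattice sum, by existence and uniqueness; the extension is unique because functions with finitely
  many nonzero differences are dense, which itself rests on a Liouville theorem.

  Two lattices occur throughout: the defective one, where the equilibrium lives, and the Bravais
  lattice, which is translation invariant. They agree outside a ball; functions pass between them by
  overwriting the core with a constant, at the price of finitely many error terms.

  The exponent 3d/2 arises because the residual outside the nonlinear region is of size |l|^(-2d),
  and its l2 norm over |l| \<ge> R is R^(-2d) times R^(d/2). In the decay argument the far part of
  the sum is bounded by the supremum of one factor Du, the small l2 tail of the other and the l2
  norm of the kernel gradient; using suprema of both factors would meet the divergent sum of |m -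
  l|^(-d).\<close>

abbreviation fun_add (infixl ".+" 65) where "u .+ v \<equiv> (\<lambda>x. u x + v x)"
abbreviation fun_sub (infixl ".-" 65) where "u .- v \<equiv> (\<lambda>x. u x - v x)"
abbreviation "along g t h \<equiv> (\<lambda>x. g x + t *\<^sub>R h x)"
abbreviation "lcomb a u b v \<equiv> (\<lambda>x. a *\<^sub>R u x + b *\<^sub>R v x)"
abbreviation "zf \<equiv> (\<lambda>_. 0)"
abbreviation "stsp \<equiv> stencil_space"

section \<open>Square-summable families\<close>

definition l2 :: "'a set => ('a => real) => bool" where
	"l2 A f \<longleftrightarrow> (\<lambda>x. (f x)\<^sup>2) summable_on A"

definition n2 :: "'a set => ('a => real) => real" where
	"n2 A f = sqrt (\<Sum>\<^sub>\<infinity>x\<in>A. (f x)\<^sup>2)"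

lemma n2_nonneg [simp]: "0 \<le> n2 A f"
	unfolding n2_def by (simp add: infsum_nonneg)

lemma n2_sq: "(n2 A f)\<^sup>2 = (\<Sum>\<^sub>\<infinity>x\<in>A. (f x)\<^sup>2)"
	unfolding n2_def by (simp add: infsum_nonneg)

lemma L2_set_le_n2:
	assumes "l2 A f" "finite F" "F \<subseteq> A"
	shows "L2_set f F \<le> n2 A f"
	unfolding L2_set_def n2_def
	using assms by (intro real_sqrt_le_mono finite_sum_le_infsum) (auto simp: l2_def)

text \<open>Nonnegative sums are suprema of finite ones, so membership and norm bound come together
  from a bound uniform in \<open>F\<close>. Minkowski and Cauchy-Schwarz are thereby used on finite
  sets only.\<close>

lemma l2_boundedI:
	assumes "!!F. finite F ==> F \<subseteq> A ==> L2_set f F \<le> M"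
	shows "l2 A f" "n2 A f \<le> M"
proof -
	have M: "0 \<le> M" using assms[of "{}"] by simp
	have *: "(\<Sum>x\<in>F. (f x)\<^sup>2) \<le> M\<^sup>2" if "finite F" "F \<subseteq> A" for F
	proof -
		have "(\<Sum>x\<in>F. (f x)\<^sup>2) = (L2_set f F)\<^sup>2"
			unfolding L2_set_def by (simp add: sum_nonneg)
		also have "\<dots> \<le> M\<^sup>2" using assms[OF that] by (intro power_mono) auto
		finally show ?thesis .
	qed
	show l: "l2 A f" unfolding l2_def
		by (rule nonneg_bdd_above_summable_on) (auto intro!: bdd_aboveI2[where M="M\<^sup>2"] *)
	have "(\<Sum>\<^sub>\<infinity>x\<in>A. (f x)\<^sup>2) \<le> M\<^sup>2"
		using l by (intro infsum_le_finite_sums) (auto simp: l2_def *)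
	then show "n2 A f \<le> M" unfolding n2_def using M by (simp add: real_le_lsqrt)
qed

lemma l2_finite_support:
	assumes "finite {x\<in>A. f x \<noteq> 0}"
	shows "l2 A f"
proof -
	have "(\<lambda>x. (f x)\<^sup>2) summable_on {x\<in>A. f x \<noteq> 0}" using assms by simp
	then show ?thesis unfolding l2_def
		by (rule summable_on_cong_neutral[THEN iffD1, rotated -1]) auto
qed

text \<open>Minkowski's inequality in the form of a domination: \<open>dn\<close> is only
  subadditive in its function, so linear combinations of lattice functions are handled through an
  inequality rather than an identity.\<close>

lemma n2_le:
	assumes "l2 A f" "l2 A g" "0 \<le> a" "0 \<le> b"
		"!!x. x \<in> A ==> \<bar>h x\<bar> \<le> a * \<bar>f x\<bar> + b * \<bar>g x\<bar>"
	shows "l2 A h" "n2 A h \<le> a * n2 A f + b * n2 A g"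
proof -
	have "L2_set h F \<le> a * n2 A f + b * n2 A g" if F: "finite F" "F \<subseteq> A" for F
	proof -
		have "L2_set h F = L2_set (\<lambda>x. \<bar>h x\<bar>) F" by (simp add: L2_set_def)
		also have "\<dots> \<le> L2_set (\<lambda>x. a * \<bar>f x\<bar> + b * \<bar>g x\<bar>) F"
			using F assms by (intro L2_set_mono) auto
		also have "\<dots> \<le> L2_set (\<lambda>x. a * \<bar>f x\<bar>) F + L2_set (\<lambda>x. b * \<bar>g x\<bar>) F"
			by (rule L2_set_triangle_ineq)
		also have "\<dots> = a * L2_set f F + b * L2_set g F"
			using assms by (simp add: L2_set_right_distrib[symmetric]) (simp add: L2_set_def)
		also have "\<dots> \<le> a * n2 A f + b * n2 A g"
			using F assms by (intro add_mono mult_left_mono L2_set_le_n2) auto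
		finally show ?thesis .
	qed
	from l2_boundedI[OF this] show "l2 A h" "n2 A h \<le> a * n2 A f + b * n2 A g" by auto
qed

lemma l2_subset:
	assumes "l2 A f" "B \<subseteq> A"
	shows "l2 B f" "n2 B f \<le> n2 A f"
proof -
	show "l2 B f" using assms unfolding l2_def by (rule summable_on_subset_banach)
	then show "n2 B f \<le> n2 A f" using assms unfolding n2_def l2_def
		by (intro real_sqrt_le_mono infsum_mono2) auto
qed

lemma abs_le_n2:
	assumes "l2 A f" "x \<in> A"
	shows "\<bar>f x\<bar> \<le> n2 A f"
	using L2_set_le_n2[OF assms(1), of "{x}"] assms(2) by simp

text \<open>Cauchy-Schwarz. The lattice sums for energies and their variations have site terms
  dominated by a product of two stencil norms, so this one fact yields both their convergence and
  their bounds.\<close>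

lemma n2_product:
	assumes "l2 A f" "l2 A g" "0 \<le> c" "!!x. x \<in> A ==> \<bar>h x\<bar> \<le> c * \<bar>f x\<bar> * \<bar>g x\<bar>"
	shows "h summable_on A" "(\<lambda>x. \<bar>h x\<bar>) summable_on A"
		"\<bar>\<Sum>\<^sub>\<infinity>x\<in>A. h x\<bar> \<le> c * n2 A f * n2 A g" "(\<Sum>\<^sub>\<infinity>x\<in>A. \<bar>h x\<bar>) \<le> c * n2 A f * n2 A g"
proof -
	have *: "(\<Sum>x\<in>F. \<bar>h x\<bar>) \<le> c * n2 A f * n2 A g" if F: "finite F" "F \<subseteq> A" for F
	proof -
		have "(\<Sum>x\<in>F. \<bar>h x\<bar>) \<le> (\<Sum>x\<in>F. c * (\<bar>f x\<bar> * \<bar>g x\<bar>))"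
			using F assms(4) by (intro sum_mono) (auto simp: mult.assoc)
		also have "\<dots> \<le> c * (L2_set f F * L2_set g F)"
			unfolding sum_distrib_left[symmetric] using assms by (intro mult_left_mono L2_set_mult_ineq) auto
		also have "\<dots> \<le> c * (n2 A f * n2 A g)"
			using F assms by (intro mult_left_mono mult_mono L2_set_le_n2) auto
		finally show ?thesis by (simp add: mult.assoc)
	qed
	show s: "(\<lambda>x. \<bar>h x\<bar>) summable_on A"
		by (rule nonneg_bdd_above_summable_on) (auto intro!: bdd_aboveI2[where M="c * n2 A f * n2 A g"] *)
	then show "h summable_on A"
		using summable_on_iff_abs_summable_on_real by auto
	show t: "(\<Sum>\<^sub>\<infinity>x\<in>A. \<bar>h x\<bar>) \<le> c * n2 A f * n2 A g"
		using s by (intro infsum_le_finite_sums) (auto simp: *)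
	have "\<bar>\<Sum>\<^sub>\<infinity>x\<in>A. h x\<bar> \<le> (\<Sum>\<^sub>\<infinity>x\<in>A. \<bar>h x\<bar>)"
		using norm_infsum_bound[of h A] s by auto
	with t show "\<bar>\<Sum>\<^sub>\<infinity>x\<in>A. h x\<bar> \<le> c * n2 A f * n2 A g" by simp
qed

text \<open>Supplies smallness far from the defect: the transfer of coercivity and the decay
  iteration both discard a finite set of sites where \<open>Du\<close> is not small.\<close>

lemma l2_tail:
	assumes "l2 A f" "0 < \<epsilon>"
	obtains F where "finite F" "F \<subseteq> A" "n2 (A - F) f < \<epsilon>"
proof -
	have s: "(\<lambda>x. (f x)\<^sup>2) summable_on A" using assms by (simp add: l2_def)
	have "0 < \<epsilon>\<^sup>2 / 2" using assms by simp
	from infsum_finite_approximation[OF s this] obtain F where F: "finite F" "F \<subseteq> A"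
		"dist (\<Sum>x\<in>F. (f x)\<^sup>2) (\<Sum>\<^sub>\<infinity>x\<in>A. (f x)\<^sup>2) \<le> \<epsilon>\<^sup>2 / 2" by blast
	have sF: "(\<lambda>x. (f x)\<^sup>2) summable_on (A - F)" using s by (rule summable_on_subset_banach) auto
	have "(\<Sum>\<^sub>\<infinity>x\<in>A. (f x)\<^sup>2) = (\<Sum>\<^sub>\<infinity>x\<in>F \<union> (A - F). (f x)\<^sup>2)"
		using F by (intro infsum_cong_neutral) auto
	also have "\<dots> = (\<Sum>x\<in>F. (f x)\<^sup>2) + (\<Sum>\<^sub>\<infinity>x\<in>A-F. (f x)\<^sup>2)"
		using F sF by (subst infsum_Un_disjoint) auto
	finally have "(\<Sum>\<^sub>\<infinity>x\<in>A-F. (f x)\<^sup>2) \<le> \<epsilon>\<^sup>2 / 2"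
		using F(3) by (simp add: dist_real_def)
	moreover have "\<epsilon>\<^sup>2 / 2 < \<epsilon>\<^sup>2" using assms(2) by simp
	ultimately have "(\<Sum>\<^sub>\<infinity>x\<in>A-F. (f x)\<^sup>2) < \<epsilon>\<^sup>2" by linarith
	then have "n2 (A - F) f < \<epsilon>" unfolding n2_def using assms(2)
		by (metis real_sqrt_less_mono real_sqrt_unique less_imp_le)
	with F show thesis using that by blast
qed

section \<open>Minimisation of uniformly midpoint-convex functionals\<close>

text \<open>A minimising sequence is Cauchy, because the midpoint of two of its members cannot lie
  below the infimum and \<open>conv\<close> charges their distance. Completeness, continuity and
  stability under midpoints are hypotheses, so that \<open>C\<close> may be a closed subspace as
  well as a ball.\<close>

lemma midpoint_convex_minimiser:
	fixes C :: "('a => 'b::real_vector) set" and p F :: "('a => 'b) => real"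
	assumes ne: "C \<noteq> {}" and \<kappa>: "0 < \<kappa>" and p0: "!!u. 0 \<le> p u"
		and comp: "!!X :: nat => 'a => 'b. (!!n. X n \<in> C) ==>
			(!!e. 0 < e ==> \<exists>N. \<forall>m\<ge>N. \<forall>n\<ge>N. p (X m .- X n) < e) ==>
			\<exists>u\<in>C. (\<lambda>n. p (X n .- u)) \<longlonglongrightarrow> 0"
		and mid: "!!u v. u \<in> C ==> v \<in> C ==> (\<lambda>x. (1/2) *\<^sub>R u x + (1/2) *\<^sub>R v x) \<in> C"
		and conv: "!!u v. u \<in> C ==> v \<in> C ==>
			F (\<lambda>x. (1/2) *\<^sub>R u x + (1/2) *\<^sub>R v x) \<le> (F u + F v) / 2 - \<kappa> * (p (u .- v))\<^sup>2"
		and bdd: "!!u. u \<in> C ==> b \<le> F u"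
		and cont: "!!X u. (!!n. X n \<in> C) ==> u \<in> C ==> (\<lambda>n::nat. p (X n .- u)) \<longlonglongrightarrow> 0 ==>
			(\<lambda>n. F (X n)) \<longlonglongrightarrow> F u"
	shows "\<exists>u\<in>C. \<forall>v\<in>C. F u \<le> F v"
proof -
	define m where "m = Inf (F ` C)"
	have bb: "bdd_below (F ` C)" using bdd by (rule bdd_belowI2)
	have m: "m \<le> F u" if "u \<in> C" for u unfolding m_def using bb that by (rule cINF_lower)
	have "\<exists>u\<in>C. F u < m + 1 / real (Suc n)" for n
	proof -
		have "Inf (F ` C) < m + 1 / real (Suc n)" unfolding m_def by simp
		then show ?thesis using ne bb by (simp add: cInf_less_iff)
	qed
	then obtain X where X: "!!n. X n \<in> C" "!!n. F (X n) < m + 1 / real (Suc n)" by metis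
	have "\<exists>N. \<forall>i\<ge>N. \<forall>j\<ge>N. p (X i .- X j) < e" if e: "0 < e" for e
	proof -
		\<comment> \<open>Beyond \<open>N\<close> the values exceed the infimum by at most 1/(N+1), and
		  \<open>conv\<close> bounds \<kappa> times the squared distance by that excess.\<close>
		obtain N where N: "1 / real (Suc N) < \<kappa> * e\<^sup>2"
			using reals_Archimedean[of "\<kappa> * e\<^sup>2"] \<kappa> e by (auto simp: inverse_eq_divide)
		have "p (X i .- X j) < e" if "i \<ge> N" "j \<ge> N" for i j
		proof -
			have "m \<le> (F (X i) + F (X j)) / 2 - \<kappa> * (p (X i .- X j))\<^sup>2"
				using m[OF mid[OF X(1) X(1)]] conv[OF X(1) X(1)] by (rule order_trans)
			moreover have "1 / real (Suc i) \<le> 1 / real (Suc N)" "1 / real (Suc j) \<le> 1 / real (Suc N)"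
				using that by (auto intro!: divide_left_mono)
			ultimately have "\<kappa> * (p (X i .- X j))\<^sup>2 \<le> 1 / real (Suc N)"
				using X(2)[of i] X(2)[of j] by argo
			then have "\<kappa> * (p (X i .- X j))\<^sup>2 < \<kappa> * e\<^sup>2" using N by linarith
			then have "(p (X i .- X j))\<^sup>2 < e\<^sup>2" using \<kappa> by simp
			then show ?thesis using e by (meson less_imp_le power_less_imp_less_base)
		qed
		then show ?thesis by blast
	qed
	from comp[OF X(1) this] obtain u where u: "u \<in> C" "(\<lambda>n. p (X n .- u)) \<longlonglongrightarrow> 0" by blast
	from cont[OF X(1) u] have F: "(\<lambda>n. F (X n)) \<longlonglongrightarrow> F u" .
	have "(\<lambda>n. m + 1 / real (Suc n)) \<longlonglongrightarrow> m + 0"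
		by (intro tendsto_intros LIMSEQ_Suc[OF lim_1_over_n])
	then have "F u \<le> m" using F X(2) by (intro LIMSEQ_le[OF F, of _ m]) (auto intro: less_imp_le)
	with m u show ?thesis by (meson order_trans)
qed

section \<open>Finite-range networks\<close>

definition nrm :: "(real^'d) set => 'd vfun => real" where
	"nrm S g = L2_set (\<lambda>\<rho>. norm (g \<rho>)) S"

lemma nrm_nonneg [simp]: "0 \<le> nrm S g" by (simp add: nrm_def)

lemma nrm_add: "nrm S (g .+ h) \<le> nrm S g + nrm S h"
	unfolding nrm_def
	by (rule order_trans[OF L2_set_mono L2_set_triangle_ineq]) (auto simp: norm_triangle_ineq)

lemma nrm_scale: "nrm S (\<lambda>\<rho>. c *\<^sub>R g \<rho>) = \<bar>c\<bar> * nrm S g"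
	unfolding nrm_def by (simp add: L2_set_right_distrib)

lemma nrm_zero [simp]: "nrm S zf = 0" by (simp add: nrm_def L2_set_0')

lemma nrm_minus: "nrm S (\<lambda>\<rho>. - g \<rho>) = nrm S g" by (simp add: nrm_def)

lemma norm_le_nrm: "finite S ==> \<rho> \<in> S ==> norm (g \<rho>) \<le> nrm S g"
	unfolding nrm_def by (rule member_le_L2_set)

lemma nrm_le_sum: "nrm S g \<le> (\<Sum>\<rho>\<in>S. norm (g \<rho>))"
	unfolding nrm_def by (rule L2_set_le_sum) auto

definition dn :: "(real^'d => (real^'d) set) => 'd vfun => real^'d => real" where
	"dn St u l = nrm (St l) (stencil_diff (St l) u l)"

text \<open>Discrete counterpart of \<open>W_12\<close>: \<open>W_12_eq\<close> identifies the two
  spaces, and the analysis is carried out with \<open>Dn\<close> in place of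
  \<open>W_norm\<close>.\<close>

definition Wd :: "(real^'d) set => (real^'d => (real^'d) set) => 'd vfun set" where
	"Wd \<Lambda> St = {u. l2 \<Lambda> (dn St u)}"

definition Dn :: "(real^'d) set => (real^'d => (real^'d) set) => 'd vfun => real" where
	"Dn \<Lambda> St u = n2 \<Lambda> (dn St u)"

text \<open>Discrete counterpart of \<open>W_c\<close>, identified with it in
  \<open>W_c_eq\<close>.\<close>

definition Wdc :: "(real^'d) set => (real^'d => (real^'d) set) => 'd vfun set" where
	"Wdc \<Lambda> St = {u. finite {l\<in>\<Lambda>. dn St u l \<noteq> 0}}"

lemma stencil_diff_in [simp]: "stencil_diff S u l \<in> stsp S"
	by (simp add: stencil_diff_def stencil_space_def)

lemma stencil_diff_lin:
	"stencil_diff S (lcomb a u b v) l = (\<lambda>\<rho>. a *\<^sub>R stencil_diff S u l \<rho> + b *\<^sub>R stencil_diff S v l \<rho>)"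
	by (auto simp: stencil_diff_def algebra_simps)

lemma stencil_diff_add:
	"stencil_diff S (u .+ v) l = (\<lambda>\<rho>. stencil_diff S u l \<rho> + stencil_diff S v l \<rho>)"
	using stencil_diff_lin[of S 1 u 1 v l] by simp

lemma stencil_diff_diff:
	"stencil_diff S (u .- v) l = (\<lambda>\<rho>. stencil_diff S u l \<rho> - stencil_diff S v l \<rho>)"
	using stencil_diff_lin[of S 1 u "-1" v l] by simp

lemma stencil_diff_scale:
	"stencil_diff S (\<lambda>x. a *\<^sub>R u x) l = (\<lambda>\<rho>. a *\<^sub>R stencil_diff S u l \<rho>)"
	using stencil_diff_lin[of S a u 0 u l] by simp

lemma stencil_diff_const [simp]: "stencil_diff S (\<lambda>_. c) l = zf"
	by (auto simp: stencil_diff_def)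

lemma dn_alt: "dn St u l = L2_set (\<lambda>\<rho>. norm (u (l + \<rho>) - u l)) (St l)"
	unfolding dn_def nrm_def by (rule L2_set_cong) (auto simp: stencil_diff_def)

lemma dn_nonneg [simp]: "0 \<le> dn St u l" by (simp add: dn_def)

lemma dn_add: "dn St (u .+ v) l \<le> dn St u l + dn St v l"
	by (simp add: dn_def stencil_diff_add nrm_add)

lemma dn_scale: "dn St (\<lambda>x. c *\<^sub>R u x) l = \<bar>c\<bar> * dn St u l"
	by (simp add: dn_def stencil_diff_scale nrm_scale)

lemma dn_lin: "dn St (lcomb a u b v) l \<le> \<bar>a\<bar> * dn St u l + \<bar>b\<bar> * dn St v l"
	using dn_add[of St "\<lambda>x. a *\<^sub>R u x" "\<lambda>x. b *\<^sub>R v x"] by (simp add: dn_scale)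

lemma dn_cong: "(!!\<rho>. \<rho> \<in> St l ==> u (l + \<rho>) - u l = v (l + \<rho>) - v l) ==> dn St u l = dn St v l"
	unfolding dn_alt by (rule L2_set_cong) auto

lemma Dn_nonneg [simp]: "0 \<le> Dn \<Lambda> St u" by (simp add: Dn_def)

lemma Wd_lin:
	assumes "u \<in> Wd \<Lambda> St" "v \<in> Wd \<Lambda> St"
	shows "(lcomb a u b v) \<in> Wd \<Lambda> St"
		"Dn \<Lambda> St (lcomb a u b v) \<le> \<bar>a\<bar> * Dn \<Lambda> St u + \<bar>b\<bar> * Dn \<Lambda> St v"
	using n2_le[of \<Lambda> "dn St u" "dn St v" "\<bar>a\<bar>" "\<bar>b\<bar>" "dn St (lcomb a u b v)"] assms dn_lin[of St a u b v]
	by (auto simp: Wd_def Dn_def)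

lemma Wd_add:
	assumes "u \<in> Wd \<Lambda> St" "v \<in> Wd \<Lambda> St"
	shows "(u .+ v) \<in> Wd \<Lambda> St" "Dn \<Lambda> St (u .+ v) \<le> Dn \<Lambda> St u + Dn \<Lambda> St v"
	using Wd_lin[OF assms, of 1 1] by auto

lemma Wd_diff:
	assumes "u \<in> Wd \<Lambda> St" "v \<in> Wd \<Lambda> St"
	shows "(u .- v) \<in> Wd \<Lambda> St" "Dn \<Lambda> St (u .- v) \<le> Dn \<Lambda> St u + Dn \<Lambda> St v"
	using Wd_lin[OF assms, of 1 "-1"] by auto

lemma Dn_scale: "Dn \<Lambda> St (\<lambda>x. a *\<^sub>R u x) = \<bar>a\<bar> * Dn \<Lambda> St u"
proof -
	have "(\<Sum>\<^sub>\<infinity>x\<in>\<Lambda>. (\<bar>a\<bar> * dn St u x)\<^sup>2) = a\<^sup>2 * (\<Sum>\<^sub>\<infinity>x\<in>\<Lambda>. (dn St u x)\<^sup>2)"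
		unfolding power_mult_distrib by (simp add: infsum_cmult_right')
	then show ?thesis unfolding Dn_def n2_def dn_scale by (simp add: real_sqrt_mult)
qed

lemma Dn_minus_commute: "Dn \<Lambda> St (u .- v) = Dn \<Lambda> St (v .- u)"
	using Dn_scale[of \<Lambda> St "-1" "\<lambda>x. u x - v x"] by simp

lemma zero_in_Wd [simp]: "(\<lambda>_. c) \<in> Wd \<Lambda> St"
	by (simp add: Wd_def dn_def l2_def)

lemma Dn_zero [simp]: "Dn \<Lambda> St (\<lambda>_. c) = 0"
	by (simp add: Dn_def dn_def n2_def)

lemma Wdc_subset_Wd: "Wdc \<Lambda> St \<subseteq> Wd \<Lambda> St"
	by (auto simp: Wdc_def Wd_def intro: l2_finite_support)

lemma dn_le_Dn: "u \<in> Wd \<Lambda> St ==> l \<in> \<Lambda> ==> dn St u l \<le> Dn \<Lambda> St u"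
	using abs_le_n2[of \<Lambda> "dn St u" l] by (simp add: Wd_def Dn_def)

text \<open>Connectedness of the stencil graph in quantitative form. The bound is by finitely many
  stencil norms, with \<open>F\<close> and \<open>C\<close> independent of \<open>u\<close>, instead
  of by the semi-norm: later error terms must stay localised near the core.\<close>

definition near :: "(real^'d) set => (real^'d => (real^'d) set) => real^'d => real^'d => bool" where
	"near \<Lambda> St x y \<longleftrightarrow> (\<exists>F C. finite F \<and> F \<subseteq> \<Lambda> \<and> 0 \<le> C \<and> (\<forall>u::'d vfun. norm (u x - u y) \<le> C * (\<Sum>l\<in>F. dn St u l)))"

lemma near_refl: "near \<Lambda> St x x"
	unfolding near_def by (rule exI[of _ "{}"]) auto

lemma near_sym: "near \<Lambda> St x y ==> near \<Lambda> St y x"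
	unfolding near_def by (simp add: norm_minus_commute)

lemma near_trans:
	assumes "near \<Lambda> St x y" "near \<Lambda> St y z"
	shows "near \<Lambda> St x z"
proof -
	obtain F C where 1: "finite F" "F \<subseteq> \<Lambda>" "0 \<le> C" "!!u::'a vfun. norm (u x - u y) \<le> C * (\<Sum>l\<in>F. dn St u l)"
		using assms(1) unfolding near_def by blast
	obtain F' C' where 2: "finite F'" "F' \<subseteq> \<Lambda>" "0 \<le> C'" "!!u::'a vfun. norm (u y - u z) \<le> C' * (\<Sum>l\<in>F'. dn St u l)"
		using assms(2) unfolding near_def by blast
	have "norm (u x - u z) \<le> (C + C') * (\<Sum>l\<in>F\<union>F'. dn St u l)" for u :: "'a vfun"
	proof -
		have "norm (u x - u z) \<le> norm (u x - u y) + norm (u y - u z)"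
			using norm_triangle_ineq[of "u x - u y" "u y - u z"] by simp
		also have "\<dots> \<le> C * (\<Sum>l\<in>F. dn St u l) + C' * (\<Sum>l\<in>F'. dn St u l)" using 1 2 by (intro add_mono) auto
		also have "\<dots> \<le> C * (\<Sum>l\<in>F\<union>F'. dn St u l) + C' * (\<Sum>l\<in>F\<union>F'. dn St u l)"
			using 1 2 by (intro add_mono mult_left_mono sum_mono2) auto
		finally show ?thesis by (simp add: algebra_simps)
	qed
	then show ?thesis unfolding near_def using 1 2 by (intro exI[of _ "F \<union> F'"] exI[of _ "C + C'"]) auto
qed

text \<open>Shared by the defective lattice and the Bravais lattice, so that completeness of
  \<open>Wd\<close> and the calculus for its semi-norm are available on both.\<close>

locale net =
	fixes \<Lambda> :: "(real^'d) set" and St :: "real^'d => (real^'d) set"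
	assumes fin: "l \<in> \<Lambda> ==> finite (St l)"
		and cl: "l \<in> \<Lambda> ==> \<rho> \<in> St l ==> l + \<rho> \<in> \<Lambda>"
		and near: "x \<in> \<Lambda> ==> y \<in> \<Lambda> ==> near \<Lambda> St x y"
		and ne: "\<Lambda> \<noteq> {}"
begin

lemma diff_le_dn: "l \<in> \<Lambda> ==> \<rho> \<in> St l ==> norm (u (l + \<rho>) - u l) \<le> dn St u l"
	unfolding dn_alt using fin by (intro member_le_L2_set) auto

lemma near_Dn:
	assumes "x \<in> \<Lambda>" "y \<in> \<Lambda>"
	obtains C where "0 \<le> C" "!!u. u \<in> Wd \<Lambda> St ==> norm (u x - u y) \<le> C * Dn \<Lambda> St u"
proof -
	obtain F C where F: "finite F" "F \<subseteq> \<Lambda>" "0 \<le> C" "!!u. norm (u x - u y) \<le> C * (\<Sum>l\<in>F. dn St u l)"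
		using near[OF assms] unfolding near_def by blast
	have "norm (u x - u y) \<le> (C * card F) * Dn \<Lambda> St u" if "u \<in> Wd \<Lambda> St" for u
	proof -
		have "(\<Sum>l\<in>F. dn St u l) \<le> card F * Dn \<Lambda> St u"
			using F that by (intro sum_bounded_above) (auto intro: dn_le_Dn)
		then show ?thesis using F(4)[of u] F(3) by (smt (verit) mult.assoc mult_left_mono)
	qed
	then show thesis using that[of "C * card F"] F(3) by auto
qed

text \<open>The semi-norm does not see constants, so the sequence is normalised to vanish at one
  site; by connectedness it is then Cauchy at each site. The pointwise limit is the limit in
  \<open>Dn\<close>, since bounds on finite sets survive the passage to the limit.\<close>

lemma Wd_complete:
	fixes X :: "nat => 'd vfun"
	assumes X: "!!n. X n \<in> Wd \<Lambda> St"
		and Cau: "!!e. 0 < e ==> \<exists>N. \<forall>m\<ge>N. \<forall>n\<ge>N. Dn \<Lambda> St (X m .- X n) < e"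
	shows "\<exists>u\<in>Wd \<Lambda> St. (\<lambda>n. Dn \<Lambda> St (X n .- u)) \<longlonglongrightarrow> 0"
proof -
	obtain x0 where x0: "x0 \<in> \<Lambda>" using ne by blast
	define Y where "Y n x = X n x - X n x0" for n x
	have "Cauchy (\<lambda>n. Y n x)" if x: "x \<in> \<Lambda>" for x
	proof -
		obtain C where C: "0 \<le> C" "!!u. u \<in> Wd \<Lambda> St ==> norm (u x - u x0) \<le> C * Dn \<Lambda> St u"
			using near_Dn[OF x x0] by blast
		show ?thesis
		proof (rule CauchyI)
			fix e :: real assume e: "0 < e"
			have "0 < e / (C + 1)" using C e by simp
			from Cau[OF this] obtain N where N: "!!m n. m \<ge> N ==> n \<ge> N ==> Dn \<Lambda> St (X m .- X n) < e / (C+1)" by blast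
			have "norm (Y m x - Y n x) < e" if "m \<ge> N" "n \<ge> N" for m n
			proof -
				have "Y m x - Y n x = (X m x - X n x) - (X m x0 - X n x0)" by (simp add: Y_def)
				then have "norm (Y m x - Y n x) \<le> C * Dn \<Lambda> St (X m .- X n)"
					using C(2)[OF Wd_diff(1)[OF X X], of m n] by simp
				also have "\<dots> \<le> (C+1) * Dn \<Lambda> St (X m .- X n)" by (intro mult_right_mono) auto
				also have "\<dots> < (C+1) * (e / (C+1))" using N[OF that] C by (intro mult_strict_left_mono) auto
				finally show ?thesis using C by simp
			qed
			then show "\<exists>M. \<forall>m\<ge>M. \<forall>n\<ge>M. norm (Y m x - Y n x) < e" by blast
		qed
	qed
	then have "\<exists>l. (\<lambda>n. Y n x) \<longlonglongrightarrow> l" if "x \<in> \<Lambda>" for x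
		using that Cauchy_convergent_iff convergent_def by blast
	then obtain u where u: "!!x. x \<in> \<Lambda> ==> (\<lambda>n. Y n x) \<longlonglongrightarrow> u x" by metis
	have dnlim: "(\<lambda>m. dn St (X n .- X m) l) \<longlonglongrightarrow> dn St (X n .- u) l" if l: "l \<in> \<Lambda>" for n l
	proof -
		have "dn St (X n .- X m) l = dn St (X n .- Y m) l" for m
			by (rule dn_cong) (simp add: Y_def)
		moreover have "(\<lambda>m. dn St (X n .- Y m) l) \<longlonglongrightarrow> dn St (X n .- u) l"
			unfolding dn_alt L2_set_def using l cl[OF l] by (intro tendsto_intros u) auto
		ultimately show ?thesis by simp
	qed
	have key: "l2 \<Lambda> (dn St (X n .- u)) \<and> Dn \<Lambda> St (X n .- u) \<le> e"
		if n: "!!m. m \<ge> N ==> Dn \<Lambda> St (X n .- X m) < e" for n N e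
	proof -
		have "L2_set (dn St (X n .- u)) F \<le> e" if F: "finite F" "F \<subseteq> \<Lambda>" for F
		proof (rule LIMSEQ_le_const2)
			show "(\<lambda>m. L2_set (dn St (X n .- X m)) F) \<longlonglongrightarrow> L2_set (dn St (X n .- u)) F"
				unfolding L2_set_def using F by (intro tendsto_intros dnlim) auto
			have "L2_set (dn St (X n .- X m)) F \<le> e" if "m \<ge> N" for m
			proof -
				have "(X n .- X m) \<in> Wd \<Lambda> St" by (intro Wd_diff X)
				then have "L2_set (dn St (X n .- X m)) F \<le> Dn \<Lambda> St (X n .- X m)"
					unfolding Dn_def using F by (intro L2_set_le_n2) (auto simp: Wd_def)
				then show ?thesis using n[OF that] by simp
			qed
			then show "\<exists>N. \<forall>m\<ge>N. L2_set (dn St (X n .- X m)) F \<le> e" by blast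
		qed
		from l2_boundedI[OF this] show ?thesis by (auto simp: Dn_def)
	qed
	obtain N0 where N0: "!!m n. m \<ge> N0 ==> n \<ge> N0 ==> Dn \<Lambda> St (X m .- X n) < 1"
		using Cau[of 1] by auto
	have "(\<lambda>x. X N0 x - u x) \<in> Wd \<Lambda> St" using key[of N0 N0 1] N0 by (auto simp: Wd_def)
	from Wd_diff(1)[OF X[of N0] this] have uW: "u \<in> Wd \<Lambda> St" by simp
	have "(\<lambda>n. Dn \<Lambda> St (X n .- u)) \<longlonglongrightarrow> 0"
	proof (rule LIMSEQ_I)
		fix r :: real assume r: "0 < r"
		then obtain N where "!!m n. m \<ge> N ==> n \<ge> N ==> Dn \<Lambda> St (X m .- X n) < r/2"
			using Cau[of "r/2"] by auto
		then have "Dn \<Lambda> St (X n .- u) \<le> r/2" if "n \<ge> N" for n using key[of N n "r/2"] that by blast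
		then show "\<exists>no. \<forall>n\<ge>no. norm (Dn \<Lambda> St (X n .- u) - 0) < r" using r
			by (intro exI[of _ N] allI impI) (smt (verit) Dn_nonneg field_sum_of_halves real_norm_def)
	qed
	with uW show ?thesis by blast
qed

end

section \<open>Site potentials\<close>

lemma stencil_space_lin: "g \<in> stsp S ==> h \<in> stsp S ==> (lcomb a g b h) \<in> stsp S"
	by (auto simp: stencil_space_def)

lemma stencil_space_line [simp]: "g \<in> stsp S ==> h \<in> stsp S ==> (along g t h) \<in> stsp S"
	by (auto simp: stencil_space_def)

lemma stencil_space_add [simp]: "g \<in> stsp S ==> h \<in> stsp S ==> (g .+ h) \<in> stsp S"
	by (auto simp: stencil_space_def)

lemma stencil_space_scale [simp]: "g \<in> stsp S ==> (\<lambda>\<rho>. t *\<^sub>R g \<rho>) \<in> stsp S"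
	by (auto simp: stencil_space_def)

lemma stencil_space_zero [simp]: "zf \<in> stsp S"
	by (auto simp: stencil_space_def)

text \<open>What one layer of \<open>C_k\<close> provides. As \<open>C_k\<close> speaks of
  directional derivatives only, linearity in the direction, Taylor expansions and symmetry of second
  derivatives all have to be derived from it.\<close>

definition line_C1 :: "(real^'d) set => ('d vfun => real) => bool" where
	"line_C1 S F \<longleftrightarrow> (\<forall>h\<in>stsp S.
		 (\<forall>g\<in>stsp S. (\<lambda>t. F (along g t h)) differentiable (at (0::real))) \<and>
		 continuous_on (stsp S) (\<lambda>g. dir_deriv F g h))"

lemma C_k_continuous: "C_k k S f ==> continuous_on (stsp S) f"
	by (cases k) auto

lemma C_k_Suc_line_C1: "C_k (Suc k) S f ==> line_C1 S f"
	unfolding line_C1_def by (auto dest: C_k_continuous)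

lemma C_k_mono: "C_k k S f ==> j \<le> k ==> C_k j S f"
proof (induction j arbitrary: k f)
	case 0 then show ?case by (auto dest: C_k_continuous)
next
	case (Suc j)
	then obtain k' where "k = Suc k'" "j \<le> k'" by (cases k) auto
	with Suc show ?case by auto
qed

text \<open>Differentiability at 0 is available for every base point, so moving the base point along
  the line gives it at every parameter.\<close>

lemma line_deriv:
	assumes "line_C1 S F" and g: "g \<in> stsp S" and h: "h \<in> stsp S"
	shows "((\<lambda>t. F (along g t h)) has_real_derivative dir_deriv F (along g t h) h) (at t)"
proof -
	have "(\<lambda>s. F (\<lambda>\<rho>. (g \<rho> + t *\<^sub>R h \<rho>) + s *\<^sub>R h \<rho>)) differentiable (at 0)"
		by (rule bspec[OF conjunct1[OF bspec[OF assms(1)[unfolded line_C1_def] h]] stencil_space_line[OF g h, of t]])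
	then have "((\<lambda>s. F (\<lambda>\<rho>. (g \<rho> + t *\<^sub>R h \<rho>) + s *\<^sub>R h \<rho>)) has_real_derivative dir_deriv F (along g t h) h) (at 0)"
		unfolding dir_deriv_def DERIV_deriv_iff_real_differentiable .
	moreover have "(\<lambda>\<rho>. (g \<rho> + t *\<^sub>R h \<rho>) + s *\<^sub>R h \<rho>) = (\<lambda>\<rho>. g \<rho> + (s + t) *\<^sub>R h \<rho>)" for s
		by (auto simp: algebra_simps)
	ultimately have "((\<lambda>s. F (\<lambda>\<rho>. g \<rho> + (s + t) *\<^sub>R h \<rho>)) has_real_derivative dir_deriv F (along g t h) h) (at 0)"
		by (simp only:)
	then have "((\<lambda>t. F (along g t h)) has_real_derivative dir_deriv F (along g t h) h) (at (0 + t))"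
		by (rule DERIV_shift[THEN iffD2])
	then show ?thesis by (simp only: add_0)
qed

lemma line_mvt:
	assumes "line_C1 S F" and g: "g \<in> stsp S" and h: "h \<in> stsp S" and "0 < t"
	obtains \<theta> where "0 < \<theta>" "\<theta> < t" "F (along g t h) - F g = t * dir_deriv F (along g \<theta> h) h"
proof -
	have "\<exists>z>0. z < t \<and> F (along g t h) - F (\<lambda>\<rho>. g \<rho> + 0 *\<^sub>R h \<rho>) = (t - 0) * dir_deriv F (along g z h) h"
		using \<open>0 < t\<close> by (intro MVT2) (auto intro: line_deriv[OF assms(1-3)])
	then show thesis using that by auto
qed

lemma dir_deriv_scale:
	assumes F: "line_C1 S F" and g: "g \<in> stsp S" and h: "h \<in> stsp S"
	shows "dir_deriv F g (\<lambda>\<rho>. c *\<^sub>R h \<rho>) = c * dir_deriv F g h"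
proof -
	have "((\<lambda>t. F (along g t h)) has_real_derivative dir_deriv F g h) (at (c * 0))"
		using line_deriv[OF assms, of 0] by simp
	moreover have "((\<lambda>t. c * t) has_real_derivative c) (at 0)"
		by (auto intro!: derivative_eq_intros)
	ultimately have "((\<lambda>t. F (\<lambda>\<rho>. g \<rho> + (c * t) *\<^sub>R h \<rho>)) has_real_derivative dir_deriv F g h * c) (at 0)"
		by (rule DERIV_chain2[where f="\<lambda>t. F (along g t h)"])
	then have "deriv (\<lambda>t. F (\<lambda>\<rho>. g \<rho> + (c * t) *\<^sub>R h \<rho>)) 0 = dir_deriv F g h * c"
		by (rule DERIV_imp_deriv)
	then show ?thesis by (simp add: dir_deriv_def mult.commute)
qed

text \<open>A directional derivative that is continuous in its base point is additive: split the
  increment along \<open>h + k\<close> at \<open>g + t h\<close> and turn the second part, by the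
  mean value theorem, into a derivative along \<open>k\<close> at a point tending to
  \<open>g\<close>.\<close>

lemma dir_deriv_add:
	assumes F: "line_C1 S F" and g: "g \<in> stsp S" and h: "h \<in> stsp S" and k: "k \<in> stsp S"
	shows "dir_deriv F g (h .+ k) = dir_deriv F g h + dir_deriv F g k"
proof -
	\<comment> \<open>Two parameters, so that continuity at (0,0) covers the intermediate point of the
	  mean value theorem, at which both displacements move.\<close>
	let ?\<Phi> = "\<lambda>z::real \<times> real. dir_deriv F (\<lambda>\<rho>. (g \<rho> + fst z *\<^sub>R h \<rho>) + snd z *\<^sub>R k \<rho>) k"
	have c: "continuous_on UNIV ?\<Phi>"
	proof (rule continuous_on_compose2[of "stsp S" "\<lambda>g. dir_deriv F g k"])
		show "continuous_on (stsp S) (\<lambda>g. dir_deriv F g k)" using F k by (auto simp: line_C1_def)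
		show "continuous_on UNIV (\<lambda>z::real \<times> real. \<lambda>\<rho>. (g \<rho> + fst z *\<^sub>R h \<rho>) + snd z *\<^sub>R k \<rho>)"
			by (rule continuous_on_coordinatewise_then_product) (intro continuous_intros)
	qed (use g h k in \<open>auto simp: stencil_space_def\<close>)
	have dh: "((\<lambda>t. (F (along g t h) - F g) / t) \<longlongrightarrow> dir_deriv F g h) (at_right 0)"
	proof -
		have "((\<lambda>t. F (along g t h)) has_real_derivative dir_deriv F g h) (at 0)"
			using line_deriv[OF F g h, of 0] by simp
		then have "((\<lambda>t. F (along g t h)) has_real_derivative dir_deriv F g h) (at_right 0)"
			by (rule has_field_derivative_at_within)
		then show ?thesis unfolding has_field_derivative_iff by simp
	qed
	have hk: "(h .+ k) \<in> stsp S" using h k by simp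
	have dhk: "((\<lambda>t. (F (\<lambda>\<rho>. g \<rho> + t *\<^sub>R (h \<rho> + k \<rho>)) - F g) / t) \<longlongrightarrow> dir_deriv F g (h .+ k)) (at_right 0)"
	proof -
		have "((\<lambda>t. F (\<lambda>\<rho>. g \<rho> + t *\<^sub>R (h \<rho> + k \<rho>))) has_real_derivative dir_deriv F g (h .+ k)) (at 0)"
			using line_deriv[OF F g hk, of 0] by simp
		then have "((\<lambda>t. F (\<lambda>\<rho>. g \<rho> + t *\<^sub>R (h \<rho> + k \<rho>))) has_real_derivative dir_deriv F g (h .+ k)) (at_right 0)"
			by (rule has_field_derivative_at_within)
		then show ?thesis unfolding has_field_derivative_iff by simp
	qed
	let ?q = "\<lambda>t. (F (\<lambda>\<rho>. g \<rho> + t *\<^sub>R (h \<rho> + k \<rho>)) - F (along g t h)) / t"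
	have dk: "(?q \<longlongrightarrow> dir_deriv F g k) (at_right 0)"
	proof (rule tendstoI)
		fix e :: real assume e: "0 < e"
		have "isCont ?\<Phi> (0,0)" using c by (simp add: continuous_on_eq_continuous_at)
		then obtain d where d: "d > 0" "!!z. dist z (0,0) < d ==> dist (?\<Phi> z) (?\<Phi> (0,0)) < e"
			unfolding continuous_at_eps_delta using e by blast
		have "dist (?q t) (dir_deriv F g k) < e" if t: "0 < t" "t < d/2" for t
		proof -
			obtain \<theta> where \<theta>: "0 < \<theta>" "\<theta> < t" "F (\<lambda>\<rho>. (g \<rho> + t *\<^sub>R h \<rho>) + t *\<^sub>R k \<rho>) - F (along g t h) = t * ?\<Phi> (t, \<theta>)"
				using line_mvt[OF F stencil_space_line[OF g h] k t(1), of t] by auto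
			have "dist (t, \<theta>) (0,0) \<le> dist t 0 + dist \<theta> 0"
				unfolding dist_Pair_Pair by (rule sqrt_sum_squares_le_sum) auto
			also have "\<dots> < d" using \<theta> t by (simp add: dist_real_def)
			finally have "dist (?\<Phi> (t,\<theta>)) (?\<Phi> (0,0)) < e" by (rule d)
			moreover have "?q t = ?\<Phi> (t, \<theta>)" using \<theta> t by (simp add: algebra_simps divide_simps)
			ultimately show ?thesis by simp
		qed
		then show "\<forall>\<^sub>F t in at_right 0. dist (?q t) (dir_deriv F g k) < e"
			unfolding eventually_at_right_field using d(1) by (intro exI[of _ "d/2"]) auto
	qed
	have "((\<lambda>t. ?q t + (F (along g t h) - F g) / t) \<longlongrightarrow> dir_deriv F g k + dir_deriv F g h) (at_right 0)"
		by (intro tendsto_add dk dh)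
	moreover have "?q t + (F (along g t h) - F g) / t = (F (\<lambda>\<rho>. g \<rho> + t *\<^sub>R (h \<rho> + k \<rho>)) - F g) / t" for t
		by (simp add: add_divide_distrib[symmetric])
	ultimately have "((\<lambda>t. (F (\<lambda>\<rho>. g \<rho> + t *\<^sub>R (h \<rho> + k \<rho>)) - F g) / t) \<longlongrightarrow> dir_deriv F g k + dir_deriv F g h) (at_right 0)"
		by simp
	from tendsto_unique[OF trivial_limit_at_right_real dhk this] show ?thesis by simp
qed

definition form1 :: "(real^'d) set => ('d vfun => real) => bool" where
	"form1 S L \<longleftrightarrow> (\<forall>g\<in>stsp S. \<forall>h\<in>stsp S. \<forall>a b.
		 L (lcomb a g b h) = a * L g + b * L h)"

lemma form1_dir_deriv: "line_C1 S F ==> g \<in> stsp S ==> form1 S (dir_deriv F g)"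
	unfolding form1_def by (auto simp: dir_deriv_add dir_deriv_scale)

lemma form1D:
	assumes "form1 S L" "g \<in> stsp S" "h \<in> stsp S"
	shows "L (lcomb a g b h) = a * L g + b * L h"
	by (rule assms(1)[unfolded form1_def, rule_format, OF assms(2,3)])

lemma form1_zero: "form1 S L ==> L zf = 0"
	using form1D[of S L "\<lambda>_. 0" "\<lambda>_. 0" 0 0] by simp

definition unit_fun :: "real^'d => 'd => 'd vfun" where
	"unit_fun \<rho> i = (\<lambda>\<sigma>. if \<sigma> = \<rho> then axis i 1 else 0)"

lemma unit_fun_in: "\<rho> \<in> S ==> unit_fun \<rho> i \<in> stsp S"
	by (auto simp: unit_fun_def stencil_space_def)

lemma form1_sum:
	assumes L: "form1 S L" and I: "finite I" and g: "!!i. i \<in> I ==> g i \<in> stsp S"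
	shows "(\<lambda>\<rho>. \<Sum>i\<in>I. c i *\<^sub>R g i \<rho>) \<in> stsp S \<and> L (\<lambda>\<rho>. \<Sum>i\<in>I. c i *\<^sub>R g i \<rho>) = (\<Sum>i\<in>I. c i * L (g i))"
	using I g
proof (induction I)
	case empty then show ?case by (simp add: form1_zero[OF L])
next
	case (insert i I)
	have "L (\<lambda>\<rho>. c i *\<^sub>R g i \<rho> + 1 *\<^sub>R (\<Sum>i\<in>I. c i *\<^sub>R g i \<rho>)) = c i * L (g i) + 1 * L (\<lambda>\<rho>. \<Sum>i\<in>I. c i *\<^sub>R g i \<rho>)"
		using insert by (intro L[unfolded form1_def, rule_format]) auto
	then show ?case using insert by (simp add: stencil_space_def)
qed

lemma stencil_expand:
	assumes "finite S" "h \<in> stsp S"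
	shows "h = (\<lambda>\<sigma>. \<Sum>p\<in>S \<times> UNIV. (h (fst p) $ snd p) *\<^sub>R unit_fun (fst p) (snd p) \<sigma>)"
proof
	fix \<sigma>
	have "(\<Sum>p\<in>S \<times> UNIV. (h (fst p) $ snd p) *\<^sub>R unit_fun (fst p) (snd p) \<sigma>)
		 = (\<Sum>\<rho>\<in>S. \<Sum>i\<in>UNIV. (h \<rho> $ i) *\<^sub>R unit_fun \<rho> i \<sigma>)"
		by (simp add: sum.cartesian_product case_prod_unfold)
	also have "\<dots> = (\<Sum>\<rho>\<in>S. if \<sigma> = \<rho> then h \<rho> else 0)"
		by (rule sum.cong) (auto simp: unit_fun_def vec_eq_iff axis_def if_distrib cong: if_cong)
	also have "\<dots> = h \<sigma>" using assms by (auto simp: stencil_space_def)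
	finally show "h \<sigma> = (\<Sum>p\<in>S \<times> UNIV. (h (fst p) $ snd p) *\<^sub>R unit_fun (fst p) (snd p) \<sigma>)" by simp
qed

text \<open>Expansion in the finite basis \<open>unit_fun\<close>. Bounds on derivatives that are
  uniform in the base point thus need compactness for finitely many basis values only.\<close>

lemma form1_bound:
	assumes S: "finite S" and L: "form1 S L" and h: "h \<in> stsp S"
		and b: "!!\<rho> i. \<rho> \<in> S ==> \<bar>L (unit_fun \<rho> i)\<bar> \<le> B"
	shows "\<bar>L h\<bar> \<le> real (card S * CARD('d)) * B * nrm S (h :: 'd::finite vfun)"
proof -
	have "L h = (\<Sum>p\<in>S \<times> UNIV. (h (fst p) $ snd p) * L (unit_fun (fst p) (snd p)))"
		using form1_sum[OF L, of "S \<times> UNIV" "\<lambda>p. unit_fun (fst p) (snd p)" "\<lambda>p. h (fst p) $ snd p"] S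
			stencil_expand[OF S h] by (auto simp: unit_fun_in)
	also have "\<bar>\<dots>\<bar> \<le> (\<Sum>p\<in>S \<times> (UNIV::'d set). nrm S h * B)"
	proof (rule order_trans[OF sum_abs], rule sum_mono)
		fix p :: "(real^'d) \<times> 'd" assume p: "p \<in> S \<times> UNIV"
		have "\<bar>h (fst p) $ snd p\<bar> \<le> norm (h (fst p))" by (rule component_le_norm_cart)
		also have "\<dots> \<le> nrm S h" using S p by (auto intro: norm_le_nrm)
		finally show "\<bar>h (fst p) $ snd p * L (unit_fun (fst p) (snd p))\<bar> \<le> nrm S h * B"
			unfolding abs_mult using b p by (intro mult_mono) auto
	qed
	finally show ?thesis by (simp add: card_cartesian_product mult_ac)
qed

text \<open>Tychonoff: off \<open>S\<close> each coordinate is confined to 0, on \<open>S\<close> to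
  a ball, and the product topology of the function type is the one used in
  \<open>C_k\<close>.\<close>

lemma compact_stencil_ball:
	assumes "finite S"
	shows "compact {g \<in> stsp S. nrm S (g :: 'd::finite vfun) \<le> M}"
proof -
	let ?P = "PiE UNIV (\<lambda>\<rho>. if \<rho> \<in> S then cball 0 M else {0}) :: 'd vfun set"
	have "compactin (product_topology (\<lambda>_. euclidean) UNIV) ?P"
		unfolding compactin_PiE by auto
	then have c: "compact ?P" by (simp add: euclidean_product_topology)
	have "closed {g :: 'd vfun. nrm S g \<le> M}"
		unfolding nrm_def L2_set_def by (intro closed_Collect_le continuous_intros continuous_on_product_coordinates)
	then have "compact (?P \<inter> {g. nrm S g \<le> M})" using c by (rule compact_Int_closed[rotated])
	moreover have "?P \<inter> {g. nrm S g \<le> M} = {g \<in> stsp S. nrm S g \<le> M}"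
	proof -
		have "norm (g \<rho>) \<le> M" if "\<rho> \<in> S" "nrm S g \<le> M" for \<rho> and g :: "'d vfun"
			using norm_le_nrm[OF assms that(1), of g] that(2) by simp
		then show ?thesis
			by (auto simp: stencil_space_def PiE_iff split: if_splits)
	qed
	ultimately show ?thesis by simp
qed

lemma stencil_bounded:
	assumes "finite S" "continuous_on (stsp S) f"
	shows "\<exists>B\<ge>0. \<forall>g\<in>stsp S. nrm S g \<le> M --> \<bar>f g\<bar> \<le> (B::real)"
proof -
	let ?K = "{g \<in> stsp S. nrm S g \<le> M}"
	have "continuous_on ?K f" using assms(2) by (rule continuous_on_subset) auto
	then have "compact (f ` ?K)" using compact_stencil_ball[OF assms(1)] by (intro compact_continuous_image)
	then have "bounded (f ` ?K)" by (rule compact_imp_bounded)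
	then obtain B where "\<forall>x\<in>f ` ?K. norm x \<le> B" unfolding bounded_iff by blast
	then show ?thesis by (intro exI[of _ "max B 0"]) (auto simp: le_max_iff_disj)
qed

lemma stencil_bounded_fin:
	assumes S: "finite S" and J: "finite J" and f: "!!j. j \<in> J ==> continuous_on (stsp S) (f j)"
	shows "\<exists>B\<ge>0. \<forall>j\<in>J. \<forall>g\<in>stsp S. nrm S g \<le> M --> \<bar>f j g\<bar> \<le> (B::real)"
proof -
	have "\<forall>j\<in>J. \<exists>B. 0 \<le> B \<and> (\<forall>g\<in>stsp S. nrm S g \<le> M --> \<bar>f j g\<bar> \<le> B)"
		using stencil_bounded[OF S f] by blast
	from bchoice[OF this] obtain B where
		B: "!!j. j \<in> J ==> 0 \<le> B j \<and> (\<forall>g\<in>stsp S. nrm S g \<le> M --> \<bar>f j g\<bar> \<le> B j)"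
		by blast
	have "B j \<le> sum B J" if "j \<in> J" for j
		using member_le_sum[of j J B] B J that by auto
	then show ?thesis using B by (intro exI[of _ "sum B J"]) (auto intro!: sum_nonneg intro: order_trans)
qed

lemma nrm_line_le: "0 \<le> t ==> t \<le> 1 ==> nrm S (along g t h) \<le> nrm S g + nrm S h"
	using nrm_add[of S g "\<lambda>\<rho>. t *\<^sub>R h \<rho>"] mult_right_mono[of t 1 "nrm S h"] by (simp add: nrm_scale)

lemma line_C1_lipschitz:
	assumes S: "finite S" and J: "finite J" and F: "!!j. j \<in> J ==> line_C1 S (F j)"
	shows "\<exists>B\<ge>0. \<forall>j\<in>J. \<forall>g\<in>stsp S. \<forall>h\<in>stsp S.
		 nrm S g \<le> M --> nrm S h \<le> M --> \<bar>F j (g .+ h) - F j g\<bar> \<le> B * nrm S (h :: 'd::finite vfun)"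
proof -
	\<comment> \<open>The segment from \<open>g\<close> to \<open>g + h\<close> stays in the ball of
	  radius 2M, hence the doubled radius.\<close>
	have "\<exists>B\<ge>0. \<forall>p\<in>J \<times> (S \<times> (UNIV :: 'd set)). \<forall>g\<in>stsp S. nrm S g \<le> 2 * M -->
			\<bar>dir_deriv (F (fst p)) g (unit_fun (fst (snd p)) (snd (snd p)))\<bar> \<le> B"
		by (rule stencil_bounded_fin[OF S]) (use S J F in \<open>auto simp: line_C1_def unit_fun_in\<close>)
	then obtain B where B: "B \<ge> 0" "!!j \<rho> i g. j \<in> J ==> \<rho> \<in> S ==> g \<in> stsp S ==> nrm S g \<le> 2 * M ==>
			\<bar>dir_deriv (F j) g (unit_fun \<rho> i)\<bar> \<le> B" by auto
	let ?C = "real (card S * CARD('d)) * B"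
	have "\<bar>F j (g .+ h) - F j g\<bar> \<le> ?C * nrm S h"
		if j: "j \<in> J" and g: "g \<in> stsp S" and h: "h \<in> stsp S" and M: "nrm S g \<le> M" "nrm S h \<le> M" for j g h
	proof -
		obtain \<theta> where \<theta>: "0 < \<theta>" "\<theta> < 1" and eq: "F j (\<lambda>\<rho>. g \<rho> + 1 *\<^sub>R h \<rho>) - F j g = 1 * dir_deriv (F j) (along g \<theta> h) h"
			using line_mvt[OF F[OF j] g h zero_less_one] by blast
		let ?g = "\<lambda>\<rho>. g \<rho> + \<theta> *\<^sub>R h \<rho>"
		have n: "nrm S ?g \<le> 2 * M" using nrm_line_le[of \<theta> S g h] \<theta> M by simp
		have "\<bar>dir_deriv (F j) ?g h\<bar> \<le> ?C * nrm S h"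
			by (rule form1_bound[OF S form1_dir_deriv[OF F[OF j] stencil_space_line[OF g h]] h])
				(rule B(2)[OF j _ stencil_space_line[OF g h] n])
		then show ?thesis using eq by simp
	qed
	moreover have "0 \<le> ?C" using B by simp
	ultimately show ?thesis by blast
qed

section \<open>Second-order Taylor bounds for site potentials\<close>

definition form2 :: "(real^'d) set => ('d vfun => 'd vfun => real) => bool" where
	"form2 S Q \<longleftrightarrow> (\<forall>g\<in>stsp S. form1 S (Q g)) \<and> (\<forall>g\<in>stsp S. \<forall>h\<in>stsp S. Q g h = Q h g)"

lemma form2_left: "form2 S Q ==> h \<in> stsp S ==> form1 S (\<lambda>g. Q g h)"
	unfolding form2_def form1_def by (simp add: stencil_space_lin)

lemma form2_bound':
	assumes S: "finite S" and 1: "!!g. g \<in> stsp S ==> form1 S (Q g)"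
		and 2: "!!h. h \<in> stsp S ==> form1 S (\<lambda>g. Q g h)"
		and h: "h \<in> stsp S" and k: "k \<in> stsp S"
		and b: "!!\<rho> i \<sigma> j. \<rho> \<in> S ==> \<sigma> \<in> S ==> \<bar>Q (unit_fun \<rho> i) (unit_fun \<sigma> j)\<bar> \<le> B"
	shows "\<bar>Q h k\<bar> \<le> real ((card S * CARD('d))^2) * B * nrm S h * nrm S (k :: 'd::finite vfun)"
proof -
	let ?c = "real (card S * CARD('d))"
	have "\<bar>Q (unit_fun \<rho> i) k\<bar> \<le> ?c * B * nrm S k" if "\<rho> \<in> S" for \<rho> i
		using form1_bound[OF S 1[OF unit_fun_in[OF that]] k] b that by auto
	from form1_bound[OF S 2[OF k] h this] show ?thesis by (simp add: power2_eq_square mult_ac)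
qed

text \<open>The information on a site potential that the energies use. Constants depend on a bound
  \<open>M\<close> of the arguments, since the potentials are controlled on bounded sets only. The
  derivatives are parameters, not \<open>dir_deriv\<close> and \<open>dder\<close>, so that the
  linearised potential can be entered with its explicit derivatives.\<close>

definition site_ok :: "(real^'d) set => (real => real) => ('d vfun => real) => ('d vfun => 'd vfun => real) =>
		('d vfun => 'd vfun => 'd vfun => real) => bool" where
	"site_ok S K V dV ddV \<longleftrightarrow>
		(\<forall>g\<in>stsp S. form1 S (dV g) \<and> form2 S (ddV g)) \<and>
		(\<forall>M. \<forall>g\<in>stsp S. \<forall>h\<in>stsp S. nrm S g \<le> M --> nrm S h \<le> M -->
			 \<bar>V (g .+ h) - V g - dV g h - ddV g h h / 2\<bar> \<le> K M * nrm S h ^ 3 \<and>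
			 (\<forall>k\<in>stsp S.
				 \<bar>dV (g .+ h) k - dV g k - ddV g h k\<bar> \<le> K M * (nrm S h)\<^sup>2 * nrm S k \<and>
				 (\<forall>l\<in>stsp S.
						\<bar>ddV g k l\<bar> \<le> K M * nrm S k * nrm S l \<and>
						\<bar>ddV (g .+ h) k l - ddV g k l\<bar> \<le> K M * nrm S h * nrm S k * nrm S l)))"

definition dder :: "('d::finite vfun => real) => 'd vfun => 'd vfun => 'd vfun => real" where
	"dder V g h k = dir_deriv (\<lambda>g'. dir_deriv V g' h) g k"

context
	fixes S :: "(real^'d::finite) set" and V :: "'d vfun => real"
	assumes S: "finite S" and V: "C_k 3 S V"
begin

lemma V_C1: "line_C1 S V"
	by (rule C_k_Suc_line_C1[of 2]) (use V in \<open>simp only: numeral_3_eq_3 numeral_2_eq_2\<close>)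

lemma dV_C2:
	assumes "h \<in> stsp S"
	shows "C_k (Suc (Suc 0)) S (\<lambda>g. dir_deriv V g h)"
	by (rule V[unfolded numeral_3_eq_3 C_k.simps(2)[of "Suc (Suc 0)"], THEN conjunct2, THEN bspec, OF assms, THEN conjunct2])

lemma dV_C1: "h \<in> stsp S ==> line_C1 S (\<lambda>g. dir_deriv V g h)"
	by (rule C_k_Suc_line_C1[OF dV_C2])

lemma ddV_C1:
	assumes "h \<in> stsp S" "k \<in> stsp S"
	shows "line_C1 S (\<lambda>g. dder V g h k)"
	unfolding dder_def
	by (rule C_k_Suc_line_C1[of 0], rule dV_C2[OF assms(1), unfolded C_k.simps(2)[of "Suc 0"], THEN conjunct2, THEN bspec, OF assms(2), THEN conjunct2])

lemma ddV_right: "g \<in> stsp S ==> h \<in> stsp S ==> form1 S (dder V g h)"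
	unfolding dder_def by (rule form1_dir_deriv[OF dV_C1])

lemma ddV_left:
	assumes g: "g \<in> stsp S" and l: "l \<in> stsp S"
	shows "form1 S (\<lambda>h. dder V g h l)"
	unfolding form1_def
proof (intro ballI allI)
	fix h k :: "'d vfun" and a b :: real assume h: "h \<in> stsp S" and k: "k \<in> stsp S"
	let ?m = "\<lambda>\<rho>. a *\<^sub>R h \<rho> + b *\<^sub>R k \<rho>"
	have "((\<lambda>t. a * dir_deriv V (along g t l) h + b * dir_deriv V (along g t l) k)
		 has_real_derivative a * dder V g h l + b * dder V g k l) (at 0)"
		unfolding dder_def using line_deriv[OF dV_C1[OF h] g l, of 0] line_deriv[OF dV_C1[OF k] g l, of 0]
		by (intro DERIV_add DERIV_cmult) auto
	moreover have "dir_deriv V (along g t l) ?m = a * dir_deriv V (along g t l) h + b * dir_deriv V (along g t l) k" for t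
		using form1_dir_deriv[OF V_C1 stencil_space_line[OF g l]] h k unfolding form1_def by blast
	ultimately have "((\<lambda>t. dir_deriv V (along g t l) ?m) has_real_derivative a * dder V g h l + b * dder V g k l) (at 0)"
		by simp
	from DERIV_imp_deriv[OF this] show "dder V g ?m l = a * dder V g h l + b * dder V g k l"
		by (simp add: dder_def dir_deriv_def[of "\<lambda>g'. dir_deriv V g' _"])
qed

lemma form1_diff: "form1 S L ==> form1 S L' ==> form1 S (\<lambda>h. L h - L' h)"
	unfolding form1_def by (simp add: algebra_simps)

text \<open>The third derivatives enter here: second derivatives in basis directions are again
  \<open>line_C1\<close>, hence Lipschitz on bounded sets.\<close>

lemma ddV_lipschitz:
	"\<exists>B\<ge>0. \<forall>g\<in>stsp S. \<forall>h\<in>stsp S. \<forall>k\<in>stsp S. \<forall>l\<in>stsp S.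
		 nrm S g \<le> M --> nrm S h \<le> M -->
		 \<bar>dder V (g .+ h) k l - dder V g k l\<bar> \<le> B * nrm S h * nrm S k * nrm S l"
proof -
	let ?J = "(S \<times> (UNIV :: 'd set)) \<times> (S \<times> (UNIV :: 'd set))"
	have "\<exists>B\<ge>0. \<forall>j\<in>?J. \<forall>g\<in>stsp S. \<forall>h\<in>stsp S.
		 nrm S g \<le> M --> nrm S h \<le> M -->
		 \<bar>dder V (g .+ h) (unit_fun (fst (fst j)) (snd (fst j))) (unit_fun (fst (snd j)) (snd (snd j)))
			 - dder V g (unit_fun (fst (fst j)) (snd (fst j))) (unit_fun (fst (snd j)) (snd (snd j)))\<bar> \<le> B * nrm S h"
		by (rule line_C1_lipschitz[OF S]) (use S in \<open>auto intro!: ddV_C1 unit_fun_in\<close>)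
	then obtain B where B: "B \<ge> 0" "!!\<rho> i \<sigma> j g h. \<rho> \<in> S ==> \<sigma> \<in> S ==> g \<in> stsp S ==> h \<in> stsp S ==>
		 nrm S g \<le> M ==> nrm S h \<le> M ==>
		 \<bar>dder V (g .+ h) (unit_fun \<rho> i) (unit_fun \<sigma> j) - dder V g (unit_fun \<rho> i) (unit_fun \<sigma> j)\<bar> \<le> B * nrm S h"
		by fastforce
	let ?c = "real ((card S * CARD('d))^2) * B"
	have "\<bar>dder V (g .+ h) k l - dder V g k l\<bar> \<le> ?c * nrm S h * nrm S k * nrm S l"
		if g: "g \<in> stsp S" and h: "h \<in> stsp S" and k: "k \<in> stsp S" and l: "l \<in> stsp S"
			and M: "nrm S g \<le> M" "nrm S h \<le> M" for g h k l
	proof -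
		have gh: "(g .+ h) \<in> stsp S" using g h by simp
		have "\<bar>dder V (g .+ h) k l - dder V g k l\<bar> \<le> real ((card S * CARD('d))^2) * (B * nrm S h) * nrm S k * nrm S l"
			by (rule form2_bound'[OF S, of "\<lambda>k l. dder V (g .+ h) k l - dder V g k l"])
				(rule form1_diff ddV_right ddV_left gh g k l B(2)[OF _ _ g h M] | assumption)+
		then show ?thesis by (simp only: mult.assoc)
	qed
	moreover have "0 \<le> ?c" using B by simp
	ultimately show ?thesis by blast
qed

lemma ddV_bounded:
	"\<exists>B\<ge>0. \<forall>g\<in>stsp S. \<forall>k\<in>stsp S. \<forall>l\<in>stsp S.
		 nrm S g \<le> M --> \<bar>dder V g k l\<bar> \<le> B * nrm S k * nrm S l"
proof -
	let ?J = "(S \<times> (UNIV :: 'd set)) \<times> (S \<times> (UNIV :: 'd set))"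
	have "\<exists>B\<ge>0. \<forall>j\<in>?J. \<forall>g\<in>stsp S. nrm S g \<le> M -->
		 \<bar>dder V g (unit_fun (fst (fst j)) (snd (fst j))) (unit_fun (fst (snd j)) (snd (snd j)))\<bar> \<le> B"
	proof (rule stencil_bounded_fin[OF S])
		fix j assume "j \<in> ?J"
		then have u: "unit_fun (fst (fst j)) (snd (fst j)) \<in> stsp S" "unit_fun (fst (snd j)) (snd (snd j)) \<in> stsp S"
			by (auto intro: unit_fun_in)
		show "continuous_on (stsp S) (\<lambda>g. dder V g (unit_fun (fst (fst j)) (snd (fst j))) (unit_fun (fst (snd j)) (snd (snd j))))"
			using dV_C1[OF u(1)] u(2) unfolding line_C1_def dder_def by blast
	qed (use S in auto)
	then obtain B where B: "B \<ge> 0" "!!\<rho> i \<sigma> j g. \<rho> \<in> S ==> \<sigma> \<in> S ==> g \<in> stsp S ==> nrm S g \<le> M ==>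
		 \<bar>dder V g (unit_fun \<rho> i) (unit_fun \<sigma> j)\<bar> \<le> B"
		by fastforce
	let ?c = "real ((card S * CARD('d))^2) * B"
	have "\<bar>dder V g k l\<bar> \<le> ?c * nrm S k * nrm S l"
		if g: "g \<in> stsp S" and k: "k \<in> stsp S" and l: "l \<in> stsp S"
			and M: "nrm S g \<le> M" for g k l
		using form2_bound'[OF S, of "dder V g" k l B] B(2)[OF _ _ g M] g k l
		by (auto intro!: ddV_right ddV_left simp: mult_ac)
	moreover have "0 \<le> ?c" using B by simp
	ultimately show ?thesis by blast
qed

text \<open>Schwarz's theorem by the second difference \<phi>: two applications of the mean value
  theorem, in either order of the directions, represent it as \<open>t * t\<close> times either
  mixed derivative at nearby points, and the Lipschitz bound lets \<open>t\<close> tend to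
  0.\<close>

lemma ddV_symmetric:
	assumes g: "g \<in> stsp S" and h: "h \<in> stsp S" and k: "k \<in> stsp S"
	shows "dder V g h k = dder V g k h"
proof -
	\<comment> \<open>For parameters below 1, displacements combined from \<open>h\<close> and
	  \<open>k\<close> have norm at most \<open>M\<close>, so that the Lipschitz bound applies to
	  them.\<close>
	define M where "M = max (nrm S g) (nrm S h + nrm S k)"
	have gM: "nrm S g \<le> M" by (simp add: M_def)
	obtain B where B0: "B \<ge> 0" "\<forall>g\<in>stsp S. \<forall>h\<in>stsp S. \<forall>k\<in>stsp S. \<forall>l\<in>stsp S.
		 nrm S g \<le> M --> nrm S h \<le> M -->
		 \<bar>dder V (g .+ h) k l - dder V g k l\<bar> \<le> B * nrm S h * nrm S k * nrm S l"
		using ddV_lipschitz[of M] by blast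
	have B: "B \<ge> 0" "!!z l m. z \<in> stsp S ==> l \<in> stsp S ==> m \<in> stsp S ==>
		 nrm S z \<le> M ==> \<bar>dder V (g .+ z) l m - dder V g l m\<bar> \<le> B * nrm S z * nrm S l * nrm S m"
		by (rule B0(1)) (rule B0(2)[rule_format, OF g _ _ _ gM])
	define \<phi> where "\<phi> t = V (\<lambda>\<rho>. g \<rho> + t *\<^sub>R h \<rho> + t *\<^sub>R k \<rho>) - V (along g t h) - V (along g t k) + V g" for t :: real
	have one: "\<exists>\<xi> \<eta>. 0 < \<xi> \<and> \<xi> < t \<and> 0 < \<eta> \<and> \<eta> < t \<and>
			V (\<lambda>\<rho>. g \<rho> + t *\<^sub>R h \<rho> + t *\<^sub>R k \<rho>) - V (along g t h) - V (along g t k) + V g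
			= t * t * dder V (\<lambda>\<rho>. (g \<rho> + \<xi> *\<^sub>R h \<rho>) + \<eta> *\<^sub>R k \<rho>) h k"
		if t: "0 < t" and h: "h \<in> stsp S" and k: "k \<in> stsp S" for t h k
	proof -
		have gk: "(along g t k) \<in> stsp S" using g k by simp
		let ?\<psi> = "\<lambda>s. V (\<lambda>\<rho>. (g \<rho> + t *\<^sub>R k \<rho>) + s *\<^sub>R h \<rho>) - V (along g s h)"
		have "\<exists>z>0. z < t \<and> ?\<psi> t - ?\<psi> 0 = (t - 0) * (dir_deriv V (\<lambda>\<rho>. (g \<rho> + t *\<^sub>R k \<rho>) + z *\<^sub>R h \<rho>) h - dir_deriv V (along g z h) h)"
			using t by (intro MVT2 DERIV_diff line_deriv[OF V_C1] gk g h)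
		then obtain \<xi> where \<xi>: "0 < \<xi>" "\<xi> < t" "?\<psi> t - ?\<psi> 0 = t * (dir_deriv V (\<lambda>\<rho>. (g \<rho> + t *\<^sub>R k \<rho>) + \<xi> *\<^sub>R h \<rho>) h - dir_deriv V (along g \<xi> h) h)" by auto
		obtain \<eta> where \<eta>: "0 < \<eta>" "\<eta> < t" "dir_deriv V (\<lambda>\<rho>. (g \<rho> + \<xi> *\<^sub>R h \<rho>) + t *\<^sub>R k \<rho>) h - dir_deriv V (along g \<xi> h) h
			 = t * dder V (\<lambda>\<rho>. (g \<rho> + \<xi> *\<^sub>R h \<rho>) + \<eta> *\<^sub>R k \<rho>) h k"
			using line_mvt[OF dV_C1[OF h] stencil_space_line[OF g h] k t, of \<xi>] unfolding dder_def by blast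
		have eq: "(\<lambda>\<rho>. (g \<rho> + t *\<^sub>R k \<rho>) + \<xi> *\<^sub>R h \<rho>) = (\<lambda>\<rho>. (g \<rho> + \<xi> *\<^sub>R h \<rho>) + t *\<^sub>R k \<rho>)"
			"(\<lambda>\<rho>. (g \<rho> + t *\<^sub>R k \<rho>) + t *\<^sub>R h \<rho>) = (\<lambda>\<rho>. (g \<rho> + t *\<^sub>R h \<rho>) + t *\<^sub>R k \<rho>)"
			by (auto simp: algebra_simps)
		show ?thesis using \<xi> \<eta> unfolding eq by (intro exI[of _ \<xi>] exI[of _ \<eta>]) auto
	qed
	have close: "\<bar>dder V (\<lambda>\<rho>. (g \<rho> + \<xi> *\<^sub>R l \<rho>) + \<eta> *\<^sub>R m \<rho>) l m - dder V g l m\<bar> \<le> t * (B * M * nrm S l * nrm S m)"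
		if l: "l \<in> stsp S" and m: "m \<in> stsp S" and lm: "nrm S l + nrm S m \<le> M" and
		 t: "0 < \<xi>" "\<xi> < t" "0 < \<eta>" "\<eta> < t" "t < 1" for \<xi> \<eta> t l m
	proof -
		let ?z = "\<lambda>\<rho>. \<xi> *\<^sub>R l \<rho> + \<eta> *\<^sub>R m \<rho>"
		have "nrm S ?z \<le> \<xi> * nrm S l + \<eta> * nrm S m"
			using nrm_add[of S "\<lambda>\<rho>. \<xi> *\<^sub>R l \<rho>" "\<lambda>\<rho>. \<eta> *\<^sub>R m \<rho>"] t by (simp add: nrm_scale)
		also have "\<dots> \<le> t * nrm S l + t * nrm S m" using t by (intro add_mono mult_right_mono) auto
		also have "\<dots> \<le> t * M" using lm t by (simp add: distrib_left[symmetric])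
		finally have z: "nrm S ?z \<le> t * M" .
		have M0: "0 \<le> M" using lm nrm_nonneg[of S l] nrm_nonneg[of S m] by linarith
		then have "nrm S ?z \<le> M" using z t mult_right_mono[of t 1 M] by simp
		from B(2)[OF stencil_space_lin[OF l m] l m this]
		have "\<bar>dder V (g .+ ?z) l m - dder V g l m\<bar> \<le> B * nrm S ?z * nrm S l * nrm S m" .
		also have "\<dots> \<le> B * (t * M) * nrm S l * nrm S m" using z B by (intro mult_right_mono mult_left_mono) auto
		finally show ?thesis by (simp add: add.assoc mult_ac)
	qed
	have lm: "nrm S h + nrm S k \<le> M" "nrm S k + nrm S h \<le> M" unfolding M_def by auto
	let ?D = "B * M * nrm S h * nrm S k"
	have bd: "\<bar>dder V g h k - dder V g k h\<bar> \<le> t * (2 * ?D)" if t: "0 < t" "t < 1" for t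
	proof -
		obtain \<xi> \<eta> where 1: "0 < \<xi>" "\<xi> < t" "0 < \<eta>" "\<eta> < t" "\<phi> t = t * t * dder V (\<lambda>\<rho>. (g \<rho> + \<xi> *\<^sub>R h \<rho>) + \<eta> *\<^sub>R k \<rho>) h k"
			using one[OF t(1) h k] unfolding \<phi>_def by blast
		obtain \<xi>' \<eta>' where 2: "0 < \<xi>'" "\<xi>' < t" "0 < \<eta>'" "\<eta>' < t" "V (\<lambda>\<rho>. g \<rho> + t *\<^sub>R k \<rho> + t *\<^sub>R h \<rho>) - V (along g t k) - V (along g t h) + V g
			 = t * t * dder V (\<lambda>\<rho>. (g \<rho> + \<xi>' *\<^sub>R k \<rho>) + \<eta>' *\<^sub>R h \<rho>) k h"
			using one[OF t(1) k h] by blast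
		have "(\<lambda>\<rho>. g \<rho> + t *\<^sub>R k \<rho> + t *\<^sub>R h \<rho>) = (\<lambda>\<rho>. g \<rho> + t *\<^sub>R h \<rho> + t *\<^sub>R k \<rho>)" by (auto simp: algebra_simps)
		then have "t * t * dder V (\<lambda>\<rho>. (g \<rho> + \<xi> *\<^sub>R h \<rho>) + \<eta> *\<^sub>R k \<rho>) h k = t * t * dder V (\<lambda>\<rho>. (g \<rho> + \<xi>' *\<^sub>R k \<rho>) + \<eta>' *\<^sub>R h \<rho>) k h"
			using 1(5) 2(5) unfolding \<phi>_def by (simp only:)
		then have "dder V (\<lambda>\<rho>. (g \<rho> + \<xi> *\<^sub>R h \<rho>) + \<eta> *\<^sub>R k \<rho>) h k = dder V (\<lambda>\<rho>. (g \<rho> + \<xi>' *\<^sub>R k \<rho>) + \<eta>' *\<^sub>R h \<rho>) k h"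
			using t by simp
		then show ?thesis using close[OF h k lm(1) 1(1-4) t(2)] close[OF k h lm(2) 2(1-4) t(2)]
			by (simp add: mult_ac)
	qed
	have "\<bar>dder V g h k - dder V g k h\<bar> \<le> 0"
	proof (rule tendsto_lowerbound)
		show "((\<lambda>t. t * (2 * ?D)) \<longlongrightarrow> 0) (at_right 0)"
			by (rule tendsto_eq_intros tendsto_ident_at refl)+ simp
		show "\<forall>\<^sub>F t in at_right 0. \<bar>dder V g h k - dder V g k h\<bar> \<le> t * (2 * ?D)"
			unfolding eventually_at_right_field using bd by (intro exI[of _ 1]) auto
	qed simp
	then show ?thesis by simp
qed

lemma site_ok_exists: "\<exists>K. (\<forall>M. 0 \<le> K M) \<and> site_ok S K V (dir_deriv V) (dder V)"
proof -
	have "\<forall>M. \<exists>B\<ge>0. \<forall>g\<in>stsp S. \<forall>h\<in>stsp S. \<forall>k\<in>stsp S. \<forall>l\<in>stsp S.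
		 nrm S g \<le> M --> nrm S h \<le> M -->
		 \<bar>dder V (g .+ h) k l - dder V g k l\<bar> \<le> B * nrm S h * nrm S k * nrm S l"
		using ddV_lipschitz by blast
	from choice[OF this] obtain K1 where K1': "\<forall>M. 0 \<le> K1 M \<and> (\<forall>g\<in>stsp S. \<forall>h\<in>stsp S. \<forall>k\<in>stsp S. \<forall>l\<in>stsp S.
		 nrm S g \<le> M --> nrm S h \<le> M -->
		 \<bar>dder V (g .+ h) k l - dder V g k l\<bar> \<le> K1 M * nrm S h * nrm S k * nrm S l)" by blast
	have K1: "!!M. 0 \<le> K1 M" "!!M g h k l. g \<in> stsp S ==> h \<in> stsp S ==> k \<in> stsp S ==> l \<in> stsp S
		==> nrm S g \<le> M ==> nrm S h \<le> M ==> \<bar>dder V (g .+ h) k l - dder V g k l\<bar> \<le> K1 M * nrm S h * nrm S k * nrm S l"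
		by (rule K1'[THEN spec, THEN conjunct1], rule K1'[THEN spec, THEN conjunct2, rule_format])
	have "\<forall>M. \<exists>B\<ge>0. \<forall>g\<in>stsp S. \<forall>k\<in>stsp S. \<forall>l\<in>stsp S.
		 nrm S g \<le> M --> \<bar>dder V g k l\<bar> \<le> B * nrm S k * nrm S l"
		using ddV_bounded by blast
	from choice[OF this] obtain K2 where K2': "\<forall>M. 0 \<le> K2 M \<and> (\<forall>g\<in>stsp S. \<forall>k\<in>stsp S. \<forall>l\<in>stsp S.
		 nrm S g \<le> M --> \<bar>dder V g k l\<bar> \<le> K2 M * nrm S k * nrm S l)" by blast
	have K2: "!!M. 0 \<le> K2 M" "!!M g k l. g \<in> stsp S ==> k \<in> stsp S ==> l \<in> stsp S
		==> nrm S g \<le> M ==> \<bar>dder V g k l\<bar> \<le> K2 M * nrm S k * nrm S l"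
		by (rule K2'[THEN spec, THEN conjunct1], rule K2'[THEN spec, THEN conjunct2, rule_format])
	define K where "K M = K1 M + K2 M" for M
	have KK: "K1 M \<le> K M" "K2 M \<le> K M" "0 \<le> K M" for M using K1(1)[of M] K2(1)[of M] by (auto simp: K_def)
	have taylor1: "\<bar>dir_deriv V (g .+ h) k - dir_deriv V g k - dder V g h k\<bar> \<le> K1 M * (nrm S h)\<^sup>2 * nrm S k"
		if g: "g \<in> stsp S" and h: "h \<in> stsp S" and k: "k \<in> stsp S" and M: "nrm S g \<le> M" "nrm S h \<le> M" for M g h k
	proof -
		obtain \<theta> where \<theta>: "0 < \<theta>" "\<theta> < 1" and eq: "dir_deriv V (\<lambda>\<rho>. g \<rho> + 1 *\<^sub>R h \<rho>) k - dir_deriv V g k = 1 * dder V (along g \<theta> h) k h"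
			using line_mvt[OF dV_C1[OF k] g h zero_less_one] unfolding dder_def by blast
		have \<theta>h: "nrm S (\<lambda>\<rho>. \<theta> *\<^sub>R h \<rho>) \<le> nrm S h" using \<theta> mult_right_mono[of \<theta> 1 "nrm S h"] by (simp add: nrm_scale)
		have "\<bar>dder V (along g \<theta> h) k h - dder V g k h\<bar> \<le> K1 M * nrm S (\<lambda>\<rho>. \<theta> *\<^sub>R h \<rho>) * nrm S k * nrm S h"
			using \<theta>h M by (intro K1(2) g stencil_space_scale h k) auto
		also have "\<dots> \<le> K1 M * nrm S h * nrm S k * nrm S h"
			using \<theta>h K1 by (intro mult_right_mono mult_left_mono) auto
		finally show ?thesis using eq ddV_symmetric[OF g h k] by (simp add: power2_eq_square mult_ac)
	qed
	have taylor2: "\<bar>V (g .+ h) - V g - dir_deriv V g h - dder V g h h / 2\<bar> \<le> K1 M * nrm S h ^ 3"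
		if g: "g \<in> stsp S" and h: "h \<in> stsp S" and M: "nrm S g \<le> M" "nrm S h \<le> M" for M g h
	proof -
		\<comment> \<open>The derivative of this function is the remainder bounded by
		  \<open>taylor1\<close>, so the cubic bound costs one more mean value step.\<close>
		let ?\<Phi> = "\<lambda>t. V (along g t h) - V g - t * dir_deriv V g h - t\<^sup>2 * dder V g h h / 2"
		have "\<exists>z>0. z < 1 \<and> ?\<Phi> 1 - ?\<Phi> 0 = (1 - 0) * (dir_deriv V (along g z h) h - dir_deriv V g h - z * dder V g h h)"
			by (intro MVT2 zero_less_one) (auto intro!: derivative_eq_intros line_deriv[OF V_C1 g h])
		then obtain z where z: "0 < z" "z < 1" "?\<Phi> 1 - ?\<Phi> 0 = dir_deriv V (along g z h) h - dir_deriv V g h - z * dder V g h h" by auto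
		have zh: "nrm S (\<lambda>\<rho>. z *\<^sub>R h \<rho>) \<le> nrm S h" using z mult_right_mono[of z 1 "nrm S h"] by (simp add: nrm_scale)
		have "dder V g (\<lambda>\<rho>. z *\<^sub>R h \<rho>) h = z * dder V g h h"
		proof -
			have "dder V g (\<lambda>\<rho>. z *\<^sub>R h \<rho> + 0 *\<^sub>R h \<rho>) h = z * dder V g h h + 0 * dder V g h h"
				using ddV_left[OF g h] h unfolding form1_def by blast
			then show ?thesis by simp
		qed
		then have "\<bar>?\<Phi> 1 - ?\<Phi> 0\<bar> \<le> K1 M * (nrm S (\<lambda>\<rho>. z *\<^sub>R h \<rho>))\<^sup>2 * nrm S h"
			unfolding z(3) using taylor1[OF g stencil_space_scale[OF h] h M(1), of z] zh M(2) by simp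
		also have "\<dots> \<le> K1 M * (nrm S h)\<^sup>2 * nrm S h"
			using zh K1 by (intro mult_right_mono mult_left_mono power_mono) auto
		finally show ?thesis by (simp add: power2_eq_square power3_eq_cube mult_ac)
	qed
	have "site_ok S K V (dir_deriv V) (dder V)"
		unfolding site_ok_def
	proof (intro conjI ballI allI impI)
		fix g :: "'d vfun" assume g: "g \<in> stsp S"
		show "form1 S (dir_deriv V g)" by (rule form1_dir_deriv[OF V_C1 g])
		show "form2 S (dder V g)" unfolding form2_def using ddV_right[OF g] ddV_symmetric[OF g] by auto
	next
		fix M and g h :: "'d vfun" assume g: "g \<in> stsp S" and h: "h \<in> stsp S" and M: "nrm S g \<le> M" "nrm S h \<le> M"
		show "\<bar>V (g .+ h) - V g - dir_deriv V g h - dder V g h h / 2\<bar> \<le> K M * nrm S h ^ 3"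
			by (rule order_trans[OF taylor2[OF g h M]]) (intro mult_right_mono KK, simp)
		fix k :: "'d vfun" assume k: "k \<in> stsp S"
		show "\<bar>dir_deriv V (g .+ h) k - dir_deriv V g k - dder V g h k\<bar> \<le> K M * (nrm S h)\<^sup>2 * nrm S k"
			by (rule order_trans[OF taylor1[OF g h k M]]) (intro mult_right_mono KK, auto)
		fix l :: "'d vfun" assume l: "l \<in> stsp S"
		show "\<bar>dder V g k l\<bar> \<le> K M * nrm S k * nrm S l"
			by (rule order_trans[OF K2(2)[OF g k l M(1)]]) (intro mult_right_mono KK, auto)
		show "\<bar>dder V (g .+ h) k l - dder V g k l\<bar> \<le> K M * nrm S h * nrm S k * nrm S l"
			by (rule order_trans[OF K1(2)[OF g h k l M]]) (intro mult_right_mono KK, auto)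
	qed
	then show ?thesis by (intro exI[of _ K] conjI allI KK(3))
qed

end

lemma site_okD:
	assumes "site_ok S K V dV ddV" and g: "g \<in> stsp S"
	shows "form1 S (dV g)" "form2 S (ddV g)"
		"!!h M. h \<in> stsp S ==> nrm S g \<le> M ==> nrm S h \<le> M ==>
			\<bar>V (g .+ h) - V g - dV g h - ddV g h h / 2\<bar> \<le> K M * nrm S h ^ 3"
		"!!h k M. h \<in> stsp S ==> k \<in> stsp S ==> nrm S g \<le> M ==> nrm S h \<le> M ==>
			\<bar>dV (g .+ h) k - dV g k - ddV g h k\<bar> \<le> K M * (nrm S h)\<^sup>2 * nrm S k"
		"!!k l M. k \<in> stsp S ==> l \<in> stsp S ==> nrm S g \<le> M ==>
			\<bar>ddV g k l\<bar> \<le> K M * nrm S k * nrm S l"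
		"!!h k l M. h \<in> stsp S ==> k \<in> stsp S ==> l \<in> stsp S ==> nrm S g \<le> M ==> nrm S h \<le> M ==>
			\<bar>ddV (g .+ h) k l - ddV g k l\<bar> \<le> K M * nrm S h * nrm S k * nrm S l"
proof -
	note d = assms(1)[unfolded site_ok_def]
	note t = d[THEN conjunct2, THEN spec, THEN bspec, OF g, THEN bspec, THEN mp, THEN mp]
	show "form1 S (dV g)" "form2 S (ddV g)" using d g by blast+
	show "\<bar>V (g .+ h) - V g - dV g h - ddV g h h / 2\<bar> \<le> K M * nrm S h ^ 3"
		if "h \<in> stsp S" "nrm S g \<le> M" "nrm S h \<le> M" for h M
		by (rule t[OF that, THEN conjunct1])
	show "\<bar>dV (g .+ h) k - dV g k - ddV g h k\<bar> \<le> K M * (nrm S h)\<^sup>2 * nrm S k"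
		if "h \<in> stsp S" "k \<in> stsp S" "nrm S g \<le> M" "nrm S h \<le> M" for h k M
		by (rule t[OF that(1,3,4), THEN conjunct2, THEN bspec, OF that(2), THEN conjunct1])
	show "\<bar>ddV g k l\<bar> \<le> K M * nrm S k * nrm S l"
		if "k \<in> stsp S" "l \<in> stsp S" "nrm S g \<le> M" for k l M
	proof -
		\<comment> \<open>In \<open>site_ok\<close> this bound stands below the quantifier over the
		  increment \<open>h\<close>; the increment 0 satisfies its premises.\<close>
		have "nrm S zf \<le> M" using order_trans[OF nrm_nonneg that(3)] by simp
		from t[OF stencil_space_zero that(3) this, THEN conjunct2, THEN bspec, OF that(1), THEN conjunct2, THEN bspec, OF that(2), THEN conjunct1]
		show ?thesis .
	qed
	show "\<bar>ddV (g .+ h) k l - ddV g k l\<bar> \<le> K M * nrm S h * nrm S k * nrm S l"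
		if "h \<in> stsp S" "k \<in> stsp S" "l \<in> stsp S" "nrm S g \<le> M" "nrm S h \<le> M" for h k l M
		by (rule t[OF that(1,4,5), THEN conjunct2, THEN bspec, OF that(2), THEN conjunct2, THEN bspec, OF that(3), THEN conjunct2])
qed

lemma site_ok_mono:
	assumes ok: "site_ok S K V dV ddV" and K: "!!M. K M \<le> K' M"
	shows "site_ok S K' V dV ddV"
	unfolding site_ok_def
proof (intro conjI ballI allI impI)
	fix g :: "'a vfun" assume g: "g \<in> stsp S"
	show "form1 S (dV g)" "form2 S (ddV g)" using site_okD[OF ok g] by auto
next
	fix M and g h :: "'a vfun" assume g: "g \<in> stsp S" and h: "h \<in> stsp S" and M: "nrm S g \<le> M" "nrm S h \<le> M"
	show "\<bar>V (g .+ h) - V g - dV g h - ddV g h h / 2\<bar> \<le> K' M * nrm S h ^ 3"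
		by (rule order_trans[OF site_okD(3)[OF ok g h M]]) (intro mult_right_mono K, simp)
	fix k :: "'a vfun" assume k: "k \<in> stsp S"
	show "\<bar>dV (g .+ h) k - dV g k - ddV g h k\<bar> \<le> K' M * (nrm S h)\<^sup>2 * nrm S k"
		by (rule order_trans[OF site_okD(4)[OF ok g h k M]]) (intro mult_right_mono K, auto)
	fix l :: "'a vfun" assume l: "l \<in> stsp S"
	show "\<bar>ddV g k l\<bar> \<le> K' M * nrm S k * nrm S l"
		by (rule order_trans[OF site_okD(5)[OF ok g k l M(1)]]) (intro mult_right_mono K, auto)
	show "\<bar>ddV (g .+ h) k l - ddV g k l\<bar> \<le> K' M * nrm S h * nrm S k * nrm S l"
		by (rule order_trans[OF site_okD(6)[OF ok g h k l M]]) (intro mult_right_mono K, auto)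
qed

lemma form2_scale:
	assumes "form2 S Q" "g \<in> stsp S" "h \<in> stsp S"
	shows "Q (g .+ h) (g .+ h) = Q g g + 2 * Q g h + Q h h"
proof -
	have *: "Q k (\<lambda>\<rho>. 1 *\<^sub>R g \<rho> + 1 *\<^sub>R h \<rho>) = 1 * Q k g + 1 * Q k h" if "k \<in> stsp S" for k
		using assms that unfolding form2_def form1_def by blast
	have "Q (g .+ h) (g .+ h) = Q (g .+ h) g + Q (g .+ h) h"
		using *[of "\<lambda>\<rho>. g \<rho> + h \<rho>"] assms by simp
	also have "\<dots> = Q g (g .+ h) + Q h (g .+ h)"
		using assms unfolding form2_def by simp
	also have "\<dots> = Q g g + Q g h + (Q h g + Q h h)" using *[of g] *[of h] assms by simp
	also have "Q h g = Q g h" using assms unfolding form2_def by simp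
	finally show ?thesis by simp
qed

lemma form2_add_left:
	assumes "form2 S Q" "g \<in> stsp S" "h \<in> stsp S" "k \<in> stsp S"
	shows "Q (g .+ h) k = Q g k + Q h k"
proof -
	have "Q (\<lambda>\<rho>. 1 *\<^sub>R g \<rho> + 1 *\<^sub>R h \<rho>) k = 1 * Q g k + 1 * Q h k"
		using form2_left[OF assms(1,4)] assms(2,3) unfolding form1_def by blast
	then show ?thesis by simp
qed

lemma form1_add: "form1 S L ==> form1 S L' ==> form1 S (\<lambda>h. L h + L' h)"
	unfolding form1_def by (simp add: algebra_simps)

text \<open>The Taylor remainders of a quadratic polynomial vanish and its Hessian is that of
  \<open>V\<close> at 0, so the constants \<open>K\<close> of \<open>V\<close> can be kept.\<close>

lemma site_ok_linearised:
	assumes ok: "site_ok S K V (dir_deriv V) (dder V)" and K0: "!!M. 0 \<le> K M"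
	shows "site_ok S K (linearised_potential V) (\<lambda>g h. dir_deriv V zf h + dder V zf g h) (\<lambda>g. dder V zf)"
proof -
	have L: "form1 S (dir_deriv V zf)" and Q: "form2 S (dder V zf)"
		using ok stencil_space_zero unfolding site_ok_def by blast+
	have Q1: "form1 S (dder V zf g)" if "g \<in> stsp S" for g
		using Q that unfolding form2_def by blast
	have b: "\<bar>dder V zf h k\<bar> \<le> K M * nrm S h * nrm S k"
		if "h \<in> stsp S" "k \<in> stsp S" "0 \<le> M" for h k M
	proof -
		have "nrm S zf \<le> M" using that by simp
		then show ?thesis using ok stencil_space_zero that unfolding site_ok_def by blast
	qed
	have La: "dir_deriv V zf (g .+ h) = dir_deriv V zf g + dir_deriv V zf h"
		if "g \<in> stsp S" "h \<in> stsp S" for g h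
	proof -
		have "dir_deriv V zf (\<lambda>\<rho>. 1 *\<^sub>R g \<rho> + 1 *\<^sub>R h \<rho>) = 1 * dir_deriv V zf g + 1 * dir_deriv V zf h"
			using L that unfolding form1_def by blast
		then show ?thesis by simp
	qed
	have lp: "linearised_potential V g = V zf + dir_deriv V zf g + dder V zf g g / 2" for g
		unfolding linearised_potential_def dder_def by simp
	have t2: "linearised_potential V (g .+ h) - linearised_potential V g
			- (dir_deriv V zf h + dder V zf g h) - dder V zf h h / 2 = 0"
		if "g \<in> stsp S" "h \<in> stsp S" for g h
		unfolding lp La[OF that] form2_scale[OF Q that] by (simp add: field_simps)
	have t1: "dir_deriv V zf k + dder V zf (g .+ h) k
			- (dir_deriv V zf k + dder V zf g k) - dder V zf h k = 0"
		if "g \<in> stsp S" "h \<in> stsp S" "k \<in> stsp S" for g h k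
		using form2_add_left[OF Q that] by simp
	show ?thesis
		unfolding site_ok_def
	proof (intro conjI ballI allI impI)
		fix g :: "'a vfun" assume g: "g \<in> stsp S"
		show "form1 S (\<lambda>h. dir_deriv V zf h + dder V zf g h)" by (intro form1_add L Q1 g)
		show "form2 S (dder V zf)" by (rule Q)
	next
		fix M and g h :: "'a vfun" assume g: "g \<in> stsp S" and h: "h \<in> stsp S" and M: "nrm S g \<le> M" "nrm S h \<le> M"
		have M0: "0 \<le> M" using M(1) nrm_nonneg[of S g] by linarith
		show "\<bar>linearised_potential V (g .+ h) - linearised_potential V g
			- (dir_deriv V zf h + dder V zf g h) - dder V zf h h / 2\<bar> \<le> K M * nrm S h ^ 3"
			unfolding t2[OF g h] using K0[of M] by simp
		fix k :: "'a vfun" assume k: "k \<in> stsp S"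
		show "\<bar>dir_deriv V zf k + dder V zf (g .+ h) k
			- (dir_deriv V zf k + dder V zf g k) - dder V zf h k\<bar> \<le> K M * (nrm S h)\<^sup>2 * nrm S k"
			unfolding t1[OF g h k] using K0[of M] by simp
		fix l :: "'a vfun" assume l: "l \<in> stsp S"
		show "\<bar>dder V zf k l\<bar> \<le> K M * nrm S k * nrm S l" by (rule b[OF k l M0])
		show "\<bar>dder V zf k l - dder V zf k l\<bar> \<le> K M * nrm S h * nrm S k * nrm S l"
			using K0[of M] by simp
	qed
qed

section \<open>Variations with respect to a semi-norm\<close>

text \<open>Abstract so that it covers \<open>W_norm\<close> on \<open>W_12\<close>, in which the
  theorem is phrased, and \<open>Dn\<close> on \<open>Wd\<close>, in which the estimates are made;
  variations are then carried from one to the other.\<close>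

locale seminormed =
	fixes W :: "'d::finite vfun set" and p :: "'d vfun => real"
	assumes lin: "u \<in> W ==> v \<in> W ==> (lcomb a u b v) \<in> W"
		and p0: "0 \<le> p v"
		and p_scale: "v \<in> W ==> p (\<lambda>x. a *\<^sub>R v x) = \<bar>a\<bar> * p v"
begin

lemma scale: "v \<in> W ==> (\<lambda>x. a *\<^sub>R v x) \<in> W"
	using lin[of v v a 0] by simp

lemma add: "u \<in> W ==> v \<in> W ==> (u .+ v) \<in> W"
	using lin[of u v 1 1] by simp

lemma diff: "u \<in> W ==> v \<in> W ==> (u .- v) \<in> W"
	using lin[of u v 1 "-1"] by simp

lemma blf_lin:
	assumes "bounded_linear_form W p L" "v \<in> W" "w \<in> W"
	shows "L (lcomb a v b w) = a * L v + b * L w"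
	using assms unfolding bounded_linear_form_def by simp

lemma blf_scale:
	assumes "bounded_linear_form W p L" "v \<in> W"
	shows "L (\<lambda>x. a *\<^sub>R v x) = a * L v"
	using blf_lin[OF assms assms(2), of a 0] by simp

lemma blf_bound:
	assumes "bounded_linear_form W p L"
	obtains K where "0 \<le> K" "!!v. v \<in> W ==> \<bar>L v\<bar> \<le> K * p v"
proof -
	obtain K where K: "\<forall>v\<in>W. \<bar>L v\<bar> \<le> K * p v" using assms unfolding bounded_linear_form_def by blast
	have "\<bar>L v\<bar> \<le> \<bar>K\<bar> * p v" if "v \<in> W" for v
		using K that p0[of v] mult_right_mono[of K "\<bar>K\<bar>" "p v"] by force
	then show thesis using that[of "\<bar>K\<bar>"] by simp
qed

lemma small_multiple:
	assumes "v \<in> W" "0 < \<delta>"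
	shows "\<exists>t>0. p (\<lambda>x. t *\<^sub>R v x) < \<delta>"
proof -
	define t where "t = \<delta> / (2 * (p v + 1))"
	have t: "0 < t" using assms p0[of v] by (auto simp: t_def intro!: divide_pos_pos)
	have "t * p v = \<delta> * (p v / (2 * (p v + 1)))" by (simp add: t_def)
	also have "\<dots> < \<delta> * 1" using assms(2) p0[of v] by (intro mult_strict_left_mono) (auto simp: divide_simps)
	finally show ?thesis using t p_scale[OF assms(1), of t] by (intro exI[of _ t]) simp
qed

text \<open>The difference of two variations is linear and o(p); testing with small multiples of a
  fixed \<open>v\<close> makes it zero.\<close>

lemma first_variation_unique:
	assumes 1: "has_first_variation W p F u L" and 2: "has_first_variation W p F u L'" and v: "v \<in> W"
	shows "L v = L' v"
proof -
	have b1: "bounded_linear_form W p L" and b2: "bounded_linear_form W p L'"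
		using 1 2 by (auto simp: has_first_variation_def)
	have "\<bar>L v - L' v\<bar> \<le> 0 + e * (2 * p v)" if e: "0 < e" for e
	proof -
		obtain d1 where d1: "d1 > 0" "!!v. v \<in> W ==> p v < d1 ==> \<bar>F (u .+ v) - F u - L v\<bar> \<le> e * p v"
			using 1 e unfolding has_first_variation_def by blast
		obtain d2 where d2: "d2 > 0" "!!v. v \<in> W ==> p v < d2 ==> \<bar>F (u .+ v) - F u - L' v\<bar> \<le> e * p v"
			using 2 e unfolding has_first_variation_def by blast
		obtain t where t: "0 < t" "p (\<lambda>x. t *\<^sub>R v x) < min d1 d2"
			using small_multiple[OF v, of "min d1 d2"] d1(1) d2(1) by (meson min_less_iff_conj)
		have "\<bar>L (\<lambda>x. t *\<^sub>R v x) - L' (\<lambda>x. t *\<^sub>R v x)\<bar> \<le> 2 * (e * p (\<lambda>x. t *\<^sub>R v x))"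
			using d1(2)[OF scale[OF v], of t] d2(2)[OF scale[OF v], of t] t(2) by simp
		then have "t * \<bar>L v - L' v\<bar> \<le> t * (e * (2 * p v))"
			using t(1) unfolding blf_scale[OF b1 v] blf_scale[OF b2 v] p_scale[OF v] right_diff_distrib[symmetric] abs_mult
			by (simp add: mult_ac)
		then show ?thesis using t(1) by simp
	qed
	then have "\<bar>L v - L' v\<bar> \<le> 0"
	proof -
		assume *: "!!e. 0 < e ==> \<bar>L v - L' v\<bar> \<le> 0 + e * (2 * p v)"
		show ?thesis
		proof (rule field_le_epsilon)
			fix e :: real assume "0 < e"
			then have "0 < e / (2 * p v + 1)" using p0[of v] by (simp add: add_nonneg_pos)
			from *[OF this] have "\<bar>L v - L' v\<bar> \<le> e * (2 * p v / (2 * p v + 1))" by simp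
			also have "\<dots> \<le> e * 1" using \<open>0 < e\<close> p0[of v] by (intro mult_left_mono) (auto simp: divide_simps)
			finally show "\<bar>L v - L' v\<bar> \<le> 0 + e" by simp
		qed
	qed
	then show ?thesis by simp
qed

lemma local_min_first_variation:
	assumes F: "has_first_variation W p F u L" and r: "0 < r"
		and min: "!!v. v \<in> W ==> p v < r ==> F u \<le> F (u .+ v)" and v: "v \<in> W"
	shows "L v = 0"
proof -
	have b: "bounded_linear_form W p L" using F by (auto simp: has_first_variation_def)
	have ge: "- (e * p v) \<le> L v" if e: "0 < e" and v: "v \<in> W" for e v
	proof -
		obtain d where d: "d > 0" "!!v. v \<in> W ==> p v < d ==> \<bar>F (u .+ v) - F u - L v\<bar> \<le> e * p v"
			using F e unfolding has_first_variation_def by blast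
		obtain t where t: "0 < t" "p (\<lambda>x. t *\<^sub>R v x) < min d r"
			using small_multiple[OF v, of "min d r"] d(1) r by (meson min_less_iff_conj)
		have "F u \<le> F (along u t v)" using min[OF scale[OF v], of t] t by simp
		moreover have "\<bar>F (along u t v) - F u - L (\<lambda>x. t *\<^sub>R v x)\<bar> \<le> e * p (\<lambda>x. t *\<^sub>R v x)"
			using d(2)[OF scale[OF v], of t] t by simp
		ultimately have "t * (- (e * p v)) \<le> t * L v"
			using t(1) unfolding blf_scale[OF b v] p_scale[OF v] by (simp add: mult_ac abs_le_iff)
		then show ?thesis using t(1) by (simp only: mult_le_cancel_left_pos)
	qed
	have ge0: "0 \<le> L v" if v: "v \<in> W" for v
	proof (rule field_le_epsilon)
		fix e :: real assume e: "0 < e"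
		then have "0 < e / (p v + 1)" using p0[of v] by (simp add: add_nonneg_pos)
		from ge[OF this v] have "- (e * (p v / (p v + 1))) \<le> L v" by simp
		moreover have "e * (p v / (p v + 1)) \<le> e * 1" using e p0[of v] by (intro mult_left_mono) (auto simp: divide_simps)
		ultimately show "0 \<le> L v + e" by linarith
	qed
	have "0 \<le> - L v" using ge0[OF scale[OF v, of "-1"]] blf_scale[OF b v, of "-1"] by simp
	then show ?thesis using ge0[OF v] by simp
qed

lemma first_variation_continuous:
	assumes "!!u. u \<in> W ==> has_first_variation W p F u (L u)"
	shows "continuous_wrt W p F"
	unfolding continuous_wrt_def
proof (intro ballI allI impI)
	fix u and e :: real assume u: "u \<in> W" and e: "0 < e"
	have F: "has_first_variation W p F u (L u)" using assms u by blast
	then have "bounded_linear_form W p (L u)" by (auto simp: has_first_variation_def)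
	then obtain K where K: "0 \<le> K" "!!v. v \<in> W ==> \<bar>L u v\<bar> \<le> K * p v" using blf_bound by blast
	obtain d where d: "d > 0" "!!v. v \<in> W ==> p v < d ==> \<bar>F (u .+ v) - F u - L u v\<bar> \<le> 1 * p v"
		using F unfolding has_first_variation_def by (metis zero_less_one)
	define d' where "d' = min d (e / (K + 1))"
	have "\<bar>F v - F u\<bar> < e" if v: "v \<in> W" "p (v .- u) < d'" for v
	proof -
		let ?w = "\<lambda>x. v x - u x"
		have w: "?w \<in> W" using diff[OF v(1) u] .
		have "\<bar>F v - F u\<bar> \<le> (K + 1) * p ?w"
			using d(2)[OF w] K(2)[OF w] v(2) by (simp add: d'_def algebra_simps)
		also have "\<dots> < (K + 1) * (e / (K + 1))" using v(2) K(1) by (intro mult_strict_left_mono) (auto simp: d'_def)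
		finally show ?thesis using K(1) by simp
	qed
	moreover have "0 < d'" using d e K by (simp add: d'_def)
	ultimately show "\<exists>\<delta>>0. \<forall>v\<in>W. p (v .- u) < \<delta> --> \<bar>F v - F u\<bar> < e" by blast
qed

text \<open>The definition of a second variation brings its own family \<open>L\<close> of first
  variations near \<open>u\<close>; uniqueness identifies it with \<open>D\<close>, and then
  \<open>B - B'\<close> is homogeneous and of smaller order.\<close>

lemma second_variation_unique:
	assumes B: "has_second_variation W p F u B" and u: "u \<in> W"
		and D: "!!w. w \<in> W ==> has_first_variation W p F w (D w)"
		and D': "!!e. 0 < e ==> \<exists>\<delta>>0. \<forall>v\<in>W. p v < \<delta> --> (\<forall>w\<in>W. \<bar>D (u .+ v) w - D u w - B' v w\<bar> \<le> e * p v * p w)"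
		and B's: "!!v w t. v \<in> W ==> w \<in> W ==> B' (\<lambda>x. t *\<^sub>R v x) w = t * B' v w"
		and v: "v \<in> W" and w: "w \<in> W"
	shows "B v w = B' v w"
proof -
	obtain r L where r: "0 < r" and L: "!!w. w \<in> W ==> p (w .- u) < r ==> has_first_variation W p F w (L w)"
		and L': "!!e. 0 < e ==> \<exists>\<delta>>0. \<forall>v\<in>W. p v < \<delta> --> (\<forall>w\<in>W. \<bar>L (u .+ v) w - L u w - B v w\<bar> \<le> e * p v * p w)"
		using B unfolding has_second_variation_def by blast
	have Bs: "B (\<lambda>x. t *\<^sub>R v x) w = t * B v w" for t
	proof -
		have "bounded_linear_form W p (\<lambda>v. B v w)" using B w unfolding has_second_variation_def by blast
		from blf_scale[OF this v] show ?thesis .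
	qed
	have p00: "p (\<lambda>x. 0) = 0" using p_scale[OF u, of 0] by simp
	have "\<bar>B v w - B' v w\<bar> \<le> e * (2 * p v * p w)" if e: "0 < e" for e
	proof -
		obtain d1 where d1: "d1 > 0" "!!v w. v \<in> W ==> p v < d1 ==> w \<in> W ==> \<bar>L (u .+ v) w - L u w - B v w\<bar> \<le> e * p v * p w"
			using L'[OF e] by blast
		obtain d2 where d2: "d2 > 0" "!!v w. v \<in> W ==> p v < d2 ==> w \<in> W ==> \<bar>D (u .+ v) w - D u w - B' v w\<bar> \<le> e * p v * p w"
			using D'[OF e] by blast
		obtain t where t: "0 < t" "p (\<lambda>x. t *\<^sub>R v x) < min (min d1 d2) r"
			using small_multiple[OF v, of "min (min d1 d2) r"] d1(1) d2(1) r by (meson min_less_iff_conj)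
		let ?v = "\<lambda>x. t *\<^sub>R v x"
		have v': "?v \<in> W" using v by (rule scale)
		have "L (u .+ ?v) w = D (u .+ ?v) w"
			using add[OF u v'] t by (intro first_variation_unique[OF L D w]) auto
		moreover have "L u w = D u w"
			using u r p00 by (intro first_variation_unique[OF L D w]) auto
		ultimately have "\<bar>B ?v w - B' ?v w\<bar> \<le> 2 * (e * p ?v * p w)"
			using d1(2)[OF v' _ w] d2(2)[OF v' _ w] t(2) by simp
		then have "t * \<bar>B v w - B' v w\<bar> \<le> t * (e * (2 * p v * p w))"
			using t(1) unfolding Bs B's[OF v w] p_scale[OF v] right_diff_distrib[symmetric] abs_mult
			by (simp add: mult_ac)
		then show ?thesis using t(1) by simp
	qed
	note * = this
	have "\<bar>B v w - B' v w\<bar> \<le> 0"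
	proof (rule field_le_epsilon)
		fix e :: real assume e: "0 < e"
		define P where "P = 2 * p v * p w"
		have P: "0 \<le> P" unfolding P_def using p0 by simp
		then have "0 < e / (P + 1)" using e by (simp add: add_nonneg_pos)
		from *[OF this] have "\<bar>B v w - B' v w\<bar> \<le> e * (P / (P + 1))" by (simp add: P_def)
		also have "\<dots> \<le> e * 1" using e P by (intro mult_left_mono) (auto simp: divide_simps)
		finally show "\<bar>B v w - B' v w\<bar> \<le> 0 + e" by simp
	qed
	then show ?thesis by simp
qed

lemma has_first_variation_cong:
	assumes "has_first_variation W p F u L" "!!v. v \<in> W ==> F' v = F v" "u \<in> W" "!!v. v \<in> W ==> L' v = L v"
	shows "has_first_variation W p F' u L'"
proof -
	have "bounded_linear_form W p L'"
		using assms(1,4) unfolding has_first_variation_def bounded_linear_form_def by (simp add: lin)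
	then show ?thesis using assms add[OF assms(3)] unfolding has_first_variation_def by simp
qed

lemma has_second_variation_cong:
	assumes "has_second_variation W p F u B" "!!v. v \<in> W ==> F' v = F v"
	shows "has_second_variation W p F' u B"
proof -
	have c: "has_first_variation W p F w L ==> w \<in> W ==> has_first_variation W p F' w L" for w L
		by (rule has_first_variation_cong[of F w L F' L]) (auto simp: assms(2))
	note d = assms(1)[unfolded has_second_variation_def]
	obtain r L where r: "0 < r" and L: "\<forall>w\<in>W. p (w .- u) < r --> has_first_variation W p F w (L w)"
		and L': "\<forall>\<epsilon>>0. \<exists>\<delta>>0. \<forall>v\<in>W. p v < \<delta> --> (\<forall>w\<in>W. \<bar>L (u .+ v) w - L u w - B v w\<bar> \<le> \<epsilon> * p v * p w)"
		using d by blast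
	have "\<forall>w\<in>W. p (w .- u) < r --> has_first_variation W p F' w (L w)" using L c by blast
	then have "\<exists>r>0. \<exists>L. (\<forall>w\<in>W. p (w .- u) < r --> has_first_variation W p F' w (L w)) \<and>
		 (\<forall>\<epsilon>>0. \<exists>\<delta>>0. \<forall>v\<in>W. p v < \<delta> --> (\<forall>w\<in>W. \<bar>L (u .+ v) w - L u w - B v w\<bar> \<le> \<epsilon> * p v * p w))"
		using r L' by (intro exI[of _ r] conjI exI[of _ L])
	then show ?thesis using d unfolding has_second_variation_def by (elim conjE, intro conjI)
qed

lemma bounded_linear_form_equiv:
	assumes "bounded_linear_form W p L" "0 < a" "!!v. v \<in> W ==> p v \<le> a * q v"
	shows "bounded_linear_form W q L"
proof -
	obtain K where K: "0 \<le> K" "!!v. v \<in> W ==> \<bar>L v\<bar> \<le> K * p v" using blf_bound[OF assms(1)] by blast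
	have "\<bar>L v\<bar> \<le> (K * a) * q v" if v: "v \<in> W" for v
	proof -
		have "K * p v \<le> K * (a * q v)" using K(1) assms(3)[OF v] by (intro mult_left_mono) auto
		then show ?thesis using K(2)[OF v] by (simp add: mult.assoc)
	qed
	then show ?thesis using assms(1) unfolding bounded_linear_form_def by blast
qed

text \<open>One inequality between the semi-norms suffices: smallness in \<open>q\<close> implies
  smallness in \<open>p\<close>, and a remainder bounded by \<open>p\<close> is bounded by
  \<open>q\<close>.\<close>

lemma has_first_variation_equiv:
	assumes F: "has_first_variation W p F u L" and a: "0 < a" "!!v. v \<in> W ==> p v \<le> a * q v"
	shows "has_first_variation W q F u L"
	unfolding has_first_variation_def
proof (intro conjI allI impI)
	show "bounded_linear_form W q L"
		using F a bounded_linear_form_equiv unfolding has_first_variation_def by blast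
	fix e :: real assume e: "0 < e"
	then have "0 < e / a" using a by simp
	then obtain d where d: "d > 0" "!!v. v \<in> W ==> p v < d ==> \<bar>F (u .+ v) - F u - L v\<bar> \<le> e / a * p v"
		using F unfolding has_first_variation_def by blast
	have "\<bar>F (u .+ v) - F u - L v\<bar> \<le> e * q v" if v: "v \<in> W" "q v < d / a" for v
	proof -
		have "a * q v < d" using v(2) a(1) by (simp add: field_simps)
		then have "\<bar>F (u .+ v) - F u - L v\<bar> \<le> e / a * p v" using a(2)[OF v(1)] by (intro d v) auto
		also have "\<dots> \<le> e / a * (a * q v)" using e a(1) a(2)[OF v(1)] by (intro mult_left_mono) auto
		finally show ?thesis using a by simp
	qed
	then show "\<exists>\<delta>>0. \<forall>v\<in>W. q v < \<delta> --> \<bar>F (u .+ v) - F u - L v\<bar> \<le> e * q v"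
		using d(1) a(1) by (intro exI[of _ "d / a"]) auto
qed

lemma has_second_variation_equiv:
	assumes F: "has_second_variation W p F u B" and a: "0 < a" "!!v. v \<in> W ==> p v \<le> a * q v"
		and u: "u \<in> W" and q0: "!!v. 0 \<le> q v"
	shows "has_second_variation W q F u B"
proof -
	obtain r L where r: "0 < r" and L: "!!w. w \<in> W ==> p (w .- u) < r ==> has_first_variation W p F w (L w)"
		and L': "!!e. 0 < e ==> \<exists>\<delta>>0. \<forall>v\<in>W. p v < \<delta> --> (\<forall>w\<in>W. \<bar>L (u .+ v) w - L u w - B v w\<bar> \<le> e * p v * p w)"
		using F unfolding has_second_variation_def by blast
	have pp: "p v * p w \<le> (a * a) * (q v * q w)" if "v \<in> W" "w \<in> W" for v w
	proof -
		have "p v * p w \<le> (a * q v) * (a * q w)" using that a p0 q0 by (intro mult_mono) auto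
		then show ?thesis by (simp add: mult_ac)
	qed
	show ?thesis
		unfolding has_second_variation_def
	proof (intro conjI)
		show "\<forall>v\<in>W. bounded_linear_form W q (B v)" "\<forall>w\<in>W. bounded_linear_form W q (\<lambda>v. B v w)"
			using F bounded_linear_form_equiv[OF _ a] unfolding has_second_variation_def by blast+
		obtain K where K: "\<forall>v\<in>W. \<forall>w\<in>W. \<bar>B v w\<bar> \<le> K * p v * p w" using F unfolding has_second_variation_def by blast
		have "\<bar>B v w\<bar> \<le> (\<bar>K\<bar> * (a * a)) * q v * q w" if "v \<in> W" "w \<in> W" for v w
		proof -
			have "\<bar>B v w\<bar> \<le> K * (p v * p w)" using K that by (simp add: mult.assoc)
			also have "\<dots> \<le> \<bar>K\<bar> * (p v * p w)" using p0 by (intro mult_right_mono) auto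
			also have "\<dots> \<le> \<bar>K\<bar> * ((a * a) * (q v * q w))" using pp[OF that] by (intro mult_left_mono) auto
			finally show ?thesis by (simp add: mult.assoc)
		qed
		then show "\<exists>K. \<forall>v\<in>W. \<forall>w\<in>W. \<bar>B v w\<bar> \<le> K * q v * q w" by blast
		have "has_first_variation W q F w (L w)" if "w \<in> W" "q (w .- u) < r / a" for w
		proof -
			have "a * q (w .- u) < r" using that(2) a(1) by (simp add: field_simps)
			then have "p (w .- u) < r" using a(2)[OF diff[OF that(1) u]] by simp
			then show ?thesis using has_first_variation_equiv[OF L a] that by blast
		qed
		moreover have "\<exists>\<delta>>0. \<forall>v\<in>W. q v < \<delta> --> (\<forall>w\<in>W. \<bar>L (u .+ v) w - L u w - B v w\<bar> \<le> e * q v * q w)" if e: "0 < e" for e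
		proof -
			have "0 < e / (a * a)" using e a by simp
			from L'[OF this] obtain d where d: "d > 0" "!!v w. v \<in> W ==> p v < d ==> w \<in> W ==> \<bar>L (u .+ v) w - L u w - B v w\<bar> \<le> e / (a * a) * p v * p w"
				by blast
			have "\<bar>L (u .+ v) w - L u w - B v w\<bar> \<le> e * q v * q w" if v: "v \<in> W" "q v < d / a" and w: "w \<in> W" for v w
			proof -
				have "a * q v < d" using v(2) a(1) by (simp add: field_simps)
				then have "\<bar>L (u .+ v) w - L u w - B v w\<bar> \<le> e / (a * a) * p v * p w" using a(2)[OF v(1)] by (intro d v w) auto
				also have "\<dots> = e / (a * a) * (p v * p w)" by simp
				also have "\<dots> \<le> e / (a * a) * ((a * a) * (q v * q w))" using e a(1) pp[OF v(1) w] by (intro mult_left_mono) auto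
				also have "\<dots> = e * q v * q w" using a by simp
				finally show ?thesis .
			qed
			then show ?thesis using d(1) a(1) by (intro exI[of _ "d / a"]) auto
		qed
		ultimately show "\<exists>r>0. \<exists>L. (\<forall>w\<in>W. q (w .- u) < r --> has_first_variation W q F w (L w)) \<and>
				(\<forall>\<epsilon>>0. \<exists>\<delta>>0. \<forall>v\<in>W. q v < \<delta> --> (\<forall>w\<in>W. \<bar>L (u .+ v) w - L u w - B v w\<bar> \<le> \<epsilon> * q v * q w))"
			using r a by (intro exI[of _ "r / a"] conjI exI[of _ L]) auto
	qed
qed

end

lemma seminormed_Wd: "seminormed (Wd \<Lambda> St) (Dn \<Lambda> St)"
	by unfold_locales (auto simp: Wd_lin Dn_scale)

lemma infsum_split_finite:
	fixes f :: "'a => real"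
	assumes "f summable_on X" "finite Y" "Y \<subseteq> X"
	shows "infsum f X = sum f Y + infsum f (X - Y)"
proof -
	have "infsum f (Y \<union> (X - Y)) = infsum f Y + infsum f (X - Y)"
		using assms by (intro infsum_Un_disjoint) (auto intro: summable_on_subset_banach)
	moreover have "Y \<union> (X - Y) = X" using assms(3) by blast
	ultimately show ?thesis using assms(2) by simp
qed

lemma infsum_diff_real:
	fixes f g :: "'a => real"
	assumes "f summable_on A" "g summable_on A"
	shows "(f .- g) summable_on A" "(\<Sum>\<^sub>\<infinity>x\<in>A. f x - g x) = infsum f A - infsum g A"
proof -
	have g: "(\<lambda>x. - g x) summable_on A" using assms(2) by (simp add: summable_on_uminus)
	show "(f .- g) summable_on A" using summable_on_add[OF assms(1) g] by simp
	show "(\<Sum>\<^sub>\<infinity>x\<in>A. f x - g x) = infsum f A - infsum g A"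
		using infsum_add[OF assms(1) g] by (simp add: infsum_uminus)
qed

section \<open>Minimising quadratic functionals\<close>

context net
begin

abbreviation "W \<equiv> Wd \<Lambda> St"
abbreviation "D \<equiv> Dn \<Lambda> St"

sublocale sn: seminormed W D by (rule seminormed_Wd)

text \<open>Lax-Milgram on a complete semi-normed space: minimise \<open>B w w / 2 - L w\<close>
  over the closed subspace \<open>C\<close> by uniform convexity. It is used once for the closure of
  the finitely supported functions and once for the whole space.\<close>

lemma riesz:
	fixes C :: "'d vfun set" and B :: "'d vfun => 'd vfun => real" and L :: "'d vfun => real"
	assumes CW: "C \<subseteq> W" and C0: "zf \<in> C"
		and Clin: "!!u v a b. u \<in> C ==> v \<in> C ==> (lcomb a u b v) \<in> C"
		and Ccl: "!!X u. (!!n::nat. X n \<in> C) ==> u \<in> W ==> (\<lambda>n. D (X n .- u)) \<longlonglongrightarrow> 0 ==> u \<in> C"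
		and Blin: "!!u v w a b. u \<in> W ==> v \<in> W ==> w \<in> W ==> B (lcomb a u b v) w = a * B u w + b * B v w"
		and Bsym: "!!u v. u \<in> W ==> v \<in> W ==> B u v = B v u"
		and Bbd: "!!u v. u \<in> W ==> v \<in> W ==> \<bar>B u v\<bar> \<le> KB * D u * D v"
		and c: "0 < c" and Bco: "!!v. v \<in> C ==> c * (D v)\<^sup>2 \<le> B v v"
		and Llin: "!!u v a b. u \<in> W ==> v \<in> W ==> L (lcomb a u b v) = a * L u + b * L v"
		and \<tau>: "0 \<le> \<tau>" and Lbd: "!!v. v \<in> W ==> \<bar>L v\<bar> \<le> \<tau> * D v"
	shows "\<exists>w\<in>C. (\<forall>\<phi>\<in>C. B w \<phi> = L \<phi>) \<and> c * D w \<le> \<tau>"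
proof -
	define F where "F w = B w w / 2 - L w" for w
	have Blin2: "B w (lcomb a u b v) = a * B w u + b * B w v" if "u \<in> W" "v \<in> W" "w \<in> W" for u v w a b
		using Blin[OF that, of a b] Bsym[OF sn.lin[OF that(1,2)] that(3), of a b] Bsym[OF that(1,3)] Bsym[OF that(2,3)] by simp
	have Badd: "B (lcomb a u b v) (lcomb a u b v) = a * a * B u u + 2 * a * b * B u v + b * b * B v v"
		if "u \<in> W" "v \<in> W" for u v a b
		using that by (simp add: Blin Blin2 sn.lin Bsym[of v u] algebra_simps)
	have Fexp: "F (along u t \<phi>) = F u + t * (B u \<phi> - L \<phi>) + t * t / 2 * B \<phi> \<phi>" if "u \<in> W" "\<phi> \<in> W" for u \<phi> t
		using Badd[OF that, of 1 t] Llin[OF that, of 1 t] by (simp add: F_def field_simps)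
	\<comment> \<open>The parallelogram identity gives the modulus c/8, completing the square the lower
	  bound -\<tau>^2/(2c).\<close>
	have "\<exists>u\<in>C. \<forall>v\<in>C. F u \<le> F v"
	proof (rule midpoint_convex_minimiser[where p=D and \<kappa>="c/8" and b="- (\<tau>\<^sup>2 / (2 * c))"])
		show "C \<noteq> {}" using C0 by blast
		show "0 < c / 8" using c by simp
		show "0 \<le> D u" for u by simp
		show "(\<lambda>x. (1/2) *\<^sub>R u x + (1/2) *\<^sub>R v x) \<in> C" if "u \<in> C" "v \<in> C" for u v using Clin that by blast
		show "\<exists>u\<in>C. (\<lambda>n. D (X n .- u)) \<longlonglongrightarrow> 0"
			if X: "!!n. X n \<in> C" and cau: "!!e. 0 < e ==> \<exists>N. \<forall>m\<ge>N. \<forall>n\<ge>N. D (X m .- X n) < e" for X :: "nat => _"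
			using Wd_complete[OF _ cau] X CW Ccl by blast
		show "F (\<lambda>x. (1/2) *\<^sub>R u x + (1/2) *\<^sub>R v x) \<le> (F u + F v) / 2 - c/8 * (D (u .- v))\<^sup>2"
			if uv: "u \<in> C" "v \<in> C" for u v
		proof -
			have W: "u \<in> W" "v \<in> W" using uv CW by auto
			have "(u .- v) \<in> C" using Clin[OF uv, of 1 "-1"] by simp
			from Bco[OF this] Badd[OF W, of 1 "-1"]
			have 1: "c * (D (u .- v))\<^sup>2 \<le> B u u - 2 * B u v + B v v" by simp
			have 2: "F (\<lambda>x. (1/2) *\<^sub>R u x + (1/2) *\<^sub>R v x) = (F u + F v) / 2 - (B u u - 2 * B u v + B v v) / 8"
				using Badd[OF W, of "1/2" "1/2"] Llin[OF W, of "1/2" "1/2"] unfolding F_def by (simp add: field_simps)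
			show ?thesis using 1 unfolding 2 by simp
		qed
		show "- (\<tau>\<^sup>2 / (2 * c)) \<le> F u" if u: "u \<in> C" for u
		proof -
			have uW: "u \<in> W" using u CW by auto
			have "c * (D u)\<^sup>2 / 2 - \<tau> * D u \<le> F u" using Bco[OF u] Lbd[OF uW] unfolding F_def by linarith
			moreover have "c * (D u)\<^sup>2 / 2 - \<tau> * D u + \<tau>\<^sup>2 / (2 * c) = (c * D u - \<tau>)\<^sup>2 / (2 * c)"
				using c by (simp add: power2_eq_square field_simps)
			moreover have "0 \<le> (c * D u - \<tau>)\<^sup>2 / (2 * c)" using c by simp
			ultimately show ?thesis by linarith
		qed
		show "(\<lambda>n. F (X n)) \<longlonglongrightarrow> F u" if X: "!!n. X n \<in> C" and u: "u \<in> C" and lim: "(\<lambda>n. D (X n .- u)) \<longlonglongrightarrow> 0" for X :: "nat => _" and u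
		proof -
			have W: "X n \<in> W" "u \<in> W" for n using X u CW by auto
			let ?e = "\<lambda>n x. X n x - u x"
			have eW: "?e n \<in> W" for n using W by (intro sn.diff)
			have eq: "F (X n) - F u = (B u (?e n) - L (?e n)) + B (?e n) (?e n) / 2" for n
				using Fexp[OF W(2) eW[of n], of 1] by simp
			have "(\<lambda>n. F (X n) - F u) \<longlonglongrightarrow> 0"
			proof (rule Lim_null_comparison)
				show "\<forall>\<^sub>F n in sequentially. norm (F (X n) - F u) \<le> (KB * D u + \<tau>) * D (?e n) + KB / 2 * D (?e n) * D (?e n)"
				proof (rule always_eventually, rule allI)
					fix n
					show "norm (F (X n) - F u) \<le> (KB * D u + \<tau>) * D (?e n) + KB / 2 * D (?e n) * D (?e n)"
						using Bbd[OF W(2) eW[of n]] Lbd[OF eW[of n]] Bbd[OF eW[of n] eW[of n]] unfolding eq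
						by (simp add: abs_le_iff algebra_simps)
				qed
				show "(\<lambda>n. (KB * D u + \<tau>) * D (?e n) + KB / 2 * D (?e n) * D (?e n)) \<longlonglongrightarrow> 0"
					by (rule tendsto_eq_intros lim refl)+ simp
			qed
			then show ?thesis by (rule LIM_zero_cancel)
		qed
	qed
	then obtain w where w: "w \<in> C" "!!v. v \<in> C ==> F w \<le> F v" by blast
	have wW: "w \<in> W" using w CW by auto
	have eq: "B w \<phi> = L \<phi>" if \<phi>: "\<phi> \<in> C" for \<phi>
	proof -
		have \<phi>W: "\<phi> \<in> W" using \<phi> CW by auto
		define b where "b = B w \<phi> - L \<phi>"
		\<comment> \<open>The added 1 makes \<open>q\<close> positive even when \<open>D \<phi>\<close>
		  vanishes; at t = -b/q the quadratic in \<open>t\<close> would be negative unless b = 0.\<close>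
		define q where "q = B \<phi> \<phi> + 1"
		have q: "0 < q" using Bco[OF \<phi>] c unfolding q_def by (smt (verit) mult_nonneg_nonneg zero_le_power2)
		have "0 \<le> t * b + t * t / 2 * q" for t
		proof -
			have "(along w t \<phi>) \<in> C" using Clin[OF w(1) \<phi>, of 1 t] by simp
			from w(2)[OF this] Fexp[OF wW \<phi>W, of t] have "0 \<le> t * b + t * t / 2 * B \<phi> \<phi>" by (simp add: b_def)
			moreover have "t * t / 2 * B \<phi> \<phi> \<le> t * t / 2 * q" unfolding q_def by (intro mult_left_mono) auto
			ultimately show ?thesis by linarith
		qed
		from this[of "- b / q"] have "b * b \<le> 0" using q by (simp add: field_simps)
		then have "b = 0" by (metis mult_eq_0_iff order_antisym zero_le_square)
		then show ?thesis by (simp add: b_def)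
	qed
	have "c * (D w)\<^sup>2 \<le> \<tau> * D w" using Bco[OF w(1)] eq[OF w(1)] Lbd[OF wW] by linarith
	then have "c * D w \<le> \<tau>" if "D w \<noteq> 0" using that Dn_nonneg[of \<Lambda> St w]
		by (simp add: power2_eq_square mult.assoc[symmetric] mult_right_le_imp_le)
	then have "c * D w \<le> \<tau>" using \<tau> by force
	then show ?thesis using w eq by blast
qed

end

section \<open>Energies with uniformly regular site potentials\<close>

text \<open>\<open>Lc\<close> stands for the sum of \<open>dV l zf (sd u l)\<close> over all sites,
  which need not converge on \<open>Wd\<close>; here it may be any bounded linear form.\<close>

locale energy_net = net \<Lambda> St for \<Lambda> :: "(real^'d) set" and St +
	fixes V :: "real^'d => 'd vfun => real" and dV :: "real^'d => 'd vfun => 'd vfun => real"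
		and ddV :: "real^'d => 'd vfun => 'd vfun => 'd vfun => real" and K :: "real => real"
		and Lc :: "'d vfun => real" and KL :: real
	assumes ok: "l \<in> \<Lambda> ==> site_ok (St l) K (V l) (dV l) (ddV l)"
		and K0: "0 \<le> K M" and V0: "l \<in> \<Lambda> ==> V l zf = 0"
		and Lc_lin: "u \<in> Wd \<Lambda> St ==> v \<in> Wd \<Lambda> St ==> Lc (lcomb a u b v) = a * Lc u + b * Lc v"
		and KL0: "0 \<le> KL" and Lc_bd: "u \<in> Wd \<Lambda> St ==> \<bar>Lc u\<bar> \<le> KL * Dn \<Lambda> St u"
begin

abbreviation sd :: "'d vfun => real^'d => 'd vfun" where "sd u l \<equiv> stencil_diff (St l) u l"

text \<open>Without its linear part the site term is quadratic in the stencil, hence summable for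
  every \<open>u\<close> in \<open>Wd\<close>; \<open>Lc\<close> puts the linear part back.\<close>

definition G :: "'d vfun => real" where
	"G u = (\<Sum>\<^sub>\<infinity>l\<in>\<Lambda>. V l (sd u l) - dV l zf (sd u l)) + Lc u"

definition dG :: "'d vfun => 'd vfun => real" where
	"dG u v = (\<Sum>\<^sub>\<infinity>l\<in>\<Lambda>. dV l (sd u l) (sd v l) - dV l zf (sd v l)) + Lc v"

definition ddG :: "'d vfun => 'd vfun => 'd vfun => real" where
	"ddG u v w = (\<Sum>\<^sub>\<infinity>l\<in>\<Lambda>. ddV l (sd u l) (sd v l) (sd w l))"

lemma nrm_sd: "nrm (St l) (sd u l) = dn St u l" by (simp add: dn_def)

lemma Wl2: "u \<in> W ==> l2 \<Lambda> (dn St u)" by (simp add: Wd_def)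

lemma dnM: "u \<in> W ==> D u \<le> M ==> l \<in> \<Lambda> ==> nrm (St l) (sd u l) \<le> M"
	unfolding nrm_sd using dn_le_Dn[of u \<Lambda> St l] by simp

lemma sd_add: "sd (u .+ v) l = (\<lambda>\<rho>. sd u l \<rho> + sd v l \<rho>)" by (rule stencil_diff_add)

lemma dV0_lin: "l \<in> \<Lambda> ==> dV l zf (sd (lcomb a u b v) l) = a * dV l zf (sd u l) + b * dV l zf (sd v l)"
	unfolding stencil_diff_lin by (rule form1D[OF site_okD(1)[OF ok]]) auto

lemma dV_lin: "l \<in> \<Lambda> ==> dV l (sd z l) (sd (lcomb a u b v) l) = a * dV l (sd z l) (sd u l) + b * dV l (sd z l) (sd v l)"
	unfolding stencil_diff_lin by (rule form1D[OF site_okD(1)[OF ok]]) auto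

lemma ddV_lin: "l \<in> \<Lambda> ==> ddV l (sd z l) (sd (lcomb a u b v) l) (sd w l) = a * ddV l (sd z l) (sd u l) (sd w l) + b * ddV l (sd z l) (sd v l) (sd w l)"
	unfolding stencil_diff_lin by (rule form1D[OF form2_left[OF site_okD(2)[OF ok]]]) auto

lemma ddV_sym: "l \<in> \<Lambda> ==> ddV l (sd z l) (sd u l) (sd w l) = ddV l (sd z l) (sd w l) (sd u l)"
	using site_okD(2)[OF ok, of l "sd z l"] unfolding form2_def by simp

lemma ddV_bd: "l \<in> \<Lambda> ==> z \<in> W ==> D z \<le> M ==>
		\<bar>ddV l (sd z l) (sd u l) (sd w l)\<bar> \<le> K M * \<bar>dn St u l\<bar> * \<bar>dn St w l\<bar>"
	using site_okD(5)[OF ok, of l "sd z l" "sd u l" "sd w l" M] dnM[of z M l] by (simp add: nrm_sd)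

lemma dV_bd:
	assumes "l \<in> \<Lambda>" "u \<in> W" "D u \<le> M"
	shows "\<bar>dV l (sd u l) (sd v l) - dV l zf (sd v l)\<bar> \<le> (K M * M + K M) * \<bar>dn St u l\<bar> * \<bar>dn St v l\<bar>"
proof -
	have M0: "0 \<le> M" using assms(3) Dn_nonneg order_trans by blast
	have b: "\<bar>ddV l zf (sd u l) (sd v l)\<bar> \<le> K M * dn St u l * dn St v l"
		using site_okD(5)[OF ok[OF assms(1)] stencil_space_zero, of "sd u l" "sd v l" M] M0 by (simp add: nrm_sd)
	have "\<bar>dV l (sd u l) (sd v l) - dV l zf (sd v l) - ddV l zf (sd u l) (sd v l)\<bar> \<le> K M * (dn St u l)\<^sup>2 * dn St v l"
		using site_okD(4)[OF ok[OF assms(1)] stencil_space_zero, of "sd u l" "sd v l" M] M0 dnM[OF assms(2,3,1)] by (simp add: nrm_sd)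
	also have "\<dots> \<le> K M * (M * dn St u l) * dn St v l"
		using K0[of M] dnM[OF assms(2,3,1)] by (intro mult_right_mono mult_left_mono) (auto simp: power2_eq_square nrm_sd intro: mult_right_mono)
	finally show ?thesis using b by (simp add: algebra_simps)
qed

lemma V_bd:
	assumes "l \<in> \<Lambda>" "u \<in> W" "D u \<le> M"
	shows "\<bar>V l (sd u l) - dV l zf (sd u l)\<bar> \<le> (K M * M + K M) * \<bar>dn St u l\<bar> * \<bar>dn St u l\<bar>"
proof -
	have M0: "0 \<le> M" using assms(3) Dn_nonneg order_trans by blast
	have b: "\<bar>ddV l zf (sd u l) (sd u l)\<bar> \<le> K M * dn St u l * dn St u l"
		using site_okD(5)[OF ok[OF assms(1)] stencil_space_zero, of "sd u l" "sd u l" M] M0 by (simp add: nrm_sd)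
	have b0: "0 \<le> K M * dn St u l * dn St u l" using K0 by simp
	have "\<bar>V l (sd u l) - dV l zf (sd u l) - ddV l zf (sd u l) (sd u l) / 2\<bar> \<le> K M * dn St u l ^ 3"
		using site_okD(3)[OF ok[OF assms(1)] stencil_space_zero, of "sd u l" M] M0 dnM[OF assms(2,3,1)] V0[OF assms(1)] by (simp add: nrm_sd)
	also have "\<dots> = K M * dn St u l * dn St u l * dn St u l" by (simp add: power3_eq_cube)
	also have "\<dots> \<le> K M * M * dn St u l * dn St u l"
		using K0[of M] dnM[OF assms(2,3,1)] by (intro mult_right_mono mult_left_mono) (auto simp: nrm_sd)
	finally show ?thesis using b b0 unfolding abs_of_nonneg[OF dn_nonneg] by (simp only: distrib_right)
qed

lemma coef0: "0 \<le> M ==> 0 \<le> K M * M + K M" using K0 by simp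

lemma V_summable: "u \<in> W ==> (\<lambda>l. V l (sd u l) - dV l zf (sd u l)) summable_on \<Lambda>"
	by (rule n2_product(1)[OF Wl2 Wl2 coef0[of "D u"] V_bd[of _ u "D u"]]) auto

lemma dV_summable: "u \<in> W ==> v \<in> W ==> (\<lambda>l. dV l (sd u l) (sd v l) - dV l zf (sd v l)) summable_on \<Lambda>"
	by (rule n2_product(1)[OF Wl2 Wl2 coef0[of "D u"] dV_bd[of _ u "D u"]]) auto

lemma ddV_summable: "u \<in> W ==> v \<in> W ==> w \<in> W ==> (\<lambda>l. ddV l (sd u l) (sd v l) (sd w l)) summable_on \<Lambda>"
	by (rule n2_product(1)[OF Wl2 Wl2 K0 ddV_bd]) (auto)

lemma dG_bound: "u \<in> W ==> D u \<le> M ==> v \<in> W ==> \<bar>dG u v\<bar> \<le> ((K M * M + K M) * D u + KL) * D v"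
proof -
	assume u: "u \<in> W" and M: "D u \<le> M" and v: "v \<in> W"
	have M0: "0 \<le> M" using M Dn_nonneg order_trans by blast
	have "\<bar>\<Sum>\<^sub>\<infinity>l\<in>\<Lambda>. dV l (sd u l) (sd v l) - dV l zf (sd v l)\<bar> \<le> (K M * M + K M) * D u * D v"
		unfolding Dn_def by (rule n2_product(3)[OF Wl2[OF u] Wl2[OF v] coef0[OF M0] dV_bd[OF _ u M]])
	then show ?thesis using Lc_bd[OF v] unfolding dG_def by (simp add: algebra_simps)
qed

lemma ddG_bound: "u \<in> W ==> D u \<le> M ==> v \<in> W ==> w \<in> W ==> \<bar>ddG u v w\<bar> \<le> K M * D v * D w"
	unfolding Dn_def ddG_def by (rule n2_product(3)[OF Wl2 Wl2 K0 ddV_bd]) (auto simp: Dn_def)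

lemma dG_lin:
	assumes "z \<in> W" "u \<in> W" "v \<in> W"
	shows "dG z (lcomb a u b v) = a * dG z u + b * dG z v"
proof -
	let ?f = "\<lambda>u l. dV l (sd z l) (sd u l) - dV l zf (sd u l)"
	have "(\<Sum>\<^sub>\<infinity>l\<in>\<Lambda>. ?f (lcomb a u b v) l) = (\<Sum>\<^sub>\<infinity>l\<in>\<Lambda>. a * ?f u l + b * ?f v l)"
		by (intro infsum_cong) (simp add: dV_lin dV0_lin algebra_simps)
	also have "\<dots> = a * (\<Sum>\<^sub>\<infinity>l\<in>\<Lambda>. ?f u l) + b * (\<Sum>\<^sub>\<infinity>l\<in>\<Lambda>. ?f v l)"
		using dV_summable[OF assms(1,2)] dV_summable[OF assms(1,3)]
		by (simp add: infsum_add summable_on_cmult_right infsum_cmult_right)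
	finally show ?thesis using Lc_lin[OF assms(2,3)] unfolding dG_def by (simp add: algebra_simps)
qed

lemma ddG_sym: "ddG z u v = ddG z v u"
	unfolding ddG_def by (intro infsum_cong ddV_sym)

lemma ddG_lin:
	assumes "z \<in> W" "u \<in> W" "v \<in> W" "w \<in> W"
	shows "ddG z (lcomb a u b v) w = a * ddG z u w + b * ddG z v w"
proof -
	have "ddG z (lcomb a u b v) w = (\<Sum>\<^sub>\<infinity>l\<in>\<Lambda>. a * ddV l (sd z l) (sd u l) (sd w l) + b * ddV l (sd z l) (sd v l) (sd w l))"
		unfolding ddG_def by (intro infsum_cong) (simp add: ddV_lin)
	also have "\<dots> = a * ddG z u w + b * ddG z v w"
		using ddV_summable[OF assms(1,2,4)] ddV_summable[OF assms(1,3,4)] unfolding ddG_def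
		by (simp add: infsum_add summable_on_cmult_right infsum_cmult_right)
	finally show ?thesis .
qed

lemma ddG_scale: "z \<in> W ==> u \<in> W ==> w \<in> W ==> ddG z (\<lambda>x. a *\<^sub>R u x) w = a * ddG z u w"
	using ddG_lin[of z u u w a 0] by simp

text \<open>The site remainder is cubic. One factor is replaced by its supremum, at most
  \<open>D v\<close>, and Cauchy-Schwarz handles the other two; \<open>dG_taylor\<close> and
  \<open>ddG_lipschitz\<close> follow the same pattern.\<close>

lemma G_taylor:
	assumes u: "u \<in> W" and v: "v \<in> W" and M: "D u \<le> M" "D v \<le> M"
	shows "\<bar>G (u .+ v) - G u - dG u v - ddG u v v / 2\<bar> \<le> K M * D v * D v * D v"
proof -
	let ?w = "\<lambda>x. u x + v x"
	have w: "?w \<in> W" using u v by (rule sn.add)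
	let ?a = "\<lambda>l. V l (sd ?w l) - dV l zf (sd ?w l)" and ?b = "\<lambda>l. V l (sd u l) - dV l zf (sd u l)"
	let ?c = "\<lambda>l. dV l (sd u l) (sd v l) - dV l zf (sd v l)" and ?d = "\<lambda>l. ddV l (sd u l) (sd v l) (sd v l)"
	note s = V_summable[OF w] V_summable[OF u] dV_summable[OF u v] ddV_summable[OF u v v]
	note s1 = infsum_diff_real[OF s(1,2)]
	note s2 = infsum_diff_real[OF s1(1) s(3)]
	have s4: "(\<lambda>l. ?d l / 2) summable_on \<Lambda>" using summable_on_cmult_left[OF s(4), of "1/2"] by simp
	have s4': "(\<Sum>\<^sub>\<infinity>l\<in>\<Lambda>. ?d l / 2) = ddG u v v / 2" using infsum_cmult_left[of "1/2" ?d \<Lambda>] s(4) by (simp add: ddG_def)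
	note s3 = infsum_diff_real[OF s2(1) s4]
	have Lc: "Lc ?w = Lc u + Lc v" using Lc_lin[OF u v, of 1 1] by simp
	have eq: "G ?w - G u - dG u v - ddG u v v / 2 = (\<Sum>\<^sub>\<infinity>l\<in>\<Lambda>. ?a l - ?b l - ?c l - ?d l / 2)"
		unfolding s3(2) s2(2) s1(2) s4' G_def dG_def Lc by simp
	have bd: "\<bar>?a l - ?b l - ?c l - ?d l / 2\<bar> \<le> (K M * D v) * \<bar>dn St v l\<bar> * \<bar>dn St v l\<bar>" if l: "l \<in> \<Lambda>" for l
	proof -
		have "dV l zf (sd ?w l) = dV l zf (sd u l) + dV l zf (sd v l)"
			using dV0_lin[OF l, of 1 u 1 v] by simp
		then have "?a l - ?b l - ?c l - ?d l / 2 = V l (\<lambda>\<rho>. sd u l \<rho> + sd v l \<rho>) - V l (sd u l) - dV l (sd u l) (sd v l) - ?d l / 2"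
			unfolding sd_add by simp
		then have "\<bar>?a l - ?b l - ?c l - ?d l / 2\<bar> \<le> K M * dn St v l ^ 3"
			using site_okD(3)[OF ok[OF l], of "sd u l" "sd v l" M] dnM[OF u M(1) l] dnM[OF v M(2) l] by (simp add: nrm_sd)
		also have "\<dots> = K M * dn St v l * dn St v l * dn St v l" by (simp add: power3_eq_cube)
		also have "\<dots> \<le> K M * D v * dn St v l * dn St v l"
			using K0[of M] dn_le_Dn[OF v l] by (intro mult_right_mono mult_left_mono) auto
		finally show ?thesis by simp
	qed
	have "0 \<le> K M * D v" using K0 by simp
	from n2_product(3)[OF Wl2[OF v] Wl2[OF v] this bd] show ?thesis unfolding eq Dn_def by simp
qed

lemma dG_taylor:
	assumes u: "u \<in> W" and v: "v \<in> W" and M: "D u \<le> M" "D v \<le> M" and w: "w \<in> W"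
	shows "\<bar>dG (u .+ v) w - dG u w - ddG u v w\<bar> \<le> K M * D v * D v * D w"
proof -
	let ?z = "\<lambda>x. u x + v x"
	have z: "?z \<in> W" using u v by (rule sn.add)
	let ?a = "\<lambda>l. dV l (sd ?z l) (sd w l) - dV l zf (sd w l)" and ?b = "\<lambda>l. dV l (sd u l) (sd w l) - dV l zf (sd w l)"
	let ?d = "\<lambda>l. ddV l (sd u l) (sd v l) (sd w l)"
	note s = dV_summable[OF z w] dV_summable[OF u w] ddV_summable[OF u v w]
	note s1 = infsum_diff_real[OF s(1,2)]
	note s2 = infsum_diff_real[OF s1(1) s(3)]
	have eq: "dG ?z w - dG u w - ddG u v w = (\<Sum>\<^sub>\<infinity>l\<in>\<Lambda>. ?a l - ?b l - ?d l)"
		unfolding s2(2) s1(2) dG_def ddG_def by simp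
	have bd: "\<bar>?a l - ?b l - ?d l\<bar> \<le> (K M * D v) * \<bar>dn St v l\<bar> * \<bar>dn St w l\<bar>" if l: "l \<in> \<Lambda>" for l
	proof -
		have "?a l - ?b l - ?d l = dV l (\<lambda>\<rho>. sd u l \<rho> + sd v l \<rho>) (sd w l) - dV l (sd u l) (sd w l) - ?d l"
			unfolding sd_add by simp
		then have "\<bar>?a l - ?b l - ?d l\<bar> \<le> K M * (dn St v l)\<^sup>2 * dn St w l"
			using site_okD(4)[OF ok[OF l], of "sd u l" "sd v l" "sd w l" M] dnM[OF u M(1) l] dnM[OF v M(2) l] by (simp add: nrm_sd)
		also have "\<dots> = K M * dn St v l * dn St v l * dn St w l" by (simp add: power2_eq_square)
		also have "\<dots> \<le> K M * D v * dn St v l * dn St w l"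
			using K0[of M] dn_le_Dn[OF v l] by (intro mult_right_mono mult_left_mono) auto
		finally show ?thesis by simp
	qed
	have "0 \<le> K M * D v" using K0 by simp
	from n2_product(3)[OF Wl2[OF v] Wl2[OF w] this bd] show ?thesis unfolding eq Dn_def by simp
qed

lemma ddG_lipschitz:
	assumes u: "u \<in> W" and v: "v \<in> W" and M: "D u \<le> M" "D v \<le> M" and w: "w \<in> W" and y: "y \<in> W"
	shows "\<bar>ddG (u .+ v) w y - ddG u w y\<bar> \<le> K M * D v * D w * D y"
proof -
	let ?z = "\<lambda>x. u x + v x"
	have z: "?z \<in> W" using u v by (rule sn.add)
	note s1 = infsum_diff_real[OF ddV_summable[OF z w y] ddV_summable[OF u w y]]
	have eq: "ddG ?z w y - ddG u w y = (\<Sum>\<^sub>\<infinity>l\<in>\<Lambda>. ddV l (sd ?z l) (sd w l) (sd y l) - ddV l (sd u l) (sd w l) (sd y l))"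
		unfolding s1(2) ddG_def by simp
	have bd: "\<bar>ddV l (sd ?z l) (sd w l) (sd y l) - ddV l (sd u l) (sd w l) (sd y l)\<bar> \<le> (K M * D v) * \<bar>dn St w l\<bar> * \<bar>dn St y l\<bar>"
		if l: "l \<in> \<Lambda>" for l
	proof -
		have "\<bar>ddV l (sd ?z l) (sd w l) (sd y l) - ddV l (sd u l) (sd w l) (sd y l)\<bar> \<le> K M * dn St v l * dn St w l * dn St y l"
			unfolding sd_add
			using site_okD(6)[OF ok[OF l], of "sd u l" "sd v l" "sd w l" "sd y l" M] dnM[OF u M(1) l] dnM[OF v M(2) l] by (simp add: nrm_sd)
		also have "\<dots> \<le> K M * D v * dn St w l * dn St y l"
			using K0[of M] dn_le_Dn[OF v l] by (intro mult_right_mono mult_left_mono) auto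
		finally show ?thesis by simp
	qed
	have "0 \<le> K M * D v" using K0 by simp
	from n2_product(3)[OF Wl2[OF w] Wl2[OF y] this bd] show ?thesis unfolding eq Dn_def by simp
qed

lemma dG_blf: "u \<in> W ==> bounded_linear_form W D (dG u)"
	unfolding bounded_linear_form_def using dG_lin dG_bound[of u "D u"] by blast

lemma G_first_variation:
	assumes u: "u \<in> W"
	shows "has_first_variation W D G u (dG u)"
	unfolding has_first_variation_def
proof (intro conjI dG_blf[OF u] allI impI)
	fix e :: real assume e: "0 < e"
	define M where "M = D u + 1"
	define c where "c = 2 * K M + 1"
	have c: "0 < c" using K0[of M] unfolding c_def by linarith
	define \<delta> where "\<delta> = min 1 (e / c)"
	have \<delta>: "0 < \<delta>" using e c by (simp add: \<delta>_def)
	have "\<bar>G (u .+ v) - G u - dG u v\<bar> \<le> e * D v" if v: "v \<in> W" "D v < \<delta>" for v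
	proof -
		have M: "D u \<le> M" "D v \<le> M" using v unfolding M_def \<delta>_def using Dn_nonneg[of \<Lambda> St u] by linarith+
		have d1: "D v \<le> 1" using v by (simp add: \<delta>_def)
		have "\<bar>G (u .+ v) - G u - dG u v\<bar> \<le> K M * D v * D v * D v + K M * D v * D v"
			using G_taylor[OF u v(1) M] ddG_bound[OF u M(1) v(1) v(1)] by linarith
		also have "\<dots> \<le> K M * D v * 1 * D v + K M * D v * D v"
			using d1 K0[of M] by (intro add_mono mult_right_mono mult_left_mono) auto
		also have "\<dots> = (2 * K M * D v) * D v" by simp
		also have "\<dots> \<le> e * D v"
		proof (rule mult_right_mono)
			have "2 * K M * D v \<le> c * D v" unfolding c_def by (intro mult_right_mono) auto
			also have "\<dots> \<le> c * (e / c)" using v c by (intro mult_left_mono) (auto simp: \<delta>_def)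
			finally show "2 * K M * D v \<le> e" using c by simp
		qed simp
		finally show ?thesis .
	qed
	then show "\<exists>\<delta>>0. \<forall>v\<in>W. D v < \<delta> --> \<bar>G (u .+ v) - G u - dG u v\<bar> \<le> e * D v"
		using \<delta> by blast
qed

lemma dG_derivative:
	assumes u: "u \<in> W" and e: "0 < e"
	shows "\<exists>\<delta>>0. \<forall>v\<in>W. D v < \<delta> --> (\<forall>w\<in>W. \<bar>dG (u .+ v) w - dG u w - ddG u v w\<bar> \<le> e * D v * D w)"
proof -
	define M where "M = D u + 1"
	define c where "c = K M + 1"
	have c: "0 < c" using K0[of M] unfolding c_def by linarith
	define \<delta> where "\<delta> = min 1 (e / c)"
	have \<delta>: "0 < \<delta>" using e c by (simp add: \<delta>_def)
	have "\<bar>dG (u .+ v) w - dG u w - ddG u v w\<bar> \<le> e * D v * D w" if v: "v \<in> W" "D v < \<delta>" and w: "w \<in> W" for v w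
	proof -
		have M: "D u \<le> M" "D v \<le> M" using v unfolding M_def \<delta>_def using Dn_nonneg[of \<Lambda> St u] by linarith+
		have "K M * D v \<le> c * D v" unfolding c_def by (intro mult_right_mono) auto
		also have "\<dots> \<le> c * (e / c)" using v c by (intro mult_left_mono) (auto simp: \<delta>_def)
		finally have "K M * D v \<le> e" using c by simp
		then have "K M * D v * D v * D w \<le> e * D v * D w" by (intro mult_right_mono) auto
		then show ?thesis using dG_taylor[OF u v(1) M w] by linarith
	qed
	then show ?thesis using \<delta> by blast
qed

lemma G_second_variation:
	assumes u: "u \<in> W"
	shows "has_second_variation W D G u (ddG u)"
	unfolding has_second_variation_def
proof (intro conjI)
	have b: "\<bar>ddG u v w\<bar> \<le> K (D u) * D v * D w" if "v \<in> W" "w \<in> W" for v w using ddG_bound[OF u _ that] by simp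
	show l: "\<forall>w\<in>W. bounded_linear_form W D (\<lambda>v. ddG u v w)"
	proof
		fix w assume w: "w \<in> W"
		have "\<forall>v\<in>W. \<bar>ddG u v w\<bar> \<le> (K (D u) * D w) * D v" using b w by (auto simp: mult_ac)
		then show "bounded_linear_form W D (\<lambda>v. ddG u v w)"
			unfolding bounded_linear_form_def using ddG_lin[OF u _ _ w] by blast
	qed
	then show "\<forall>v\<in>W. bounded_linear_form W D (ddG u v)" using ddG_sym[of u] by simp
	show "\<exists>K. \<forall>v\<in>W. \<forall>w\<in>W. \<bar>ddG u v w\<bar> \<le> K * D v * D w" using b by blast
	show "\<exists>r>0. \<exists>L. (\<forall>w\<in>W. D (w .- u) < r --> has_first_variation W D G w (L w)) \<and>
				(\<forall>\<epsilon>>0. \<exists>\<delta>>0. \<forall>v\<in>W. D v < \<delta> --> (\<forall>w\<in>W. \<bar>L (u .+ v) w - L u w - ddG u v w\<bar> \<le> \<epsilon> * D v * D w))"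
		using G_first_variation dG_derivative[OF u] by (intro exI[of _ 1] exI[of _ dG] conjI) auto
qed

lemma G_continuous: "continuous_wrt W D G"
	by (rule sn.first_variation_continuous[OF G_first_variation])

lemma G_tendsto:
	assumes X: "!!n::nat. X n \<in> W" and u: "u \<in> W" and lim: "(\<lambda>n. D (X n .- u)) \<longlonglongrightarrow> 0"
	shows "(\<lambda>n. G (X n)) \<longlonglongrightarrow> G u"
proof (rule LIMSEQ_I)
	fix e :: real assume "0 < e"
	then obtain d where d: "d > 0" "!!v. v \<in> W ==> D (v .- u) < d ==> \<bar>G v - G u\<bar> < e"
		using G_continuous u unfolding continuous_wrt_def by meson
	obtain N where "!!n. n \<ge> N ==> D (X n .- u) < d" using LIMSEQ_D[OF lim d(1)] by auto
	then show "\<exists>no. \<forall>n\<ge>no. norm (G (X n) - G u) < e" using d X by auto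
qed

text \<open>Uniform convexity on the ball of radius \<open>r\<close> around \<open>ub\<close>: the
  Hessian moves by at most \<open>K M * r\<close>, the cubic remainder costs twice that, and the
  factor 10 leaves c/4 of c/2. The bound \<open>M\<close> has room for the points of the ball and
  for increments up to 2r \<le> 2.\<close>

lemma G_convex_expansion:
	assumes ub: "ub \<in> W" and c: "\<forall>v\<in>W. c * (D v)\<^sup>2 \<le> ddG ub v v"
		and M: "M = D ub + 2" and r: "r \<le> 1" "10 * (K M * r) \<le> c"
		and z: "z \<in> W" "D (z .- ub) \<le> r" and v: "v \<in> W" "D (\<lambda>x. z x + v x - ub x) \<le> r"
	shows "G z + dG z v + c / 4 * (D v)\<^sup>2 \<le> G (z .+ v)"
		"(c - K M * r) * (D v)\<^sup>2 \<le> ddG z v v"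
proof -
	have zu: "(z .- ub) \<in> W" using z ub by (intro sn.diff)
	have zM: "D z \<le> M" using Wd_add(2)[OF ub zu] z r M by simp
	have vr: "D v \<le> 2 * r"
		using Wd_diff(2)[OF sn.diff[OF sn.add[OF z(1) v(1)] ub] zu] z v by simp
	have vM: "D v \<le> M" using vr r M Dn_nonneg[of \<Lambda> St ub] by linarith
	have "\<bar>ddG (\<lambda>x. ub x + (z x - ub x)) v v - ddG ub v v\<bar> \<le> K M * D (z .- ub) * D v * D v"
		using z r M Dn_nonneg[of \<Lambda> St ub] by (intro ddG_lipschitz ub zu v) linarith+
	also have "\<dots> \<le> K M * r * D v * D v" using K0[of M] z by (intro mult_right_mono mult_left_mono) auto
	finally have 1: "\<bar>ddG z v v - ddG ub v v\<bar> \<le> K M * r * (D v)\<^sup>2" by (simp add: power2_eq_square mult.assoc)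
	then show 2: "(c - K M * r) * (D v)\<^sup>2 \<le> ddG z v v"
		using c[rule_format, OF v(1)] by (simp add: algebra_simps)
	have "K M * D v * D v * D v \<le> K M * (2 * r) * D v * D v"
		using K0[of M] vr by (intro mult_right_mono mult_left_mono) auto
	then have "\<bar>G (z .+ v) - G z - dG z v - ddG z v v / 2\<bar> \<le> 2 * (K M * r) * (D v)\<^sup>2"
		using G_taylor[OF z(1) v(1) zM vM] by (simp add: power2_eq_square mult_ac)
	then have 3: "G z + dG z v + ddG z v v / 2 - 2 * (K M * r) * (D v)\<^sup>2 \<le> G (z .+ v)" by linarith
	have "c / 4 * (D v)\<^sup>2 \<le> ((c - K M * r) / 2 - 2 * (K M * r)) * (D v)\<^sup>2"
	proof (rule mult_right_mono)
		have aux: "10 * x \<le> y ==> y / 4 \<le> (y - x) / 2 - 2 * x" for x y :: real by (simp add: diff_divide_distrib)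
		show "c / 4 \<le> (c - K M * r) / 2 - 2 * (K M * r)" using r(2) by (rule aux)
	qed simp
	then have 4: "c / 4 * (D v)\<^sup>2 \<le> (c - K M * r) * (D v)\<^sup>2 / 2 - 2 * (K M * r) * (D v)\<^sup>2" by (simp add: algebra_simps)
	show "G z + dG z v + c / 4 * (D v)\<^sup>2 \<le> G (z .+ v)"
		using 2 3 4 by linarith
qed

text \<open>Minimise over the closed ball of radius \<open>r\<close> around \<open>ub\<close>.
  Comparing the minimiser with \<open>ub\<close> in the convexity estimate bounds its distance by 4
  \<tau> / c, which the last assumption makes smaller than \<open>r\<close>; the minimiser is
  therefore interior and critical.\<close>

lemma perturbed_minimiser:
	assumes ub: "ub \<in> W" and c0: "0 < c" and c: "!!v. v \<in> W ==> c * (D v)\<^sup>2 \<le> ddG ub v v"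
		and M: "M = D ub + 2" and r: "0 < r" "r \<le> 1" "10 * (K M * r) \<le> c"
		and \<tau>: "!!v. v \<in> W ==> \<bar>dG ub v\<bar> \<le> \<tau> * D v" "0 \<le> \<tau>" "4 * \<tau> < c * r"
	shows "\<exists>u\<in>W. D (u .- ub) \<le> 4 * \<tau> / c \<and>
		(\<exists>s>0. \<forall>v\<in>W. D (v .- u) < s --> G u \<le> G v) \<and>
		(\<forall>v\<in>W. dG u v = 0) \<and> (\<forall>v\<in>W. c / 2 * (D v)\<^sup>2 \<le> ddG u v v)"
proof -
	define C where "C = {u \<in> W. D (u .- ub) \<le> r}"
	have c': "\<forall>v\<in>W. c * (D v)\<^sup>2 \<le> ddG ub v v" using c by blast
	note conv = G_convex_expansion[OF ub c' M r(2,3)]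
	have ubC: "ub \<in> C" using ub r by (simp add: C_def)
	have "\<exists>u\<in>C. \<forall>v\<in>C. G u \<le> G v"
	proof (rule midpoint_convex_minimiser[where p=D and \<kappa>="c/16" and b="G ub - \<tau> * r"])
		show "C \<noteq> {}" using ubC by blast
		show "0 < c / 16" using c0 by simp
		show "0 \<le> D u" for u by simp
		show mid: "(\<lambda>x. (1/2) *\<^sub>R u x + (1/2) *\<^sub>R v x) \<in> C" if "u \<in> C" "v \<in> C" for u v
		proof -
			have "(\<lambda>x. (1/2) *\<^sub>R (u x - ub x) + (1/2) *\<^sub>R (v x - ub x)) = (\<lambda>x. (1/2) *\<^sub>R u x + (1/2) *\<^sub>R v x - ub x)"
				by (auto simp: algebra_simps simp flip: scaleR_left_distrib)
			moreover have "D (\<lambda>x. (1/2) *\<^sub>R (u x - ub x) + (1/2) *\<^sub>R (v x - ub x)) \<le> \<bar>1/2\<bar> * D (u .- ub) + \<bar>1/2\<bar> * D (v .- ub)"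
				using that ub by (intro Wd_lin(2)[OF sn.diff sn.diff]) (auto simp: C_def)
			ultimately show ?thesis using that sn.lin[of u v "1/2" "1/2"] by (auto simp: C_def)
		qed
		show "\<exists>u\<in>C. (\<lambda>n. D (X n .- u)) \<longlonglongrightarrow> 0"
			if X: "!!n. X n \<in> C" and cau: "!!e. 0 < e ==> \<exists>N. \<forall>m\<ge>N. \<forall>n\<ge>N. D (X m .- X n) < e" for X :: "nat => _"
		proof -
			have XW: "X n \<in> W" and Xr: "D (X n .- ub) \<le> r" for n using X[of n] by (auto simp: C_def)
			obtain u where u: "u \<in> W" "(\<lambda>n. D (X n .- u)) \<longlonglongrightarrow> 0" using Wd_complete[OF XW cau] by blast
			have "D (u .- ub) \<le> r + 0"
			proof (rule LIMSEQ_le_const)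
				show "(\<lambda>n. r + D (X n .- u)) \<longlonglongrightarrow> r + 0" by (intro tendsto_intros u)
				have "D (u .- ub) \<le> r + D (X n .- u)" for n
					using Wd_diff(2)[OF sn.diff[OF XW ub] sn.diff[OF XW u(1)], of n n] Xr[of n] by simp
				then show "\<exists>N. \<forall>n\<ge>N. D (u .- ub) \<le> r + D (X n .- u)" by blast
			qed
			then show ?thesis using u by (auto simp: C_def)
		qed
		show "G (\<lambda>x. (1/2) *\<^sub>R u x + (1/2) *\<^sub>R v x) \<le> (G u + G v) / 2 - c/16 * (D (u .- v))\<^sup>2"
			if uv: "u \<in> C" "v \<in> C" for u v
		proof -
			\<comment> \<open>Both endpoints are seen from the midpoint: \<open>u\<close> is reached by
			  \<open>?h\<close> and \<open>v\<close> by its negative \<open>?k\<close>, so the first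
			  variations cancel in the sum, and half differences turn c/4 into c/16.\<close>
			let ?m = "\<lambda>x. (1/2) *\<^sub>R u x + (1/2) *\<^sub>R v x" and ?h = "\<lambda>x. (1/2) *\<^sub>R u x + (-1/2) *\<^sub>R v x"
				and ?k = "\<lambda>x. (1/2) *\<^sub>R v x + (-1/2) *\<^sub>R u x"
			have W: "u \<in> W" "v \<in> W" using uv by (auto simp: C_def)
			have mC: "?m \<in> C" by (rule mid[OF uv])
			then have m: "?m \<in> W" "D (?m .- ub) \<le> r" by (auto simp: C_def)
			have hW: "?h \<in> W" "?k \<in> W" by (rule sn.lin[OF W], rule sn.lin[OF W(2,1)])
			have e1: "(?m .+ ?h) = u" by (auto simp: algebra_simps simp flip: scaleR_left_distrib)
			have e2: "(?m .+ ?k) = v" by (auto simp: algebra_simps simp flip: scaleR_left_distrib)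
			have "D (\<lambda>x. ?m x + ?h x - ub x) \<le> r" using uv fun_cong[OF e1] by (simp add: C_def)
			from conv(1)[OF m hW(1) this] have 1: "G ?m + dG ?m ?h + c / 4 * (D ?h)\<^sup>2 \<le> G u" unfolding e1 .
			have "D (\<lambda>x. ?m x + ?k x - ub x) \<le> r" using uv fun_cong[OF e2] by (simp add: C_def)
			from conv(1)[OF m hW(2) this] have 2: "G ?m + dG ?m ?k + c / 4 * (D ?k)\<^sup>2 \<le> G v" unfolding e2 .
			have h: "?h = (\<lambda>x. (1/2) *\<^sub>R (u x - v x))" and k: "?k = (\<lambda>x. (-1/2) *\<^sub>R (u x - v x))"
				by (auto simp: algebra_simps)
			have "dG ?m ?k = - dG ?m ?h" using dG_lin[OF m(1) W, of "-1/2" "1/2"] dG_lin[OF m(1) W, of "1/2" "-1/2"]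
				by (simp add: add.commute)
			moreover have "c / 4 * (D ?h)\<^sup>2 = c / 16 * (D (u .- v))\<^sup>2" "c / 4 * (D ?k)\<^sup>2 = c / 16 * (D (u .- v))\<^sup>2"
				unfolding h k Dn_scale by (simp_all add: power2_eq_square)
			ultimately show ?thesis using 1 2 by argo
		qed
		show "G ub - \<tau> * r \<le> G u" if u: "u \<in> C" for u
		proof -
			have uW: "u \<in> W" and ur: "D (u .- ub) \<le> r" using u by (auto simp: C_def)
			let ?v = "\<lambda>x. u x - ub x"
			have v: "?v \<in> W" using uW ub by (rule sn.diff)
			have "G ub + dG ub ?v + c / 4 * (D ?v)\<^sup>2 \<le> G (ub .+ ?v)"
				using r ur by (intro conv(1) ub v) auto
			moreover have "0 \<le> c / 4 * (D ?v)\<^sup>2" using c0 by simp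
			moreover have "\<tau> * D ?v \<le> \<tau> * r" using ur \<tau>(2) by (rule mult_left_mono)
			ultimately show ?thesis using \<tau>(1)[OF v] by simp
		qed
		show "(\<lambda>n. G (X n)) \<longlonglongrightarrow> G u" if "!!n. X n \<in> C" "u \<in> C" "(\<lambda>n. D (X n .- u)) \<longlonglongrightarrow> 0" for X :: "nat => _" and u
			using that by (intro G_tendsto) (auto simp: C_def)
	qed
	then obtain u where u: "u \<in> C" "!!v. v \<in> C ==> G u \<le> G v" by blast
	have uW: "u \<in> W" and ur: "D (u .- ub) \<le> r" using u by (auto simp: C_def)
	let ?v = "\<lambda>x. u x - ub x"
	have v: "?v \<in> W" using uW ub by (rule sn.diff)
	have "G ub + dG ub ?v + c / 4 * (D ?v)\<^sup>2 \<le> G (ub .+ ?v)"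
		using r ur by (intro conv(1) ub v) auto
	then have "c / 4 * (D ?v)\<^sup>2 \<le> \<tau> * D ?v" using u(2)[OF ubC] \<tau>(1)[OF v] by simp
	then have d: "D ?v \<le> 4 * \<tau> / c"
	proof (cases "D ?v = 0")
		case False
		then have "0 < D ?v" using Dn_nonneg[of \<Lambda> St ?v] by linarith
		moreover assume "c / 4 * (D ?v)\<^sup>2 \<le> \<tau> * D ?v"
		ultimately have "c / 4 * D ?v \<le> \<tau>" by (simp add: power2_eq_square mult.assoc[symmetric] mult_right_le_imp_le)
		then show ?thesis using c0 by (simp add: field_simps)
	qed (use \<tau>(2) c0 in simp)
	then have dr: "D ?v < r" using \<tau>(3) c0 by (smt (verit) divide_less_eq mult.commute)
	have min: "G u \<le> G v" if v': "v \<in> W" "D (v .- u) < r - D ?v" for v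
	proof (rule u(2))
		have "D (\<lambda>x. (v x - u x) + (u x - ub x)) \<le> D (v .- u) + D ?v"
			using v' uW ub by (intro Wd_add(2) sn.diff)
		then show "v \<in> C" using v' by (simp add: C_def)
	qed
	have "dG u \<phi> = 0" if "\<phi> \<in> W" for \<phi>
	proof (rule sn.local_min_first_variation[OF G_first_variation[OF uW] _ _ that])
		show "0 < r - D ?v" using dr by simp
		show "G u \<le> G (u .+ v)" if "v \<in> W" "D v < r - D ?v" for v
			using min[OF sn.add[OF uW that(1)]] that by simp
	qed
	moreover have "c / 2 * (D v)\<^sup>2 \<le> ddG u v v" if v: "v \<in> W" for v
	proof -
		\<comment> \<open>\<open>conv\<close> gives the Hessian bound only for increments that stay in the
		  ball. Both sides are homogeneous of degree two, so \<open>v\<close> is shrunk by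
		  \<open>t\<close>; the 1 avoids division by zero.\<close>
		define t where "t = (r - D ?v) / (D v + 1)"
		have t: "0 < t" using dr unfolding t_def by (intro divide_pos_pos) (auto intro: add_nonneg_pos)
		let ?w = "\<lambda>x. t *\<^sub>R v x"
		have wW: "?w \<in> W" using v by (rule sn.scale)
		have "D ?w = (r - D ?v) * (D v / (D v + 1))" using t by (simp add: Dn_scale) (simp add: t_def)
		also have "\<dots> \<le> (r - D ?v) * 1"
		proof (rule mult_left_mono)
			have "0 < D v + 1" using Dn_nonneg[of \<Lambda> St v] by linarith
			then show "D v / (D v + 1) \<le> 1" by (simp add: divide_le_eq_1)
		qed (use dr in simp)
		finally have "D (\<lambda>x. u x + ?w x - ub x) \<le> r"
			using Wd_add(2)[OF sn.diff[OF uW ub] wW] by (simp add: algebra_simps)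
		from conv(2)[OF uW ur wW this] have "(c - K M * r) * (D ?w)\<^sup>2 \<le> ddG u ?w ?w" .
		moreover have "ddG u ?w ?w = t * t * ddG u v v"
			using ddG_scale[OF uW v wW, of t] ddG_scale[OF uW v v, of t] ddG_sym[of u v ?w] by simp
		ultimately have "t * t * ((c - K M * r) * (D v)\<^sup>2) \<le> t * t * ddG u v v"
			by (simp add: Dn_scale power2_eq_square mult_ac)
		then have "(c - K M * r) * (D v)\<^sup>2 \<le> ddG u v v" using t by (simp add: mult_le_cancel_left_pos)
		moreover have "c / 2 * (D v)\<^sup>2 \<le> (c - K M * r) * (D v)\<^sup>2" using r c0 by (intro mult_right_mono) auto
		ultimately show ?thesis by linarith
	qed
	ultimately show ?thesis using uW d min dr by (intro bexI[of _ u] conjI exI[of _ "r - D ?v"]) auto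
qed

end

section \<open>Interior regularity on a Bravais lattice\<close>

locale hom_lattice =
	fixes A :: "real^'d^'d" and S :: "(real^'d) set"
	assumes inv: "invertible A" and finS: "finite S" and SL: "S \<subseteq> bravais_lattice A"
		and eS: "A *v axis n 1 \<in> S"
begin

abbreviation "L \<equiv> bravais_lattice A"
abbreviation "e n \<equiv> A *v axis n 1"
abbreviation "sdL v l \<equiv> stencil_diff S v l"
abbreviation "dnL \<equiv> dn (\<lambda>_. S)"

lemma L_zero [simp]: "0 \<in> L"
	unfolding bravais_lattice_def by (rule CollectI, rule exI[of _ 0]) simp

lemma L_add: "x \<in> L ==> y \<in> L ==> x + y \<in> L"
proof -
	assume "x \<in> L" "y \<in> L"
	then obtain z w where "x = A *v z" "y = A *v w" and zw: "\<forall>i. z $ i \<in> \<int>" "\<forall>i. w $ i \<in> \<int>"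
		unfolding bravais_lattice_def by blast
	then have "x + y = A *v (z + w)" by (simp add: matrix_vector_right_distrib)
	then show ?thesis unfolding bravais_lattice_def using zw by (auto intro!: exI[of _ "z + w"])
qed

lemma L_diff: "x \<in> L ==> y \<in> L ==> x - y \<in> L"
proof -
	assume "x \<in> L" "y \<in> L"
	then obtain z w where "x = A *v z" "y = A *v w" and zw: "\<forall>i. z $ i \<in> \<int>" "\<forall>i. w $ i \<in> \<int>"
		unfolding bravais_lattice_def by blast
	then have "x - y = A *v (z - w)" by (simp add: matrix_vector_mult_diff_distrib)
	then show ?thesis unfolding bravais_lattice_def using zw by (auto intro!: exI[of _ "z - w"])
qed

lemma L_S: "x \<in> L ==> \<rho> \<in> S ==> x + \<rho> \<in> L" using L_add SL by blast

lemma L_multiple: "x \<in> L ==> x + real k *\<^sub>R e n \<in> L"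
proof (induction k)
	case (Suc k)
	have "(x + real k *\<^sub>R e n) + e n \<in> L" using Suc eS[of n] SL by (intro L_add[of "x + real k *\<^sub>R e n"]) auto
	then show ?case by (simp add: algebra_simps)
qed simp

lemma inverse_bound: obtains B K where "B ** A = mat 1" "0 \<le> K" "!!x. norm (B *v x) \<le> K * norm x"
proof -
	obtain B where B: "B ** A = mat 1" using inv unfolding invertible_def by blast
	have "bounded_linear ((*v) B)" by (rule matrix_vector_mul_bounded_linear)
	from bounded_linear.nonneg_bounded[OF this] obtain K where "0 \<le> K" "!!x. norm (B *v x) \<le> norm x * K" by blast
	with B show thesis using that by (simp add: mult.commute)
qed

lemma int_box:
	fixes n :: nat
	shows "finite {z::real^'d. \<forall>i. z $ i \<in> \<int> \<and> \<bar>z $ i\<bar> \<le> real n}" (is "finite ?Z")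
		and "card {z::real^'d. \<forall>i. z $ i \<in> \<int> \<and> \<bar>z $ i\<bar> \<le> real n} \<le> (2 * n + 1) ^ CARD('d)"
proof -
	let ?P = "PiE (UNIV :: 'd set) (\<lambda>_. {- int n..int n})"
	let ?h = "\<lambda>f::'d => int. (\<chi> i. real_of_int (f i)) :: real^'d"
	have sub: "?Z \<subseteq> ?h ` ?P"
	proof
		fix z :: "real^'d" assume z: "z \<in> ?Z"
		have fl: "real_of_int \<lfloor>z $ i\<rfloor> = z $ i" for i using z by (auto elim: Ints_cases)
		have "\<bar>real_of_int \<lfloor>z $ i\<rfloor>\<bar> \<le> real n" for i unfolding fl using z by auto
		then have "\<bar>\<lfloor>z $ i\<rfloor>\<bar> \<le> int n" for i by (metis of_int_abs of_int_le_iff of_int_of_nat_eq)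
		then have "(\<lambda>i. \<lfloor>z $ i\<rfloor>) \<in> ?P" by (auto simp: abs_le_iff) (metis minus_le_iff)
		then have "?h (\<lambda>i. \<lfloor>z $ i\<rfloor>) \<in> ?h ` ?P" by (rule imageI)
		moreover have "?h (\<lambda>i. \<lfloor>z $ i\<rfloor>) = z" unfolding vec_eq_iff vec_lambda_beta fl by simp
		ultimately show "z \<in> ?h ` ?P" by simp
	qed
	have fin: "finite ?P" by (rule finite_PiE) auto
	then show "finite ?Z" using sub finite_subset by blast
	have "card ?Z \<le> card (?h ` ?P)" using sub fin by (intro card_mono) auto
	also have "\<dots> \<le> card ?P" using fin by (rule card_image_le)
	also have "\<dots> = (2 * n + 1) ^ CARD('d)"
	proof -
		have "card {- int n..int n} = 2 * n + 1" by simp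
		then show ?thesis by (simp only: card_PiE[OF finite] prod_constant)
	qed
	finally show "card ?Z \<le> (2 * n + 1) ^ CARD('d)" .
qed

text \<open>\<open>A\<close> has a bounded inverse, so a ball is pulled back into an integer box of
  comparable size.\<close>

lemma L_count:
	obtains C where "0 \<le> C" "!!r. 1 \<le> r ==> real (card (L \<inter> ball 0 r)) \<le> C * r ^ CARD('d)" "!!r. finite (L \<inter> ball 0 r)"
proof -
	obtain B K where B: "B ** A = mat 1" and K: "0 \<le> K" "!!x. norm (B *v x) \<le> K * norm x" using inverse_bound by blast
	have BA: "B *v (A *v z) = z" for z by (simp add: matrix_vector_mul_assoc B)
	let ?Z = "\<lambda>n. {z::real^'d. \<forall>i. z $ i \<in> \<int> \<and> \<bar>z $ i\<bar> \<le> real n}"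
	have sub: "L \<inter> ball 0 r \<subseteq> (*v) A ` ?Z (nat \<lceil>K * r\<rceil>)" for r
	proof
		fix x assume x: "x \<in> L \<inter> ball 0 r"
		then obtain z where z: "x = A *v z" "\<forall>i. z $ i \<in> \<int>" unfolding bravais_lattice_def by auto
		have "norm z \<le> K * norm x" using K(2)[of x] BA[of z] z by simp
		also have "\<dots> \<le> K * r" using x K by (intro mult_left_mono) auto
		finally have nz: "norm z \<le> K * r" .
		have "\<bar>z $ i\<bar> \<le> real (nat \<lceil>K * r\<rceil>)" for i
			using component_le_norm_cart[of z i] nz real_nat_ceiling_ge[of "K * r"] by linarith
		then show "x \<in> (*v) A ` ?Z (nat \<lceil>K * r\<rceil>)" using z by blast
	qed
	have fin: "finite (L \<inter> ball 0 r)" for r using sub[of r] int_box(1) finite_subset by blast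
	\<comment> \<open>For r \<ge> 1 the box has at most 2 K r + 3 \<le> (2 K + 3) r integers in each
	  coordinate, the 3 including the rounding of K r.\<close>
	have "real (card (L \<inter> ball 0 r)) \<le> (2 * K + 3) ^ CARD('d) * r ^ CARD('d)" if r: "1 \<le> r" for r
	proof -
		have "card (L \<inter> ball 0 r) \<le> card ((*v) A ` ?Z (nat \<lceil>K * r\<rceil>))" using sub int_box(1) by (intro card_mono) auto
		also have "\<dots> \<le> card (?Z (nat \<lceil>K * r\<rceil>))" using int_box(1) by (rule card_image_le)
		also have "\<dots> \<le> (2 * nat \<lceil>K * r\<rceil> + 1) ^ CARD('d)" by (rule int_box(2))
		finally have "real (card (L \<inter> ball 0 r)) \<le> real ((2 * nat \<lceil>K * r\<rceil> + 1) ^ CARD('d))" by (rule of_nat_mono)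
		also have "\<dots> = (2 * real (nat \<lceil>K * r\<rceil>) + 1) ^ CARD('d)" by (simp add: add.commute)
		also have "\<dots> \<le> ((2 * K + 3) * r) ^ CARD('d)"
		proof (rule power_mono)
			have "0 \<le> K * r" using K r by simp
			then have "real (nat \<lceil>K * r\<rceil>) \<le> K * r + 1" by linarith
			then show "2 * real (nat \<lceil>K * r\<rceil>) + 1 \<le> (2 * K + 3) * r" using r by (simp add: algebra_simps)
		qed simp
		finally show ?thesis by (simp add: power_mult_distrib)
	qed
	then show thesis using that[of "(2 * K + 3) ^ CARD('d)"] K fin by simp
qed

lemma fin_ball: "finite (L \<inter> ball x r)"
proof -
	obtain C :: real where "!!r. finite (L \<inter> ball 0 r)" using L_count by blast
	moreover have "L \<inter> ball x r \<subseteq> L \<inter> ball 0 (r + norm x)"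
		by (auto simp: dist_norm) (smt (verit) norm_minus_commute norm_triangle_ineq2)
	ultimately show ?thesis using finite_subset by blast
qed

lemma near_step: "x \<in> L ==> near L (\<lambda>_. S) x (x + e n)"
	unfolding near_def
proof (intro exI[of _ "{x}"] exI[of _ 1] conjI allI)
	fix u :: "'d vfun"
	have "norm (u (x + e n) - u x) \<le> dnL u x" unfolding dn_alt using finS eS by (intro member_le_L2_set) auto
	then show "norm (u x - u (x + e n)) \<le> 1 * (\<Sum>l\<in>{x}. dnL u l)" by (simp add: norm_minus_commute)
qed auto

lemma near_multiple: "x \<in> L ==> near L (\<lambda>_. S) x (x + real k *\<^sub>R e n)"
proof (induction k)
	case 0 then show ?case by (simp add: near_refl)
next
	case (Suc k)
	have "near L (\<lambda>_. S) (x + real k *\<^sub>R e n) ((x + real k *\<^sub>R e n) + e n)"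
		using L_multiple Suc by (intro near_step) auto
	moreover have "(x + real k *\<^sub>R e n) + e n = x + real (Suc k) *\<^sub>R e n" by (simp add: algebra_simps)
	ultimately show ?case using near_trans Suc by metis
qed

lemma near_int:
	assumes "x \<in> L" "x + c *\<^sub>R e n \<in> L" "c \<in> \<int>"
	shows "near L (\<lambda>_. S) x (x + c *\<^sub>R e n)"
proof -
	obtain k where k: "c = of_int k" using assms Ints_cases by blast
	show ?thesis
	proof (cases "0 \<le> k")
		case True
		then show ?thesis using near_multiple[OF assms(1), of "nat k" n] k by simp
	next
		case False
		have "(x + c *\<^sub>R e n) + real (nat (- k)) *\<^sub>R e n = x" using False k by (simp add: algebra_simps)
		then show ?thesis using near_multiple[OF assms(2), of "nat (- k)" n] near_sym by metis
	qed
qed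

text \<open>Walk from 0 to \<open>x\<close> through one coordinate direction after another; the
  basis vectors belong to the stencil.\<close>

lemma near_zero: "x \<in> L ==> near L (\<lambda>_. S) 0 x"
proof -
	assume "x \<in> L"
	then obtain z where z: "x = A *v z" "\<forall>i. z $ i \<in> \<int>" unfolding bravais_lattice_def by auto
	have inL: "(\<Sum>n\<in>J. z $ n *\<^sub>R e n) \<in> L" for J
	proof -
		have "(\<Sum>n\<in>J. z $ n *\<^sub>R e n) = A *v (\<chi> i. if i \<in> J then z $ i else 0)"
			unfolding matrix_vector_mul_component[symmetric]
			by (simp add: vec_eq_iff matrix_vector_mult_def axis_def if_distrib sum.If_cases mult.commute cong: if_cong)
		then show ?thesis unfolding bravais_lattice_def using z(2) by auto
	qed
	have "near L (\<lambda>_. S) 0 (\<Sum>n\<in>J. z $ n *\<^sub>R e n)" if "finite J" for J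
		using that
	proof (induction J)
		case empty then show ?case by (simp add: near_refl)
	next
		case (insert i J)
		have "near L (\<lambda>_. S) (\<Sum>n\<in>J. z $ n *\<^sub>R e n) ((\<Sum>n\<in>J. z $ n *\<^sub>R e n) + z $ i *\<^sub>R e i)"
			using inL[of J] inL[of "insert i J"] insert z(2) by (intro near_int) (auto simp: add.commute)
		then show ?case using insert near_trans by (simp add: add.commute) blast
	qed
	from this[of UNIV] have "near L (\<lambda>_. S) 0 (\<Sum>n\<in>UNIV. z $ n *\<^sub>R e n)" by simp
	moreover have "(\<Sum>n\<in>UNIV. z $ n *\<^sub>R e n) = x"
		unfolding z(1) by (simp add: vec_eq_iff matrix_vector_mult_def axis_def if_distrib mult.commute cong: if_cong)
	ultimately show ?thesis by simp
qed

sublocale net "bravais_lattice A" "\<lambda>_. S"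
proof
	show "near L (\<lambda>_. S) x y" if "x \<in> L" "y \<in> L" for x y
		by (rule near_trans[OF near_sym[OF near_zero[OF that(1)]] near_zero[OF that(2)]])
	show "L \<noteq> {}" using L_zero by blast
qed (use finS L_S in auto)

definition rc :: real where "rc = 1 + (\<Sum>\<rho>\<in>S. norm \<rho>)"

lemma rc1: "1 \<le> rc" unfolding rc_def by (simp add: sum_nonneg)

lemma rc: "\<rho> \<in> S ==> norm \<rho> \<le> rc"
	unfolding rc_def using member_le_sum[of \<rho> S norm] finS by simp

definition HB :: "('d vfun => 'd vfun => real) => 'd vfun => 'd vfun => real" where
	"HB Q v w = (\<Sum>\<^sub>\<infinity>l\<in>L. Q (sdL v l) (sdL w l))"

definition Fs :: "'d vfun set" where "Fs = {v. finite {l\<in>L. v l \<noteq> 0}}"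

text \<open>Weak discrete form of div (Q Dv) = 0 in \<open>X\<close>. Against \<phi> in
  \<open>Fs\<close> the sum in \<open>HB\<close> is finite, so the notion makes sense for
  \<open>v\<close> of infinite energy.\<close>

definition harm :: "('d vfun => 'd vfun => real) => 'd vfun => (real^'d) set => bool" where
	"harm Q v X \<longleftrightarrow> (\<forall>\<phi>\<in>Fs. {l\<in>L. \<phi> l \<noteq> 0} \<subseteq> X --> HB Q v \<phi> = 0)"

lemma harm_mono: "harm Q v X ==> Y \<subseteq> X ==> harm Q v Y"
	unfolding harm_def by blast

lemma harmD: "harm Q v X ==> \<phi> \<in> Fs ==> {l\<in>L. \<phi> l \<noteq> 0} \<subseteq> X ==> HB Q v \<phi> = 0"
	by (simp add: harm_def)

lemma sdL_zero:
	assumes "!!\<rho>. \<rho> \<in> insert 0 S ==> v (l + \<rho>) = 0"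
	shows "sdL v l = zf"
proof
	fix \<rho>
	have "v l = 0" using assms[of 0] by simp
	then show "sdL v l \<rho> = 0" using assms[of \<rho>] by (cases "\<rho> \<in> S") (simp_all add: stencil_diff_def)
qed

lemma sdL_shift: "sdL (\<lambda>x. v (x + a)) l = sdL v (l + a)"
	by (auto simp: stencil_diff_def algebra_simps)

lemma bij_shift: "a \<in> L ==> bij_betw (\<lambda>l. l + a) L L"
	by (rule bij_betwI[where g="\<lambda>l. l - a"]) (auto intro: L_add L_diff)

lemma HB_shift: "a \<in> L ==> HB Q (\<lambda>x. v (x + a)) (\<lambda>x. w (x + a)) = HB Q v w"
	unfolding HB_def sdL_shift[of v a] sdL_shift[of w a]
	by (rule infsum_reindex_bij_betw[OF bij_shift, where f="\<lambda>l. Q (sdL v l) (sdL w l)"])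

lemma Fs_fin:
	assumes "\<phi> \<in> Fs"
	shows "finite {l\<in>L. sdL \<phi> l \<noteq> zf}"
proof (rule finite_subset)
	have 1: "finite {l\<in>L. \<phi> l \<noteq> 0}" using assms by (simp add: Fs_def)
	show "finite (\<Union>\<rho>\<in>insert 0 S. (\<lambda>y. y - \<rho>) ` {l\<in>L. \<phi> l \<noteq> 0})" using 1 finS by blast
	show "{l\<in>L. sdL \<phi> l \<noteq> zf} \<subseteq> (\<Union>\<rho>\<in>insert 0 S. (\<lambda>y. y - \<rho>) ` {l\<in>L. \<phi> l \<noteq> 0})"
	proof
		fix l assume l: "l \<in> {l\<in>L. sdL \<phi> l \<noteq> zf}"
		then obtain \<rho> where \<rho>: "\<rho> \<in> insert 0 S" "\<phi> (l + \<rho>) \<noteq> 0" using sdL_zero by blast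
		then have "l + \<rho> \<in> {l\<in>L. \<phi> l \<noteq> 0}" using l L_S by auto
		then show "l \<in> (\<Union>\<rho>\<in>insert 0 S. (\<lambda>y. y - \<rho>) ` {l\<in>L. \<phi> l \<noteq> 0})"
			using \<rho>(1) by (intro UN_I[of \<rho>] image_eqI[of _ _ "l + \<rho>"]) auto
	qed
qed

lemma Fs_Wdc: "Fs \<subseteq> Wdc L (\<lambda>_. S)"
proof
	fix v assume "v \<in> Fs"
	then have "finite {l\<in>L. sdL v l \<noteq> zf}" by (rule Fs_fin)
	moreover have "{l\<in>L. dnL v l \<noteq> 0} \<subseteq> {l\<in>L. sdL v l \<noteq> zf}" by (auto simp: dn_def)
	ultimately show "v \<in> Wdc L (\<lambda>_. S)" by (auto simp: Wdc_def intro: finite_subset)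
qed

lemma Fs_W: "Fs \<subseteq> W" using Fs_Wdc Wdc_subset_Wd by blast

lemma Fs_lin: "u \<in> Fs ==> v \<in> Fs ==> (lcomb a u b v) \<in> Fs"
proof -
	assume "u \<in> Fs" "v \<in> Fs"
	then have "finite ({l\<in>L. u l \<noteq> 0} \<union> {l\<in>L. v l \<noteq> 0})" by (simp add: Fs_def)
	moreover have "{l\<in>L. a *\<^sub>R u l + b *\<^sub>R v l \<noteq> 0} \<subseteq> {l\<in>L. u l \<noteq> 0} \<union> {l\<in>L. v l \<noteq> 0}" by auto
	ultimately show ?thesis unfolding Fs_def by (auto intro: finite_subset)
qed

lemma Fs_shift: "a \<in> L ==> v \<in> Fs ==> (\<lambda>x. v (x - a)) \<in> Fs"
proof -
	assume a: "a \<in> L" and "v \<in> Fs"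
	then have "finite ((\<lambda>l. l + a) ` {l\<in>L. v l \<noteq> 0})" by (simp add: Fs_def)
	moreover have "{l\<in>L. v (l - a) \<noteq> 0} \<subseteq> (\<lambda>l. l + a) ` {l\<in>L. v l \<noteq> 0}"
		using a by (auto intro!: image_eqI[of _ _ "_ - a"] L_diff)
	ultimately show ?thesis unfolding Fs_def by (auto intro: finite_subset)
qed

end

locale hom_form = hom_lattice A S for A :: "real^'d^'d" and S +
	fixes Q :: "'d vfun => 'd vfun => real" and KQ c :: real
	assumes Q2: "form2 S Q" and KQ0: "0 \<le> KQ"
		and Qb: "g \<in> stsp S ==> h \<in> stsp S ==> \<bar>Q g h\<bar> \<le> KQ * nrm S g * nrm S h"
		and c0: "0 < c"
		and co: "v \<in> Fs ==> c * (Dn (bravais_lattice A) (\<lambda>_. S) v)\<^sup>2 \<le> HB Q v v"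
begin

lemma Q_lin1: "g \<in> stsp S ==> h \<in> stsp S ==> k \<in> stsp S ==>
		Q (lcomb a g b h) k = a * Q g k + b * Q h k"
	by (rule form1D[OF form2_left[OF Q2]])

lemma Q_lin2: "g \<in> stsp S ==> h \<in> stsp S ==> k \<in> stsp S ==>
		Q k (lcomb a g b h) = a * Q k g + b * Q k h"
	by (rule form1D[OF Q2[unfolded form2_def, THEN conjunct1, rule_format]])

lemma Q_sym: "g \<in> stsp S ==> h \<in> stsp S ==> Q g h = Q h g"
	by (rule Q2[unfolded form2_def, THEN conjunct2, rule_format])

lemma Q_zero: "k \<in> stsp S ==> Q k zf = 0" "k \<in> stsp S ==> Q zf k = 0"
	using Qb[of k "\<lambda>_. 0"] Qb[of "\<lambda>_. 0" k] by auto

lemma HB_sum: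
	assumes "finite U" "U \<subseteq> L" "\<forall>l\<in>L - U. sdL \<phi> l = zf"
	shows "HB Q v \<phi> = (\<Sum>l\<in>U. Q (sdL v l) (sdL \<phi> l))"
proof -
	have "HB Q v \<phi> = (\<Sum>\<^sub>\<infinity>l\<in>U. Q (sdL v l) (sdL \<phi> l))"
		unfolding HB_def using assms by (intro infsum_cong_neutral) (auto simp: Q_zero)
	then show ?thesis using assms by simp
qed

text \<open>The form is translation invariant, so the difference of a harmonic function and its
  translate by \<sigma> is harmonic where both are; this costs a margin of one interaction radius
  \<open>rc\<close>.\<close>

lemma harm_diff:
	assumes v: "harm Q v (ball x r)" and \<sigma>: "\<sigma> \<in> S" and r: "r' + rc \<le> r"
	shows "harm Q (\<lambda>y. v (y + \<sigma>) - v y) (ball x r')"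
	unfolding harm_def
proof (intro ballI impI)
	fix \<phi> assume \<phi>: "\<phi> \<in> Fs" and s: "{l\<in>L. \<phi> l \<noteq> 0} \<subseteq> ball x r'"
	have \<sigma>L: "\<sigma> \<in> L" using \<sigma> SL by blast
	let ?\<psi> = "\<lambda>y. \<phi> (y - \<sigma>)"
	have \<psi>: "?\<psi> \<in> Fs" using \<sigma>L \<phi> by (rule Fs_shift)
	have "{l\<in>L. ?\<psi> l \<noteq> 0} \<subseteq> ball x r"
	proof
		fix l assume l: "l \<in> {l\<in>L. ?\<psi> l \<noteq> 0}"
		then have "l - \<sigma> \<in> ball x r'" using s L_diff[OF _ \<sigma>L] by blast
		moreover have "dist x l \<le> dist x (l - \<sigma>) + norm \<sigma>"
			using norm_triangle_ineq4[of "x - (l - \<sigma>)" \<sigma>] by (simp add: dist_norm algebra_simps)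
		ultimately show "l \<in> ball x r" using rc[OF \<sigma>] r by simp
	qed
	then have 1: "HB Q v ?\<psi> = 0" by (rule harmD[OF v \<psi>])
	have "HB Q (\<lambda>y. v (y + \<sigma>)) (\<lambda>y. ?\<psi> (y + \<sigma>)) = HB Q v ?\<psi>" by (rule HB_shift[OF \<sigma>L])
	then have 2: "HB Q (\<lambda>y. v (y + \<sigma>)) \<phi> = 0" using 1 by simp
	have "ball x r' \<subseteq> ball x r" using r rc1 by (intro subset_ball) simp
	with s have "{l\<in>L. \<phi> l \<noteq> 0} \<subseteq> ball x r" by (rule subset_trans)
	then have 3: "HB Q v \<phi> = 0" by (rule harmD[OF v \<phi>])
	define U where "U = {l\<in>L. sdL \<phi> l \<noteq> zf}"
	have U: "finite U" "U \<subseteq> L" "\<forall>l\<in>L - U. sdL \<phi> l = zf" using Fs_fin[OF \<phi>] by (auto simp: U_def)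
	have "HB Q (\<lambda>y. v (y + \<sigma>) - v y) \<phi> = (\<Sum>l\<in>U. Q (sdL (\<lambda>y. v (y + \<sigma>)) l) (sdL \<phi> l) - Q (sdL v l) (sdL \<phi> l))"
		unfolding HB_sum[OF U]
	proof (rule sum.cong)
		fix l assume "l \<in> U"
		show "Q (sdL (\<lambda>y. v (y + \<sigma>) - v y) l) (sdL \<phi> l) = Q (sdL (\<lambda>y. v (y + \<sigma>)) l) (sdL \<phi> l) - Q (sdL v l) (sdL \<phi> l)"
			using Q_lin1[of "sdL (\<lambda>y. v (y + \<sigma>)) l" "sdL v l" "sdL \<phi> l" 1 "-1"] by (simp add: stencil_diff_diff)
	qed simp
	also have "\<dots> = HB Q (\<lambda>y. v (y + \<sigma>)) \<phi> - HB Q v \<phi>" unfolding HB_sum[OF U] by (rule sum_subtractf)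
	finally show "HB Q (\<lambda>y. v (y + \<sigma>) - v y) \<phi> = 0" using 2 3 by simp
qed

text \<open>Testing with \<open>\<eta>\<^sup>2 v\<close> leaves only error terms containing two
	differences of the cutoff \<open>\<eta>\<close>; the remaining difference of \<open>v\<close> may be bounded by \<open>v\<close> itself, since the
	lattice spacing is fixed.\<close>

lemma caccioppoli:
	obtains C where "0 \<le> C" "!!s x v. rc \<le> s ==> harm Q v (ball x (6 * s)) ==>
		 (\<Sum>l\<in>L \<inter> ball x s. (dnL v l)\<^sup>2) \<le> C / s\<^sup>2 * (\<Sum>l\<in>L \<inter> ball x (6 * s). (norm (v l))\<^sup>2)"
proof -
	define N where "N = real (card (insert 0 S))"
	have N1: "1 \<le> N" unfolding N_def using finS by (simp add: card_gt_0_iff Suc_le_eq)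
	define C where "C = KQ * (2 + N) * rc\<^sup>2 * N * N / c"
	have C: "0 \<le> C" using KQ0 N1 c0 unfolding C_def by simp
	have main: "(\<Sum>l\<in>L \<inter> ball x s. (dnL v l)\<^sup>2) \<le> C / s\<^sup>2 * (\<Sum>l\<in>L \<inter> ball x (6 * s). (norm (v l))\<^sup>2)"
		if s: "rc \<le> s" and v: "harm Q v (ball x (6 * s))" for s x v
	proof -
		have s0: "1 \<le> s" using s rc1 by linarith
		define U where "U = L \<inter> ball x (4 * s + rc)"
		have U: "finite U" "U \<subseteq> L" unfolding U_def using fin_ball by auto
		\<comment> \<open>The cutoff is 1 up to radius 2s and 0 beyond 4s. Since rc \<le> s, stencils
		  based in the ball of radius s see only \<eta> = 1, and those based outside \<open>U\<close> see
		  only \<eta> = 0.\<close>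
		define \<eta> where "\<eta> y = max 0 (min 1 (2 - dist x y / (2 * s)))" for y
		have \<eta>0: "\<eta> y = 0" if "4 * s \<le> dist x y" for y using that s0 by (auto simp: \<eta>_def field_simps)
		have \<eta>1: "\<eta> y = 1" if "dist x y \<le> 2 * s" for y using that s0 by (auto simp: \<eta>_def field_simps)
		have \<eta>lip: "\<bar>\<eta> (l + \<rho>) - \<eta> l\<bar> \<le> rc / s" if \<rho>: "\<rho> \<in> S" for l \<rho>
		proof -
			have "\<bar>\<eta> (l + \<rho>) - \<eta> l\<bar> \<le> \<bar>dist x (l + \<rho>) / (2 * s) - dist x l / (2 * s)\<bar>" unfolding \<eta>_def by linarith
			also have "\<dots> = \<bar>dist x (l + \<rho>) - dist x l\<bar> / (2 * s)" using s0 by (simp add: diff_divide_distrib[symmetric])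
			also have "\<dots> \<le> norm \<rho> / (2 * s)"
			proof -
				have "\<bar>dist x (l + \<rho>) - dist x l\<bar> \<le> norm \<rho>"
					using dist_triangle2[of x "l + \<rho>" l] dist_triangle2[of x l "l + \<rho>"] by (simp add: dist_norm abs_le_iff norm_minus_commute)
				then show ?thesis using s0 by (intro divide_right_mono) auto
			qed
			also have "\<dots> \<le> rc / s" using rc[OF \<rho>] rc1 s0 by (intro frac_le) auto
			finally show ?thesis .
		qed
		define \<phi> where "\<phi> y = (\<eta> y)\<^sup>2 *\<^sub>R v y" for y
		define w where "w y = \<eta> y *\<^sub>R v y" for y
		have supp: "{l\<in>L. \<phi> l \<noteq> 0} \<subseteq> L \<inter> ball x (4 * s)" "{l\<in>L. w l \<noteq> 0} \<subseteq> L \<inter> ball x (4 * s)"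
			using \<eta>0 unfolding \<phi>_def w_def by (auto simp: not_le[symmetric])
		have Fs: "\<phi> \<in> Fs" "w \<in> Fs" unfolding Fs_def using supp fin_ball finite_subset by blast+
		have "{l\<in>L. \<phi> l \<noteq> 0} \<subseteq> ball x (6 * s)" using supp s0 by auto
		then have H0: "HB Q v \<phi> = 0" by (rule harmD[OF v Fs(1)])
		have far: "\<eta> (l + \<rho>) = 0" if "l \<in> L - U" "\<rho> \<in> insert 0 S" for l \<rho>
		proof (rule \<eta>0)
			have "norm \<rho> \<le> rc" using rc rc1 that by auto
			moreover have "dist x l \<le> dist x (l + \<rho>) + norm \<rho>"
				using norm_triangle_ineq[of "x - (l + \<rho>)" \<rho>] by (simp add: dist_norm algebra_simps)
			moreover have "4 * s + rc \<le> dist x l" using that by (auto simp: U_def)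
			ultimately show "4 * s \<le> dist x (l + \<rho>)" by linarith
		qed
		have out: "\<forall>l\<in>L - U. sdL \<phi> l = zf" "\<forall>l\<in>L - U. sdL w l = zf"
			by (rule ballI, rule sdL_zero, simp only: \<phi>_def w_def far, simp)+
		define m where "m l = (\<Sum>\<rho>\<in>insert 0 S. norm (v (l + \<rho>)))" for l
		have m0: "0 \<le> m l" for l unfolding m_def by (simp add: sum_nonneg)
		have point: "Q (sdL w l) (sdL w l) \<le> Q (sdL v l) (sdL \<phi> l) + KQ * (2 + N) * (rc / s)\<^sup>2 * (m l)\<^sup>2" for l
		proof -
			\<comment> \<open>Discrete product rule: with \<open>g\<close> the stencil of \<open>v\<close>,
			  \<open>w\<close> has stencil \<open>t g + a\<close> and \<phi> has
			  \<open>t (t g + 2 a) + a'\<close>, where \<open>a\<close> and \<open>a'\<close> are of first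
			  and second order in the differences of \<eta>. The two values of the form differ by
			  \<open>Q a a - Q g a'\<close>.\<close>
			define t where "t = \<eta> l"
			define g where "g = sdL v l"
			define a where "a = (\<lambda>\<rho>. if \<rho> \<in> S then (\<eta> (l + \<rho>) - \<eta> l) *\<^sub>R v (l + \<rho>) else 0)"
			define a' where "a' = (\<lambda>\<rho>. if \<rho> \<in> S then (\<eta> (l + \<rho>) - \<eta> l)\<^sup>2 *\<^sub>R v (l + \<rho>) else 0)"
			have sp: "g \<in> stsp S" "a \<in> stsp S" "a' \<in> stsp S"
				unfolding g_def by simp (auto simp: a_def a'_def stencil_space_def)
			have w: "sdL w l = (\<lambda>\<rho>. t *\<^sub>R g \<rho> + 1 *\<^sub>R a \<rho>)"
				by (auto simp: w_def stencil_diff_def g_def a_def t_def algebra_simps)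
			have \<phi>: "sdL \<phi> l = (\<lambda>\<rho>. t *\<^sub>R (t *\<^sub>R g \<rho> + 2 *\<^sub>R a \<rho>) + 1 *\<^sub>R a' \<rho>)"
			proof
				fix \<rho>
				show "sdL \<phi> l \<rho> = t *\<^sub>R (t *\<^sub>R g \<rho> + 2 *\<^sub>R a \<rho>) + 1 *\<^sub>R a' \<rho>"
				proof (cases "\<rho> \<in> S")
					case True
					have "t *\<^sub>R (t *\<^sub>R (v (l + \<rho>) - v l) + 2 *\<^sub>R ((\<eta> (l + \<rho>) - t) *\<^sub>R v (l + \<rho>))) + (\<eta> (l + \<rho>) - t)\<^sup>2 *\<^sub>R v (l + \<rho>)
						= (t * t + 2 * t * (\<eta> (l + \<rho>) - t) + (\<eta> (l + \<rho>) - t)\<^sup>2) *\<^sub>R v (l + \<rho>) - (t * t) *\<^sub>R v l"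
						by (simp add: scaleR_left_distrib scaleR_right_diff_distrib scaleR_right_distrib mult_ac)
					also have "t * t + 2 * t * (\<eta> (l + \<rho>) - t) + (\<eta> (l + \<rho>) - t)\<^sup>2 = (\<eta> (l + \<rho>))\<^sup>2"
						by (simp add: power2_eq_square algebra_simps)
					finally show ?thesis using True by (simp add: \<phi>_def stencil_diff_def g_def a_def a'_def t_def power2_eq_square)
				qed (simp add: stencil_diff_def g_def a_def a'_def)
			qed
			have in1: "(\<lambda>\<rho>. t *\<^sub>R g \<rho> + 2 *\<^sub>R a \<rho>) \<in> stsp S" using sp by (intro stencil_space_lin)
			have in2: "(\<lambda>\<rho>. t *\<^sub>R g \<rho> + 1 *\<^sub>R a \<rho>) \<in> stsp S" using sp by (intro stencil_space_lin)
			have e1: "Q (sdL w l) (sdL w l) = t * (t * Q g g + Q g a) + (t * Q a g + Q a a)"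
				unfolding w using Q_lin1[OF sp(1,2) in2, of t 1] Q_lin2[OF sp(1,2) sp(1), of t 1] Q_lin2[OF sp(1,2) sp(2), of t 1] by simp
			have e2: "Q (sdL v l) (sdL \<phi> l) = t * (t * Q g g + 2 * Q g a) + Q g a'"
				unfolding \<phi> g_def[symmetric] using Q_lin2[OF in1 sp(3,1), of t 1] Q_lin2[OF sp(1,2,1), of t 2] by simp
			have diff: "Q (sdL w l) (sdL w l) - Q (sdL v l) (sdL \<phi> l) = Q a a - Q g a'"
				unfolding e1 e2 Q_sym[OF sp(2,1)] by (simp add: algebra_simps)
			have mS: "(\<Sum>\<rho>\<in>S. norm (v (l + \<rho>))) \<le> m l"
				unfolding m_def using finS by (intro sum_mono2) auto
			have vl: "norm (v l) \<le> m l"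
				unfolding m_def using member_le_sum[of 0 "insert 0 S" "\<lambda>\<rho>. norm (v (l + \<rho>))"] finS by simp
			have na: "nrm S a \<le> rc / s * m l"
			proof -
				have "nrm S a \<le> (\<Sum>\<rho>\<in>S. norm (a \<rho>))" by (rule nrm_le_sum)
				also have "\<dots> \<le> (\<Sum>\<rho>\<in>S. rc / s * norm (v (l + \<rho>)))"
				proof (rule sum_mono)
					fix \<rho> assume \<rho>: "\<rho> \<in> S"
					have "\<bar>\<eta> (l + \<rho>) - \<eta> l\<bar> * norm (v (l + \<rho>)) \<le> rc / s * norm (v (l + \<rho>))"
						by (rule mult_right_mono[OF \<eta>lip[OF \<rho>]]) simp
					then show "norm (a \<rho>) \<le> rc / s * norm (v (l + \<rho>))" using \<rho> by (simp add: a_def)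
				qed
				also have "\<dots> \<le> rc / s * m l" unfolding sum_distrib_left[symmetric] using mS rc1 s0 by (intro mult_left_mono) auto
				finally show ?thesis .
			qed
			have na': "nrm S a' \<le> (rc / s)\<^sup>2 * m l"
			proof -
				have "nrm S a' \<le> (\<Sum>\<rho>\<in>S. norm (a' \<rho>))" by (rule nrm_le_sum)
				also have "\<dots> \<le> (\<Sum>\<rho>\<in>S. (rc / s)\<^sup>2 * norm (v (l + \<rho>)))"
				proof (rule sum_mono)
					fix \<rho> assume \<rho>: "\<rho> \<in> S"
					have "\<bar>\<eta> (l + \<rho>) - \<eta> l\<bar>\<^sup>2 \<le> (rc / s)\<^sup>2" using \<eta>lip[OF \<rho>] by (rule power_mono) simp
					then show "norm (a' \<rho>) \<le> (rc / s)\<^sup>2 * norm (v (l + \<rho>))" using \<rho> by (simp add: a'_def mult_right_mono)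
				qed
				also have "\<dots> = (rc / s)\<^sup>2 * (\<Sum>\<rho>\<in>S. norm (v (l + \<rho>)))" by (simp add: sum_distrib_left)
				also have "\<dots> \<le> (rc / s)\<^sup>2 * m l" using mS by (intro mult_left_mono) auto
				finally show ?thesis .
			qed
			have ng: "nrm S g \<le> (1 + N) * m l"
			proof -
				have "nrm S g \<le> (\<Sum>\<rho>\<in>S. norm (g \<rho>))" by (rule nrm_le_sum)
				also have "\<dots> \<le> (\<Sum>\<rho>\<in>S. norm (v (l + \<rho>)) + norm (v l))"
					by (intro sum_mono) (auto simp: g_def stencil_diff_def norm_triangle_ineq4)
				also have "\<dots> = (\<Sum>\<rho>\<in>S. norm (v (l + \<rho>))) + card S * norm (v l)" by (simp add: sum.distrib)
				also have "\<dots> \<le> m l + N * m l"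
				proof (intro add_mono mS mult_mono vl)
					show "real (card S) \<le> N" unfolding N_def using finS by (intro of_nat_mono card_mono) auto
				qed (use N1 in auto)
				also have "\<dots> = (1 + N) * m l" by (simp add: algebra_simps)
				finally show ?thesis .
			qed
			have "\<bar>Q a a\<bar> \<le> KQ * (rc / s * m l) * (rc / s * m l)"
				using na KQ0 m0[of l] rc1 s0 by (intro order_trans[OF Qb[OF sp(2,2)]] mult_mono mult_nonneg_nonneg divide_nonneg_nonneg) auto
			moreover have "\<bar>Q g a'\<bar> \<le> KQ * ((1 + N) * m l) * ((rc / s)\<^sup>2 * m l)"
				using na' ng KQ0 m0[of l] N1 by (intro order_trans[OF Qb[OF sp(1,3)]] mult_mono mult_nonneg_nonneg) auto
			moreover have "KQ * (q * m l) * (q * m l) + KQ * ((1 + N) * m l) * (q\<^sup>2 * m l) = KQ * (2 + N) * q\<^sup>2 * (m l)\<^sup>2" for q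
				by (simp add: power2_eq_square algebra_simps)
			note this[of "rc / s"]
			ultimately show ?thesis using diff by linarith
		qed
		have msq: "(m l)\<^sup>2 \<le> N * (\<Sum>\<rho>\<in>insert 0 S. (norm (v (l + \<rho>)))\<^sup>2)" for l
			unfolding m_def N_def using sum_squared_le_sum_of_squares[of "\<lambda>\<rho>. norm (v (l + \<rho>))" "insert 0 S"]
			by (simp only: mult.commute)
		define T where "T = (\<Sum>l\<in>L \<inter> ball x (6 * s). (norm (v l))\<^sup>2)"
		have "(\<Sum>l\<in>U. (m l)\<^sup>2) \<le> (\<Sum>l\<in>U. N * (\<Sum>\<rho>\<in>insert 0 S. (norm (v (l + \<rho>)))\<^sup>2))" by (intro sum_mono msq)
		also have "\<dots> = N * (\<Sum>\<rho>\<in>insert 0 S. \<Sum>l\<in>U. (norm (v (l + \<rho>)))\<^sup>2)"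
			unfolding sum_distrib_left[symmetric] by (subst sum.swap) simp
		also have "\<dots> \<le> N * (\<Sum>\<rho>\<in>insert 0 S. T)"
		proof (intro mult_left_mono sum_mono)
			fix \<rho> assume \<rho>: "\<rho> \<in> insert 0 S"
			have "(\<Sum>l\<in>U. (norm (v (l + \<rho>)))\<^sup>2) = (\<Sum>y\<in>(\<lambda>l. l + \<rho>) ` U. (norm (v y))\<^sup>2)"
				by (subst sum.reindex) auto
			also have "\<dots> \<le> T" unfolding T_def
			proof (rule sum_mono2[OF fin_ball])
				show "(\<lambda>l. l + \<rho>) ` U \<subseteq> L \<inter> ball x (6 * s)"
				proof clarify
					fix l assume l: "l \<in> U"
					have n: "norm \<rho> \<le> rc" using rc rc1 \<rho> by auto
					have "dist x (l + \<rho>) \<le> dist x l + norm \<rho>"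
						using norm_triangle_ineq4[of "x - l" \<rho>] by (simp add: dist_norm algebra_simps)
					then have "dist x (l + \<rho>) < 6 * s" using l n s by (auto simp: U_def)
					then show "l + \<rho> \<in> L \<inter> ball x (6 * s)" using l \<rho> L_S by (auto simp: U_def)
				qed
			qed auto
			finally show "(\<Sum>l\<in>U. (norm (v (l + \<rho>)))\<^sup>2) \<le> T" .
		qed (use N1 in auto)
		also have "\<dots> = N * N * T" unfolding N_def by simp
		finally have mT: "(\<Sum>l\<in>U. (m l)\<^sup>2) \<le> N * N * T" .
		have "HB Q w w \<le> HB Q v \<phi> + KQ * (2 + N) * (rc / s)\<^sup>2 * (\<Sum>l\<in>U. (m l)\<^sup>2)"
			unfolding HB_sum[OF U out(1)] HB_sum[OF U out(2)] sum_distrib_left sum.distrib[symmetric]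
			by (intro sum_mono point)
		also have "\<dots> \<le> 0 + KQ * (2 + N) * (rc / s)\<^sup>2 * (N * N * T)"
			using mT KQ0 N1 H0 by (intro add_mono mult_left_mono) auto
		finally have Hw: "HB Q w w \<le> KQ * (2 + N) * (rc / s)\<^sup>2 * (N * N * T)" by simp
		have "(\<Sum>l\<in>L \<inter> ball x s. (dnL v l)\<^sup>2) = (\<Sum>l\<in>L \<inter> ball x s. (dnL w l)\<^sup>2)"
		proof (intro sum.cong arg_cong[where f="\<lambda>x. x\<^sup>2"] refl dn_cong)
			fix l \<rho> assume l: "l \<in> L \<inter> ball x s" and \<rho>: "\<rho> \<in> S"
			have "dist x (l + \<rho>) \<le> dist x l + norm \<rho>"
				using norm_triangle_ineq4[of "x - l" \<rho>] by (simp add: dist_norm algebra_simps)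
			then have "dist x (l + \<rho>) \<le> 2 * s" "dist x l \<le> 2 * s" using l rc[OF \<rho>] s s0 by auto
			then show "v (l + \<rho>) - v l = w (l + \<rho>) - w l" by (simp add: w_def \<eta>1)
		qed
		also have "\<dots> \<le> (Dn L (\<lambda>_. S) w)\<^sup>2"
			unfolding Dn_def n2_sq using Fs Fs_W fin_ball by (intro finite_sum_le_infsum) (auto simp: Wd_def l2_def)
		finally have "c * (\<Sum>l\<in>L \<inter> ball x s. (dnL v l)\<^sup>2) \<le> KQ * (2 + N) * (rc / s)\<^sup>2 * (N * N * T)"
			using co[OF Fs(2)] Hw c0 by (smt (verit) mult_left_mono)
		then have "(\<Sum>l\<in>L \<inter> ball x s. (dnL v l)\<^sup>2) \<le> KQ * (2 + N) * (rc / s)\<^sup>2 * (N * N * T) / c"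
			by (subst pos_le_divide_eq[OF c0]) (simp only: mult.commute)
		also have "\<dots> = C / s\<^sup>2 * T" by (simp add: C_def power_divide mult_ac)
		finally show ?thesis unfolding T_def .
	qed
	show thesis by (rule that[OF C main])
qed

end

text \<open>Compare \<open>w 0\<close> with each \<open>w k\<close> by telescoping and average over
  k < n. The weights 1/n and n match the scaling of Caccioppoli's inequality, which gains 1/n^2 for
  a squared difference.\<close>

lemma sobolev_line:
	fixes w :: "nat => 'a::real_normed_vector"
	assumes n: "1 \<le> n"
	shows "(norm (w 0))\<^sup>2 \<le> (\<Sum>k<n. 2 / n * (norm (w k))\<^sup>2 + 2 * n * (norm (w (Suc k) - w k))\<^sup>2)"
proof -
	define T where "T = (\<Sum>j<n. norm (w (Suc j) - w j))"
	have T0: "0 \<le> T" unfolding T_def by (simp add: sum_nonneg)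
	have pt: "(norm (w 0))\<^sup>2 \<le> 2 * (norm (w k))\<^sup>2 + 2 * T\<^sup>2" if k: "k < n" for k
	proof -
		have "w k - w 0 = (\<Sum>j<k. w (Suc j) - w j)" by (simp add: sum_lessThan_telescope)
		then have "norm (w k - w 0) \<le> (\<Sum>j<k. norm (w (Suc j) - w j))" by (simp add: norm_sum)
		also have "\<dots> \<le> T" unfolding T_def using k by (intro sum_mono2) auto
		finally have "norm (w 0) \<le> norm (w k) + T" using norm_triangle_ineq4[of "w k" "w k - w 0"] by simp
		then have "(norm (w 0))\<^sup>2 \<le> (norm (w k) + T)\<^sup>2" by (rule power_mono) simp
		also have "\<dots> \<le> 2 * (norm (w k))\<^sup>2 + 2 * T\<^sup>2" using sum_squares_bound[of "norm (w k)" T] by (simp add: power2_sum)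
		finally show ?thesis .
	qed
	have TT: "T\<^sup>2 \<le> n * (\<Sum>j<n. (norm (w (Suc j) - w j))\<^sup>2)"
		unfolding T_def using sum_squared_le_sum_of_squares[of "\<lambda>j. norm (w (Suc j) - w j)" "{..<n}"] by (simp add: mult.commute)
	have "n * (norm (w 0))\<^sup>2 = (\<Sum>k<n. (norm (w 0))\<^sup>2)" by simp
	also have "\<dots> \<le> (\<Sum>k<n. 2 * (norm (w k))\<^sup>2 + 2 * T\<^sup>2)" using pt by (intro sum_mono) auto
	also have "\<dots> = 2 * (\<Sum>k<n. (norm (w k))\<^sup>2) + 2 * n * T\<^sup>2" by (simp add: sum.distrib sum_distrib_left)
	also have "\<dots> \<le> 2 * (\<Sum>k<n. (norm (w k))\<^sup>2) + 2 * n * (n * (\<Sum>j<n. (norm (w (Suc j) - w j))\<^sup>2))"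
		using TT by (intro add_left_mono mult_left_mono) auto
	finally have "(norm (w 0))\<^sup>2 \<le> (2 * (\<Sum>k<n. (norm (w k))\<^sup>2) + 2 * n * (n * (\<Sum>j<n. (norm (w (Suc j) - w j))\<^sup>2))) / n"
		using n by (subst pos_le_divide_eq) (simp_all add: mult.commute)
	also have "\<dots> = 2 / n * (\<Sum>k<n. (norm (w k))\<^sup>2) + 2 * n * (\<Sum>j<n. (norm (w (Suc j) - w j))\<^sup>2)"
		using n by (simp add: add_divide_distrib)
	finally show ?thesis by (simp add: sum.distrib sum_distrib_left)
qed

section \<open>Sums over lattice boxes\<close>

context hom_lattice
begin

text \<open>Recursion over the list of directions, so that adding a direction is one step of the
  induction in \<open>box_interior\<close>; \<open>boxsum_eq\<close> identifies the result with a
  sum over the point set \<open>boxset\<close>.\<close>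

primrec boxsum :: "nat => 'd list => (real^'d => real) => real^'d => real" where
	"boxsum n [] f x = f x"
| "boxsum n (i # js) f x = (\<Sum>k<n. boxsum n js f (x + real k *\<^sub>R e i))"

lemma boxsum_mono: "(!!y. f y \<le> g y) ==> boxsum n js f x \<le> boxsum n js g x"
	by (induction js arbitrary: x) (auto intro: sum_mono)

lemma boxsum_scale: "boxsum n js (\<lambda>y. c * f y) x = c * boxsum n js f x"
	by (induction js arbitrary: x) (auto simp: sum_distrib_left)

lemma boxsum_add: "boxsum n js (f .+ g) x = boxsum n js f x + boxsum n js g x"
	by (induction js arbitrary: x) (auto simp: sum.distrib)

lemma boxsum_shift: "boxsum n js (\<lambda>y. f (y + a)) x = boxsum n js f (x + a)"
proof (induction js arbitrary: x)
	case (Cons i js)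
	then show ?case by (simp add: add.assoc add.commute[of a])
qed simp

lemma boxsum_sum: "boxsum n js (\<lambda>y. \<Sum>k<(m::nat). f k y) x = (\<Sum>k<m. boxsum n js (f k) x)"
proof (induction js arbitrary: x)
	case (Cons i js)
	then show ?case by (simp add: sum.swap[of _ "{..<m}"])
qed simp

lemma boxsum_step: "boxsum n js (\<lambda>y. \<Sum>k<n. f (y + real k *\<^sub>R e i)) x = boxsum n (i # js) f x"
	by (simp add: boxsum_sum boxsum_shift)

primrec boxset :: "nat => 'd list => real^'d => (real^'d) set" where
	"boxset n [] x = {x}"
| "boxset n (i # js) x = (\<Union>k<n. boxset n js (x + real k *\<^sub>R e i))"

lemma boxset_finite: "finite (boxset n js x)"
	by (induction js arbitrary: x) auto

lemma boxset_L: "x \<in> L ==> boxset n js x \<subseteq> L"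
proof (induction js arbitrary: x)
	case (Cons i js)
	then show ?case using L_multiple[OF Cons.prems] by fastforce
qed simp

lemma boxset_coord: "y \<in> boxset n js x ==> \<exists>z. y = x + A *v z \<and> (\<forall>j. j \<notin> set js --> z $ j = 0)"
proof (induction js arbitrary: x)
	case Nil then show ?case by (intro exI[of _ 0]) auto
next
	case (Cons i js)
	then obtain k where "y \<in> boxset n js (x + real k *\<^sub>R e i)" by auto
	from Cons.IH[OF this] obtain z where z: "y = x + real k *\<^sub>R e i + A *v z" "\<forall>j. j \<notin> set js --> z $ j = 0" by blast
	have "y = x + A *v (real k *\<^sub>R axis i 1 + z)"
		using z(1) by (simp add: matrix_vector_right_distrib matrix_vector_mult_scaleR add.assoc)
	moreover have "\<forall>j. j \<notin> set (i # js) --> (real k *\<^sub>R axis i 1 + z) $ j = 0"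
		using z(2) by (auto simp: axis_def)
	ultimately show ?case by blast
qed

lemma boxset_norm: "y \<in> boxset n js x ==> dist x y \<le> real n * (\<Sum>i\<leftarrow>js. norm (e i))"
proof (induction js arbitrary: x)
	case (Cons i js)
	then obtain k where k: "k < n" "y \<in> boxset n js (x + real k *\<^sub>R e i)" by auto
	have "dist x y \<le> dist x (x + real k *\<^sub>R e i) + dist (x + real k *\<^sub>R e i) y" by (rule dist_triangle)
	also have "\<dots> \<le> real n * norm (e i) + real n * (\<Sum>i\<leftarrow>js. norm (e i))"
		using Cons.IH[OF k(2)] k(1) by (intro add_mono) (auto simp: dist_norm intro!: mult_right_mono)
	finally show ?case by (simp add: distrib_left)
qed simp

text \<open>Distinct directions are linearly independent because \<open>A\<close> is invertible;
  hence the translates that form the box are disjoint.\<close>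

lemma boxsum_eq: "distinct js ==> boxsum n js f x = sum f (boxset n js x)"
proof (induction js arbitrary: x)
	case (Cons i js)
	obtain B where B: "B ** A = mat 1" using inv unfolding invertible_def by blast
	have inj: "z = w" if "A *v z = A *v w" for z w
		using arg_cong[OF that, of "(*v) B"] by (simp add: matrix_vector_mul_assoc B)
	have disj: "boxset n js (x + real k *\<^sub>R e i) \<inter> boxset n js (x + real l *\<^sub>R e i) = {}" if "k \<noteq> l" for k l
	proof (rule ccontr)
		assume "boxset n js (x + real k *\<^sub>R e i) \<inter> boxset n js (x + real l *\<^sub>R e i) \<noteq> {}"
		then obtain y where y: "y \<in> boxset n js (x + real k *\<^sub>R e i)" "y \<in> boxset n js (x + real l *\<^sub>R e i)" by blast
		obtain z where z: "y = x + real k *\<^sub>R e i + A *v z" "z $ i = 0" using boxset_coord[OF y(1)] Cons.prems by auto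
		obtain w where w: "y = x + real l *\<^sub>R e i + A *v w" "w $ i = 0" using boxset_coord[OF y(2)] Cons.prems by auto
		have "A *v (real k *\<^sub>R axis i 1 + z) = A *v (real l *\<^sub>R axis i 1 + w)"
			using z(1) w(1) by (simp add: matrix_vector_right_distrib matrix_vector_mult_scaleR add.assoc)
		from inj[OF this] have "(real k *\<^sub>R axis i 1 + z) $ i = (real l *\<^sub>R axis i 1 + w) $ i" by simp
		then show False using z w that by simp
	qed
	have "boxsum n (i # js) f x = (\<Sum>k<n. sum f (boxset n js (x + real k *\<^sub>R e i)))" using Cons by simp
	also have "\<dots> = sum f (\<Union>k<n. boxset n js (x + real k *\<^sub>R e i))"
		using disj by (subst sum.UNION_disjoint) (auto simp: boxset_finite)
	finally show ?case by simp
qed simp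

end

section \<open>Interior estimates for harmonic functions\<close>

context hom_form
begin

text \<open>By the one-dimensional Sobolev inequality in direction \<open>i\<close>, a box sum over the directions \<open>js\<close>
	is controlled by box sums over \<open>i # js\<close> of \<open>v\<close> and its difference in direction \<open>i\<close>, which is again
	harmonic and which Caccioppoli's inequality bounds in terms of \<open>v\<close>.\<close>

lemma box_interior:
	assumes "distinct (is @ js)" "set (is @ js) = UNIV"
	shows "\<exists>C \<kappa>. 0 \<le> C \<and> 1 \<le> \<kappa> \<and> (\<forall>n x v. 1 \<le> n --> rc \<le> real n --> x \<in> L --> harm Q v (ball x (\<kappa> * real n)) -->
		 boxsum n js (\<lambda>y. (norm (v y))\<^sup>2) x \<le> C * real n ^ length js / real n ^ CARD('d) * (\<Sum>l\<in>L \<inter> ball x (\<kappa> * real n). (norm (v l))\<^sup>2))"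
	using assms
proof (induction "is" arbitrary: js)
	\<comment> \<open>The induction is on the directions not yet summed over. With none left, the box
	  is full-dimensional and lies in the ball, and the powers of n cancel.\<close>
	case Nil
	define \<kappa> where "\<kappa> = 1 + (\<Sum>i\<leftarrow>js. norm (e i))"
	have s0: "0 \<le> (\<Sum>i\<leftarrow>js. norm (e i))" by (rule sum_list_nonneg) auto
	have len: "length js = CARD('d)" using Nil by (metis append_Nil distinct_card)
	have "boxsum n js (\<lambda>y. (norm (v y))\<^sup>2) x \<le> 1 * real n ^ length js / real n ^ CARD('d) * (\<Sum>l\<in>L \<inter> ball x (\<kappa> * real n). (norm (v l))\<^sup>2)"
		if n: "1 \<le> n" and x: "x \<in> L" for n x v
	proof -
		have "boxset n js x \<subseteq> L \<inter> ball x (\<kappa> * real n)"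
		proof
			fix y assume y: "y \<in> boxset n js x"
			have "dist x y < \<kappa> * real n" using boxset_norm[OF y] n unfolding \<kappa>_def by (simp add: algebra_simps)
			then show "y \<in> L \<inter> ball x (\<kappa> * real n)" using y boxset_L[OF x] by auto
		qed
		then have "sum (\<lambda>y. (norm (v y))\<^sup>2) (boxset n js x) \<le> (\<Sum>l\<in>L \<inter> ball x (\<kappa> * real n). (norm (v l))\<^sup>2)"
			by (intro sum_mono2 fin_ball) auto
		then show ?thesis using boxsum_eq[of js n "\<lambda>y. (norm (v y))\<^sup>2" x] Nil n len by simp
	qed
	then show ?case using s0 by (intro exI[of _ 1] exI[of _ \<kappa>]) (auto simp: \<kappa>_def)
next
	case (Cons i "is")
	have "distinct (is @ i # js)" "set (is @ i # js) = UNIV" using Cons.prems by auto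
	from Cons.IH[OF this] obtain C \<kappa> where C: "0 \<le> C" "1 \<le> \<kappa>" and IH: "!!n x v. 1 \<le> n ==> rc \<le> real n ==> x \<in> L ==> harm Q v (ball x (\<kappa> * real n)) ==>
		 boxsum n (i # js) (\<lambda>y. (norm (v y))\<^sup>2) x \<le> C * real n ^ length (i # js) / real n ^ CARD('d) * (\<Sum>l\<in>L \<inter> ball x (\<kappa> * real n). (norm (v l))\<^sup>2)"
		by blast
	obtain C' where C': "0 \<le> C'" and cacc: "!!s x v. rc \<le> s ==> harm Q v (ball x (6 * s)) ==>
		 (\<Sum>l\<in>L \<inter> ball x s. (dnL v l)\<^sup>2) \<le> C' / s\<^sup>2 * (\<Sum>l\<in>L \<inter> ball x (6 * s). (norm (v l))\<^sup>2)" using caccioppoli by blast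
	\<comment> \<open>The part 2 C comes from the values of \<open>v\<close>, and 2 C C' from its
	  difference, where the weight 2n and the factor n of the longer list cancel against the 1/n^2 of
	  Caccioppoli's inequality.\<close>
	define C2 where "C2 = C * (2 + 2 * C')"
	have "boxsum n js (\<lambda>y. (norm (v y))\<^sup>2) x \<le> C2 * real n ^ length js / real n ^ CARD('d) * (\<Sum>l\<in>L \<inter> ball x ((6 * \<kappa>) * real n). (norm (v l))\<^sup>2)"
		if n: "1 \<le> n" "rc \<le> real n" and x: "x \<in> L" and v: "harm Q v (ball x ((6 * \<kappa>) * real n))" for n x v
	proof -
		define w where "w y = v (y + e i) - v y" for y
		define T where "T = (\<Sum>l\<in>L \<inter> ball x ((6 * \<kappa>) * real n). (norm (v l))\<^sup>2)"
		define P where "P = C * real n ^ length js / real n ^ CARD('d)"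
		have P0: "0 \<le> P" using C by (simp add: P_def)
		have kn: "real n \<le> \<kappa> * real n" using C(2) n by simp
		have sub: "ball x (\<kappa> * real n) \<subseteq> ball x ((6 * \<kappa>) * real n)" using kn by (intro subset_ball) simp
		have T1: "(\<Sum>l\<in>L \<inter> ball x (\<kappa> * real n). (norm (v l))\<^sup>2) \<le> T"
			unfolding T_def using sub by (intro sum_mono2 fin_ball) auto
		have hw: "harm Q w (ball x (\<kappa> * real n))"
			unfolding w_def by (rule harm_diff[OF v eS]) (use kn n in linarith)
		have hv: "harm Q v (ball x (\<kappa> * real n))" using harm_mono[OF v sub] .
		have "(\<Sum>l\<in>L \<inter> ball x (\<kappa> * real n). (norm (w l))\<^sup>2) \<le> (\<Sum>l\<in>L \<inter> ball x (\<kappa> * real n). (dnL v l)\<^sup>2)"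
			unfolding w_def using diff_le_dn[OF _ eS] by (intro sum_mono power_mono) auto
		also have "\<dots> \<le> C' / (\<kappa> * real n)\<^sup>2 * T"
			using cacc[of "\<kappa> * real n" v x] kn n v unfolding T_def by (simp add: mult.assoc)
		also have "\<dots> \<le> C' / (real n)\<^sup>2 * T"
			using kn n C' unfolding T_def by (intro mult_right_mono divide_left_mono power_mono sum_nonneg) (auto intro!: mult_pos_pos)
		finally have T2: "(\<Sum>l\<in>L \<inter> ball x (\<kappa> * real n). (norm (w l))\<^sup>2) \<le> C' / (real n)\<^sup>2 * T" .
		have line: "(norm (v y))\<^sup>2 \<le> (\<Sum>k<n. 2 / n * (norm (v (y + real k *\<^sub>R e i)))\<^sup>2 + 2 * n * (norm (w (y + real k *\<^sub>R e i)))\<^sup>2)" for y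
		proof -
			have "v (y + real (Suc k) *\<^sub>R e i) - v (y + real k *\<^sub>R e i) = w (y + real k *\<^sub>R e i)" for k
				unfolding w_def by (simp add: algebra_simps)
			then show ?thesis using sobolev_line[OF n(1), of "\<lambda>k. v (y + real k *\<^sub>R e i)"] by simp
		qed
		let ?f = "\<lambda>z. 2 / n * (norm (v z))\<^sup>2 + 2 * n * (norm (w z))\<^sup>2"
		have "boxsum n js (\<lambda>y. (norm (v y))\<^sup>2) x \<le> boxsum n js (\<lambda>y. \<Sum>k<n. ?f (y + real k *\<^sub>R e i)) x"
			using line by (intro boxsum_mono) simp
		also have "\<dots> = boxsum n (i # js) ?f x" by (rule boxsum_step[of n js ?f])
		also have "\<dots> = 2 / n * boxsum n (i # js) (\<lambda>y. (norm (v y))\<^sup>2) x + 2 * n * boxsum n (i # js) (\<lambda>y. (norm (w y))\<^sup>2) x"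
			unfolding boxsum_add boxsum_scale by simp
		also have "\<dots> \<le> 2 / n * ((P * n) * T) + 2 * n * ((P * n) * (C' / (real n)\<^sup>2 * T))"
		proof (intro add_mono mult_left_mono)
			have "boxsum n (i # js) (\<lambda>y. (norm (v y))\<^sup>2) x \<le> (P * n) * (\<Sum>l\<in>L \<inter> ball x (\<kappa> * real n). (norm (v l))\<^sup>2)"
				using IH[OF n x hv] unfolding P_def by (simp add: mult_ac)
			also have "\<dots> \<le> (P * n) * T" using T1 P0 by (intro mult_left_mono) auto
			finally show "boxsum n (i # js) (\<lambda>y. (norm (v y))\<^sup>2) x \<le> (P * n) * T" .
			have "boxsum n (i # js) (\<lambda>y. (norm (w y))\<^sup>2) x \<le> (P * n) * (\<Sum>l\<in>L \<inter> ball x (\<kappa> * real n). (norm (w l))\<^sup>2)"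
				using IH[OF n x hw] unfolding P_def by (simp add: mult_ac)
			also have "\<dots> \<le> (P * n) * (C' / (real n)\<^sup>2 * T)" using T2 P0 by (intro mult_left_mono) auto
			finally show "boxsum n (i # js) (\<lambda>y. (norm (w y))\<^sup>2) x \<le> (P * n) * (C' / (real n)\<^sup>2 * T)" .
		qed auto
		also have "\<dots> = P * (2 + 2 * C') * T" using n by (simp add: power2_eq_square field_simps)
		also have "\<dots> = C2 * real n ^ length js / real n ^ CARD('d) * T" by (simp add: P_def C2_def)
		finally show ?thesis unfolding T_def .
	qed
	moreover have "0 \<le> C2" using C C' by (simp add: C2_def)
	ultimately show ?case using C(2) by (intro exI[of _ C2] exI[of _ "6 * \<kappa>"]) auto
qed

lemma point_interior:
	obtains C \<kappa> where "0 \<le> C" "1 \<le> \<kappa>" "!!n x v. 1 \<le> n ==> rc \<le> real n ==> x \<in> L ==> harm Q v (ball x (\<kappa> * real n)) ==>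
		 (norm (v x))\<^sup>2 \<le> C / real n ^ CARD('d) * (\<Sum>l\<in>L \<inter> ball x (\<kappa> * real n). (norm (v l))\<^sup>2)"
proof -
	obtain ls :: "'d list" where ls: "set ls = UNIV" "distinct ls" using finite_distinct_list[OF finite[of "UNIV :: 'd set"]] by blast
	then have "distinct (ls @ [])" "set (ls @ []) = UNIV" by auto
	from box_interior[OF this] obtain C \<kappa> where 1: "0 \<le> C" "1 \<le> \<kappa>" and
		2: "\<forall>n x v. 1 \<le> n --> rc \<le> real n --> x \<in> L --> harm Q v (ball x (\<kappa> * real n)) -->
		 boxsum n [] (\<lambda>y. (norm (v y))\<^sup>2) x \<le> C * real n ^ length ([] :: 'd list) / real n ^ CARD('d) * (\<Sum>l\<in>L \<inter> ball x (\<kappa> * real n). (norm (v l))\<^sup>2)" by blast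
	show thesis
	proof (rule that[OF 1])
		fix n x v assume "1 \<le> n" "rc \<le> real n" "x \<in> L" "harm Q v (ball x (\<kappa> * real n))"
		then show "(norm (v x))\<^sup>2 \<le> C / real n ^ CARD('d) * (\<Sum>l\<in>L \<inter> ball x (\<kappa> * real n). (norm (v l))\<^sup>2)"
			using 2[rule_format, of n x v] by simp
	qed
qed

text \<open>Each stencil difference of \<open>u\<close> is harmonic on a slightly smaller ball, so
  the pointwise estimate applies to it. For bounded \<open>R\<close> the term at \<open>x\<close> is
  itself part of the sum on the right, and the constant absorbs R^d.\<close>

lemma gradient_interior:
	obtains C where "0 \<le> C" "!!R x u. 1 \<le> R ==> x \<in> L ==> harm Q u (ball x R) ==>
		 (dnL u x)\<^sup>2 \<le> C / R ^ CARD('d) * (\<Sum>l\<in>L \<inter> ball x R. (dnL u l)\<^sup>2)"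
proof -
	obtain C \<kappa> where C: "0 \<le> C" "1 \<le> \<kappa>" and int: "!!n x v. 1 \<le> n ==> rc \<le> real n ==> x \<in> L ==> harm Q v (ball x (\<kappa> * real n)) ==>
		 (norm (v x))\<^sup>2 \<le> C / real n ^ CARD('d) * (\<Sum>l\<in>L \<inter> ball x (\<kappa> * real n). (norm (v l))\<^sup>2)"
		using point_interior by blast
	\<comment> \<open>Beyond \<open>R0\<close> the integer part of (R - rc)/\<kappa> is at least
	  \<open>rc\<close>, at least 1, and at least R/(2 \<kappa>).\<close>
	define R0 where "R0 = 2 * (\<kappa> * (rc + 1)) + 2 * rc"
	define C2 where "C2 = R0 ^ CARD('d) + card S * (C * (2 * \<kappa>) ^ CARD('d))"
	have R01: "1 \<le> R0"
	proof -
		have "0 \<le> \<kappa> * (rc + 1)" using C rc1 by simp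
		then show ?thesis using rc1 unfolding R0_def by argo
	qed
	have main: "(dnL u x)\<^sup>2 \<le> C2 / R ^ CARD('d) * (\<Sum>l\<in>L \<inter> ball x R. (dnL u l)\<^sup>2)"
		if R: "1 \<le> R" and x: "x \<in> L" and u: "harm Q u (ball x R)" for R x u
	proof -
		define T where "T = (\<Sum>l\<in>L \<inter> ball x R. (dnL u l)\<^sup>2)"
		have T0: "0 \<le> T" unfolding T_def by (simp add: sum_nonneg)
		have Rd: "0 < R ^ CARD('d)" using R by simp
		show ?thesis
		proof (cases "R \<le> R0")
			case True
			have "(dnL u x)\<^sup>2 \<le> T" unfolding T_def using x R fin_ball by (intro member_le_sum) auto
			also have "\<dots> = R ^ CARD('d) / R ^ CARD('d) * T" using R by simp
			also have "\<dots> \<le> C2 / R ^ CARD('d) * T"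
			proof (intro mult_right_mono divide_right_mono T0)
				have "R ^ CARD('d) \<le> R0 ^ CARD('d)" using True R by (intro power_mono) auto
				also have "\<dots> \<le> C2" unfolding C2_def using C by simp
				finally show "R ^ CARD('d) \<le> C2" .
			qed (use R in simp)
			finally show ?thesis unfolding T_def .
		next
			case False
			define n where "n = nat \<lfloor>(R - rc) / \<kappa>\<rfloor>"
			have k0: "0 < \<kappa>" using C by simp
			have big: "\<kappa> * (rc + 1) \<le> R - rc"
			proof -
				have "0 \<le> \<kappa> * (rc + 1)" using C rc1 by simp
				then show ?thesis using False rc1 unfolding R0_def by argo
			qed
			then have q: "rc + 1 \<le> (R - rc) / \<kappa>" using k0 by (simp add: pos_le_divide_eq mult.commute)
			have nle: "real n \<le> (R - rc) / \<kappa>" and nge: "(R - rc) / \<kappa> - 1 \<le> real n"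
				unfolding n_def using q rc1 by linarith+
			have n1: "1 \<le> n" "rc \<le> real n" using nge q rc1 by linarith+
			have kn: "\<kappa> * real n + rc \<le> R" using nle k0 by (simp add: pos_le_divide_eq mult.commute)
			have nR: "R / (2 * \<kappa>) \<le> real n"
			proof -
				have "R / (2 * \<kappa>) \<le> (R - rc) / \<kappa> - 1"
				proof -
					have "2 * (rc + \<kappa>) \<le> R"
					proof -
						have "\<kappa> \<le> \<kappa> * (rc + 1)" using k0 rc1 by simp
						then show ?thesis using False unfolding R0_def by argo
					qed
					then show ?thesis using k0 by (simp add: field_simps)
				qed
				then show ?thesis using nge by linarith
			qed
			have nd: "1 / real n ^ CARD('d) \<le> (2 * \<kappa>) ^ CARD('d) / R ^ CARD('d)"
			proof -
				have "(R / (2 * \<kappa>)) ^ CARD('d) \<le> real n ^ CARD('d)" using nR R k0 by (intro power_mono) auto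
				then have "1 / real n ^ CARD('d) \<le> 1 / (R / (2 * \<kappa>)) ^ CARD('d)"
					using R k0 n1 by (intro divide_left_mono) (auto intro!: mult_pos_pos zero_less_power)
				then show ?thesis by (simp add: power_divide)
			qed
			have one: "(norm (u (x + \<rho>) - u x))\<^sup>2 \<le> C * (2 * \<kappa>) ^ CARD('d) / R ^ CARD('d) * T" if \<rho>: "\<rho> \<in> S" for \<rho>
			proof -
				let ?v = "\<lambda>y. u (y + \<rho>) - u y"
				have "harm Q ?v (ball x (\<kappa> * real n))" by (rule harm_diff[OF u \<rho> kn])
				from int[OF n1 x this]
				have "(norm (?v x))\<^sup>2 \<le> C * (1 / real n ^ CARD('d)) * (\<Sum>l\<in>L \<inter> ball x (\<kappa> * real n). (norm (?v l))\<^sup>2)" by simp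
				also have "\<dots> \<le> C * ((2 * \<kappa>) ^ CARD('d) / R ^ CARD('d)) * T"
				proof (intro mult_mono nd)
					have "ball x (\<kappa> * real n) \<subseteq> ball x R" using kn rc1 by (intro subset_ball) linarith
					then have "(\<Sum>l\<in>L \<inter> ball x (\<kappa> * real n). (norm (?v l))\<^sup>2) \<le> (\<Sum>l\<in>L \<inter> ball x R. (norm (?v l))\<^sup>2)"
						by (intro sum_mono2 fin_ball) auto
					also have "\<dots> \<le> T" unfolding T_def using diff_le_dn[OF _ \<rho>] by (intro sum_mono power_mono) auto
					finally show "(\<Sum>l\<in>L \<inter> ball x (\<kappa> * real n). (norm (?v l))\<^sup>2) \<le> T" .
				qed (use C R k0 in \<open>auto intro!: sum_nonneg mult_nonneg_nonneg divide_nonneg_nonneg\<close>)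
				finally show ?thesis by simp
			qed
			have "(dnL u x)\<^sup>2 = (\<Sum>\<rho>\<in>S. (norm (u (x + \<rho>) - u x))\<^sup>2)" unfolding dn_alt L2_set_def by (simp add: sum_nonneg)
			also have "\<dots> \<le> (\<Sum>\<rho>\<in>S. C * (2 * \<kappa>) ^ CARD('d) / R ^ CARD('d) * T)" using one by (intro sum_mono) auto
			also have "\<dots> = (card S * (C * (2 * \<kappa>) ^ CARD('d))) / R ^ CARD('d) * T" by simp
			also have "\<dots> \<le> C2 / R ^ CARD('d) * T"
				unfolding C2_def using T0 R R01 by (intro mult_right_mono divide_right_mono) auto
			finally show ?thesis unfolding T_def .
		qed
	qed
	have "0 \<le> C2" unfolding C2_def using C R01 by simp
	then show thesis by (rule that[OF _ main])
qed

text \<open>The energy on balls stays bounded while the factor R^(-d) tends to 0.\<close>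

lemma liouville:
	assumes u: "u \<in> W" and h: "harm Q u UNIV" and x: "x \<in> L"
	shows "dnL u x = 0"
proof -
	obtain C where C: "0 \<le> C" and g: "!!R x u. 1 \<le> R ==> x \<in> L ==> harm Q u (ball x R) ==>
		 (dnL u x)\<^sup>2 \<le> C / R ^ CARD('d) * (\<Sum>l\<in>L \<inter> ball x R. (dnL u l)\<^sup>2)" using gradient_interior by blast
	have b: "(dnL u x)\<^sup>2 \<le> C * (D u)\<^sup>2 / R" if R: "1 \<le> R" for R
	proof -
		have "(\<Sum>l\<in>L \<inter> ball x R. (dnL u l)\<^sup>2) \<le> (D u)\<^sup>2"
			unfolding Dn_def n2_sq using u fin_ball by (intro finite_sum_le_infsum) (auto simp: Wd_def l2_def)
		then have "(dnL u x)\<^sup>2 \<le> C / R ^ CARD('d) * (D u)\<^sup>2"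
			using g[OF R x harm_mono[OF h]] C R by (smt (verit) mult_left_mono divide_nonneg_nonneg zero_le_power top_greatest)
		also have "\<dots> \<le> C / R * (D u)\<^sup>2"
			using C R power_increasing[of 1 "CARD('d)" R] by (intro mult_right_mono divide_left_mono) (auto intro!: mult_pos_pos)
		finally show ?thesis by simp
	qed
	have "(dnL u x)\<^sup>2 \<le> 0"
	proof (rule tendsto_lowerbound)
		show "((\<lambda>R. C * (D u)\<^sup>2 / R) \<longlongrightarrow> 0) at_top" by (intro tendsto_divide_0[OF tendsto_const] filterlim_at_top_imp_at_infinity filterlim_ident)
		show "\<forall>\<^sub>F R in at_top. (dnL u x)\<^sup>2 \<le> C * (D u)\<^sup>2 / R" using eventually_ge_at_top[of 1] b by (rule eventually_mono)
	qed simp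
	then show ?thesis by simp
qed

end

section \<open>Density, and the decay of the Green kernel\<close>

context hom_form
begin

lemma HB_term_bound: "\<bar>Q (sdL u l) (sdL v l)\<bar> \<le> KQ * \<bar>dnL u l\<bar> * \<bar>dnL v l\<bar>"
	using Qb[of "sdL u l" "sdL v l"] by (simp add: dn_def)

lemma l2W: "u \<in> W ==> l2 L (dnL u)" by (simp add: Wd_def)

lemma HB_summable: "u \<in> W ==> v \<in> W ==> (\<lambda>l. Q (sdL u l) (sdL v l)) summable_on L"
	by (rule n2_product(1)[OF l2W l2W KQ0 HB_term_bound])

lemma HB_bound: "u \<in> W ==> v \<in> W ==> \<bar>HB Q u v\<bar> \<le> KQ * D u * D v"
	unfolding HB_def Dn_def by (rule n2_product(3)[OF l2W l2W KQ0 HB_term_bound])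

lemma HB_sym: "HB Q u v = HB Q v u"
	unfolding HB_def by (intro infsum_cong Q_sym) auto

lemma HB_lin:
	assumes "u \<in> W" "v \<in> W" "w \<in> W"
	shows "HB Q (lcomb a u b v) w = a * HB Q u w + b * HB Q v w"
proof -
	have "HB Q (lcomb a u b v) w = (\<Sum>\<^sub>\<infinity>l\<in>L. a * Q (sdL u l) (sdL w l) + b * Q (sdL v l) (sdL w l))"
		unfolding HB_def by (intro infsum_cong) (simp add: stencil_diff_lin Q_lin1)
	also have "\<dots> = a * HB Q u w + b * HB Q v w"
		using HB_summable[OF assms(1,3)] HB_summable[OF assms(2,3)] unfolding HB_def
		by (simp add: infsum_add summable_on_cmult_right infsum_cmult_right)
	finally show ?thesis .
qed

lemma HB_diff: "u \<in> W ==> v \<in> W ==> w \<in> W ==> HB Q (u .- v) w = HB Q u w - HB Q v w"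
	using HB_lin[of u v w 1 "-1"] by simp

end

text \<open>The form whose \<open>HB\<close> is the inner product behind \<open>D\<close>. Being an
  instance of \<open>hom_form\<close>, it provides Liouville's theorem for the projection in
  \<open>Fs_dense\<close>, before any stability enters.\<close>

definition Q0 :: "(real^'d) set => 'd vfun => 'd vfun => real" where
	"Q0 S g h = (\<Sum>\<rho>\<in>S. inner (g \<rho>) (h \<rho>))"

lemma Q0_self: "Q0 S g g = (nrm S g)\<^sup>2"
	unfolding Q0_def nrm_def L2_set_def by (simp add: sum_nonneg power2_norm_eq_inner)

lemma Q0_bound: "\<bar>Q0 S g h\<bar> \<le> nrm S g * nrm S h"
proof -
	have "\<bar>Q0 S g h\<bar> \<le> (\<Sum>\<rho>\<in>S. \<bar>norm (g \<rho>)\<bar> * \<bar>norm (h \<rho>)\<bar>)"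
		unfolding Q0_def by (rule order_trans[OF sum_abs], rule sum_mono) (simp add: Cauchy_Schwarz_ineq2)
	also have "\<dots> \<le> nrm S g * nrm S h" unfolding nrm_def by (rule L2_set_mult_ineq)
	finally show ?thesis .
qed

lemma Q0_form2: "form2 S (Q0 S)"
	unfolding form2_def form1_def Q0_def
	by (simp add: inner_right_distrib sum.distrib sum_distrib_left inner_commute)

context hom_lattice
begin

lemma HB_Q0: "HB (Q0 S) v v = (D v)\<^sup>2"
	unfolding HB_def Q0_self Dn_def n2_sq dn_def ..

lemma Q0_hom_form: "hom_form A S (Q0 S) 1 1"
	by unfold_locales (auto simp: Q0_form2 Q0_bound HB_Q0)

text \<open>The orthogonal projection of \<open>u\<close> onto the closure of the finitely supported functions differs
	from \<open>u\<close> by a function of finite energy that is harmonic everywhere.\<close>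

lemma Fs_dense:
	assumes u: "u \<in> W" and \<epsilon>: "0 < \<epsilon>"
	shows "\<exists>v\<in>Fs. D (u .- v) < \<epsilon>"
proof -
	interpret id: hom_form A S "Q0 S" 1 1 by (rule Q0_hom_form)
	define N where "N = {w \<in> W. \<forall>\<epsilon>>0. \<exists>v\<in>Fs. D (w .- v) < \<epsilon>}"
	have NI: "Fs \<subseteq> N"
	proof
		fix v assume v: "v \<in> Fs"
		have "D (v .- v) = 0" by simp
		then show "v \<in> N" unfolding N_def using v Fs_W by (auto intro!: bexI[of _ v])
	qed
	have Nlin: "(lcomb a v b w) \<in> N" if v: "v \<in> N" and w: "w \<in> N" for v w a b
		unfolding N_def
	proof (intro CollectI conjI allI impI)
		show "(lcomb a v b w) \<in> W" using v w by (intro sn.lin) (auto simp: N_def)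
		fix \<epsilon> :: real assume \<epsilon>: "0 < \<epsilon>"
		define \<delta> where "\<delta> = \<epsilon> / (\<bar>a\<bar> + \<bar>b\<bar> + 1)"
		have \<delta>: "0 < \<delta>" using \<epsilon> by (simp add: \<delta>_def add_nonneg_pos)
		obtain v' where v': "v' \<in> Fs" "D (v .- v') < \<delta>" using v \<delta> unfolding N_def by blast
		obtain w' where w': "w' \<in> Fs" "D (w .- w') < \<delta>" using w \<delta> unfolding N_def by blast
		have W: "v \<in> W" "w \<in> W" "v' \<in> W" "w' \<in> W" using v w v' w' Fs_W by (auto simp: N_def)
		have "D (\<lambda>x. a *\<^sub>R (v x - v' x) + b *\<^sub>R (w x - w' x)) \<le> \<bar>a\<bar> * D (v .- v') + \<bar>b\<bar> * D (w .- w')"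
			using W by (intro Wd_lin(2) sn.diff)
		also have "\<dots> \<le> \<bar>a\<bar> * \<delta> + \<bar>b\<bar> * \<delta>" using v' w' by (intro add_mono mult_left_mono) auto
		also have "\<dots> < (\<bar>a\<bar> + \<bar>b\<bar> + 1) * \<delta>" using \<delta> by (simp add: algebra_simps)
		also have "\<dots> = \<epsilon>"
		proof -
			have "0 < \<bar>a\<bar> + \<bar>b\<bar> + 1" by linarith
			then show ?thesis by (simp add: \<delta>_def)
		qed
		finally have "D (\<lambda>x. (a *\<^sub>R v x + b *\<^sub>R w x) - (a *\<^sub>R v' x + b *\<^sub>R w' x)) < \<epsilon>" by (simp add: algebra_simps)
		then show "\<exists>y\<in>Fs. D (\<lambda>x. (a *\<^sub>R v x + b *\<^sub>R w x) - y x) < \<epsilon>"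
			by (intro bexI[of _ "\<lambda>x. a *\<^sub>R v' x + b *\<^sub>R w' x"] Fs_lin v'(1) w'(1))
	qed
	have Ncl: "y \<in> N" if X: "!!n. X n \<in> N" and y: "y \<in> W" and lim: "(\<lambda>n. D (X n .- y)) \<longlonglongrightarrow> 0" for X :: "nat => _" and y
		unfolding N_def
	proof (intro CollectI conjI allI impI y)
		fix \<epsilon> :: real assume "0 < \<epsilon>"
		then have e2: "0 < \<epsilon> / 2" by simp
		from LIMSEQ_D[OF lim this] obtain n where n: "D (X n .- y) < \<epsilon> / 2" by auto
		obtain v where v: "v \<in> Fs" "D (X n .- v) < \<epsilon> / 2" using X[of n] e2 unfolding N_def by blast
		have W: "X n \<in> W" "v \<in> W" using X[of n] v Fs_W by (auto simp: N_def)
		have "D (\<lambda>x. (X n x - v x) - (X n x - y x)) \<le> D (X n .- v) + D (X n .- y)"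
			using W y by (intro Wd_diff(2) sn.diff)
		then have "D (y .- v) < \<epsilon>" using n v by simp
		then show "\<exists>v\<in>Fs. D (y .- v) < \<epsilon>" by (intro bexI[of _ v] v(1))
	qed
	have "\<exists>w\<in>N. (\<forall>\<phi>\<in>N. HB (Q0 S) w \<phi> = HB (Q0 S) u \<phi>) \<and> 1 * D w \<le> D u"
	proof (rule riesz[where KB=1])
		show "N \<subseteq> W" by (auto simp: N_def)
		show "zf \<in> N" using NI by (auto simp: Fs_def)
		show "HB (Q0 S) (lcomb a u b v) w = a * HB (Q0 S) u w + b * HB (Q0 S) v w"
			if "u \<in> W" "v \<in> W" "w \<in> W" for u v w a b using id.HB_lin[OF that] .
		show "HB (Q0 S) u v = HB (Q0 S) v u" for u v by (rule id.HB_sym)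
		show "\<bar>HB (Q0 S) u v\<bar> \<le> 1 * D u * D v" if "u \<in> W" "v \<in> W" for u v using id.HB_bound[OF that] .
		show "1 * (D v)\<^sup>2 \<le> HB (Q0 S) v v" for v by (simp add: HB_Q0)
		show "HB (Q0 S) u (lcomb a v b w) = a * HB (Q0 S) u v + b * HB (Q0 S) u w"
			if "v \<in> W" "w \<in> W" for v w a b using id.HB_lin[OF that u, of a b] by (simp add: id.HB_sym[of u])
		show "\<bar>HB (Q0 S) u v\<bar> \<le> D u * D v" if "v \<in> W" for v using id.HB_bound[OF u that] by simp
		show "y \<in> N" if "!!n. X n \<in> N" "y \<in> W" "(\<lambda>n. D (X n .- y)) \<longlonglongrightarrow> 0" for X :: "nat => _" and y
			by (rule Ncl[OF that])
		show "(lcomb a v b w) \<in> N" if "v \<in> N" "w \<in> N" for v w a b by (rule Nlin[OF that])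
	qed auto
	then obtain w where w: "w \<in> N" "!!\<phi>. \<phi> \<in> N ==> HB (Q0 S) w \<phi> = HB (Q0 S) u \<phi>" by blast
	have wW: "w \<in> W" using w by (simp add: N_def)
	have hW: "(u .- w) \<in> W" using u wW by (rule sn.diff)
	have "harm (Q0 S) (u .- w) UNIV"
		unfolding harm_def
	proof (intro ballI impI)
		fix \<phi> assume "\<phi> \<in> Fs"
		then have "\<phi> \<in> N" "\<phi> \<in> W" using NI Fs_W by auto
		then show "HB (Q0 S) (u .- w) \<phi> = 0" using id.HB_diff[OF u wW] w(2) by simp
	qed
	then have "dnL (u .- w) l = 0" if "l \<in> L" for l using id.liouville[OF hW _ that] by blast
	then have "D (u .- w) = 0" unfolding Dn_def n2_def by (simp add: infsum_0)
	moreover obtain v where v: "v \<in> Fs" "D (w .- v) < \<epsilon>" using w(1) \<epsilon> unfolding N_def by blast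
	moreover have "D (\<lambda>x. (u x - w x) + (w x - v x)) \<le> D (u .- w) + D (w .- v)"
		using v Fs_W by (intro Wd_add(2) hW sn.diff wW) auto
	ultimately show ?thesis by (intro bexI[of _ v]) auto
qed

lemma dn_shift: "dnL (\<lambda>x. u (x + a)) l = dnL u (l + a)"
	unfolding dn_def sdL_shift[of u a] ..

lemma W_shift:
	assumes "a \<in> L" "u \<in> W"
	shows "(\<lambda>x. u (x + a)) \<in> W" "D (\<lambda>x. u (x + a)) = D u"
proof -
	have "(\<lambda>l. (dnL u (l + a))\<^sup>2) summable_on L \<longleftrightarrow> (\<lambda>l. (dnL u l)\<^sup>2) summable_on L"
		by (rule summable_on_reindex_bij_betw[OF bij_shift[OF assms(1)], where f="\<lambda>l. (dnL u l)\<^sup>2"])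
	moreover have "(\<lambda>l. (dnL (\<lambda>x. u (x + a)) l)\<^sup>2) = (\<lambda>l. (dnL u (l + a))\<^sup>2)" unfolding dn_shift[of u a] ..
	ultimately show "(\<lambda>x. u (x + a)) \<in> W" using assms(2) by (simp only: Wd_def l2_def mem_Collect_eq)
	have "(\<Sum>\<^sub>\<infinity>l\<in>L. (dnL u (l + a))\<^sup>2) = (\<Sum>\<^sub>\<infinity>l\<in>L. (dnL u l)\<^sup>2)"
		by (rule infsum_reindex_bij_betw[OF bij_shift[OF assms(1)], where f="\<lambda>l. (dnL u l)\<^sup>2"])
	then show "D (\<lambda>x. u (x + a)) = D u" unfolding Dn_def n2_def dn_shift[of u a] by simp
qed

text \<open>Dyadic shells: the shell at radius 2^j R has at most a multiple of (2^j R)^d sites and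
  terms of size K^2 (2^j R)^(-2d), which leaves a series dominated by a geometric one, with sum of
  order K^2 R^(-d).\<close>

lemma tail_sum:
	obtains C where "0 \<le> C" "!!R K f. 1 \<le> R ==> 0 \<le> K ==> (!!l. l \<in> L - ball 0 R ==> \<bar>f l\<bar> \<le> K / norm l ^ CARD('d)) ==>
		 l2 (L - ball 0 R) f \<and> (n2 (L - ball 0 R) f)\<^sup>2 \<le> C * K\<^sup>2 / R ^ CARD('d)"
proof -
	obtain C1 where C1: "0 \<le> C1" "!!r. 1 \<le> r ==> real (card (L \<inter> ball 0 r)) \<le> C1 * r ^ CARD('d)" "!!r. finite (L \<inter> ball 0 r)" by (rule L_count) (rule that, assumption+)
	define C where "C = 2 * C1 * 2 ^ CARD('d)"
	have C0: "0 \<le> C" using C1 by (simp add: C_def)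
	have main: "l2 (L - ball 0 R) f \<and> (n2 (L - ball 0 R) f)\<^sup>2 \<le> C * K\<^sup>2 / R ^ CARD('d)"
		if R: "1 \<le> R" and K: "0 \<le> K" and f: "!!l. l \<in> L - ball 0 R ==> \<bar>f l\<bar> \<le> K / norm l ^ CARD('d)" for R K f
	proof -
		define Z where "Z = C1 * 2 ^ CARD('d) * K\<^sup>2 / R ^ CARD('d)"
		have Z0: "0 \<le> Z" unfolding Z_def using C1 R by simp
		have shells: "(\<Sum>l\<in>L \<inter> ball 0 (2 ^ J * R) - ball 0 R. (f l)\<^sup>2) \<le> Z * (\<Sum>j<J. (1/2) ^ j)" for J
		proof (induction J)
			case 0
			have e: "L \<inter> ball 0 (2 ^ 0 * R) - ball 0 R = {}" by auto
			show ?case unfolding e by simp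
		next
			case (Suc J)
			define X where "X = L \<inter> ball 0 (2 ^ J * R) - ball 0 R"
			define Y where "Y = L \<inter> ball 0 (2 ^ Suc J * R) - ball 0 (2 ^ J * R)"
			have R2: "R \<le> 2 ^ J * R" using R by simp
			have fin: "finite X" "finite Y" unfolding X_def Y_def using fin_ball by auto
			have "L \<inter> ball 0 (2 ^ Suc J * R) - ball 0 R \<subseteq> X \<union> Y" unfolding X_def Y_def by auto
			then have "(\<Sum>l\<in>L \<inter> ball 0 (2 ^ Suc J * R) - ball 0 R. (f l)\<^sup>2) \<le> (\<Sum>l\<in>X \<union> Y. (f l)\<^sup>2)"
				using fin by (intro sum_mono2) auto
			also have "\<dots> = (\<Sum>l\<in>X. (f l)\<^sup>2) + (\<Sum>l\<in>Y. (f l)\<^sup>2)"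
				using fin by (intro sum.union_disjoint) (auto simp: X_def Y_def)
			also have "(\<Sum>l\<in>Y. (f l)\<^sup>2) \<le> Z * (1/2) ^ J"
			proof -
				let ?r = "2 ^ J * R"
				have r1: "1 \<le> ?r" using R2 R by linarith
				have "(f l)\<^sup>2 \<le> (K / ?r ^ CARD('d))\<^sup>2" if l: "l \<in> Y" for l
				proof -
					have nl: "?r \<le> norm l" using l by (auto simp: Y_def)
					have "\<bar>f l\<bar> \<le> K / norm l ^ CARD('d)" using l R2 by (intro f) (auto simp: Y_def)
					also have "\<dots> \<le> K / ?r ^ CARD('d)"
						using nl r1 K R by (intro divide_left_mono power_mono) (auto intro!: mult_pos_pos zero_less_power)
					finally have "\<bar>f l\<bar>\<^sup>2 \<le> (K / ?r ^ CARD('d))\<^sup>2" by (rule power_mono) simp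
					then show ?thesis by simp
				qed
				then have "(\<Sum>l\<in>Y. (f l)\<^sup>2) \<le> card Y * (K / ?r ^ CARD('d))\<^sup>2" by (intro sum_bounded_above) auto
				also have "\<dots> \<le> (C1 * (2 * ?r) ^ CARD('d)) * (K / ?r ^ CARD('d))\<^sup>2"
				proof (rule mult_right_mono)
					have "real (card Y) \<le> real (card (L \<inter> ball 0 (2 * ?r)))"
						unfolding Y_def using fin_ball by (intro of_nat_mono card_mono) (auto simp: mult.assoc)
					also have "\<dots> \<le> C1 * (2 * ?r) ^ CARD('d)" using r1 by (intro C1) linarith
					finally show "real (card Y) \<le> C1 * (2 * ?r) ^ CARD('d)" .
				qed simp
				also have "\<dots> = C1 * 2 ^ CARD('d) * K\<^sup>2 / ?r ^ CARD('d)"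
					using R by (simp add: power_mult_distrib power2_eq_square)
				also have "\<dots> = Z * (1 / (2 ^ J) ^ CARD('d))" unfolding Z_def by (simp add: power_mult_distrib)
				also have "\<dots> \<le> Z * (1 / (2 ^ J))"
					using Z0 power_increasing[of 1 "CARD('d)" "2 ^ J :: real"] by (intro mult_left_mono divide_left_mono) auto
				finally show ?thesis by (simp add: power_one_over)
			qed
			finally show ?case using Suc unfolding X_def by (simp add: distrib_left)
		qed
		have geo: "(\<Sum>j<J. (1/2::real) ^ j) \<le> 2" for J by (simp add: geometric_sum)
		have bd: "(\<Sum>l\<in>F. (f l)\<^sup>2) \<le> 2 * Z" if F: "finite F" "F \<subseteq> L - ball 0 R" for F
		proof -
			obtain J :: nat where J: "(\<Sum>l\<in>F. norm l) + 1 < 2 ^ J" using real_arch_pow[of 2] by auto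
			have "F \<subseteq> L \<inter> ball 0 (2 ^ J * R) - ball 0 R"
			proof
				fix l assume l: "l \<in> F"
				have "norm l \<le> (\<Sum>l\<in>F. norm l)" using l F by (intro member_le_sum) auto
				also have "\<dots> < 2 ^ J * 1" using J by simp
				also have "\<dots> \<le> 2 ^ J * R" using R by (intro mult_left_mono) auto
				finally show "l \<in> L \<inter> ball 0 (2 ^ J * R) - ball 0 R" using l F by auto
			qed
			then have "(\<Sum>l\<in>F. (f l)\<^sup>2) \<le> (\<Sum>l\<in>L \<inter> ball 0 (2 ^ J * R) - ball 0 R. (f l)\<^sup>2)"
				by (intro sum_mono2) (auto simp: fin_ball)
			also have "\<dots> \<le> Z * (\<Sum>j<J. (1/2) ^ j)" by (rule shells)
			also have "\<dots> \<le> Z * 2" using geo Z0 by (rule mult_left_mono)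
			finally show ?thesis by simp
		qed
		have s: "l2 (L - ball 0 R) f" unfolding l2_def
			by (rule nonneg_bdd_above_summable_on) (auto intro!: bdd_aboveI2[where M="2 * Z"] bd)
		moreover have "(n2 (L - ball 0 R) f)\<^sup>2 \<le> 2 * Z"
			unfolding n2_sq using s bd by (intro infsum_le_finite_sums) (auto simp: l2_def)
		ultimately show ?thesis unfolding C_def Z_def by simp
	qed
	show thesis by (rule that[OF C0 main])
qed

end

section \<open>The kernel and the decay of its gradient\<close>

context hom_form
begin

text \<open>\<open>hom_form\<close> has coercivity on \<open>Fs\<close>; density and continuity of
  the form extend it to the complete space on which \<open>riesz\<close> can be applied.\<close>

lemma coercive_W:
	assumes v: "v \<in> W"
	shows "c * (D v)\<^sup>2 \<le> HB Q v v"
proof -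
	have "\<exists>w\<in>Fs. D (v .- w) < 1 / real (Suc n)" for n by (rule Fs_dense[OF v]) simp
	then obtain X where X: "!!n. X n \<in> Fs" "!!n. D (v .- X n) < 1 / real (Suc n)" by metis
	have XW: "X n \<in> W" for n using X(1) Fs_W by blast
	let ?d = "\<lambda>n. D (v .- X n)"
	have dW: "(v .- X n) \<in> W" for n by (rule sn.diff[OF v XW])
	have d0: "?d \<longlonglongrightarrow> 0"
	proof (rule tendsto_sandwich[of "\<lambda>_. 0" _ _ "\<lambda>n. 1 / real (Suc n)"])
		show "(\<lambda>n. 1 / real (Suc n)) \<longlonglongrightarrow> 0" by (rule LIMSEQ_Suc[OF lim_1_over_n])
	qed (use X(2) in \<open>auto intro!: always_eventually less_imp_le\<close>)
	have dist: "\<bar>D (X n) - D v\<bar> \<le> ?d n" for n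
		using Wd_diff(2)[OF v dW, of n] Wd_add(2)[OF XW dW, of n n] by (simp add: abs_le_iff)
	have "(\<lambda>n. D (X n) - D v) \<longlonglongrightarrow> 0"
		by (rule Lim_null_comparison[OF _ d0]) (use dist in auto)
	then have lD: "(\<lambda>n. D (X n)) \<longlonglongrightarrow> D v" by (rule LIM_zero_cancel)
	have "(\<lambda>n. HB Q (X n) (X n) - HB Q v v) \<longlonglongrightarrow> 0"
	proof (rule Lim_null_comparison)
		show "(\<lambda>n. KQ * ?d n * D (X n) + KQ * ?d n * D v) \<longlonglongrightarrow> 0"
			by (rule tendsto_eq_intros d0 lD refl)+ simp
		have "norm (HB Q (X n) (X n) - HB Q v v) \<le> KQ * ?d n * D (X n) + KQ * ?d n * D v" for n
		proof -
			have 1: "HB Q (v .- X n) (X n) = HB Q v (X n) - HB Q (X n) (X n)" by (rule HB_diff[OF v XW XW])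
			have 2: "HB Q (v .- X n) v = HB Q v v - HB Q (X n) v" by (rule HB_diff[OF v XW v])
			have "HB Q v v - HB Q (X n) (X n) = HB Q (v .- X n) (X n) + HB Q (v .- X n) v"
				using 1 2 HB_sym[of v "X n"] by simp
			then show ?thesis using HB_bound[OF dW XW, of n n] HB_bound[OF dW v, of n] by (simp add: abs_le_iff)
		qed
		then show "\<forall>\<^sub>F n in sequentially. norm (HB Q (X n) (X n) - HB Q v v) \<le> KQ * ?d n * D (X n) + KQ * ?d n * D v" by simp
	qed
	then have "(\<lambda>n. HB Q (X n) (X n)) \<longlonglongrightarrow> HB Q v v" by (rule LIM_zero_cancel)
	moreover have "(\<lambda>n. c * (D (X n))\<^sup>2) \<longlonglongrightarrow> c * (D v)\<^sup>2" by (intro tendsto_intros lD)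
	ultimately show ?thesis using co[OF X(1)] by (intro LIMSEQ_le) auto
qed

lemma riesz_W:
	assumes "!!u v a b. u \<in> W ==> v \<in> W ==> F (lcomb a u b v) = a * F u + b * F v"
		and "0 \<le> \<tau>" "!!v. v \<in> W ==> \<bar>F v\<bar> \<le> \<tau> * D v"
	shows "\<exists>w\<in>W. (\<forall>\<phi>\<in>W. HB Q w \<phi> = F \<phi>) \<and> c * D w \<le> \<tau>"
proof (rule riesz[where KB=KQ])
	show "HB Q (lcomb a u b v) w = a * HB Q u w + b * HB Q v w"
		if "u \<in> W" "v \<in> W" "w \<in> W" for u v w a b using HB_lin[OF that] .
	show "HB Q u v = HB Q v u" for u v by (rule HB_sym)
	show "\<bar>HB Q u v\<bar> \<le> KQ * D u * D v" if "u \<in> W" "v \<in> W" for u v using HB_bound[OF that] .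
	show "c * (D v)\<^sup>2 \<le> HB Q v v" if "v \<in> W" for v using coercive_W[OF that] .
qed (use assms c0 sn.lin in auto)

text \<open>The tail of the kernel \<open>w\<close> is estimated by duality: the solution \<open>z\<close> driven by that tail is
	harmonic near the origin, where the interior estimate applies.\<close>

lemma kernel_tail:
	obtains C where "0 \<le> C" "!!w \<sigma> j R. w \<in> W ==> \<sigma> \<in> S ==> (!!\<phi>. \<phi> \<in> W ==> HB Q w \<phi> = (\<phi> \<sigma> - \<phi> 0) $ j) ==> rc + 1 \<le> R ==>
		(n2 (L - ball 0 R) (dnL w))\<^sup>2 \<le> C / (R - rc) ^ CARD('d)"
proof -
	obtain C where C: "0 \<le> C" and g: "!!R x u. 1 \<le> R ==> x \<in> L ==> harm Q u (ball x R) ==>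
		 (dnL u x)\<^sup>2 \<le> C / R ^ CARD('d) * (\<Sum>l\<in>L \<inter> ball x R. (dnL u l)\<^sup>2)" using gradient_interior by blast
	have main: "(n2 (L - ball 0 R) (dnL w))\<^sup>2 \<le> (C / c\<^sup>2) / (R - rc) ^ CARD('d)"
		if w: "w \<in> W" and \<sigma>: "\<sigma> \<in> S" and eq: "!!\<phi>. \<phi> \<in> W ==> HB Q w \<phi> = (\<phi> \<sigma> - \<phi> 0) $ j" and R: "rc + 1 \<le> R" for w \<sigma> j R
	proof -
		define X where "X = L - ball 0 R"
		define T where "T = n2 X (dnL w)"
		\<comment> \<open>The functional dual to the tail of \<open>w\<close>: its norm is at most
		  \<open>T\<close>, and its value at \<open>w\<close> is T^2.\<close>
		define F where "F \<phi> = (\<Sum>\<^sub>\<infinity>l\<in>X. Q0 S (sdL w l) (sdL \<phi> l))" for \<phi>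
		have XL: "X \<subseteq> L" by (auto simp: X_def)
		have lX: "l2 X (dnL v)" "n2 X (dnL v) \<le> D v" if "v \<in> W" for v
			using l2_subset[OF l2W[OF that] XL] by (auto simp: Dn_def)
		have tb: "\<bar>Q0 S (sdL w l) (sdL \<phi> l)\<bar> \<le> 1 * \<bar>dnL w l\<bar> * \<bar>dnL \<phi> l\<bar>" for \<phi> l
			using Q0_bound[of S "sdL w l" "sdL \<phi> l"] by (simp add: dn_def)
		have sF: "(\<lambda>l. Q0 S (sdL w l) (sdL \<phi> l)) summable_on X" if "\<phi> \<in> W" for \<phi>
			by (rule n2_product(1)[OF lX(1)[OF w] lX(1)[OF that] zero_le_one tb])
		have Flin: "F (lcomb a u b v) = a * F u + b * F v" if "u \<in> W" "v \<in> W" for u v a b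
		proof -
			have "F (lcomb a u b v) = (\<Sum>\<^sub>\<infinity>l\<in>X. a * Q0 S (sdL w l) (sdL u l) + b * Q0 S (sdL w l) (sdL v l))"
				unfolding F_def stencil_diff_lin by (simp add: Q0_def inner_right_distrib sum.distrib sum_distrib_left)
			also have "\<dots> = a * F u + b * F v"
				using sF[OF that(1)] sF[OF that(2)] unfolding F_def
				by (simp add: infsum_add summable_on_cmult_right infsum_cmult_right)
			finally show ?thesis .
		qed
		have Fbd: "\<bar>F \<phi>\<bar> \<le> T * D \<phi>" if "\<phi> \<in> W" for \<phi>
		proof -
			have "\<bar>F \<phi>\<bar> \<le> 1 * n2 X (dnL w) * n2 X (dnL \<phi>)"
				unfolding F_def by (rule n2_product(3)[OF lX(1)[OF w] lX(1)[OF that] zero_le_one tb])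
			also have "\<dots> \<le> T * D \<phi>" unfolding T_def using lX(2)[OF that] by (simp add: mult_left_mono)
			finally show ?thesis .
		qed
		have T0: "0 \<le> T" by (simp add: T_def)
		obtain z where z: "z \<in> W" "!!\<phi>. \<phi> \<in> W ==> HB Q z \<phi> = F \<phi>" "c * D z \<le> T"
			using riesz_W[OF Flin T0 Fbd] by blast
		\<comment> \<open>Symmetry of the form turns the tail energy of \<open>w\<close> into a difference
		  of \<open>z\<close> at the origin; bounding that by the interior estimate and
		  \<open>c * D z \<le> T\<close> gives T^4 bounded by a multiple of T^2, from which T^2 is
		  cancelled.\<close>
		have "T\<^sup>2 = F w" unfolding F_def Q0_self T_def n2_sq dn_def ..
		also have "\<dots> = HB Q w z" using z(2)[OF w] HB_sym[of w z] by simp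
		also have "\<dots> = (z \<sigma> - z 0) $ j" by (rule eq[OF z(1)])
		also have "\<dots> \<le> norm (z \<sigma> - z 0)" using component_le_norm_cart[of "z \<sigma> - z 0" j] by linarith
		also have "\<dots> \<le> dnL z 0" using diff_le_dn[OF L_zero \<sigma>, of z] by simp
		finally have T2: "T\<^sup>2 \<le> dnL z 0" .
		have hz: "harm Q z (ball 0 (R - rc))"
			unfolding harm_def
		proof (intro ballI impI)
			fix \<phi> assume \<phi>: "\<phi> \<in> Fs" and s: "{l\<in>L. \<phi> l \<noteq> 0} \<subseteq> ball 0 (R - rc)"
			have "sdL \<phi> l = zf" if l: "l \<in> X" for l
			proof (rule sdL_zero)
				fix \<rho> assume \<rho>: "\<rho> \<in> insert 0 S"
				have "l + \<rho> \<in> L" using l \<rho> L_S by (auto simp: X_def)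
				moreover have "R - rc \<le> norm (l + \<rho>)"
				proof -
					have "norm \<rho> \<le> rc" using rc rc1 \<rho> by auto
					moreover have "R \<le> norm l" using l by (auto simp: X_def)
					ultimately show ?thesis using norm_diff_ineq[of l \<rho>] by linarith
				qed
				ultimately show "\<phi> (l + \<rho>) = 0" using s by force
			qed
			then have "F \<phi> = (\<Sum>\<^sub>\<infinity>l\<in>X. 0)" unfolding F_def by (intro infsum_cong) (simp add: Q0_def)
			then show "HB Q z \<phi> = 0" using z(2) \<phi> Fs_W by auto
		qed
		have R1: "1 \<le> R - rc" using R by simp
		have "(T\<^sup>2)\<^sup>2 \<le> (dnL z 0)\<^sup>2" using T2 by (intro power_mono) auto
		also have "\<dots> \<le> C / (R - rc) ^ CARD('d) * (\<Sum>l\<in>L \<inter> ball 0 (R - rc). (dnL z l)\<^sup>2)" by (rule g[OF R1 L_zero hz])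
		also have "\<dots> \<le> C / (R - rc) ^ CARD('d) * (D z)\<^sup>2"
		proof (rule mult_left_mono)
			show "(\<Sum>l\<in>L \<inter> ball 0 (R - rc). (dnL z l)\<^sup>2) \<le> (D z)\<^sup>2"
				unfolding Dn_def n2_sq using z(1) fin_ball by (intro finite_sum_le_infsum) (auto simp: Wd_def l2_def)
		qed (use C R1 in simp)
		also have "\<dots> \<le> C / (R - rc) ^ CARD('d) * (T / c)\<^sup>2"
			using z(3) c0 C R1 by (intro mult_left_mono power_mono) (auto simp: pos_le_divide_eq mult.commute)
		finally have "T\<^sup>2 * T\<^sup>2 \<le> (C / c\<^sup>2 / (R - rc) ^ CARD('d)) * T\<^sup>2" by (simp add: power2_eq_square power_divide mult_ac)
		then have "T\<^sup>2 \<le> C / c\<^sup>2 / (R - rc) ^ CARD('d)" if "T \<noteq> 0"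
			by (rule mult_right_le_imp_le) (use that in simp)
		moreover have "T\<^sup>2 \<le> C / c\<^sup>2 / (R - rc) ^ CARD('d)" if "T = 0" using that C R1 by simp
		ultimately show ?thesis unfolding T_def X_def by blast
	qed
	have "0 \<le> C / c\<^sup>2" using C by simp
	from that[OF this main] show thesis .
qed

text \<open>\<open>w\<close> is a difference of the Green kernel, harmonic away from 0 and \<sigma>.
  On the ball of radius |m|/2 around \<open>m\<close> the interior estimate and the tail bound
  contribute a factor |m|^(-d/2) each.\<close>

lemma kernel_at_zero:
	assumes \<sigma>: "\<sigma> \<in> S"
	shows "\<exists>C w. 0 \<le> C \<and> w \<in> W \<and> (\<forall>\<phi>\<in>W. HB Q w \<phi> = (\<phi> \<sigma> - \<phi> 0) $ j) \<and> D w \<le> C \<and> (\<forall>m\<in>L. dnL w m \<le> C / (1 + norm m) ^ CARD('d))"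
proof -
	have \<sigma>L: "\<sigma> \<in> L" using \<sigma> SL by blast
	have bd: "\<bar>(v \<sigma> - v 0) $ j\<bar> \<le> 1 * D v" if "v \<in> W" for v
	proof -
		have "\<bar>(v \<sigma> - v 0) $ j\<bar> \<le> norm (v \<sigma> - v 0)" by (rule component_le_norm_cart)
		also have "\<dots> \<le> dnL v 0" using diff_le_dn[OF L_zero \<sigma>, of v] by simp
		also have "\<dots> \<le> D v" by (rule dn_le_Dn[OF that L_zero])
		finally show ?thesis by simp
	qed
	obtain w where w: "w \<in> W" "!!\<phi>. \<phi> \<in> W ==> HB Q w \<phi> = (\<phi> \<sigma> - \<phi> 0) $ j"
		using riesz_W[of "\<lambda>v. (v \<sigma> - v 0) $ j" 1] bd by (auto simp: algebra_simps)
	obtain C1 where C1: "0 \<le> C1" and g: "!!R x u. 1 \<le> R ==> x \<in> L ==> harm Q u (ball x R) ==>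
		 (dnL u x)\<^sup>2 \<le> C1 / R ^ CARD('d) * (\<Sum>l\<in>L \<inter> ball x R. (dnL u l)\<^sup>2)" using gradient_interior by blast
	obtain C2 where C2: "0 \<le> C2" and t: "!!w \<sigma> j R. w \<in> W ==> \<sigma> \<in> S ==> (!!\<phi>. \<phi> \<in> W ==> HB Q w \<phi> = (\<phi> \<sigma> - \<phi> 0) $ j) ==> rc + 1 \<le> R ==>
		(n2 (L - ball 0 R) (dnL w))\<^sup>2 \<le> C2 / (R - rc) ^ CARD('d)" using kernel_tail by blast
	\<comment> \<open>For |m| > M0 the radius r = |m|/2 is at least 2 rc + 2: the ball around
	  \<open>m\<close> avoids 0 and \<sigma>, and r - rc \<ge> r/2.\<close>
	define M0 where "M0 = 4 * rc + 4"
	define C where "C = D w * (1 + M0) ^ CARD('d) + sqrt (C1 * C2) * 8 ^ CARD('d)"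
	have M0: "1 \<le> M0" using rc1 by (simp add: M0_def)
	have C0: "0 \<le> C" unfolding C_def using M0 C1 C2 by simp
	have "dnL w m \<le> C / (1 + norm m) ^ CARD('d)" if m: "m \<in> L" for m
	proof -
		have pos: "0 < (1 + norm m) ^ CARD('d)" by (intro zero_less_power add_pos_nonneg) auto
		show ?thesis
		proof (cases "norm m \<le> M0")
			case True
			have "dnL w m * (1 + norm m) ^ CARD('d) \<le> D w * (1 + M0) ^ CARD('d)"
				using True M0 dn_le_Dn[OF w(1) m] by (intro mult_mono power_mono) auto
			also have "\<dots> \<le> C" unfolding C_def using C1 C2 by simp
			finally show ?thesis using pos by (simp add: pos_le_divide_eq)
		next
			case False
			define r where "r = norm m / 2"
			have r: "2 * rc + 2 \<le> r" using False by (simp add: r_def M0_def)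
			have hw: "harm Q w (ball m r)"
				unfolding harm_def
			proof (intro ballI impI)
				fix \<phi> assume \<phi>: "\<phi> \<in> Fs" and s: "{l\<in>L. \<phi> l \<noteq> 0} \<subseteq> ball m r"
				have "\<not> dist m 0 < r" using r rc1 by (simp add: r_def)
				then have "0 \<notin> ball m r" by simp
				then have "\<phi> 0 = 0" using s L_zero by blast
				moreover have "\<not> dist m \<sigma> < r"
				proof -
					have "norm m \<le> dist m \<sigma> + norm \<sigma>" using norm_triangle_ineq[of "m - \<sigma>" \<sigma>] by (simp add: dist_norm)
					then show ?thesis using rc[OF \<sigma>] r rc1 unfolding r_def by linarith
				qed
				then have "\<sigma> \<notin> ball m r" by simp
				then have "\<phi> \<sigma> = 0" using s \<sigma>L by blast
				ultimately show "HB Q w \<phi> = 0" using w(2) \<phi> Fs_W by auto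
			qed
			have "L \<inter> ball m r \<subseteq> L - ball 0 r"
			proof
				fix l assume l: "l \<in> L \<inter> ball m r"
				have "norm m \<le> dist m l + norm l" using norm_triangle_ineq[of "m - l" l] by (simp add: dist_norm)
				then show "l \<in> L - ball 0 r" using l by (auto simp: r_def)
			qed
			then have "(\<Sum>l\<in>L \<inter> ball m r. (dnL w l)\<^sup>2) \<le> (n2 (L - ball 0 r) (dnL w))\<^sup>2"
				unfolding n2_sq using l2_subset(1)[OF l2W[OF w(1)], of "L - ball 0 r"] fin_ball
				by (intro finite_sum_le_infsum) (auto simp: l2_def)
			also have "\<dots> \<le> C2 / (r - rc) ^ CARD('d)" using r rc1 by (intro t[OF w(1) \<sigma> w(2)]) auto
			also have "\<dots> \<le> C2 / (r / 2) ^ CARD('d)"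
				using r rc1 C2 by (intro divide_left_mono power_mono) (auto intro!: mult_pos_pos zero_less_power)
			finally have s2: "(\<Sum>l\<in>L \<inter> ball m r. (dnL w l)\<^sup>2) \<le> C2 / (r / 2) ^ CARD('d)" .
			have r1: "1 \<le> r" using r rc1 by linarith
			have "(dnL w m)\<^sup>2 \<le> C1 / r ^ CARD('d) * (\<Sum>l\<in>L \<inter> ball m r. (dnL w l)\<^sup>2)" by (rule g[OF r1 m hw])
			also have "\<dots> \<le> C1 / r ^ CARD('d) * (C2 / (r / 2) ^ CARD('d))"
				using s2 C1 r1 by (intro mult_left_mono) auto
			also have "\<dots> \<le> C1 / (r / 2) ^ CARD('d) * (C2 / (r / 2) ^ CARD('d))"
				using C1 C2 r1 by (intro mult_right_mono divide_left_mono power_mono) (auto intro!: mult_pos_pos zero_less_power)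
			also have "\<dots> = (sqrt (C1 * C2) / (r / 2) ^ CARD('d))\<^sup>2"
				using C1 C2 by (simp add: power_divide power2_eq_square[of "(r / 2) ^ _"]) (simp add: power2_eq_square power_divide)
			finally have "dnL w m \<le> sqrt (C1 * C2) / (r / 2) ^ CARD('d)"
				by (rule power2_le_imp_le) (use C1 C2 r1 in simp)
			also have "\<dots> \<le> sqrt (C1 * C2) / ((1 + norm m) / 8) ^ CARD('d)"
				using C1 C2 r1 by (intro divide_left_mono power_mono) (auto intro!: mult_pos_pos zero_less_power simp: r_def add_nonneg_pos)
			also have "\<dots> = sqrt (C1 * C2) * 8 ^ CARD('d) / (1 + norm m) ^ CARD('d)" by (simp add: power_divide)
			also have "\<dots> \<le> C / (1 + norm m) ^ CARD('d)"
				using pos M0 unfolding C_def by (intro divide_right_mono) auto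
			finally show ?thesis .
		qed
	qed
	moreover have "D w \<le> C"
	proof -
		have "D w * 1 \<le> D w * (1 + M0) ^ CARD('d)" using M0 by (intro mult_left_mono one_le_power) auto
		then show ?thesis unfolding C_def using C1 C2 by (simp add: add_increasing2)
	qed
	ultimately show ?thesis using C0 w by blast
qed

text \<open>Translates of the kernels at 0; the finitely many pairs of a stencil vector and a
  component share one constant.\<close>

lemma kernel:
	obtains C where "0 \<le> C" "!!l \<sigma> j. l \<in> L ==> \<sigma> \<in> S ==>
		\<exists>w\<in>W. (\<forall>\<phi>\<in>W. HB Q w \<phi> = (\<phi> (l + \<sigma>) - \<phi> l) $ j) \<and> D w \<le> C \<and> (\<forall>m\<in>L. dnL w m \<le> C / (1 + norm (m - l)) ^ CARD('d))"
proof -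
	have "\<forall>p\<in>S \<times> (UNIV :: 'd set). \<exists>C w. 0 \<le> C \<and> w \<in> W \<and> (\<forall>\<phi>\<in>W. HB Q w \<phi> = (\<phi> (fst p) - \<phi> 0) $ (snd p)) \<and> D w \<le> C \<and> (\<forall>m\<in>L. dnL w m \<le> C / (1 + norm m) ^ CARD('d))"
		using kernel_at_zero by auto
	from bchoice[OF this] obtain Cf where Cf: "\<forall>p\<in>S \<times> (UNIV :: 'd set). \<exists>w. 0 \<le> Cf p \<and> w \<in> W \<and> (\<forall>\<phi>\<in>W. HB Q w \<phi> = (\<phi> (fst p) - \<phi> 0) $ (snd p)) \<and> D w \<le> Cf p \<and> (\<forall>m\<in>L. dnL w m \<le> Cf p / (1 + norm m) ^ CARD('d))"
		by blast
	define C where "C = sum Cf (S \<times> (UNIV :: 'd set))"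
	have Cf0: "0 \<le> Cf p" if "p \<in> S \<times> (UNIV :: 'd set)" for p using Cf that by blast
	have fin: "finite (S \<times> (UNIV :: 'd set))" using finS by simp
	have C0: "0 \<le> C" unfolding C_def using Cf0 by (rule sum_nonneg)
	have main: "\<exists>w\<in>W. (\<forall>\<phi>\<in>W. HB Q w \<phi> = (\<phi> (l + \<sigma>) - \<phi> l) $ j) \<and> D w \<le> C \<and> (\<forall>m\<in>L. dnL w m \<le> C / (1 + norm (m - l)) ^ CARD('d))"
		if l: "l \<in> L" and \<sigma>: "\<sigma> \<in> S" for l \<sigma> j
	proof -
		have p: "(\<sigma>, j) \<in> S \<times> (UNIV :: 'd set)" using \<sigma> by simp
		from Cf[rule_format, OF p] obtain w where w: "w \<in> W" "\<forall>\<phi>\<in>W. HB Q w \<phi> = (\<phi> \<sigma> - \<phi> 0) $ j" "D w \<le> Cf (\<sigma>, j)"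
			"\<forall>m\<in>L. dnL w m \<le> Cf (\<sigma>, j) / (1 + norm m) ^ CARD('d)" by auto
		have le: "Cf (\<sigma>, j) \<le> C" unfolding C_def using p Cf0 fin by (intro member_le_sum) auto
		let ?w = "\<lambda>x. w (x + (- l))"
		have ml: "- l \<in> L" using L_diff[OF L_zero l] by simp
		have "HB Q ?w \<phi> = (\<phi> (l + \<sigma>) - \<phi> l) $ j" if \<phi>: "\<phi> \<in> W" for \<phi>
		proof -
			have "HB Q ?w \<phi> = HB Q (\<lambda>x. ?w (x + l)) (\<lambda>x. \<phi> (x + l))" by (rule HB_shift[OF l, symmetric])
			also have "\<dots> = HB Q w (\<lambda>x. \<phi> (x + l))" by simp
			also have "\<dots> = (\<phi> (\<sigma> + l) - \<phi> (0 + l)) $ j" by (rule w(2)[rule_format, OF W_shift(1)[OF l \<phi>]])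
			finally show ?thesis by (simp add: add.commute)
		qed
		moreover have "?w \<in> W" "D ?w \<le> C" using W_shift[OF ml w(1)] w(3) le by auto
		moreover have "dnL ?w m \<le> C / (1 + norm (m - l)) ^ CARD('d)" if m: "m \<in> L" for m
		proof -
			have "dnL ?w m = dnL w (m + (- l))" by (rule dn_shift)
			also have "\<dots> \<le> Cf (\<sigma>, j) / (1 + norm (m + (- l))) ^ CARD('d)" by (rule w(4)[rule_format, OF L_add[OF m ml]])
			also have "\<dots> \<le> C / (1 + norm (m + (- l))) ^ CARD('d)" using le by (intro divide_right_mono) auto
			finally show ?thesis by simp
		qed
		ultimately show ?thesis by (intro bexI[of _ ?w]) auto
	qed
	from that[OF C0 main] show thesis .
qed

end

section \<open>The mesh and the piecewise affine interpolant\<close>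

lemma norm_matrix_vector_le:
	fixes M :: "real^'n^'m"
	shows "norm (M *v x) \<le> real (CARD('m) * CARD('n)) * norm M * norm x"
proof -
	have "\<bar>M $ i $ j\<bar> \<le> norm M" for i j
		using component_le_norm_cart[of "M $ i" j] Finite_Cartesian_Product.norm_nth_le[of M i] by linarith
	then have "onorm ((*v) M) \<le> real CARD('m) * real CARD('n) * norm M"
		by (rule onorm_le_matrix_component)
	then have "onorm ((*v) M) * norm x \<le> (real CARD('m) * real CARD('n) * norm M) * norm x"
		by (rule mult_right_mono) simp
	moreover have "norm (M *v x) \<le> onorm ((*v) M) * norm x"
		by (rule onorm[OF matrix_vector_mul_bounded_linear])
	ultimately show ?thesis by simp
qed

text \<open>Coordinate vectors are combinations of \<open>B\<close>, so a matrix is controlled by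
  its action there. \<open>B\<close> will consist of the edge vectors of a simplex at one vertex,
  and the constant depends on \<open>B\<close> alone.\<close>

lemma norm_matrix_le_basis:
	fixes B :: "(real^'n) set"
	assumes "finite B" "span B = UNIV"
	shows "\<exists>C\<ge>0. \<forall>M::real^'n^'m. norm M \<le> C * (\<Sum>b\<in>B. norm (M *v b))"
proof -
	have "\<exists>r. axis j 1 = (\<Sum>b\<in>B. r b *\<^sub>R b)" for j :: 'n
	proof -
		have "axis j 1 \<in> span B" using assms(2) by simp
		then show ?thesis unfolding span_finite[OF assms(1)] by (elim rangeE) (rule exI)
	qed
	then have "\<forall>j::'n. \<exists>r. axis j 1 = (\<Sum>b\<in>B. r b *\<^sub>R b)" by blast
	from choice[OF this] obtain r where r: "!!j::'n. axis j 1 = (\<Sum>b\<in>B. r j b *\<^sub>R b)" by blast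
	define m where "m = (\<Sum>j\<in>(UNIV::'n set). \<Sum>b\<in>B. \<bar>r j b\<bar>)"
	have m: "\<bar>r j b\<bar> \<le> m" if "b \<in> B" for j b
	proof -
		have "\<bar>r j b\<bar> \<le> (\<Sum>b\<in>B. \<bar>r j b\<bar>)" using that assms(1) by (intro member_le_sum) auto
		also have "\<dots> \<le> m" unfolding m_def by (intro member_le_sum) (auto intro: sum_nonneg)
		finally show ?thesis .
	qed
	have m0: "0 \<le> m" unfolding m_def by (intro sum_nonneg) auto
	have "norm M \<le> (CARD('m) * CARD('n) * m) * (\<Sum>b\<in>B. norm (M *v b))" for M :: "real^'n^'m"
	proof -
		define T where "T = (\<Sum>b\<in>B. norm (M *v b))"
		have T0: "0 \<le> T" unfolding T_def by (simp add: sum_nonneg)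
		have col: "\<bar>M $ i $ j\<bar> \<le> m * T" for i j
		proof -
			have "M $ i $ j = (M *v axis j 1) $ i" by (simp add: matrix_vector_mult_basis column_def)
			also have "\<bar>\<dots>\<bar> \<le> norm (M *v axis j 1)" by (rule component_le_norm_cart)
			also have "M *v axis j 1 = (\<Sum>b\<in>B. r j b *\<^sub>R (M *v b))"
				unfolding r[of j] by (simp add: linear_sum[OF matrix_vector_mul_linear] matrix_vector_mult_scaleR)
			also have "norm \<dots> \<le> (\<Sum>b\<in>B. \<bar>r j b\<bar> * norm (M *v b))" by (rule order_trans[OF norm_sum]) simp
			also have "\<dots> \<le> (\<Sum>b\<in>B. m * norm (M *v b))" using m by (intro sum_mono mult_right_mono) auto
			finally show ?thesis by (simp add: T_def sum_distrib_left)
		qed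
		have "norm M \<le> (\<Sum>i\<in>UNIV. norm (M $ i))" by (simp add: norm_vec_def L2_set_le_sum)
		also have "\<dots> \<le> (\<Sum>i\<in>(UNIV::'m set). \<Sum>j\<in>(UNIV::'n set). \<bar>M $ i $ j\<bar>)" by (intro sum_mono norm_le_l1_cart)
		also have "\<dots> \<le> (\<Sum>i\<in>(UNIV::'m set). \<Sum>j\<in>(UNIV::'n set). m * T)" by (intro sum_mono col)
		finally show ?thesis by (simp add: T_def)
	qed
	then show ?thesis using m0 by (intro exI[of _ "CARD('m) * CARD('n) * m"]) auto
qed

locale defect = hom_lattice A S for A :: "real^'d^'d" and S :: "(real^'d) set" +
	fixes Rdef rcut :: real and \<Lambda> :: "(real^'d) set" and \<T> :: "(real^'d) set set"
		and St :: "real^'d => (real^'d) set"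
	assumes Rdef: "0 < Rdef" and config: "reference_configuration A Rdef \<Lambda>"
		and mesh: "regular_partition \<T> \<Lambda>" and rcut: "0 < rcut"
		and stencil: "l \<in> \<Lambda> ==> St l \<subseteq> (ball 0 rcut \<inter> (\<lambda>x. x - l) ` \<Lambda>) - {0}"
		and edges: "T \<in> \<T> ==> closed_segment l (l + \<rho>) edge_of T ==> \<rho> \<in> St l"
		and St_hom: "l \<in> \<Lambda> ==> Rdef \<le> norm l ==> St l = S"
begin

lemma far_iff: "Rdef \<le> norm l ==> l \<in> \<Lambda> \<longleftrightarrow> l \<in> L"
proof -
	assume "Rdef \<le> norm l"
	then have "l \<notin> ball 0 Rdef" by simp
	moreover have "l \<in> \<Lambda> - ball 0 Rdef \<longleftrightarrow> l \<in> L - ball 0 Rdef"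
		using config unfolding reference_configuration_def by (elim conjE) (simp only:)
	ultimately show ?thesis by blast
qed

lemma fin\<Lambda>: "finite (\<Lambda> \<inter> ball x r)"
proof -
	have "\<Lambda> \<inter> ball x r \<subseteq> (\<Lambda> \<inter> ball 0 Rdef) \<union> (L \<inter> ball x r)"
	proof
		fix l assume l: "l \<in> \<Lambda> \<inter> ball x r"
		show "l \<in> (\<Lambda> \<inter> ball 0 Rdef) \<union> (L \<inter> ball x r)"
		proof (cases "Rdef \<le> norm l")
			case True
			then show ?thesis using far_iff[OF True] l by blast
		qed (use l in auto)
	qed
	then show ?thesis using config fin_ball unfolding reference_configuration_def by (auto intro: finite_subset)
qed

lemma St_norm: "l \<in> \<Lambda> ==> \<rho> \<in> St l ==> norm \<rho> < rcut" using stencil[of l] by auto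

lemma St_\<Lambda>: "l \<in> \<Lambda> ==> \<rho> \<in> St l ==> l + \<rho> \<in> \<Lambda>" using stencil[of l] by force

lemma fin_St: "l \<in> \<Lambda> ==> finite (St l)"
proof (rule finite_subset[OF _ finite_imageI[OF fin\<Lambda>[of l rcut]]])
	assume l: "l \<in> \<Lambda>"
	show "St l \<subseteq> (\<lambda>x. x - l) ` (\<Lambda> \<inter> ball l rcut)"
	proof
		fix \<rho> assume \<rho>: "\<rho> \<in> St l"
		then have "l + \<rho> \<in> \<Lambda> \<inter> ball l rcut" using St_norm[OF l] St_\<Lambda>[OF l] by (simp add: dist_norm)
		then show "\<rho> \<in> (\<lambda>x. x - l) ` (\<Lambda> \<inter> ball l rcut)" by (rule rev_image_eqI) simp
	qed
qed

lemma countable\<Lambda>: "countable \<Lambda>"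
proof -
	have "\<Lambda> \<subseteq> (\<Union>n::nat. \<Lambda> \<inter> ball 0 (real n))"
	proof
		fix l assume l: "l \<in> \<Lambda>"
		obtain n :: nat where "norm l < real n" using reals_Archimedean2 by blast
		then show "l \<in> (\<Union>n::nat. \<Lambda> \<inter> ball 0 (real n))" using l by auto
	qed
	moreover have "countable (\<Union>n::nat. \<Lambda> \<inter> ball 0 (real n))"
		by (rule countable_UN[OF countableI_type]) (intro countable_finite fin\<Lambda>)
	ultimately show ?thesis by (rule countable_subset)
qed

definition vs :: "(real^'d) set => (real^'d) set" where "vs T = {x. x extreme_point_of T}"

lemma simplexD:
	assumes "T \<in> \<T>"
	shows "\<not> affine_dependent (vs T)" "card (vs T) = Suc CARD('d)" "convex hull (vs T) = T" "finite (vs T)" "vs T \<subseteq> \<Lambda>"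
		"interior T \<noteq> {}" "compact T" "convex T" "vs T \<noteq> {}"
proof -
	have "int CARD('d) simplex T" using mesh assms unfolding regular_partition_def by blast
	then obtain C where C: "\<not> affine_dependent C" "int (card C) = int CARD('d) + 1" "T = convex hull C"
		unfolding simplex_def by blast
	have vsC: "vs T = C" unfolding vs_def C(3) using extreme_point_of_convex_hull_affine_independent[OF C(1)] by auto
	then show 1: "\<not> affine_dependent (vs T)" "card (vs T) = Suc CARD('d)" "convex hull (vs T) = T" using C by auto
	then show "finite (vs T)" using aff_independent_finite by blast
	show "interior T \<noteq> {}" using interior_convex_hull_eq_empty[of "vs T"] 1 by simp
	show "compact T" using \<open>finite (vs T)\<close> 1(3) finite_imp_compact_convex_hull by metis
	show "convex T" using 1(3) convex_convex_hull by metis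
	show "vs T \<noteq> {}" using 1(2) by auto
	show "vs T \<subseteq> \<Lambda>" using mesh assms unfolding regular_partition_def vs_def by blast
qed

lemma cover: "\<exists>T\<in>\<T>. x \<in> T"
	using mesh unfolding regular_partition_def by blast

lemma vs_sub: "T \<in> \<T> ==> vs T \<subseteq> T"
	using hull_subset[of "vs T" convex] simplexD(3)[of T] by simp

text \<open>Faces of a simplex are the hulls of subsets of its vertices, so any two vertices span an
  edge. This makes all nodal differences of the interpolant on \<open>T\<close> stencil
  differences.\<close>

lemma edge_in_St:
	assumes T: "T \<in> \<T>" and v: "v \<in> vs T" and w: "w \<in> vs T" and "v \<noteq> w"
	shows "w - v \<in> St v"
proof -
	have "convex hull {v, w} face_of convex hull (vs T)"
		unfolding face_of_convex_hull_affine_independent[OF simplexD(1)[OF T]]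
		using v w by (intro exI[of _ "{v, w}"]) auto
	then have "closed_segment v w face_of T" using simplexD(3)[OF T] by (simp add: segment_convex_hull)
	moreover have "aff_dim (closed_segment v w) = 1"
		using \<open>v \<noteq> w\<close> by (simp add: segment_convex_hull aff_dim_convex_hull aff_dim_2)
	ultimately have "closed_segment v (v + (w - v)) edge_of T" by (simp add: edge_of_def)
	then show ?thesis by (rule edges[OF T])
qed

text \<open>Edges are stencil vectors, hence shorter than \<open>rcut\<close>; the convex hull of
  the vertices inherits the bound.\<close>

lemma T_sub_ball:
	assumes T: "T \<in> \<T>" and x: "x \<in> T"
	shows "T \<subseteq> ball x rcut"
proof -
	have v: "T \<subseteq> ball v rcut" if v: "v \<in> vs T" for v
	proof -
		have "w \<in> ball v rcut" if w: "w \<in> vs T" for w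
		proof (cases "v = w")
			case False
			then show ?thesis using St_norm[OF _ edge_in_St[OF T v w]] simplexD(5)[OF T] v by (auto simp: dist_norm norm_minus_commute)
		qed (use rcut in auto)
		then have "convex hull (vs T) \<subseteq> ball v rcut" by (intro hull_minimal) auto
		then show ?thesis using simplexD(3)[OF T] by simp
	qed
	have "vs T \<subseteq> ball x rcut"
	proof
		fix w assume "w \<in> vs T"
		then have "x \<in> ball w rcut" using v x by blast
		then show "w \<in> ball x rcut" by (simp add: dist_commute)
	qed
	then have "convex hull (vs T) \<subseteq> ball x rcut" by (intro hull_minimal) auto
	then show ?thesis using simplexD(3)[OF T] by simp
qed

lemma T_inj: "inj_on vs \<T>"
proof (rule inj_onI)
	fix T T' assume T: "T \<in> \<T>" "T' \<in> \<T>" and eq: "vs T = vs T'"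
	have "T = convex hull (vs T')" using simplexD(3)[OF T(1)] unfolding eq by (rule sym)
	then show "T = T'" unfolding simplexD(3)[OF T(2)] .
qed

definition nb :: "real^'d => real => (real^'d) set set" where
	"nb x r = {T\<in>\<T>. T \<inter> ball x r \<noteq> {}}"

lemma nb_sub: "T \<in> nb x r ==> T \<subseteq> ball x (r + rcut)"
proof
	fix y assume T: "T \<in> nb x r" and y: "y \<in> T"
	then obtain z where z: "T \<in> \<T>" "z \<in> T" "dist x z < r" unfolding nb_def by auto
	then have "dist z y < rcut" using T_sub_ball[of T z] y by auto
	then show "y \<in> ball x (r + rcut)" using z(3) dist_triangle[of x y z] by simp
qed

text \<open>A simplex is determined by its vertices, and only finitely many sites lie near a point.
  Local finiteness of the mesh is thus inherited from the lattice.\<close>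

lemma nb_fin: "finite (nb x r)"
proof (rule inj_on_finite[where f=vs and B="Pow (\<Lambda> \<inter> ball x (r + rcut))"])
	show "inj_on vs (nb x r)" by (rule inj_on_subset[OF T_inj]) (auto simp: nb_def)
	show "vs ` nb x r \<subseteq> Pow (\<Lambda> \<inter> ball x (r + rcut))"
	proof clarify
		fix T v assume T: "T \<in> nb x r" and v: "v \<in> vs T"
		have "T \<in> \<T>" using T by (simp add: nb_def)
		then show "v \<in> \<Lambda> \<inter> ball x (r + rcut)" using nb_sub[OF T] vs_sub simplexD(5) v by blast
	qed
	show "finite (Pow (\<Lambda> \<inter> ball x (r + rcut)))" by (simp only: finite_Pow_iff fin\<Lambda>)
qed

lemma countable_T: "countable \<T>"
proof -
	have "\<T> \<subseteq> (\<Union>n::nat. nb 0 (real n))"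
	proof
		fix T assume T: "T \<in> \<T>"
		then obtain v where "v \<in> T" using simplexD(9) vs_sub by blast
		moreover obtain n :: nat where "norm v < real n" using reals_Archimedean2 by blast
		ultimately have "v \<in> T \<inter> ball 0 (real n)" by simp
		then have "T \<in> nb 0 (real n)" using T unfolding nb_def by blast
		then show "T \<in> (\<Union>n::nat. nb 0 (real n))" by blast
	qed
	moreover have "countable (\<Union>n::nat. nb 0 (real n))"
		by (rule countable_UN[OF countableI_type]) (intro countable_finite nb_fin)
	ultimately show ?thesis by (rule countable_subset)
qed

lemma basisD:
	assumes T: "T \<in> \<T>" and v: "v \<in> vs T"
	shows "independent ((\<lambda>x. - v + x) ` (vs T - {v}))" "span ((\<lambda>x. - v + x) ` (vs T - {v})) = UNIV"
proof -
	let ?B = "(\<lambda>x. - v + x) ` (vs T - {v})"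
	show ind: "independent ?B" using simplexD(1)[OF T] affine_dependent_iff_dependent2[OF v] by simp
	have "card ?B = card (vs T - {v})" by (intro card_image) (auto intro: inj_onI)
	also have "\<dots> = DIM(real^'d)" using simplexD(2,4)[OF T] v by simp
	finally have "dim ?B = DIM(real^'d)" using dim_eq_card_independent[OF ind] by simp
	then show "span ?B = UNIV" using dim_eq_full by blast
qed

lemma affine_vertices:
	assumes T: "T \<in> \<T>"
	shows "\<exists>M b. \<forall>v\<in>vs T. M *v v + b = (u v :: real^'d)"
proof -
	obtain v where v: "v \<in> vs T" using simplexD(9)[OF T] by blast
	obtain g :: "real^'d => real^'d" where g: "linear g" "\<forall>x\<in>(\<lambda>x. - v + x) ` (vs T - {v}). g x = u (v + x) - u v"
		using linear_independent_extend[OF basisD(1)[OF T v], of "\<lambda>x. u (v + x) - u v"] by blast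
	have "matrix g *v w + (u v - g v) = u w" if w: "w \<in> vs T" for w
	proof -
		have "g (- v + w) = u w - u v"
		proof (cases "w = v")
			case True then show ?thesis using linear_0[OF g(1)] by simp
		next
			case False
			then have "- v + w \<in> (\<lambda>x. - v + x) ` (vs T - {v})" using w by blast
			then show ?thesis using g(2) by force
		qed
		then have "g w - g v = u w - u v" using linear_diff[OF g(1), of w v] by simp
		moreover have "matrix g *v w = g w"
		proof -
			have "(*v) (matrix g) = g" using g(1) by simp
			then show ?thesis by (rule fun_cong)
		qed
		ultimately show ?thesis by (simp add: algebra_simps)
	qed
	then show ?thesis by blast
qed

lemma affine_hull_eq:
	fixes M M' :: "real^'d^'d"
	assumes "!!v. v \<in> C ==> M *v v + b = M' *v v + (b' :: real^'d)" "x \<in> convex hull C"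
	shows "M *v x + b = M' *v x + b'"
proof -
	have "convex {x. M *v x + b = M' *v x + b'}"
	proof (rule convexI)
		fix x y :: "real^'d" and s t :: real
		assume x: "x \<in> {x. M *v x + b = M' *v x + b'}" and y: "y \<in> {x. M *v x + b = M' *v x + b'}" and st: "0 \<le> s" "0 \<le> t" "s + t = 1"
		have e: "N *v (s *\<^sub>R x + t *\<^sub>R y) + a = s *\<^sub>R (N *v x + a) + t *\<^sub>R (N *v y + a)" for N :: "real^'d^'d" and a
		proof -
			have "s *\<^sub>R (N *v x + a) + t *\<^sub>R (N *v y + a) = s *\<^sub>R (N *v x) + t *\<^sub>R (N *v y) + (s + t) *\<^sub>R a"
				by (simp add: algebra_simps)
			then show ?thesis using st(3) by (simp add: matrix_vector_right_distrib matrix_vector_mult_scaleR)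
		qed
		show "s *\<^sub>R x + t *\<^sub>R y \<in> {x. M *v x + b = M' *v x + b'}" using x y by (simp add: e)
	qed
	then have "convex hull C \<subseteq> {x. M *v x + b = M' *v x + b'}" using assms(1) by (intro hull_minimal) auto
	then show ?thesis using assms(2) by blast
qed

text \<open>The common face is the hull of vertices of \<open>T\<close> and also of vertices of
  \<open>T'\<close>; both sets are its extreme points, hence equal. Affine pieces that agree at
  common nodes therefore agree on the whole intersection.\<close>

lemma T_Int:
	assumes "T \<in> \<T>" "T' \<in> \<T>"
	shows "T \<inter> T' = convex hull (vs T \<inter> vs T')"
proof -
	have f: "(T \<inter> T') face_of T" "(T \<inter> T') face_of T'" using mesh assms unfolding regular_partition_def by blast+
	obtain c where c: "c \<subseteq> vs T" "T \<inter> T' = convex hull c"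
		using f(1) face_of_convex_hull_affine_independent[OF simplexD(1)[OF assms(1)]] simplexD(3)[OF assms(1)] by metis
	obtain c' where c': "c' \<subseteq> vs T'" "T \<inter> T' = convex hull c'"
		using f(2) face_of_convex_hull_affine_independent[OF simplexD(1)[OF assms(2)]] simplexD(3)[OF assms(2)] by metis
	have "c = {x. x extreme_point_of (convex hull c)}"
		using extreme_point_of_convex_hull_affine_independent[of c] affine_independent_subset[OF simplexD(1)[OF assms(1)] c(1)] by blast
	moreover have "c' = {x. x extreme_point_of (convex hull c')}"
		using extreme_point_of_convex_hull_affine_independent[of c'] affine_independent_subset[OF simplexD(1)[OF assms(2)] c'(1)] by blast
	ultimately have "c = c'" using c c' by metis
	then have "T \<inter> T' \<subseteq> convex hull (vs T \<inter> vs T')" using c c' by (simp add: hull_mono)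
	moreover have "convex hull (vs T \<inter> vs T') \<subseteq> T \<inter> T'"
		using simplexD(3)[OF assms(1)] simplexD(3)[OF assms(2)] hull_mono[of "vs T \<inter> vs T'"] by (metis Int_lower1 Int_lower2 le_inf_iff)
	ultimately show ?thesis by blast
qed

lemma continuous_piecewise:
	assumes "!!T. T \<in> \<T> ==> \<exists>M b. \<forall>x\<in>T. f x = M *v x + (b :: real^'d)"
	shows "continuous_on UNIV f"
proof -
	have cT: "continuous_on T f" if T: "T \<in> \<T>" for T
	proof -
		obtain M b where "\<forall>x\<in>T. f x = M *v x + b" using assms[OF T] by blast
		moreover have "continuous_on T (\<lambda>x. M *v x + b)" by (intro continuous_intros matrix_vector_mult_linear_continuous_on)
		ultimately show ?thesis by (metis (mono_tags, lifting) continuous_on_eq)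
	qed
	have "isCont f x" for x
	proof -
		have "continuous_on (\<Union>T\<in>nb x 1. T) f"
			using cT nb_fin simplexD(7) by (intro continuous_on_closed_Union) (auto simp: nb_def compact_imp_closed)
		moreover have "ball x 1 \<subseteq> (\<Union>T\<in>nb x 1. T)" using cover by (fastforce simp: nb_def)
		ultimately have "continuous_on (ball x 1) f" using continuous_on_subset by blast
		then show ?thesis by (simp add: continuous_on_eq_continuous_at)
	qed
	then show ?thesis by (simp add: continuous_at_imp_continuous_on)
qed

section \<open>The interpolant and its gradient\<close>

abbreviation "I u \<equiv> interpolant \<T> \<Lambda> u"

text \<open>Makes the definite description in \<open>interpolant\<close> meaningful. For existence,
  take any simplex containing \<open>x\<close>; \<open>T_Int\<close> makes the value independent of
  the choice.\<close>

lemma interpolant_ex1: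
	"\<exists>!f. continuous_on UNIV f \<and> (\<forall>T\<in>\<T>. \<exists>M b. \<forall>x\<in>T. f x = M *v x + b) \<and> (\<forall>l\<in>\<Lambda>. f l = (u l :: real^'d))"
proof -
	have "\<forall>T\<in>\<T>. \<exists>M b. \<forall>v\<in>vs T. M *v v + b = u v" using affine_vertices by blast
	then obtain M b where Mb: "!!T v. T \<in> \<T> ==> v \<in> vs T ==> M T *v v + b T = u v" by metis
	obtain \<tau> where \<tau>: "!!x. \<tau> x \<in> \<T> \<and> x \<in> \<tau> x" using cover by metis
	define f where "f x = M (\<tau> x) *v x + b (\<tau> x)" for x
	have fT: "f x = M T *v x + b T" if T: "T \<in> \<T>" and x: "x \<in> T" for T x
		unfolding f_def
	proof (rule affine_hull_eq)
		show "x \<in> convex hull (vs (\<tau> x) \<inter> vs T)" using T_Int[of "\<tau> x" T] \<tau>[of x] T x by blast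
		show "M (\<tau> x) *v v + b (\<tau> x) = M T *v v + b T" if "v \<in> vs (\<tau> x) \<inter> vs T" for v
			using Mb[of "\<tau> x" v] Mb[of T v] \<tau>[of x] T that by auto
	qed
	have pw: "\<exists>M b. \<forall>x\<in>T. f x = M *v x + b" if "T \<in> \<T>" for T using fT that by blast
	have vert: "\<exists>T\<in>\<T>. l \<in> vs T" if "l \<in> \<Lambda>" for l using mesh that unfolding regular_partition_def vs_def by blast
	show ?thesis
	proof (rule ex1I[of _ f])
		have "f l = u l" if l: "l \<in> \<Lambda>" for l
		proof -
			obtain T where T: "T \<in> \<T>" "l \<in> vs T" using vert[OF l] by blast
			then show ?thesis using fT[OF T(1)] vs_sub[OF T(1)] Mb[OF T] by auto
		qed
		then show "continuous_on UNIV f \<and> (\<forall>T\<in>\<T>. \<exists>M b. \<forall>x\<in>T. f x = M *v x + b) \<and> (\<forall>l\<in>\<Lambda>. f l = u l)"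
			using continuous_piecewise[of f] pw by blast
	next
		fix g assume g: "continuous_on UNIV g \<and> (\<forall>T\<in>\<T>. \<exists>M b. \<forall>x\<in>T. g x = M *v x + b) \<and> (\<forall>l\<in>\<Lambda>. g l = u l)"
		show "g = f"
		proof
			fix x
			obtain T where T: "T \<in> \<T>" "x \<in> T" using cover by blast
			obtain N a where N: "\<forall>x\<in>T. g x = N *v x + a" using g T by blast
			have "N *v x + a = M T *v x + b T"
			proof (rule affine_hull_eq)
				show "x \<in> convex hull (vs T)" using simplexD(3)[OF T(1)] T by simp
				show "N *v v + a = M T *v v + b T" if v: "v \<in> vs T" for v
				proof -
					have "N *v v + a = g v" using N v vs_sub[OF T(1)] by auto
					also have "\<dots> = u v" using g v simplexD(5)[OF T(1)] by blast
					finally show ?thesis using Mb[OF T(1) v] by simp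
				qed
			qed
			then show "g x = f x" using N T fT by simp
		qed
	qed
qed

lemma interpolantD:
	"T \<in> \<T> ==> \<exists>M b. \<forall>x\<in>T. I u x = M *v x + b" "l \<in> \<Lambda> ==> I u l = u l" "continuous_on UNIV (I u)"
	using theI'[OF interpolant_ex1[of u]] unfolding interpolant_def by blast+

lemma interpolantI:
	assumes "!!T. T \<in> \<T> ==> \<exists>M b. \<forall>x\<in>T. f x = M *v x + b" "!!l. l \<in> \<Lambda> ==> f l = u l"
	shows "I u = f"
	unfolding interpolant_def
	by (rule the1_equality[OF interpolant_ex1]) (use assms continuous_piecewise[of f] in auto)

lemma interpolant_lin: "I (lcomb a u b v) = (\<lambda>x. a *\<^sub>R I u x + b *\<^sub>R I v x)"
proof (rule interpolantI)
	fix T assume T: "T \<in> \<T>"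
	obtain M c where 1: "\<forall>x\<in>T. I u x = M *v x + c" using interpolantD(1)[OF T] by blast
	obtain N d where 2: "\<forall>x\<in>T. I v x = N *v x + d" using interpolantD(1)[OF T] by blast
	have "\<forall>x\<in>T. a *\<^sub>R I u x + b *\<^sub>R I v x = (a *\<^sub>R M + b *\<^sub>R N) *v x + (a *\<^sub>R c + b *\<^sub>R d)"
		using 1 2 by (simp add: matrix_vector_mult_add_rdistrib scaleR_matrix_vector_assoc[symmetric] algebra_simps)
	then show "\<exists>M c. \<forall>x\<in>T. a *\<^sub>R I u x + b *\<^sub>R I v x = M *v x + c" by blast
qed (simp add: interpolantD(2))

definition GT :: "'d vfun => (real^'d) set => real^'d^'d" where
	"GT u T = (SOME M. \<exists>b. \<forall>x\<in>T. I u x = M *v x + b)"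

lemma GT: "T \<in> \<T> ==> \<exists>b. \<forall>x\<in>T. I u x = GT u T *v x + b"
	unfolding GT_def using someI_ex[OF interpolantD(1)[of T u]] by blast

lemma GT_diff: "T \<in> \<T> ==> x \<in> T ==> y \<in> T ==> I u x - I u y = GT u T *v (x - y)"
	using GT[of T u] by (auto simp: matrix_vector_mult_diff_distrib)

lemma grad_interior:
	assumes T: "T \<in> \<T>" and x: "x \<in> interior T"
	shows "I u differentiable (at x)" "grad \<T> \<Lambda> u x = GT u T"
proof -
	obtain b where b: "\<forall>y\<in>T. I u y = GT u T *v y + b" using GT[OF T] by blast
	have "((\<lambda>y. GT u T *v y + b) has_derivative (\<lambda>h. GT u T *v h)) (at x)"
		by (auto intro!: derivative_eq_intros bounded_linear.has_derivative[OF matrix_vector_mul_bounded_linear])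
	then have d: "(I u has_derivative (\<lambda>h. GT u T *v h)) (at x)"
	proof (rule has_derivative_transform_within_open[OF _ open_interior x])
		fix y assume "y \<in> interior T"
		then have "y \<in> T" using interior_subset by blast
		then show "GT u T *v y + b = I u y" using b by simp
	qed
	then show df: "I u differentiable (at x)" unfolding differentiable_def by blast
	have "frechet_derivative (I u) (at x) = (\<lambda>h. GT u T *v h)" using d frechet_derivative_at by metis
	then show "grad \<T> \<Lambda> u x = GT u T" using df by (simp add: grad_def jacobian_def)
qed

definition Z :: "(real^'d) set" where "Z = (\<Union>T\<in>\<T>. frontier T)"

lemma Z_negligible: "negligible Z"
	unfolding Z_def using countable_T simplexD(8) negligible_convex_frontier by (intro negligible_countable_Union) auto

lemma notZ: "x \<notin> Z ==> \<exists>T\<in>\<T>. x \<in> interior T"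
	using cover[of x] unfolding Z_def frontier_def using simplexD(7) compact_imp_closed closure_closed by fastforce

lemma AE_interior: "AE x in lebesgue. \<exists>T\<in>\<T>. x \<in> interior T"
proof (rule AE_I')
	show "Z \<in> null_sets lebesgue" using Z_negligible negligible_iff_null_sets by blast
	show "{x \<in> space lebesgue. \<not> (\<exists>T\<in>\<T>. x \<in> interior T)} \<subseteq> Z" using notZ by blast
qed

text \<open>On the open simplex interiors the gradient is constant; what remains is negligible, and
  Lebesgue measure is complete.\<close>

lemma grad_measurable: "grad \<T> \<Lambda> u \<in> borel_measurable lebesgue"
proof (rule measurableI)
	fix B :: "(real^'d^'d) set" assume "B \<in> sets borel"
	let ?O = "\<Union>T\<in>{T\<in>\<T>. GT u T \<in> B}. interior T"
	let ?N = "(grad \<T> \<Lambda> u -` B) \<inter> (- (\<Union>T\<in>\<T>. interior T))"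
	have eq: "grad \<T> \<Lambda> u -` B \<inter> space lebesgue = ?O \<union> ?N" using grad_interior(2) by auto
	have "?O \<in> sets lebesgue"
	proof -
		have "open ?O" by (intro open_UN) auto
		then show ?thesis using sets_completionI_sets[of ?O lborel] by simp
	qed
	moreover have "?N \<in> sets lebesgue"
	proof -
		have "negligible ?N" by (rule negligible_subset[OF Z_negligible]) (use notZ in blast)
		then show ?thesis using negligible_imp_sets by blast
	qed
	ultimately show "grad \<T> \<Lambda> u -` B \<inter> space lebesgue \<in> sets lebesgue" unfolding eq by (rule sets.Un)
qed simp

lemma GT_lin: "T \<in> \<T> ==> GT (lcomb a u b v) T = a *\<^sub>R GT u T + b *\<^sub>R GT v T"
proof -
	assume T: "T \<in> \<T>"
	obtain v0 where v0: "v0 \<in> vs T" using simplexD(9)[OF T] by blast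
	let ?B = "(\<lambda>x. - v0 + x) ` (vs T - {v0})"
	let ?M = "GT (lcomb a u b v) T" and ?N = "a *\<^sub>R GT u T + b *\<^sub>R GT v T"
	have "?M *v y = ?N *v y" if y: "y \<in> ?B" for y
	proof -
		obtain x where x: "x \<in> T" "y = x - v0" using y vs_sub[OF T] by auto
		have v0T: "v0 \<in> T" using v0 vs_sub[OF T] by blast
		have "?N *v y = a *\<^sub>R (GT u T *v (x - v0)) + b *\<^sub>R (GT v T *v (x - v0))"
			unfolding x(2) by (simp add: matrix_vector_mult_add_rdistrib scaleR_matrix_vector_assoc[symmetric])
		then show ?thesis unfolding x(2) GT_diff[OF T x(1) v0T, symmetric] interpolant_lin
			by (simp add: algebra_simps)
	qed
	then have "?M *v y = ?N *v y" for y
		using linear_eq_on_span[OF matrix_vector_mul_linear matrix_vector_mul_linear, of ?B ?M ?N y] basisD(2)[OF T v0] by auto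
	then show ?thesis by (simp add: matrix_eq)
qed

lemma grad_lin_AE: "AE x in lebesgue. grad \<T> \<Lambda> (lcomb a u b v) x = a *\<^sub>R grad \<T> \<Lambda> u x + b *\<^sub>R grad \<T> \<Lambda> v x"
	using AE_interior by (rule AE_mp) (auto simp: grad_interior(2) GT_lin)

end

section \<open>Equivalence of the continuous and the discrete semi-norm\<close>

context defect
begin

definition base :: "(real^'d) set => real^'d" where "base T = (SOME v. v \<in> vs T)"

text \<open>The vertices up to translation. Constants that have to be uniform over the mesh are
  taken over these finitely many classes.\<close>

definition shape :: "(real^'d) set => (real^'d) set" where "shape T = (\<lambda>x. - base T + x) ` vs T"

lemma base: "T \<in> \<T> ==> base T \<in> vs T" "T \<in> \<T> ==> base T \<in> \<Lambda>" "T \<in> \<T> ==> base T \<in> T"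
proof -
	assume T: "T \<in> \<T>"
	show 1: "base T \<in> vs T" unfolding base_def using simplexD(9)[OF T] by (simp add: some_in_eq)
	then show "base T \<in> \<Lambda>" "base T \<in> T" using simplexD(5)[OF T] vs_sub[OF T] by blast+
qed

text \<open>Simplices near the core are finite in number; for the others all vertices are points of
  the Bravais lattice, so their differences are lattice vectors shorter than
  \<open>rcut\<close>.\<close>

lemma finite_shapes: "finite (shape ` \<T>)"
proof (rule finite_subset)
	let ?F = "(\<Lambda> \<inter> ball 0 (Rdef + rcut)) \<times> Pow (\<Lambda> \<inter> ball 0 (Rdef + 2 * rcut))"
	show "finite (Pow (L \<inter> ball 0 rcut) \<union> (\<lambda>p. (\<lambda>x. - fst p + x) ` snd p) ` ?F)"
		by (intro finite_UnI finite_imageI finite_SigmaI) (simp_all only: finite_Pow_iff fin_ball fin\<Lambda>)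
	show "shape ` \<T> \<subseteq> Pow (L \<inter> ball 0 rcut) \<union> (\<lambda>p. (\<lambda>x. - fst p + x) ` snd p) ` ?F"
	proof
		fix X assume "X \<in> shape ` \<T>"
		then obtain T where T: "T \<in> \<T>" "X = shape T" by blast
		have near: "norm (w - base T) < rcut" if "w \<in> vs T" for w
			using T_sub_ball[OF T(1) base(3)[OF T(1)]] vs_sub[OF T(1)] that by (auto simp: dist_norm norm_minus_commute)
		show "X \<in> Pow (L \<inter> ball 0 rcut) \<union> (\<lambda>p. (\<lambda>x. - fst p + x) ` snd p) ` ?F"
		proof (cases "norm (base T) < Rdef + rcut")
			case True
			have "vs T \<subseteq> \<Lambda> \<inter> ball 0 (Rdef + 2 * rcut)"
			proof
				fix w assume w: "w \<in> vs T"
				have "norm w \<le> norm (base T) + norm (w - base T)" using norm_triangle_ineq[of "base T" "w - base T"] by simp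
				then have "norm w < Rdef + 2 * rcut" using near[OF w] True by linarith
				then show "w \<in> \<Lambda> \<inter> ball 0 (Rdef + 2 * rcut)" using simplexD(5)[OF T(1)] w by auto
			qed
			then have "(base T, vs T) \<in> ?F" using True base(2)[OF T(1)] by auto
			then have "(\<lambda>p. (\<lambda>x. - fst p + x) ` snd p) (base T, vs T) \<in> (\<lambda>p. (\<lambda>x. - fst p + x) ` snd p) ` ?F" by (rule imageI)
			then show ?thesis unfolding T(2) shape_def by simp
		next
			case False
			have inL: "w \<in> L" if w: "w \<in> vs T" for w
			proof -
				have "norm (base T) \<le> norm w + norm (w - base T)" using norm_triangle_ineq4[of w "w - base T"] by simp
				then have "Rdef \<le> norm w" using near[OF w] False by linarith
				then show ?thesis using far_iff simplexD(5)[OF T(1)] w by blast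
			qed
			have "shape T \<subseteq> L \<inter> ball 0 rcut"
			proof
				fix y assume "y \<in> shape T"
				then obtain w where w: "w \<in> vs T" "y = w - base T" unfolding shape_def by auto
				then show "y \<in> L \<inter> ball 0 rcut" using near[OF w(1)] L_diff[OF inL[OF w(1)] inL[OF base(1)[OF T(1)]]] by simp
			qed
			then show ?thesis unfolding T(2) by blast
		qed
	qed
qed

text \<open>The edges at the base vertex span the space, and the nodal differences along them belong
  to the stencil there. The constant of \<open>norm_matrix_le_basis\<close> depends on the shape
  only.\<close>

lemma GT_bound: obtains C where "0 \<le> C" "!!T u. T \<in> \<T> ==> norm (GT u T) \<le> C * dn St u (base T)"
proof -
	let ?P = "\<lambda>X C. 0 \<le> C \<and> (\<forall>M::real^'d^'d. norm M \<le> C * (\<Sum>b\<in>X - {0}. norm (M *v b)))"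
	have shape0: "shape T - {0} = (\<lambda>x. - base T + x) ` (vs T - {base T})" if T: "T \<in> \<T>" for T
		unfolding shape_def by force
	have "\<forall>X\<in>shape ` \<T>. \<exists>C. ?P X C"
	proof
		fix X assume "X \<in> shape ` \<T>"
		then obtain T where T: "T \<in> \<T>" "X = shape T" by blast
		have "finite (X - {0})" unfolding T(2) shape_def using simplexD(4)[OF T(1)] by simp
		moreover have "span (X - {0}) = UNIV" unfolding T(2) shape0[OF T(1)] by (rule basisD(2)[OF T(1) base(1)[OF T(1)]])
		ultimately show "\<exists>C. ?P X C" using norm_matrix_le_basis[of "X - {0}"] by blast
	qed
	from bchoice[OF this] obtain Cf where Cf: "!!X. X \<in> shape ` \<T> ==> ?P X (Cf X)" by blast
	define C where "C = (\<Sum>X\<in>shape ` \<T>. Cf X) * CARD('d)"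
	have s0: "0 \<le> (\<Sum>X\<in>shape ` \<T>. Cf X)" using Cf by (intro sum_nonneg) blast
	have main: "norm (GT u T) \<le> C * dn St u (base T)" if T: "T \<in> \<T>" for T u
	proof -
		let ?B = "shape T - {0}"
		have le: "Cf (shape T) \<le> (\<Sum>X\<in>shape ` \<T>. Cf X)"
			using finite_shapes T Cf by (intro member_le_sum) auto
		have cardB: "card ?B \<le> CARD('d)"
		proof -
			have "card ?B \<le> card (vs T - {base T})" unfolding shape0[OF T] using simplexD(4)[OF T] by (intro card_image_le) auto
			then show ?thesis using simplexD(2,4)[OF T] base(1)[OF T] by simp
		qed
		have b: "norm (GT u T *v y) \<le> dn St u (base T)" if y: "y \<in> ?B" for y
		proof -
			obtain w where w: "w \<in> vs T" "w \<noteq> base T" "y = w - base T" using y unfolding shape0[OF T] by auto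
			have "GT u T *v y = I u w - I u (base T)"
				unfolding w(3) using GT_diff[OF T _ base(3)[OF T], of w u] vs_sub[OF T] w(1) by auto
			also have "\<dots> = u w - u (base T)" using interpolantD(2) simplexD(5)[OF T] w(1) base(2)[OF T] by (metis subsetD)
			finally have eq: "GT u T *v y = u (base T + y) - u (base T)" using w(3) by simp
			have "y \<in> St (base T)" unfolding w(3) using edge_in_St[OF T base(1)[OF T] w(1)] w(2) by auto
			then show ?thesis unfolding eq dn_alt using fin_St[OF base(2)[OF T]] by (intro member_le_L2_set) auto
		qed
		have "norm (GT u T) \<le> Cf (shape T) * (\<Sum>y\<in>?B. norm (GT u T *v y))" using Cf T by blast
		also have "\<dots> \<le> (\<Sum>X\<in>shape ` \<T>. Cf X) * (CARD('d) * dn St u (base T))"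
		proof (intro mult_mono le s0)
			have "(\<Sum>y\<in>?B. norm (GT u T *v y)) \<le> real (card ?B) * dn St u (base T)" using b by (rule sum_bounded_above)
			also have "\<dots> \<le> CARD('d) * dn St u (base T)" using cardB by (intro mult_right_mono) auto
			finally show "(\<Sum>y\<in>?B. norm (GT u T *v y)) \<le> CARD('d) * dn St u (base T)" .
		qed (auto intro: sum_nonneg)
		finally show ?thesis by (simp add: C_def)
	qed
	have "0 \<le> C" using s0 by (simp add: C_def)
	from that[OF this main] show thesis .
qed

lemma volume_bound: obtains \<mu> where "0 < \<mu>" "!!T. T \<in> \<T> ==> \<mu> \<le> measure lebesgue (interior T)"
proof -
	let ?m = "\<lambda>X. measure lebesgue (interior (convex hull X))"
	have tr: "interior T = (+) (base T) ` interior (convex hull (shape T))" if T: "T \<in> \<T>" for T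
	proof -
		have "vs T = (+) (base T) ` shape T" unfolding shape_def by force
		then have "T = (+) (base T) ` (convex hull (shape T))" using simplexD(3)[OF T] convex_hull_translation by metis
		then show ?thesis using interior_translation by metis
	qed
	have pos: "0 < ?m X" if X: "X \<in> shape ` \<T>" for X
	proof -
		obtain T where T: "T \<in> \<T>" "X = shape T" using X by blast
		have ne: "interior (convex hull X) \<noteq> {}" using tr[OF T(1)] simplexD(6)[OF T(1)] T(2) by auto
		then obtain x e where e: "0 < e" "ball x e \<subseteq> interior (convex hull X)" using open_contains_ball open_interior by blast
		have "finite X" unfolding T(2) shape_def using simplexD(4)[OF T(1)] by simp
		then have "bounded (interior (convex hull X))"
			using finite_imp_bounded_convex_hull bounded_subset interior_subset by metis
		then have "interior (convex hull X) \<in> lmeasurable" by (rule lmeasurable_open) simp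
		then have "measure lebesgue (ball x e) \<le> ?m X" using e by (intro measure_mono_fmeasurable) auto
		moreover have "0 < measure lebesgue (ball x e)" using content_ball_pos[OF e(1)] by simp
		ultimately show ?thesis by linarith
	qed
	define \<mu> where "\<mu> = Min (insert 1 (?m ` shape ` \<T>))"
	have f: "finite (insert 1 (?m ` shape ` \<T>))" using finite_shapes by simp
	have "0 < \<mu>" unfolding \<mu>_def using pos f by (subst Min_gr_iff) auto
	moreover have "\<mu> \<le> measure lebesgue (interior T)" if T: "T \<in> \<T>" for T
	proof -
		have "\<mu> \<le> ?m (shape T)" unfolding \<mu>_def using f T by (intro Min_le) auto
		then show ?thesis unfolding tr[OF T] measure_translation .
	qed
	ultimately show thesis by (rule that)
qed

text \<open>A nonempty set \<open>L \<inter> ball x r\<close> is moved into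
  \<open>ball 0 (2 * r)\<close> by subtracting one of its own points; the core adds a fixed finite
  number.\<close>

lemma uniform_count: "\<exists>N. \<forall>x. real (card (\<Lambda> \<inter> ball x r)) \<le> N"
proof (intro exI allI)
	fix x
	have "card (L \<inter> ball x r) \<le> card (L \<inter> ball 0 (2 * r))"
	proof (cases "L \<inter> ball x r = {}")
		case False
		then obtain y where y: "y \<in> L" "dist x y < r" by auto
		have "card (L \<inter> ball x r) = card ((\<lambda>z. z - y) ` (L \<inter> ball x r))" by (intro card_image[symmetric] inj_onI) simp
		also have "\<dots> \<le> card (L \<inter> ball 0 (2 * r))"
		proof (intro card_mono fin_ball subsetI)
			fix w assume "w \<in> (\<lambda>z. z - y) ` (L \<inter> ball x r)"
			then obtain z where z: "z \<in> L" "dist x z < r" "w = z - y" by auto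
			have "norm w \<le> dist x y + dist x z" unfolding z(3) using dist_triangle2[of z y x] by (simp add: dist_norm norm_minus_commute)
			then show "w \<in> L \<inter> ball 0 (2 * r)" using y z L_diff by simp
		qed
		finally show ?thesis .
	qed simp
	moreover have "card (\<Lambda> \<inter> ball x r) \<le> card ((\<Lambda> \<inter> ball 0 Rdef) \<union> (L \<inter> ball x r))"
	proof (intro card_mono finite_UnI fin_ball fin\<Lambda> subsetI)
		fix l assume l: "l \<in> \<Lambda> \<inter> ball x r"
		show "l \<in> (\<Lambda> \<inter> ball 0 Rdef) \<union> (L \<inter> ball x r)"
		proof (cases "Rdef \<le> norm l")
			case True
			then show ?thesis using far_iff[OF True] l by blast
		qed (use l in auto)
	qed
	moreover have "card ((\<Lambda> \<inter> ball 0 Rdef) \<union> (L \<inter> ball x r)) \<le> card (\<Lambda> \<inter> ball 0 Rdef) + card (L \<inter> ball x r)" by (rule card_Un_le)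
	ultimately show "real (card (\<Lambda> \<inter> ball x r)) \<le> real (card (\<Lambda> \<inter> ball 0 Rdef) + card (L \<inter> ball 0 (2 * r)))" by (intro of_nat_mono) linarith
qed

text \<open>Along a segment the interpolant has finitely many affine pieces on closed parameter
  sets, and a common Lipschitz constant on closed pieces covering an interval holds on the interval.
  The gradients that matter are those on simplices met by the segment.\<close>

lemma interpolant_lipschitz:
	assumes m: "!!T. T \<in> \<T> ==> T \<inter> closed_segment x y \<noteq> {} ==> norm (GT u T) \<le> m" and m0: "0 \<le> m"
	shows "norm (I u y - I u x) \<le> real (CARD('d) * CARD('d)) * m * norm (y - x)"
proof -
	define r where "r = norm (y - x) + 1"
	define \<gamma> where "\<gamma> t = x + t *\<^sub>R (y - x)" for t
	let ?J = "nb x r"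
	let ?U = "\<lambda>T. {t. 0 \<le> t \<and> t \<le> 1 \<and> \<gamma> t \<in> T}"
	have seg: "\<gamma> t \<in> closed_segment x y" if "0 \<le> t" "t \<le> 1" for t
		unfolding in_segment \<gamma>_def using that by (intro exI[of _ t]) (auto simp: algebra_simps)
	have K0: "0 \<le> real (CARD('d) * CARD('d)) * m * norm (y - x)" using m0 by simp
	have "(real (CARD('d) * CARD('d)) * m * norm (y - x))-lipschitz_on {0..1} (\<lambda>t. I u (\<gamma> t))"
	proof (rule lipschitz_on_closed_Union[where I="?J" and U="?U"])
		fix T assume T: "T \<in> ?J"
		then have TT: "T \<in> \<T>" by (simp add: nb_def)
		show "(real (CARD('d) * CARD('d)) * m * norm (y - x))-lipschitz_on (?U T) (\<lambda>t. I u (\<gamma> t))"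
		proof (rule lipschitz_onI[OF _ K0])
			fix s t assume s: "s \<in> ?U T" and t: "t \<in> ?U T"
			have "T \<inter> closed_segment x y \<noteq> {}" using s seg by blast
			then have gm: "norm (GT u T) \<le> m" by (rule m[OF TT])
			have "I u (\<gamma> s) - I u (\<gamma> t) = GT u T *v (\<gamma> s - \<gamma> t)" using s t by (intro GT_diff[OF TT]) auto
			then have "dist (I u (\<gamma> s)) (I u (\<gamma> t)) \<le> real (CARD('d) * CARD('d)) * norm (GT u T) * norm (\<gamma> s - \<gamma> t)"
				unfolding dist_norm using norm_matrix_vector_le[of "GT u T" "\<gamma> s - \<gamma> t"] by simp
			also have "\<gamma> s - \<gamma> t = (s - t) *\<^sub>R (y - x)" by (simp add: \<gamma>_def algebra_simps)
			also have "real (CARD('d) * CARD('d)) * norm (GT u T) * norm ((s - t) *\<^sub>R (y - x)) \<le> real (CARD('d) * CARD('d)) * m * norm ((s - t) *\<^sub>R (y - x))"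
				using gm by (intro mult_right_mono mult_left_mono) auto
			finally show "dist (I u (\<gamma> s)) (I u (\<gamma> t)) \<le> real (CARD('d) * CARD('d)) * m * norm (y - x) * dist s t"
				by (simp add: dist_norm mult_ac)
		qed
		have "closed T" using simplexD(7)[OF TT] by (rule compact_imp_closed)
		then have "closed ({0..1} \<inter> \<gamma> -` T)" unfolding \<gamma>_def by (intro closed_Int closed_vimage continuous_intros) auto
		moreover have "{0..1} \<inter> \<gamma> -` T = ?U T" by auto
		ultimately show "closed (?U T)" by simp
	next
		show "{0..1} \<subseteq> (\<Union>T\<in>?J. ?U T)"
		proof
			fix t :: real assume t: "t \<in> {0..1}"
			obtain T where T: "T \<in> \<T>" "\<gamma> t \<in> T" using cover by blast
			have "dist x (\<gamma> t) \<le> norm (y - x)" unfolding \<gamma>_def dist_norm using t mult_right_mono[of t 1 "norm (y - x)"] by simp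
			then have "\<gamma> t \<in> ball x r" by (simp add: r_def)
			then have "T \<in> ?J" using T unfolding nb_def by blast
			then show "t \<in> (\<Union>T\<in>?J. ?U T)" using t T by auto
		qed
	qed (use nb_fin K0 in auto)
	then have "dist (I u (\<gamma> 1)) (I u (\<gamma> 0)) \<le> real (CARD('d) * CARD('d)) * m * norm (y - x) * dist (1::real) 0" by (rule lipschitz_onD) auto
	then show ?thesis by (simp add: \<gamma>_def dist_norm)
qed

text \<open>Connectedness of the defective lattice comes from the mesh: the segment from
  \<open>x\<close> to \<open>y\<close> meets finitely many simplices, and the gradient on each is
  bounded by a stencil norm at its base vertex.\<close>

lemma near\<Lambda>:
	assumes x: "x \<in> \<Lambda>" and y: "y \<in> \<Lambda>"
	shows "near \<Lambda> St x y"
proof -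
	obtain C where C: "0 \<le> C" "!!T u. T \<in> \<T> ==> norm (GT u T) \<le> C * dn St u (base T)" using GT_bound by blast
	define J where "J = nb x (norm (y - x) + 1)"
	have J: "finite J" "J \<subseteq> \<T>" using nb_fin by (auto simp: J_def nb_def)
	have "norm (u x - u y) \<le> (real (CARD('d) * CARD('d)) * C * norm (y - x)) * (\<Sum>l\<in>base ` J. dn St u l)" for u
	proof -
		let ?m = "C * (\<Sum>l\<in>base ` J. dn St u l)"
		have "norm (I u y - I u x) \<le> real (CARD('d) * CARD('d)) * ?m * norm (y - x)"
		proof (rule interpolant_lipschitz)
			fix T assume T: "T \<in> \<T>" and s: "T \<inter> closed_segment x y \<noteq> {}"
			obtain z where z: "z \<in> T" "z \<in> closed_segment x y" using s by blast
			have "norm (z - x) \<le> norm (y - x)" using segment_bound(1)[OF z(2)] .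
			then have "z \<in> T \<inter> ball x (norm (y - x) + 1)" using z by (simp add: dist_norm norm_minus_commute)
			then have TJ: "T \<in> J" using T unfolding J_def nb_def by blast
			have "norm (GT u T) \<le> C * dn St u (base T)" by (rule C(2)[OF T])
			also have "\<dots> \<le> ?m" using C(1) J TJ by (intro mult_left_mono member_le_sum) auto
			finally show "norm (GT u T) \<le> ?m" .
		qed (use C in \<open>auto intro!: sum_nonneg mult_nonneg_nonneg\<close>)
		then show ?thesis using interpolantD(2) x y by (simp add: norm_minus_commute mult_ac)
	qed
	then show ?thesis unfolding near_def using J C base(2)
		by (intro exI[of _ "base ` J"] exI[of _ "real (CARD('d) * CARD('d)) * C * norm (y - x)"]) auto
qed

sublocale N: net \<Lambda> St
proof
	show "\<Lambda> \<noteq> {}" using base(2) cover by blast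
qed (use fin_St St_\<Lambda> near\<Lambda> in auto)

text \<open>Local converse of \<open>GT_bound\<close>: a stencil vector is shorter than
  \<open>rcut\<close>, so the segment along it meets simplices of \<open>nb l rcut\<close>
  only.\<close>

lemma dn_le_gradients:
	obtains C where "0 \<le> C" "!!l u. l \<in> \<Lambda> ==> (dn St u l)\<^sup>2 \<le> C * (\<Sum>T\<in>nb l rcut. (norm (GT u T))\<^sup>2)"
proof -
	obtain N where N: "!!x. real (card (\<Lambda> \<inter> ball x rcut)) \<le> N" using uniform_count by blast
	have N0: "0 \<le> N" using N[of 0] by (meson of_nat_0_le_iff order_trans)
	define C where "C = N * (real (CARD('d) * CARD('d)) * rcut)\<^sup>2"
	have main: "(dn St u l)\<^sup>2 \<le> C * (\<Sum>T\<in>nb l rcut. (norm (GT u T))\<^sup>2)" if l: "l \<in> \<Lambda>" for l u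
	proof -
		define m where "m = L2_set (\<lambda>T. norm (GT u T)) (nb l rcut)"
		have m0: "0 \<le> m" by (simp add: m_def)
		have one: "(norm (u (l + \<rho>) - u l))\<^sup>2 \<le> (real (CARD('d) * CARD('d)) * rcut)\<^sup>2 * m\<^sup>2" if \<rho>: "\<rho> \<in> St l" for \<rho>
		proof -
			have "norm (I u (l + \<rho>) - I u l) \<le> real (CARD('d) * CARD('d)) * m * norm (l + \<rho> - l)"
			proof (rule interpolant_lipschitz[OF _ m0])
				fix T assume T: "T \<in> \<T>" and s: "T \<inter> closed_segment l (l + \<rho>) \<noteq> {}"
				obtain z where z: "z \<in> T" "z \<in> closed_segment l (l + \<rho>)" using s by blast
				have "norm (z - l) \<le> norm \<rho>" using segment_bound(1)[OF z(2)] by simp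
				then have "z \<in> T \<inter> ball l rcut" using z St_norm[OF l \<rho>] by (simp add: dist_norm norm_minus_commute)
				then have "T \<in> nb l rcut" using T unfolding nb_def by blast
				then show "norm (GT u T) \<le> m" unfolding m_def using nb_fin by (intro member_le_L2_set) auto
			qed
			also have "\<dots> \<le> real (CARD('d) * CARD('d)) * m * rcut" using St_norm[OF l \<rho>] m0 by (intro mult_left_mono) auto
			finally have "norm (u (l + \<rho>) - u l) \<le> real (CARD('d) * CARD('d)) * rcut * m" using interpolantD(2) l St_\<Lambda>[OF l \<rho>] by (simp add: mult_ac)
			then have "(norm (u (l + \<rho>) - u l))\<^sup>2 \<le> (real (CARD('d) * CARD('d)) * rcut * m)\<^sup>2" by (rule power_mono) simp
			then show ?thesis by (simp add: power_mult_distrib)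
		qed
		have "card (St l) \<le> card (\<Lambda> \<inter> ball l rcut)"
			by (rule card_inj_on_le[of "\<lambda>\<rho>. l + \<rho>"]) (use St_norm[OF l] St_\<Lambda>[OF l] fin\<Lambda> in \<open>auto simp: dist_norm inj_on_def\<close>)
		then have cS: "real (card (St l)) \<le> N" using N[of l] by linarith
		have "(dn St u l)\<^sup>2 = (\<Sum>\<rho>\<in>St l. (norm (u (l + \<rho>) - u l))\<^sup>2)" unfolding dn_alt L2_set_def by (simp add: sum_nonneg)
		also have "\<dots> \<le> real (card (St l)) * ((real (CARD('d) * CARD('d)) * rcut)\<^sup>2 * m\<^sup>2)" using one by (rule sum_bounded_above)
		also have "\<dots> \<le> N * ((real (CARD('d) * CARD('d)) * rcut)\<^sup>2 * m\<^sup>2)" using cS by (intro mult_right_mono) auto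
		also have "\<dots> = C * (\<Sum>T\<in>nb l rcut. (norm (GT u T))\<^sup>2)" unfolding C_def m_def L2_set_def by (simp add: sum_nonneg)
		finally show ?thesis .
	qed
	have "0 \<le> C" using N0 by (simp add: C_def)
	from that[OF this main] show thesis .
qed

lemma interior_disjoint:
	assumes "T \<in> \<T>" "T' \<in> \<T>" "T \<noteq> T'"
	shows "interior T \<inter> interior T' = {}"
proof -
	have ne: "vs T \<noteq> vs T'" using T_inj assms unfolding inj_on_def by blast
	have "\<not> vs T \<subseteq> vs T'" using ne card_subset_eq[OF simplexD(4)[OF assms(2)], of "vs T"] simplexD(2)[OF assms(1)] simplexD(2)[OF assms(2)] by auto
	then have "vs T \<inter> vs T' \<subset> vs T" by blast
	then have "card (vs T \<inter> vs T') < card (vs T)" by (rule psubset_card_mono[OF simplexD(4)[OF assms(1)]])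
	then have "card (vs T \<inter> vs T') \<le> DIM(real^'d)" using simplexD(2)[OF assms(1)] by simp
	then have "interior (convex hull (vs T \<inter> vs T')) = {}" using simplexD(4)[OF assms(1)] by (intro empty_interior_convex_hull) auto
	then show ?thesis using T_Int[OF assms(1,2)] by (metis interior_Int)
qed

lemma interior_lmeasurable: "T \<in> \<T> ==> interior T \<in> lmeasurable"
	by (intro lmeasurable_open open_interior bounded_subset[OF compact_imp_bounded[OF simplexD(7)] interior_subset])

lemma W12_D: "u \<in> W_12 \<T> \<Lambda> ==> integrable lebesgue (\<lambda>x. (norm (grad \<T> \<Lambda> u x))\<^sup>2)"
	by (simp add: W_12_def)

text \<open>Simplices have disjoint interiors of volume at least \<mu>, on which the gradient is
  constant, and those meeting the ball of radius \<open>rcut\<close> lie in the ball of twice that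
  radius.\<close>

lemma local_energy:
	assumes \<mu>: "!!T. T \<in> \<T> ==> \<mu> \<le> measure lebesgue (interior T)" and u: "u \<in> W_12 \<T> \<Lambda>"
	shows "\<mu> * (\<Sum>T\<in>nb l rcut. (norm (GT u T))\<^sup>2) \<le> (LINT x|lebesgue. indicator (ball l (2 * rcut)) x * (norm (grad \<T> \<Lambda> u x))\<^sup>2)"
proof -
	let ?g = "\<lambda>x. (norm (grad \<T> \<Lambda> u x))\<^sup>2"
	note g = W12_D[OF u]
	have nbT: "T \<in> \<T>" if "T \<in> nb l rcut" for T using that by (simp add: nb_def)
	have int1: "integrable lebesgue (\<lambda>x. indicator (interior T) x * ?g x)" if "T \<in> \<T>" for T
		using integrable_mult_indicator[OF fmeasurableD[OF interior_lmeasurable[OF that]] g] by simp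
	have int2: "integrable lebesgue (\<lambda>x. indicator (ball l (2 * rcut)) x * ?g x)"
		using integrable_mult_indicator[OF _ g, of "ball l (2 * rcut)"] by simp
	have "\<mu> * (\<Sum>T\<in>nb l rcut. (norm (GT u T))\<^sup>2) \<le> (\<Sum>T\<in>nb l rcut. (LINT x|lebesgue. indicator (interior T) x * ?g x))"
		unfolding sum_distrib_left
	proof (rule sum_mono)
		fix T assume T: "T \<in> nb l rcut"
		have "\<mu> * (norm (GT u T))\<^sup>2 \<le> measure lebesgue (interior T) * (norm (GT u T))\<^sup>2"
			using \<mu>[OF nbT[OF T]] by (intro mult_right_mono) auto
		also have "\<dots> = (LINT x|lebesgue. indicator (interior T) x * (norm (GT u T))\<^sup>2)" by simp
		also have "\<dots> = (LINT x|lebesgue. indicator (interior T) x * ?g x)"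
			using grad_interior(2)[OF nbT[OF T]] by (intro Bochner_Integration.integral_cong) (auto simp: indicator_def)
		finally show "\<mu> * (norm (GT u T))\<^sup>2 \<le> (LINT x|lebesgue. indicator (interior T) x * ?g x)" .
	qed
	also have "\<dots> = (LINT x|lebesgue. (\<Sum>T\<in>nb l rcut. indicator (interior T) x * ?g x))"
		using int1 nbT by (intro Bochner_Integration.integral_sum[symmetric]) auto
	also have "\<dots> \<le> (LINT x|lebesgue. indicator (ball l (2 * rcut)) x * ?g x)"
	proof (rule integral_mono)
		show "integrable lebesgue (\<lambda>x. \<Sum>T\<in>nb l rcut. indicator (interior T) x * ?g x)"
			using int1 nbT by (intro Bochner_Integration.integrable_sum) auto
		show "(\<Sum>T\<in>nb l rcut. indicator (interior T) x * ?g x) \<le> indicator (ball l (2 * rcut)) x * ?g x" for x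
		proof (cases "\<exists>T\<in>nb l rcut. x \<in> interior T")
			case True
			then obtain T where T: "T \<in> nb l rcut" "x \<in> interior T" by blast
			have "x \<notin> interior T'" if "T' \<in> nb l rcut - {T}" for T'
				using interior_disjoint[OF nbT[OF T(1)] nbT[of T']] that T(2) by blast
			then have "(\<Sum>T\<in>nb l rcut. indicator (interior T) x * ?g x) = indicator (interior T) x * ?g x"
				using T(1) nb_fin by (subst sum.remove[OF nb_fin T(1)]) (simp add: sum.neutral)
			moreover have "x \<in> ball l (2 * rcut)" using subsetD[OF nb_sub[OF T(1)] subsetD[OF interior_subset T(2)]] by simp
			ultimately show ?thesis using T by simp
		next
			case False
			then have "(\<Sum>T\<in>nb l rcut. indicator (interior T) x * ?g x) = 0" by (intro sum.neutral) (auto simp: indicator_def)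
			then show ?thesis by simp
		qed
	qed (rule int2)
	finally show ?thesis .
qed

lemma W_norm_sq: "(W_norm \<T> \<Lambda> u)\<^sup>2 = (LINT x|lebesgue. (norm (grad \<T> \<Lambda> u x))\<^sup>2)"
	unfolding W_norm_def L2_norm_def by simp

lemma W_norm_nonneg [simp]: "0 \<le> W_norm \<T> \<Lambda> u"
	unfolding W_norm_def L2_norm_def by simp

text \<open>Summing \<open>local_energy\<close> over the sites counts each point of space at most
  \<open>N\<close> times.\<close>

lemma Dn_le_W_norm: obtains C where "0 < C" "!!u. u \<in> W_12 \<T> \<Lambda> ==> u \<in> Wd \<Lambda> St \<and> Dn \<Lambda> St u \<le> C * W_norm \<T> \<Lambda> u"
proof -
	obtain C where C: "0 \<le> C" "!!l u. l \<in> \<Lambda> ==> (dn St u l)\<^sup>2 \<le> C * (\<Sum>T\<in>nb l rcut. (norm (GT u T))\<^sup>2)" using dn_le_gradients by blast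
	obtain \<mu> where \<mu>: "0 < \<mu>" "!!T. T \<in> \<T> ==> \<mu> \<le> measure lebesgue (interior T)" using volume_bound by blast
	obtain N where N: "!!x. real (card (\<Lambda> \<inter> ball x (2 * rcut))) \<le> N" using uniform_count by blast
	have N0: "0 \<le> N" using N[of 0] by (meson of_nat_0_le_iff order_trans)
	define K where "K = C / \<mu> * N + 1"
	have K0: "0 < K" using C(1) \<mu>(1) N0 unfolding K_def by (intro add_nonneg_pos) auto
	have main: "u \<in> Wd \<Lambda> St \<and> Dn \<Lambda> St u \<le> sqrt K * W_norm \<T> \<Lambda> u" if u: "u \<in> W_12 \<T> \<Lambda>" for u
	proof -
		let ?g = "\<lambda>x. (norm (grad \<T> \<Lambda> u x))\<^sup>2"
		note g = W12_D[OF u]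
		let ?E = "LINT x|lebesgue. ?g x"
		have int2: "integrable lebesgue (\<lambda>x. indicator (ball l (2 * rcut)) x * ?g x)" for l
			using integrable_mult_indicator[OF _ g, of "ball l (2 * rcut)"] by simp
		have E0: "0 \<le> ?E" by simp
		have "L2_set (dn St u) F \<le> sqrt K * W_norm \<T> \<Lambda> u" if F: "finite F" "F \<subseteq> \<Lambda>" for F
		proof -
			have "(\<Sum>l\<in>F. (dn St u l)\<^sup>2) \<le> (\<Sum>l\<in>F. C / \<mu> * (LINT x|lebesgue. indicator (ball l (2 * rcut)) x * ?g x))"
			proof (rule sum_mono)
				fix l assume l: "l \<in> F"
				have "(dn St u l)\<^sup>2 \<le> C * (\<Sum>T\<in>nb l rcut. (norm (GT u T))\<^sup>2)" using C(2) l F by blast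
				also have "\<dots> = C / \<mu> * (\<mu> * (\<Sum>T\<in>nb l rcut. (norm (GT u T))\<^sup>2))" using \<mu>(1) by simp
				also have "\<dots> \<le> C / \<mu> * (LINT x|lebesgue. indicator (ball l (2 * rcut)) x * ?g x)"
					using C(1) \<mu>(1) by (intro mult_left_mono local_energy[OF \<mu>(2) u]) auto
				finally show "(dn St u l)\<^sup>2 \<le> C / \<mu> * (LINT x|lebesgue. indicator (ball l (2 * rcut)) x * ?g x)" .
			qed
			also have "\<dots> = C / \<mu> * (LINT x|lebesgue. (\<Sum>l\<in>F. indicator (ball l (2 * rcut)) x * ?g x))"
				unfolding sum_distrib_left[symmetric] using int2 by (subst Bochner_Integration.integral_sum) auto
			also have "\<dots> \<le> C / \<mu> * (LINT x|lebesgue. N * ?g x)"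
			proof (intro mult_left_mono integral_mono)
				show "integrable lebesgue (\<lambda>x. \<Sum>l\<in>F. indicator (ball l (2 * rcut)) x * ?g x)" using int2 by (intro Bochner_Integration.integrable_sum) auto
				show "integrable lebesgue (\<lambda>x. N * ?g x)" using g by simp
				show "(\<Sum>l\<in>F. indicator (ball l (2 * rcut)) x * ?g x) \<le> N * ?g x" for x
				proof -
					have "(\<Sum>l\<in>F. indicator (ball l (2 * rcut)) x :: real) = (\<Sum>l\<in>F \<inter> ball x (2 * rcut). 1)"
						unfolding sum.inter_restrict[OF F(1)] by (intro sum.cong) (auto simp: indicator_def dist_commute)
					also have "\<dots> = real (card (F \<inter> ball x (2 * rcut)))" by simp
					also have "\<dots> \<le> real (card (\<Lambda> \<inter> ball x (2 * rcut)))" using F fin\<Lambda> by (intro of_nat_mono card_mono) auto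
					also have "\<dots> \<le> N" by (rule N)
					finally show ?thesis unfolding sum_distrib_right[symmetric] by (intro mult_right_mono) auto
				qed
			qed (use C(1) \<mu>(1) in simp)
			also have "\<dots> = (C / \<mu> * N) * ?E" by simp
			also have "\<dots> \<le> K * ?E" using E0 unfolding K_def by (intro mult_right_mono) auto
			finally have "sqrt (\<Sum>l\<in>F. (dn St u l)\<^sup>2) \<le> sqrt (K * (W_norm \<T> \<Lambda> u)\<^sup>2)" unfolding W_norm_sq by (rule real_sqrt_le_mono)
			then show ?thesis unfolding L2_set_def by (simp add: real_sqrt_mult)
		qed
		from l2_boundedI[OF this] show ?thesis by (simp add: Wd_def Dn_def)
	qed
	have "0 < sqrt K" using K0 by simp
	from that[OF this main] show thesis .
qed

text \<open>At almost every point the squared gradient is below a sum of multiples of indicators of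
  balls centred at the sites; countability of the lattice allows integration term by term.\<close>

lemma W_norm_le_Dn: obtains C where "0 < C" "!!u. u \<in> Wd \<Lambda> St ==> u \<in> W_12 \<T> \<Lambda> \<and> W_norm \<T> \<Lambda> u \<le> C * Dn \<Lambda> St u"
proof -
	obtain C where C: "0 \<le> C" "!!T u. T \<in> \<T> ==> norm (GT u T) \<le> C * dn St u (base T)" using GT_bound by blast
	define v where "v = measure lebesgue (ball (0::real^'d) rcut)"
	have v0: "0 \<le> v" by (simp add: v_def)
	define K where "K = C\<^sup>2 * v + 1"
	have K0: "0 < K" using v0 unfolding K_def by (intro add_nonneg_pos) auto
	have main: "u \<in> W_12 \<T> \<Lambda> \<and> W_norm \<T> \<Lambda> u \<le> sqrt K * Dn \<Lambda> St u" if u: "u \<in> Wd \<Lambda> St" for u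
	proof -
		let ?g = "\<lambda>x. (norm (grad \<T> \<Lambda> u x))\<^sup>2"
		have meas: "?g \<in> borel_measurable lebesgue" using grad_measurable[of u] by simp
		let ?h = "\<lambda>l x. ennreal (C\<^sup>2 * (dn St u l)\<^sup>2) * indicator (ball l rcut) x"
		have "AE x in lebesgue. ennreal (?g x) \<le> (\<integral>\<^sup>+ l. ?h l x \<partial>count_space \<Lambda>)"
			using AE_interior
		proof (rule AE_mp, intro AE_I2 impI)
			fix x assume "\<exists>T\<in>\<T>. x \<in> interior T"
			then obtain T where T: "T \<in> \<T>" "x \<in> interior T" by blast
			have xT: "x \<in> T" using T(2) interior_subset by blast
			have "norm (grad \<T> \<Lambda> u x) \<le> C * dn St u (base T)" unfolding grad_interior(2)[OF T] by (rule C(2)[OF T(1)])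
			then have "?g x \<le> (C * dn St u (base T))\<^sup>2" by (rule power_mono) simp
			then have "ennreal (?g x) \<le> ennreal (C\<^sup>2 * (dn St u (base T))\<^sup>2)" by (intro ennreal_leI) (simp add: power_mult_distrib)
			also have "\<dots> = ?h (base T) x"
				using T_sub_ball[OF T(1) base(3)[OF T(1)]] xT by (auto simp: indicator_def)
			also have "\<dots> \<le> (\<integral>\<^sup>+ l. ?h l x \<partial>count_space \<Lambda>)" by (rule nn_integral_ge_point[OF base(2)[OF T(1)]])
			finally show "ennreal (?g x) \<le> (\<integral>\<^sup>+ l. ?h l x \<partial>count_space \<Lambda>)" .
		qed
		then have "(\<integral>\<^sup>+ x. ennreal (?g x) \<partial>lebesgue) \<le> (\<integral>\<^sup>+ x. (\<integral>\<^sup>+ l. ?h l x \<partial>count_space \<Lambda>) \<partial>lebesgue)" by (rule nn_integral_mono_AE)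
		also have "\<dots> = (\<integral>\<^sup>+ l. (\<integral>\<^sup>+ x. ?h l x \<partial>lebesgue) \<partial>count_space \<Lambda>)"
			by (rule nn_integral_count_space_nn_integral[OF countable\<Lambda>]) (intro borel_measurable_times_ennreal borel_measurable_const borel_measurable_indicator, simp)
		\<comment> \<open>Here K = C^2 v + 1, and the subtracted square undoes the 1 that keeps
		  \<open>K\<close> positive.\<close>
		also have "\<dots> = (\<integral>\<^sup>+ l. ennreal (K * (dn St u l)\<^sup>2 - (dn St u l)\<^sup>2) \<partial>count_space \<Lambda>)"
		proof (rule nn_integral_cong)
			fix l :: "real^'d"
			have "emeasure lebesgue (ball l rcut) = ennreal v"
			proof -
				have "measure lebesgue (ball l rcut) = v" unfolding v_def using measure_translation[of l "ball 0 rcut"] by (simp only: ball_translation[symmetric] add_0_right)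
				then show ?thesis using emeasure_eq_measure2[of "ball l rcut" lebesgue] lmeasurable_ball[of l rcut] by (simp add: fmeasurable_def emeasure_eq_ennreal_measure top.not_eq_extremum)
			qed
			then have "(\<integral>\<^sup>+ x. ?h l x \<partial>lebesgue) = ennreal (C\<^sup>2 * (dn St u l)\<^sup>2) * ennreal v"
				by (subst nn_integral_cmult_indicator) auto
			also have "\<dots> = ennreal (K * (dn St u l)\<^sup>2 - (dn St u l)\<^sup>2)" using v0 by (simp add: ennreal_mult[symmetric] K_def algebra_simps)
			finally show "(\<integral>\<^sup>+ x. ?h l x \<partial>lebesgue) = ennreal (K * (dn St u l)\<^sup>2 - (dn St u l)\<^sup>2)" .
		qed
		also have "\<dots> \<le> (\<integral>\<^sup>+ l. ennreal (K * (dn St u l)\<^sup>2) \<partial>count_space \<Lambda>)" by (intro nn_integral_mono ennreal_leI) simp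
		also have "\<dots> = ennreal (K * (Dn \<Lambda> St u)\<^sup>2)"
		proof -
			have s: "(\<lambda>l. K * (dn St u l)\<^sup>2) summable_on \<Lambda>" using u by (intro summable_on_cmult_right) (simp add: Wd_def l2_def)
			have "Infinite_Set_Sum.abs_summable_on (\<lambda>l. K * (dn St u l)\<^sup>2) \<Lambda>"
				using s K0 by (simp add: abs_summable_equivalent[symmetric] abs_mult)
			then have "(\<integral>\<^sup>+ l. ennreal (K * (dn St u l)\<^sup>2) \<partial>count_space \<Lambda>) = ennreal (\<Sum>\<^sub>\<infinity>l\<in>\<Lambda>. K * (dn St u l)\<^sup>2)"
				using K0 by (subst nn_integral_conv_infsetsum) (auto simp: infsetsum_infsum)
			also have "(\<Sum>\<^sub>\<infinity>l\<in>\<Lambda>. K * (dn St u l)\<^sup>2) = K * (Dn \<Lambda> St u)\<^sup>2" unfolding Dn_def n2_sq by (rule infsum_cmult_right')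
			finally show ?thesis .
		qed
		finally have le: "(\<integral>\<^sup>+ x. ennreal (?g x) \<partial>lebesgue) \<le> ennreal (K * (Dn \<Lambda> St u)\<^sup>2)" .
		have int: "integrable lebesgue ?g"
		proof (rule integrableI_bounded[OF meas])
			have "(\<integral>\<^sup>+ x. ennreal (norm (?g x)) \<partial>lebesgue) \<le> ennreal (K * (Dn \<Lambda> St u)\<^sup>2)" using le by simp
			then show "(\<integral>\<^sup>+ x. ennreal (norm (?g x)) \<partial>lebesgue) < \<infinity>" by (rule le_less_trans) simp
		qed
		have "ennreal (LINT x|lebesgue. ?g x) \<le> ennreal (K * (Dn \<Lambda> St u)\<^sup>2)" using le nn_integral_eq_integral[OF int] by simp
		then have "(W_norm \<T> \<Lambda> u)\<^sup>2 \<le> K * (Dn \<Lambda> St u)\<^sup>2" unfolding W_norm_sq using K0 by (subst (asm) ennreal_le_iff) auto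
		then have "sqrt ((W_norm \<T> \<Lambda> u)\<^sup>2) \<le> sqrt (K * (Dn \<Lambda> St u)\<^sup>2)" by (rule real_sqrt_le_mono)
		then have "W_norm \<T> \<Lambda> u \<le> sqrt K * Dn \<Lambda> St u" by (simp add: real_sqrt_mult)
		then show ?thesis using int grad_measurable by (simp add: W_12_def)
	qed
	have "0 < sqrt K" using K0 by simp
	from that[OF this main] show thesis .
qed

lemma W_12_eq: "W_12 \<T> \<Lambda> = Wd \<Lambda> St"
proof -
	obtain C :: real where "!!u. u \<in> W_12 \<T> \<Lambda> ==> u \<in> Wd \<Lambda> St \<and> Dn \<Lambda> St u \<le> C * W_norm \<T> \<Lambda> u" using Dn_le_W_norm by blast
	moreover obtain C' :: real where "!!u. u \<in> Wd \<Lambda> St ==> u \<in> W_12 \<T> \<Lambda> \<and> W_norm \<T> \<Lambda> u \<le> C' * Dn \<Lambda> St u" using W_norm_le_Dn by blast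
	ultimately show ?thesis by (intro equalityI subsetI) simp_all
qed

lemma L2_norm_cong_AE:
	assumes "AE x in lebesgue. norm (F x) = norm (G x)" "F \<in> borel_measurable lebesgue" "G \<in> borel_measurable lebesgue"
	shows "L2_norm F = L2_norm G"
proof -
	have "(LINT x|lebesgue. (norm (F x))\<^sup>2) = (LINT x|lebesgue. (norm (G x))\<^sup>2)"
	proof (rule integral_cong_AE)
		show "AE x in lebesgue. (norm (F x))\<^sup>2 = (norm (G x))\<^sup>2" using assms(1) by (rule AE_mp) (auto intro!: AE_I2)
	qed (use assms(2,3) in simp_all)
	then show ?thesis by (simp add: L2_norm_def)
qed

lemma W_norm_diff: "L2_norm (\<lambda>x. grad \<T> \<Lambda> u x - grad \<T> \<Lambda> v x) = W_norm \<T> \<Lambda> (u .- v)"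
	unfolding W_norm_def
proof (rule L2_norm_cong_AE)
	show "AE x in lebesgue. norm (grad \<T> \<Lambda> u x - grad \<T> \<Lambda> v x) = norm (grad \<T> \<Lambda> (u .- v) x)"
		using grad_lin_AE[of 1 u "-1" v] by (rule AE_mp) (auto intro!: AE_I2)
qed (use grad_measurable in auto)

lemma W_norm_scale: "W_norm \<T> \<Lambda> (\<lambda>x. a *\<^sub>R u x) = \<bar>a\<bar> * W_norm \<T> \<Lambda> u"
proof -
	have "W_norm \<T> \<Lambda> (\<lambda>x. a *\<^sub>R u x) = L2_norm (\<lambda>x. a *\<^sub>R grad \<T> \<Lambda> u x)"
		unfolding W_norm_def
	proof (rule L2_norm_cong_AE)
		show "AE x in lebesgue. norm (grad \<T> \<Lambda> (\<lambda>x. a *\<^sub>R u x) x) = norm (a *\<^sub>R grad \<T> \<Lambda> u x)"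
			using grad_lin_AE[of a u 0 u] by (rule AE_mp) (auto intro!: AE_I2)
	qed (use grad_measurable in auto)
	also have "\<dots> = \<bar>a\<bar> * W_norm \<T> \<Lambda> u"
		unfolding W_norm_def L2_norm_def by (simp add: power_mult_distrib real_sqrt_mult)
	finally show ?thesis .
qed

lemma seminormed_W12: "seminormed (W_12 \<T> \<Lambda>) (W_norm \<T> \<Lambda>)"
proof
	show "(lcomb a u b v) \<in> W_12 \<T> \<Lambda>" if "u \<in> W_12 \<T> \<Lambda>" "v \<in> W_12 \<T> \<Lambda>" for u v a b
		using that unfolding W_12_eq by (rule Wd_lin)
	show "0 \<le> W_norm \<T> \<Lambda> v" for v by (rule W_norm_nonneg)
	show "W_norm \<T> \<Lambda> (\<lambda>x. a *\<^sub>R v x) = \<bar>a\<bar> * W_norm \<T> \<Lambda> v" for v a by (rule W_norm_scale)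
qed

text \<open>On a locally finite lattice finite support means bounded support, and a bounded set has
  compact closure; the comparisons between \<open>GT\<close> and \<open>dn\<close> are local, so
  they carry boundedness of supports both ways.\<close>

lemma W_c_eq: "W_c \<T> \<Lambda> = Wdc \<Lambda> St"
proof (intro equalityI subsetI)
	fix u assume "u \<in> W_c \<T> \<Lambda>"
	then have "bounded (closure {x. grad \<T> \<Lambda> u x \<noteq> 0})" by (simp add: W_c_def compact_imp_bounded)
	then have "bounded {x. grad \<T> \<Lambda> u x \<noteq> 0}" using bounded_subset closure_subset by metis
	then obtain r where r: "!!x. grad \<T> \<Lambda> u x \<noteq> 0 ==> norm x \<le> r" unfolding bounded_iff by blast
	have G0: "GT u T = 0" if T: "T \<in> \<T>" and far: "!!x. x \<in> T ==> r < norm x" for T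
	proof -
		obtain x where x: "x \<in> interior T" using simplexD(6)[OF T] by blast
		then have "r < norm x" using far interior_subset by blast
		then show ?thesis using grad_interior(2)[OF T x] r[of x] by force
	qed
	obtain C where C: "0 \<le> C" "!!l u. l \<in> \<Lambda> ==> (dn St u l)\<^sup>2 \<le> C * (\<Sum>T\<in>nb l rcut. (norm (GT u T))\<^sup>2)" using dn_le_gradients by blast
	have "dn St u l = 0" if l: "l \<in> \<Lambda>" and far: "r + 2 * rcut \<le> norm l" for l
	proof -
		have "GT u T = 0" if T: "T \<in> nb l rcut" for T
		proof (rule G0)
			show "T \<in> \<T>" using T by (simp add: nb_def)
			fix x assume "x \<in> T"
			then have "norm (l - x) < 2 * rcut" using nb_sub[OF T] by (auto simp: dist_norm)
			then show "r < norm x" using far norm_triangle_ineq2[of l x] by linarith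
		qed
		then have "(dn St u l)\<^sup>2 \<le> 0" using C(2)[OF l, of u] by simp
		then show ?thesis by simp
	qed
	then have "{l \<in> \<Lambda>. dn St u l \<noteq> 0} \<subseteq> \<Lambda> \<inter> ball 0 (r + 2 * rcut)" by (auto simp: not_le[symmetric])
	then show "u \<in> Wdc \<Lambda> St" unfolding Wdc_def using fin\<Lambda> finite_subset by blast
next
	fix u assume "u \<in> Wdc \<Lambda> St"
	then have "bounded {l \<in> \<Lambda>. dn St u l \<noteq> 0}" unfolding Wdc_def by (simp add: finite_imp_bounded)
	then obtain r where r: "!!l. l \<in> \<Lambda> ==> dn St u l \<noteq> 0 ==> norm l \<le> r" unfolding bounded_iff by blast
	obtain C where C: "0 \<le> C" "!!T u. T \<in> \<T> ==> norm (GT u T) \<le> C * dn St u (base T)" using GT_bound by blast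
	\<comment> \<open>Points on simplex boundaries count for the support as well, so the interpolant is
	  shown to be constant on a whole ball around \<open>x\<close>.\<close>
	have "grad \<T> \<Lambda> u x = 0" if far: "r + rcut + 2 \<le> norm x" for x
	proof -
		have "I u y = I u x" if y: "y \<in> ball x 1" for y
		proof -
			have "norm (I u y - I u x) \<le> real (CARD('d) * CARD('d)) * 0 * norm (y - x)"
			proof (rule interpolant_lipschitz)
				fix T assume T: "T \<in> \<T>" and s: "T \<inter> closed_segment x y \<noteq> {}"
				obtain z where z: "z \<in> T" "z \<in> closed_segment x y" using s by blast
				have "norm (z - x) < 1" using segment_bound(1)[OF z(2)] y by (simp add: dist_norm norm_minus_commute)
				moreover have "norm (base T - z) < rcut" using T_sub_ball[OF T z(1)] base(3)[OF T] by (auto simp: dist_norm norm_minus_commute)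
				moreover have "norm x \<le> norm (base T) + norm (base T - z) + norm (z - x)"
					using norm_triangle_ineq4[of "base T" "base T - z"] norm_triangle_ineq4[of z "z - x"] by simp
				ultimately have "r < norm (base T)" using far by linarith
				then have "dn St u (base T) = 0" using r[OF base(2)[OF T]] by force
				then show "norm (GT u T) \<le> 0" using C(2)[OF T, of u] by simp
			qed simp
			then show ?thesis by simp
		qed
		then have eq: "I u x = I u y" if "y \<in> ball x 1" for y using that by metis
		have "(I u has_derivative (\<lambda>h. 0)) (at x)"
			by (rule has_derivative_transform_within_open[OF has_derivative_const open_ball _ eq]) simp_all
		then have "frechet_derivative (I u) (at x) = (\<lambda>h. 0)" by (rule frechet_derivative_at[symmetric])
		then show ?thesis unfolding grad_def jacobian_def by (simp add: matrix_def vec_eq_iff)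
	qed
	then have "{x. grad \<T> \<Lambda> u x \<noteq> 0} \<subseteq> ball 0 (r + rcut + 2)" by (auto simp: not_le[symmetric])
	then have "bounded {x. grad \<T> \<Lambda> u x \<noteq> 0}" using bounded_subset bounded_ball by blast
	then show "u \<in> W_c \<T> \<Lambda>" unfolding W_c_def by (simp add: compact_closure)
qed

end

section \<open>Patching lattice functions and the extended energies\<close>

text \<open>Compares square-summable families over two lattices that agree outside finite sets; on
  the exceptional set \<open>Y0\<close> finitely many values of \<open>f\<close> must control
  \<open>g\<close>. The constant is quantified before \<open>f\<close> and \<open>g\<close>, so that
  it serves all lattice functions at once.\<close>

lemma l2_transfer:
	fixes f :: "'a => real" and g :: "'a => real"
	assumes F: "finite F" "F \<subseteq> X" and Y: "finite Y0" "Y - Y0 \<subseteq> X" and C: "0 \<le> C"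
	shows "\<exists>C'\<ge>0. \<forall>f g. l2 X f --> (\<forall>l\<in>Y - Y0. \<bar>g l\<bar> \<le> \<bar>f l\<bar>) --> (\<forall>l\<in>Y0. \<bar>g l\<bar> \<le> C * (\<Sum>l\<in>F. \<bar>f l\<bar>)) -->
		l2 Y g \<and> n2 Y g \<le> C' * n2 X (f :: 'a => real)"
proof (intro exI conjI allI impI)
	let ?C = "real (card Y0) * (C * real (card F)) + 1"
	show C': "0 \<le> ?C" using C by simp
	fix f g :: "'a => real"
	assume f: "l2 X f" and 1: "\<forall>l\<in>Y - Y0. \<bar>g l\<bar> \<le> \<bar>f l\<bar>" and 2: "\<forall>l\<in>Y0. \<bar>g l\<bar> \<le> C * (\<Sum>l\<in>F. \<bar>f l\<bar>)"
	have "(\<Sum>l\<in>F. \<bar>f l\<bar>) \<le> real (card F) * n2 X f"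
		using abs_le_n2[OF f] F by (intro sum_bounded_above) blast
	then have 3: "C * (\<Sum>l\<in>F. \<bar>f l\<bar>) \<le> C * (real (card F) * n2 X f)" using C by (rule mult_left_mono)
	have core: "(\<Sum>l\<in>Y0. \<bar>g l\<bar>) \<le> real (card Y0) * (C * (real (card F) * n2 X f))"
		by (rule sum_bounded_above) (use 2 3 in force)
	have "L2_set g J \<le> ?C * n2 X f" if J: "finite J" "J \<subseteq> Y" for J
	proof -
		have "L2_set g J = L2_set (\<lambda>l. (if l \<in> Y0 then g l else 0) + (if l \<in> Y0 then 0 else g l)) J"
			by (intro L2_set_cong) auto
		also have "\<dots> \<le> L2_set (\<lambda>l. if l \<in> Y0 then g l else 0) J + L2_set (\<lambda>l. if l \<in> Y0 then 0 else g l) J" by (rule L2_set_triangle_ineq)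
		also have "L2_set (\<lambda>l. if l \<in> Y0 then g l else 0) J \<le> (\<Sum>l\<in>J. \<bar>if l \<in> Y0 then g l else 0\<bar>)" by (rule L2_set_le_sum_abs)
		also have "\<dots> = (\<Sum>l\<in>J \<inter> Y0. \<bar>g l\<bar>)" unfolding sum.inter_restrict[OF J(1)] by (intro sum.cong) auto
		also have "\<dots> \<le> (\<Sum>l\<in>Y0. \<bar>g l\<bar>)" using Y by (intro sum_mono2) auto
		also have "L2_set (\<lambda>l. if l \<in> Y0 then 0 else g l) J = L2_set g (J - Y0)"
			unfolding L2_set_def using J by (intro arg_cong[where f=sqrt] sum.mono_neutral_cong_right) auto
		also have "\<dots> = L2_set (\<lambda>l. \<bar>g l\<bar>) (J - Y0)" by (simp add: L2_set_def)
		also have "\<dots> \<le> L2_set (\<lambda>l. \<bar>f l\<bar>) (J - Y0)" using 1 J by (intro L2_set_mono) auto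
		also have "\<dots> = L2_set f (J - Y0)" by (simp add: L2_set_def)
		also have "\<dots> \<le> n2 X f" using J Y by (intro L2_set_le_n2[OF f]) auto
		finally show ?thesis using core by (simp add: algebra_simps)
	qed
	from l2_boundedI[of Y g, OF this] show "l2 Y g" "n2 Y g \<le> ?C * n2 X f" by blast+
qed

lemma form1_bounded:
	assumes S: "finite S" and L: "form1 S L"
	shows "\<exists>C\<ge>0. \<forall>h\<in>stsp S. \<bar>L h\<bar> \<le> C * nrm S (h :: 'd::finite vfun)"
proof -
	let ?B = "\<Sum>p\<in>S \<times> (UNIV :: 'd set). \<bar>L (unit_fun (fst p) (snd p))\<bar>"
	have "\<bar>L (unit_fun \<rho> i)\<bar> \<le> ?B" if "\<rho> \<in> S" for \<rho> i
		using member_le_sum[of "(\<rho>, i)" "S \<times> UNIV" "\<lambda>p. \<bar>L (unit_fun (fst p) (snd p))\<bar>"] S that by simp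
	then have "\<bar>L h\<bar> \<le> real (card S * CARD('d)) * ?B * nrm S h" if "h \<in> stsp S" for h
		using form1_bound[OF S L that] by blast
	then show ?thesis by (intro exI[of _ "real (card S * CARD('d)) * ?B"]) (auto intro!: mult_nonneg_nonneg sum_nonneg)
qed

lemma (in net) near_finite:
	assumes "finite J" "J \<subseteq> \<Lambda> \<times> \<Lambda>"
	shows "\<exists>F C. finite F \<and> F \<subseteq> \<Lambda> \<and> 0 \<le> C \<and> (\<forall>p\<in>J. \<forall>u. norm (u (fst p) - u (snd p)) \<le> C * (\<Sum>l\<in>F. dn St u l))"
	using assms
proof (induction J rule: finite_induct)
	case empty
	show ?case by (intro exI[of _ "{}"] exI[of _ 0]) simp
next
	case (insert p J)
	obtain F C where 1: "finite F" "F \<subseteq> \<Lambda>" "0 \<le> C" "!!q u. q \<in> J ==> norm (u (fst q) - u (snd q)) \<le> C * (\<Sum>l\<in>F. dn St u l)"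
		using insert.IH insert.prems by (metis insert_subset)
	have "near \<Lambda> St (fst p) (snd p)" using insert.prems by (intro near) auto
	then obtain F' C' where 2: "finite F'" "F' \<subseteq> \<Lambda>" "0 \<le> C'" "!!u. norm (u (fst p) - u (snd p)) \<le> C' * (\<Sum>l\<in>F'. dn St u l)"
		unfolding near_def by blast
	have m1: "C * (\<Sum>l\<in>F. dn St u l) \<le> (C + C') * (\<Sum>l\<in>F \<union> F'. dn St u l)" for u
		using 1(1,3) 2(1,3) by (intro mult_mono sum_mono2 sum_nonneg) auto
	have m2: "C' * (\<Sum>l\<in>F'. dn St u l) \<le> (C + C') * (\<Sum>l\<in>F \<union> F'. dn St u l)" for u
		using 1(1,3) 2(1,3) by (intro mult_mono sum_mono2 sum_nonneg) auto
	have "\<forall>q\<in>insert p J. \<forall>u. norm (u (fst q) - u (snd q)) \<le> (C + C') * (\<Sum>l\<in>F \<union> F'. dn St u l)"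
	proof (intro ballI allI)
		fix q u assume "q \<in> insert p J"
		then show "norm (u (fst q) - u (snd q)) \<le> (C + C') * (\<Sum>l\<in>F \<union> F'. dn St u l)"
			using order_trans[OF 1(4)[of q u] m1] order_trans[OF 2(4) m2] by auto
	qed
	then show ?case using 1 2 by (intro exI[of _ "F \<union> F'"] exI[of _ "C + C'"]) auto
qed

section \<open>Linear terms telescope on the homogeneous lattice\<close>

context hom_lattice
begin

lemma far_exists: "\<exists>x. x \<in> L \<and> r \<le> norm x"
proof (rule ccontr)
	assume "\<not> ?thesis"
	then have "L \<subseteq> L \<inter> ball 0 r" by (auto simp: not_le)
	then have f: "finite L" using fin_ball finite_subset by metis
	have "inj (\<lambda>k::nat. 0 + real k *\<^sub>R e undefined)"
	proof (rule injI)
		fix j k :: nat assume eq: "0 + real j *\<^sub>R e undefined = 0 + real k *\<^sub>R e undefined"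
		have "e undefined \<noteq> 0" using inv by (metis axis_eq_0_iff invertible_def matrix_left_invertible_ker zero_neq_one)
		then show "j = k" using eq by simp
	qed
	then have "infinite (range (\<lambda>k::nat. 0 + real k *\<^sub>R e undefined))" using finite_imageD infinite_UNIV_nat by blast
	moreover have "range (\<lambda>k::nat. 0 + real k *\<^sub>R e undefined) \<subseteq> L" using L_multiple[OF L_zero] by blast
	ultimately show False using f finite_subset by blast
qed

text \<open>Moving in direction k \<noteq> i leaves the i-th coordinate unchanged, so the whole line
  stays outside the box of half-width \<open>N\<close>.\<close>

lemma line_const:
	assumes v: "!!z. (\<forall>i. z $ i \<in> \<int>) ==> N < \<bar>z $ i\<bar> ==> v (A *v (z + axis k 1)) = (v (A *v z) :: real^'d)"
		and z: "\<forall>i. z $ i \<in> \<int>" "N < \<bar>z $ i\<bar>" and z': "\<forall>j. j \<noteq> k --> z' $ j = z $ j" "z' $ k \<in> \<int>" and "k \<noteq> i"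
	shows "v (A *v z') = v (A *v z)"
proof -
	have up: "v (A *v (y + axis k (real n))) = v (A *v y)" if y: "\<forall>i. y $ i \<in> \<int>" "N < \<bar>y $ i\<bar>" for y n
	proof (induction n)
		case (Suc n)
		have "v (A *v ((y + axis k (real n)) + axis k 1)) = v (A *v (y + axis k (real n)))"
			using y \<open>k \<noteq> i\<close> by (intro v) (auto simp: axis_def)
		moreover have "axis k (real (Suc n)) = axis k (real n) + axis k 1" by (auto simp: axis_def vec_eq_iff)
		ultimately show ?case using Suc by (simp add: add.assoc)
	qed (simp add: axis_def vec_eq_iff flip: zero_vec_def)
	have z'i: "\<forall>i. z' $ i \<in> \<int>" "N < \<bar>z' $ i\<bar>" using z z' \<open>k \<noteq> i\<close> by metis+
	obtain m :: int where m: "z' $ k - z $ k = of_int m" using z(1) z'(2) Ints_diff Ints_cases by metis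
	show ?thesis
	proof (cases "0 \<le> m")
		case True
		then have "z' = z + axis k (real (nat m))" using m z'(1) by (auto simp: vec_eq_iff axis_def)
		then show ?thesis using up[OF z] by simp
	next
		case False
		then have "z = z' + axis k (real (nat (- m)))" using m z'(1) by (auto simp: vec_eq_iff axis_def)
		then show ?thesis using up[OF z'i] by simp
	qed
qed

text \<open>In dimension at least two the complement of a box in the lattice is connected.\<close>

lemma Wdc_constant_far:
	assumes d: "2 \<le> CARD('d)" and v: "v \<in> Wdc L (\<lambda>_. S)"
	shows "\<exists>c. (\<lambda>x. v x - c) \<in> Fs"
proof -
	obtain B K where B: "B ** A = mat 1" "0 \<le> K" "!!x. norm (B *v x) \<le> K * norm x" by (rule inverse_bound) (rule that, assumption+)
	have BA: "B *v (A *v z) = z" for z by (simp add: matrix_vector_mul_assoc B(1))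
	define r where "r = (\<Sum>l\<in>{l \<in> L. dnL v l \<noteq> 0}. norm (B *v l))"
	have fv: "finite {l \<in> L. dnL v l \<noteq> 0}" using v by (simp add: Wdc_def)
	have r: "norm (B *v l) \<le> r" if "l \<in> L" "dnL v l \<noteq> 0" for l
		unfolding r_def using that by (intro member_le_sum fv) auto
	obtain N :: nat where N: "r < real N" using reals_Archimedean2 by blast
	have step: "v (A *v (z + axis k 1)) = v (A *v z)" if z: "\<forall>i. z $ i \<in> \<int>" and zi: "real N < \<bar>z $ i\<bar>" for z i k
	proof -
		have l: "A *v z \<in> L" unfolding bravais_lattice_def using z by blast
		have "real N < norm z" using zi component_le_norm_cart[of z i] by linarith
		then have "dnL v (A *v z) = 0" using r[OF l] N BA[of z] by (cases "dnL v (A *v z) = 0") simp_all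
		then have "norm (v (A *v z + e k) - v (A *v z)) \<le> 0" using diff_le_dn[OF l eS, of v k] by simp
		then show ?thesis by (simp add: matrix_vector_right_distrib)
	qed
	have move: "v (A *v (\<chi> j. if j \<in> J then y $ j else z $ j)) = v (A *v z)"
		if z: "\<forall>i. z $ i \<in> \<int>" "real N < \<bar>z $ i\<bar>" and y: "\<forall>i. y $ i \<in> \<int>" and J: "finite J" "i \<notin> J" for z y i J
		using J
	proof (induction J rule: finite_induct)
		case empty
		show ?case by simp
	next
		case (insert k J)
		let ?w = "\<chi> j. if j \<in> J then y $ j else z $ j"
		have "v (A *v (\<chi> j. if j \<in> insert k J then y $ j else z $ j)) = v (A *v ?w)"
		proof (rule line_const)
			show "v (A *v (z + axis k' 1)) = v (A *v z)" if "\<forall>i. z $ i \<in> \<int>" "real N < \<bar>z $ i'\<bar>" for z i' k'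
				using that by (rule step)
			show "\<forall>i. ?w $ i \<in> \<int>" "(\<chi> j. if j \<in> insert k J then y $ j else z $ j) $ k \<in> \<int>" using z y by simp_all
			show "real N < \<bar>?w $ i\<bar>" using z insert.prems by simp
			show "\<forall>j. j \<noteq> k --> (\<chi> j. if j \<in> insert k J then y $ j else z $ j) $ j = ?w $ j" by simp
			show "k \<noteq> i" using insert.prems by blast
		qed
		then show ?case using insert.IH insert.prems by simp
	qed
	\<comment> \<open>A reference point outside the box. From \<open>z\<close> with large i-th
	  coordinate, first another coordinate j is set to that of \<open>p\<close>, with i as witness of
	  staying outside; then j is the witness while all others are changed.\<close>
	define p :: "real^'d" where "p = (\<chi> j. real N + 1)"
	have p: "\<forall>i. p $ i \<in> \<int>" by (simp add: p_def)
	have const: "v (A *v z) = v (A *v p)" if z: "\<forall>i. z $ i \<in> \<int>" "real N < \<bar>z $ i\<bar>" for z i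
	proof -
		obtain j where j: "j \<noteq> i"
		proof -
			have "\<not> (UNIV :: 'd set) \<subseteq> {i}" using d card_mono[of "{i}" "UNIV :: 'd set"] by auto
			then show thesis using that by blast
		qed
		let ?w = "\<chi> k. if k \<in> {j} then p $ k else z $ k"
		have 1: "v (A *v ?w) = v (A *v z)" using move[OF z p, of "{j}"] j by simp
		have w: "\<forall>i. ?w $ i \<in> \<int>" "real N < \<bar>?w $ j\<bar>" using z p by (auto simp: p_def)
		have "v (A *v (\<chi> k. if k \<in> UNIV - {j} then p $ k else ?w $ k)) = v (A *v ?w)" by (rule move[OF w p]) auto
		moreover have "(\<chi> k. if k \<in> UNIV - {j} then p $ k else ?w $ k) = p" by (auto simp: vec_eq_iff)
		ultimately show ?thesis using 1 by simp
	qed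
	have "{l \<in> L. v l - v (A *v p) \<noteq> 0} \<subseteq> (\<lambda>z. A *v z) ` {z. \<forall>i. z $ i \<in> \<int> \<and> \<bar>z $ i\<bar> \<le> real N}"
	proof
		fix l assume l: "l \<in> {l \<in> L. v l - v (A *v p) \<noteq> 0}"
		then obtain z where z: "l = A *v z" "\<forall>i. z $ i \<in> \<int>" unfolding bravais_lattice_def by blast
		have "\<bar>z $ i\<bar> \<le> real N" for i using const[OF z(2), of i] l z(1) by force
		then show "l \<in> (\<lambda>z. A *v z) ` {z. \<forall>i. z $ i \<in> \<int> \<and> \<bar>z $ i\<bar> \<le> real N}" using z by blast
	qed
	then have "finite {l \<in> L. v l - v (A *v p) \<noteq> 0}" by (rule finite_subset) (rule finite_imageI[OF int_box(1)])
	then have "(\<lambda>x. v x - v (A *v p)) \<in> Fs" by (simp add: Fs_def)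
	then show ?thesis by (rule exI)
qed

text \<open>Up to a constant \<open>v\<close> is finitely supported, so for each stencil vector the
  differences sum to zero over the lattice; linearity brings the sum inside
  \<open>f\<close>.\<close>

lemma telescope:
	assumes d: "2 \<le> CARD('d)" and v: "v \<in> Wdc L (\<lambda>_. S)" and f: "form1 S f"
	shows "(\<Sum>\<^sub>\<infinity>l\<in>L. f (sdL v l)) = 0"
proof -
	obtain c where w: "(\<lambda>x. v x - c) \<in> Fs" using Wdc_constant_far[OF d v] by blast
	define w where "w = (\<lambda>x. v x - c)"
	have wF: "w \<in> Fs" using w by (simp add: w_def)
	have sd: "sdL v l = sdL w l" for l by (rule ext) (simp add: w_def stencil_diff_def)
	let ?s = "{l\<in>L. w l \<noteq> 0}"
	let ?U = "{l\<in>L. sdL w l \<noteq> zf} \<union> ?s \<union> (\<Union>\<rho>\<in>S. (\<lambda>x. x - \<rho>) ` ?s)"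
	have fs: "finite ?s" using wF by (simp add: Fs_def)
	have fU: "finite ?U" using fs Fs_fin[OF wF] finS by (intro finite_UnI finite_UN_I finite_imageI) auto
	have U: "?U \<subseteq> L" using SL L_diff by auto
	have "(\<Sum>\<^sub>\<infinity>l\<in>L. f (sdL w l)) = (\<Sum>\<^sub>\<infinity>l\<in>?U. f (sdL w l))"
		using U by (intro infsum_cong_neutral) (auto simp: form1_zero[OF f])
	also have "\<dots> = (\<Sum>l\<in>?U. 1 * f (sdL w l))" using fU by simp
	also have "\<dots> = f (\<lambda>\<rho>. \<Sum>l\<in>?U. 1 *\<^sub>R sdL w l \<rho>)"
		using form1_sum[OF f fU, of "\<lambda>l. sdL w l" "\<lambda>_. 1"] by simp
	also have "(\<lambda>\<rho>. \<Sum>l\<in>?U. 1 *\<^sub>R sdL w l \<rho>) = zf"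
	proof
		fix \<rho>
		show "(\<Sum>l\<in>?U. 1 *\<^sub>R sdL w l \<rho>) = 0"
		proof (cases "\<rho> \<in> S")
			case True
			have "(\<Sum>l\<in>?U. w (l + \<rho>)) = (\<Sum>y\<in>(\<lambda>l. l + \<rho>) ` ?U. w y)" by (subst sum.reindex) (auto simp: inj_on_def)
			also have "\<dots> = (\<Sum>y\<in>?s. w y)"
			proof (rule sum.mono_neutral_right)
				show "?s \<subseteq> (\<lambda>l. l + \<rho>) ` ?U"
				proof
					fix y assume "y \<in> ?s"
					then have "y - \<rho> \<in> ?U" using True by blast
					then show "y \<in> (\<lambda>l. l + \<rho>) ` ?U" by (rule rev_image_eqI) simp
				qed
				show "\<forall>i\<in>(\<lambda>l. l + \<rho>) ` ?U - ?s. w i = 0" using U L_S[OF _ True] by blast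
			qed (use fU in simp)
			also have "\<dots> = (\<Sum>y\<in>?U. w y)" by (rule sum.mono_neutral_left[OF fU]) (use U in auto)
			finally show ?thesis using True by (simp add: stencil_diff_def sum_subtractf)
		qed (simp add: stencil_diff_def)
	qed
	finally show ?thesis by (simp add: sd form1_zero[OF f])
qed

end

section \<open>Passing between the two lattices\<close>

context defect
begin

lemma far_L: "l \<in> \<Lambda> ==> Rdef \<le> norm l ==> l \<in> L" and far_\<Lambda>: "l \<in> L ==> Rdef \<le> norm l ==> l \<in> \<Lambda>"
	using far_iff by blast+

text \<open>A site beyond \<open>R1\<close> and its neighbours lie outside
  \<open>ball 0 Rdef\<close>, where both lattices and both stencils coincide.\<close>

definition R1 :: real where "R1 = Rdef + rcut"
definition x0 :: "real^'d" where "x0 = (SOME x. x \<in> L \<and> R1 \<le> norm x)"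
text \<open>On either lattice it uses only values at sites common to both, so it carries functions
  in both directions. The core is filled with one value taken at a far site, which keeps the new
  differences under the control of \<open>near\<close>.\<close>

definition patch :: "'d vfun => 'd vfun" where "patch u l = (if Rdef \<le> norm l then u l else u x0)"

abbreviation "core\<Lambda> \<equiv> \<Lambda> \<inter> ball 0 R1"
abbreviation "coreL \<equiv> L \<inter> ball 0 R1"

lemma R1: "Rdef \<le> R1" "0 < R1" using Rdef rcut by (auto simp: R1_def)

lemma x0: "x0 \<in> L" "R1 \<le> norm x0" "x0 \<in> \<Lambda>"
proof -
	have "x0 \<in> L \<and> R1 \<le> norm x0" unfolding x0_def using far_exists by (rule someI_ex)
	then show "x0 \<in> L" "R1 \<le> norm x0" by auto
	then show "x0 \<in> \<Lambda>" using far_iff[of x0] R1 by simp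
qed

lemma S_norm: "\<sigma> \<in> S ==> norm \<sigma> < rcut" using St_norm[OF x0(3)] St_hom[OF x0(3)] x0(2) R1 by simp

lemma far_neighbour: "R1 \<le> norm l ==> \<sigma> \<in> insert 0 S ==> Rdef \<le> norm (l + \<sigma>)"
	using S_norm[of \<sigma>] norm_triangle_ineq4[of "l + \<sigma>" \<sigma>] rcut by (auto simp: R1_def)

lemma far_St: "l \<in> \<Lambda> ==> R1 \<le> norm l ==> St l = S" using St_hom R1 by simp

lemma patch_far: "Rdef \<le> norm l ==> patch u l = u l" by (simp add: patch_def)

lemma sd_patch: "R1 \<le> norm l ==> sdL (patch u) l = sdL u l"
	using far_neighbour[of l] far_neighbour[of l 0] unfolding stencil_diff_def by (intro ext) (simp add: patch_far)

lemma dnL_patch: "R1 \<le> norm l ==> dnL (patch u) l = dnL u l" by (simp add: dn_def sd_patch)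

lemma dn_far: "l \<in> \<Lambda> ==> R1 \<le> norm l ==> dn St u l = dnL u l" by (simp add: dn_def far_St)

lemma patch_lin: "patch (lcomb a u b v) = (\<lambda>x. a *\<^sub>R patch u x + b *\<^sub>R patch v x)"
	by (auto simp: patch_def)

lemma patch_in: "patch u x = u (if Rdef \<le> norm x then x else x0)" by (simp add: patch_def)

lemma patch_core_L: "\<exists>F C. finite F \<and> F \<subseteq> \<Lambda> \<and> 0 \<le> C \<and> (\<forall>u. \<forall>l\<in>coreL. dnL (patch u) l \<le> C * (\<Sum>l\<in>F. dn St u l))"
proof -
	let ?t = "\<lambda>x. if Rdef \<le> norm x then x else x0"
	let ?J = "(\<lambda>p. (?t (fst p + snd p), ?t (fst p))) ` (coreL \<times> S)"
	have t: "?t x \<in> \<Lambda>" if "x \<in> L" for x using far_\<Lambda>[OF that] x0 by (cases "Rdef \<le> norm x") simp_all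
	have "finite ?J" using fin_ball finS by blast
	moreover have "?J \<subseteq> \<Lambda> \<times> \<Lambda>" by (intro image_subsetI SigmaI t) (use L_S in auto)
	ultimately obtain F C where F: "finite F" "F \<subseteq> \<Lambda>" "0 \<le> C" "!!p u. p \<in> ?J ==> norm (u (fst p) - u (snd p)) \<le> C * (\<Sum>l\<in>F. dn St u l)"
		using N.near_finite[of ?J] by blast
	have "dnL (patch u) l \<le> (real (card S) * C) * (\<Sum>l\<in>F. dn St u l)" if l: "l \<in> coreL" for u l
	proof -
		have "dnL (patch u) l \<le> (\<Sum>\<sigma>\<in>S. norm (patch u (l + \<sigma>) - patch u l))" unfolding dn_alt by (rule L2_set_le_sum) simp
		also have "\<dots> \<le> real (card S) * (C * (\<Sum>l\<in>F. dn St u l))"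
		proof (rule sum_bounded_above)
			fix \<sigma> assume "\<sigma> \<in> S"
			then have "(?t (l + \<sigma>), ?t l) \<in> ?J" using l by (intro rev_image_eqI[of "(l, \<sigma>)"]) auto
			from F(4)[OF this, of u] show "norm (patch u (l + \<sigma>) - patch u l) \<le> C * (\<Sum>l\<in>F. dn St u l)"
				unfolding patch_in by simp
		qed
		finally show ?thesis by (simp add: mult.assoc)
	qed
	then show ?thesis using F by (intro exI[of _ F] exI[of _ "real (card S) * C"]) auto
qed

lemma patch_core_\<Lambda>: "\<exists>F C. finite F \<and> F \<subseteq> L \<and> 0 \<le> C \<and> (\<forall>v. \<forall>l\<in>core\<Lambda>. dn St (patch v) l \<le> C * (\<Sum>l\<in>F. dnL v l))"
proof -
	let ?t = "\<lambda>x. if Rdef \<le> norm x then x else x0"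
	let ?J = "(\<lambda>p. (?t (fst p + snd p), ?t (fst p))) ` (SIGMA l:core\<Lambda>. St l)"
	have t: "?t x \<in> L" if "x \<in> \<Lambda>" for x using far_L[OF that] x0 by (cases "Rdef \<le> norm x") simp_all
	have fJ: "finite ?J" using fin\<Lambda> fin_St by (intro finite_imageI finite_SigmaI) auto
	moreover have "?J \<subseteq> L \<times> L" by (intro image_subsetI SigmaI t) (use St_\<Lambda> in auto)
	ultimately obtain F C where F: "finite F" "F \<subseteq> L" "0 \<le> C" "!!p u. p \<in> ?J ==> norm (u (fst p) - u (snd p)) \<le> C * (\<Sum>l\<in>F. dnL u l)"
		using near_finite[of ?J] by blast
	let ?N = "\<Sum>l\<in>core\<Lambda>. real (card (St l))"
	have "dn St (patch u) l \<le> (?N * C) * (\<Sum>l\<in>F. dnL u l)" if l: "l \<in> core\<Lambda>" for u l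
	proof -
		have "dn St (patch u) l \<le> (\<Sum>\<sigma>\<in>St l. norm (patch u (l + \<sigma>) - patch u l))" unfolding dn_alt by (rule L2_set_le_sum) simp
		also have "\<dots> \<le> real (card (St l)) * (C * (\<Sum>l\<in>F. dnL u l))"
		proof (rule sum_bounded_above)
			fix \<sigma> assume "\<sigma> \<in> St l"
			then have "(?t (l + \<sigma>), ?t l) \<in> ?J" using l by (intro rev_image_eqI[of "(l, \<sigma>)"]) auto
			from F(4)[OF this, of u] show "norm (patch u (l + \<sigma>) - patch u l) \<le> C * (\<Sum>l\<in>F. dnL u l)"
				unfolding patch_in by simp
		qed
		also have "\<dots> \<le> ?N * (C * (\<Sum>l\<in>F. dnL u l))"
			using l fin\<Lambda> F(3) by (intro mult_right_mono member_le_sum mult_nonneg_nonneg sum_nonneg) auto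
		finally show ?thesis by (simp add: mult.assoc)
	qed
	then show ?thesis using F by (intro exI[of _ F] exI[of _ "?N * C"]) (auto intro!: mult_nonneg_nonneg sum_nonneg)
qed

lemma far_sets: "L - coreL \<subseteq> \<Lambda>" "\<Lambda> - core\<Lambda> \<subseteq> L" "L - coreL = \<Lambda> - core\<Lambda>"
proof -
	have f: "l \<in> \<Lambda> \<longleftrightarrow> l \<in> L" if "l \<notin> ball 0 R1" for l using that R1 by (intro far_iff) simp
	show "L - coreL \<subseteq> \<Lambda>" "\<Lambda> - core\<Lambda> \<subseteq> L" "L - coreL = \<Lambda> - core\<Lambda>" using f by blast+
qed

lemma patch_W_L: "\<exists>C\<ge>0. \<forall>u\<in>N.W. patch u \<in> W \<and> D (patch u) \<le> C * N.D u"
proof -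
	obtain F C where F: "finite F" "F \<subseteq> \<Lambda>" "0 \<le> C" "!!u l. l \<in> coreL ==> dnL (patch u) l \<le> C * (\<Sum>l\<in>F. dn St u l)"
		using patch_core_L by blast
	obtain C' where C': "0 \<le> C'" "!!f g. l2 \<Lambda> f ==> (\<forall>l\<in>L - coreL. \<bar>g l\<bar> \<le> \<bar>f l\<bar>) ==> (\<forall>l\<in>coreL. \<bar>g l\<bar> \<le> C * (\<Sum>l\<in>F. \<bar>f l\<bar>)) ==>
			l2 L g \<and> n2 L g \<le> C' * n2 \<Lambda> f"
		using l2_transfer[OF F(1,2) fin_ball far_sets(1) F(3)] by blast
	have "patch u \<in> W \<and> D (patch u) \<le> C' * N.D u" if u: "u \<in> N.W" for u
		unfolding Wd_def Dn_def mem_Collect_eq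
	proof (rule C'(2))
		show "l2 \<Lambda> (dn St u)" using u by (simp add: Wd_def)
		show "\<forall>l\<in>L - coreL. \<bar>dnL (patch u) l\<bar> \<le> \<bar>dn St u l\<bar>" using far_sets by (auto simp: dnL_patch dn_far)
		show "\<forall>l\<in>coreL. \<bar>dnL (patch u) l\<bar> \<le> C * (\<Sum>l\<in>F. \<bar>dn St u l\<bar>)" using F(4) by simp
	qed
	then show ?thesis using C'(1) by blast
qed

lemma patch_W_\<Lambda>: "\<exists>C\<ge>0. \<forall>v\<in>W. patch v \<in> N.W \<and> N.D (patch v) \<le> C * D v"
proof -
	obtain F C where F: "finite F" "F \<subseteq> L" "0 \<le> C" "!!u l. l \<in> core\<Lambda> ==> dn St (patch u) l \<le> C * (\<Sum>l\<in>F. dnL u l)"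
		using patch_core_\<Lambda> by blast
	obtain C' where C': "0 \<le> C'" "!!f g. l2 L f ==> (\<forall>l\<in>\<Lambda> - core\<Lambda>. \<bar>g l\<bar> \<le> \<bar>f l\<bar>) ==> (\<forall>l\<in>core\<Lambda>. \<bar>g l\<bar> \<le> C * (\<Sum>l\<in>F. \<bar>f l\<bar>)) ==>
			l2 \<Lambda> g \<and> n2 \<Lambda> g \<le> C' * n2 L f"
		using l2_transfer[OF F(1,2) fin\<Lambda> far_sets(2) F(3)] by blast
	have "patch u \<in> N.W \<and> N.D (patch u) \<le> C' * D u" if u: "u \<in> W" for u
		unfolding Wd_def Dn_def mem_Collect_eq
	proof (rule C'(2))
		show "l2 L (dnL u)" using u by (simp add: Wd_def)
		show "\<forall>l\<in>\<Lambda> - core\<Lambda>. \<bar>dn St (patch u) l\<bar> \<le> \<bar>dnL u l\<bar>" by (auto simp: not_less dn_def sd_patch far_St)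
		show "\<forall>l\<in>core\<Lambda>. \<bar>dn St (patch u) l\<bar> \<le> C * (\<Sum>l\<in>F. \<bar>dnL u l\<bar>)" using F(4) by simp
	qed
	then show ?thesis using C'(1) by blast
qed

lemma patch_Wdc: "u \<in> Wdc \<Lambda> St ==> patch u \<in> Wdc L (\<lambda>_. S)"
proof -
	assume "u \<in> Wdc \<Lambda> St"
	then have "finite ({l\<in>\<Lambda>. dn St u l \<noteq> 0} \<union> coreL)" using fin_ball by (simp add: Wdc_def)
	moreover have "{l\<in>L. dnL (patch u) l \<noteq> 0} \<subseteq> {l\<in>\<Lambda>. dn St u l \<noteq> 0} \<union> coreL"
	proof
		fix l assume l: "l \<in> {l\<in>L. dnL (patch u) l \<noteq> 0}"
		show "l \<in> {l\<in>\<Lambda>. dn St u l \<noteq> 0} \<union> coreL"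
		proof (cases "R1 \<le> norm l")
			case True
			then have "l \<in> \<Lambda>" using l far_iff R1 by simp
			then show ?thesis using l True by (simp add: dnL_patch dn_far)
		qed (use l in auto)
	qed
	ultimately show ?thesis unfolding Wdc_def using finite_subset by blast
qed

text \<open>Approximate on the Bravais lattice and transport the correction:
  \<open>v = u + patch (w - patch u)\<close> agrees outside the core with the finitely supported
  \<open>w\<close>, and its distance to \<open>u\<close> is the norm of the patched
  correction.\<close>

lemma Wdc_dense:
	assumes u: "u \<in> N.W" and \<epsilon>: "0 < \<epsilon>"
	shows "\<exists>v\<in>Wdc \<Lambda> St. N.D (v .- u) < \<epsilon>"
proof -
	obtain C where C: "0 \<le> C" "!!v. v \<in> W ==> patch v \<in> N.W" "!!v. v \<in> W ==> N.D (patch v) \<le> C * D v"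
		using patch_W_\<Lambda> by blast
	have pu: "patch u \<in> W" using patch_W_L u by blast
	have "0 < \<epsilon> / (C + 1)" using \<epsilon> C(1) by simp
	then obtain w where w: "w \<in> Fs" "D (patch u .- w) < \<epsilon> / (C + 1)" using Fs_dense[OF pu] by blast
	have wW: "w \<in> W" using w(1) Fs_W by blast
	define y where "y = (w .- patch u)"
	have yW: "y \<in> W" unfolding y_def using wW pu by (rule Wd_diff)
	have yD: "D y < \<epsilon> / (C + 1)" using w(2) unfolding y_def by (subst Dn_minus_commute)
	define v where "v = (u .+ patch y)"
	have "N.D (v .- u) = N.D (patch y)" by (simp add: v_def)
	also have "\<dots> \<le> C * D y" by (rule C(3)[OF yW])
	also have "\<dots> \<le> C * (\<epsilon> / (C + 1))" using yD C(1) by (intro mult_left_mono) auto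
	also have "\<dots> < \<epsilon>" using C(1) \<epsilon> by (simp add: field_simps)
	finally have 1: "N.D (v .- u) < \<epsilon>" .
	have far: "dn St v l = dnL w l" if l: "l \<in> \<Lambda>" "R1 \<le> norm l" for l
	proof -
		have "dn St v l = dnL v l" using l by (rule dn_far)
		also have "\<dots> = dnL w l"
		proof (rule dn_cong)
			fix \<rho> assume "\<rho> \<in> S"
			then have "Rdef \<le> norm (l + \<rho>)" "Rdef \<le> norm l" using far_neighbour[OF l(2)] far_neighbour[OF l(2), of 0] by auto
			then show "v (l + \<rho>) - v l = w (l + \<rho>) - w l" by (simp add: v_def y_def patch_far)
		qed
		finally show ?thesis .
	qed
	have "finite ({l\<in>L. dnL w l \<noteq> 0} \<union> core\<Lambda>)" using w(1) Fs_Wdc fin\<Lambda> by (auto simp: Wdc_def)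
	moreover have "{l\<in>\<Lambda>. dn St v l \<noteq> 0} \<subseteq> {l\<in>L. dnL w l \<noteq> 0} \<union> core\<Lambda>"
	proof
		fix l assume l: "l \<in> {l\<in>\<Lambda>. dn St v l \<noteq> 0}"
		show "l \<in> {l\<in>L. dnL w l \<noteq> 0} \<union> core\<Lambda>"
		proof (cases "R1 \<le> norm l")
			case True
			then have "l \<in> L" using l far_iff R1 by simp
			then show ?thesis using l far[of l] True by auto
		qed (use l in auto)
	qed
	ultimately have "v \<in> Wdc \<Lambda> St" unfolding Wdc_def using finite_subset by blast
	then show ?thesis using 1 by blast
qed

text \<open>Resolves the definite description: density of \<open>Wdc\<close> forces every continuous
  extension to equal \<open>G\<close> on \<open>W_12\<close>, and extensionality fixes it
  elsewhere.\<close>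

lemma continuous_extension_eq:
	assumes G: "continuous_wrt N.W N.D G" and eq: "!!u. u \<in> Wdc \<Lambda> St ==> G u = F u" and u: "u \<in> N.W"
	shows "continuous_extension \<T> \<Lambda> F u = G u"
proof -
	obtain C :: real where C: "0 < C" "!!u. u \<in> W_12 \<T> \<Lambda> ==> u \<in> Wd \<Lambda> St \<and> Dn \<Lambda> St u \<le> C * W_norm \<T> \<Lambda> u" by (rule Dn_le_W_norm) blast
	obtain C' :: real where C': "0 < C'" "!!u. u \<in> Wd \<Lambda> St ==> u \<in> W_12 \<T> \<Lambda> \<and> W_norm \<T> \<Lambda> u \<le> C' * Dn \<Lambda> St u" by (rule W_norm_le_Dn) blast
	have diffW: "(u .- v) \<in> N.W" if "u \<in> N.W" "v \<in> N.W" for u v using that by (rule Wd_diff)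
	let ?P = "\<lambda>H. H \<in> extensional (W_12 \<T> \<Lambda>) \<and> continuous_wrt (W_12 \<T> \<Lambda>) (W_norm \<T> \<Lambda>) H \<and> (\<forall>u\<in>W_c \<T> \<Lambda>. H u = F u)"
	let ?R = "restrict G (W_12 \<T> \<Lambda>)"
	have cont: "continuous_wrt (W_12 \<T> \<Lambda>) (W_norm \<T> \<Lambda>) ?R"
		unfolding continuous_wrt_def W_12_eq
	proof (intro ballI allI impI)
		fix u and \<epsilon> :: real assume u: "u \<in> N.W" and \<epsilon>: "0 < \<epsilon>"
		obtain \<delta> where \<delta>: "0 < \<delta>" "!!v. v \<in> N.W ==> N.D (v .- u) < \<delta> ==> \<bar>G v - G u\<bar> < \<epsilon>"
			using G u \<epsilon> unfolding continuous_wrt_def by blast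
		show "\<exists>\<delta>>0. \<forall>v\<in>N.W. W_norm \<T> \<Lambda> (v .- u) < \<delta> --> \<bar>restrict G N.W v - restrict G N.W u\<bar> < \<epsilon>"
		proof (intro exI[of _ "\<delta> / C"] conjI ballI impI)
			show "0 < \<delta> / C" using \<delta> C by simp
			fix v assume v: "v \<in> N.W" and d: "W_norm \<T> \<Lambda> (v .- u) < \<delta> / C"
			have "N.D (v .- u) \<le> C * W_norm \<T> \<Lambda> (v .- u)" using C(2) diffW[OF v u] W_12_eq by blast
			also have "\<dots> < \<delta>" using d C(1) by (simp add: field_simps)
			finally show "\<bar>restrict G N.W v - restrict G N.W u\<bar> < \<epsilon>" using \<delta>(2)[OF v] v u by simp
		qed
	qed
	have sub: "W_c \<T> \<Lambda> \<subseteq> W_12 \<T> \<Lambda>" unfolding W_c_eq W_12_eq by (rule Wdc_subset_Wd)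
	have 1: "?P ?R" using cont sub eq W_c_eq by auto
	have 2: "H = ?R" if H: "?P H" for H
	proof
		fix v
		show "H v = ?R v"
		proof (cases "v \<in> W_12 \<T> \<Lambda>")
			case False
			then show ?thesis using H by (simp add: extensional_def)
		next
			case True
			then have v: "v \<in> N.W" by (simp add: W_12_eq)
			have "\<bar>H v - ?R v\<bar> \<le> 0 + \<epsilon>" if \<epsilon>: "0 < \<epsilon>" for \<epsilon>
			proof -
				have e2: "0 < \<epsilon> / 2" using \<epsilon> by simp
				obtain d1 where d1: "0 < d1" "!!w. w \<in> W_12 \<T> \<Lambda> ==> W_norm \<T> \<Lambda> (w .- v) < d1 ==> \<bar>H w - H v\<bar> < \<epsilon> / 2"
					using H True e2 unfolding continuous_wrt_def by blast
				obtain d2 where d2: "0 < d2" "!!w. w \<in> W_12 \<T> \<Lambda> ==> W_norm \<T> \<Lambda> (w .- v) < d2 ==> \<bar>?R w - ?R v\<bar> < \<epsilon> / 2"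
					using cont True e2 unfolding continuous_wrt_def by blast
				have "0 < min d1 d2 / C'" using d1 d2 C' by simp
				then obtain w where w: "w \<in> Wdc \<Lambda> St" "N.D (w .- v) < min d1 d2 / C'" using Wdc_dense[OF v] by blast
				have wW: "w \<in> N.W" using w(1) Wdc_subset_Wd by blast
				have "W_norm \<T> \<Lambda> (w .- v) \<le> C' * N.D (w .- v)" using C'(2) diffW[OF wW v] by blast
				also have "\<dots> < min d1 d2" using w(2) C'(1) by (simp add: field_simps)
				finally have d: "W_norm \<T> \<Lambda> (w .- v) < d1" "W_norm \<T> \<Lambda> (w .- v) < d2" by auto
				have w12: "w \<in> W_12 \<T> \<Lambda>" using wW by (simp add: W_12_eq)
				have "H w = ?R w" using H 1 w(1) W_c_eq by simp
				then show ?thesis using d1(2)[OF w12 d(1)] d2(2)[OF w12 d(2)] by linarith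
			qed
			then have "\<bar>H v - ?R v\<bar> \<le> 0" by (rule field_le_epsilon)
			then show ?thesis by simp
		qed
	qed
	have "continuous_extension \<T> \<Lambda> F = ?R" unfolding continuous_extension_def using 1 2 by (rule the_equality)
	then show ?thesis using u by (simp add: W_12_eq)
qed

end

section \<open>Strong stability in terms of lattice sums\<close>

context energy_net
begin

text \<open>Strong stability is formulated on \<open>W_c\<close>; continuity of the Hessian and
  density carry it to the whole space.\<close>

lemma coercive_dense:
	assumes u: "u \<in> W" and v: "v \<in> W" and C: "C \<subseteq> W" and co: "!!w. w \<in> C ==> c * (D w)\<^sup>2 \<le> ddG u w w"
		and dense: "!!\<epsilon>. 0 < \<epsilon> ==> \<exists>w\<in>C. D (w .- v) < \<epsilon>"
	shows "c * (D v)\<^sup>2 \<le> ddG u v v"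
proof -
	let ?K = "K (D u)"
	have "\<exists>w\<in>C. D (w .- v) < 1 / real (Suc n)" for n by (rule dense) simp
	then obtain X where X: "!!n. X n \<in> C" "!!n. D (X n .- v) < 1 / real (Suc n)" by metis
	have XW: "X n \<in> W" for n using X(1) C by blast
	let ?y = "\<lambda>n x. X n x - v x"
	let ?d = "\<lambda>n. D (?y n)"
	have yW: "?y n \<in> W" for n by (rule sn.diff[OF XW v])
	have d0: "?d \<longlonglongrightarrow> 0"
	proof (rule tendsto_sandwich[of "\<lambda>_. 0" _ _ "\<lambda>n. 1 / real (Suc n)"])
		show "(\<lambda>n. 1 / real (Suc n)) \<longlonglongrightarrow> 0" by (rule LIMSEQ_Suc[OF lim_1_over_n])
	qed (use X(2) sn.p0 in \<open>auto intro!: always_eventually less_imp_le\<close>)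
	have dist: "\<bar>D (X n) - D v\<bar> \<le> ?d n" for n
		using Wd_diff(2)[OF XW yW, of n n] Wd_add(2)[OF v yW, of n] by (simp add: abs_le_iff)
	have "(\<lambda>n. D (X n) - D v) \<longlonglongrightarrow> 0"
		by (rule Lim_null_comparison[OF _ d0]) (use dist in auto)
	then have lD: "(\<lambda>n. D (X n)) \<longlonglongrightarrow> D v" by (rule LIM_zero_cancel)
	have "(\<lambda>n. ddG u (X n) (X n) - ddG u v v) \<longlonglongrightarrow> 0"
	proof (rule Lim_null_comparison)
		show "(\<lambda>n. ?K * ?d n * D (X n) + ?K * ?d n * D v) \<longlonglongrightarrow> 0"
			by (rule tendsto_eq_intros d0 lD refl)+ simp
		have "norm (ddG u (X n) (X n) - ddG u v v) \<le> ?K * ?d n * D (X n) + ?K * ?d n * D v" for n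
		proof -
			have 1: "ddG u (?y n) (X n) = ddG u (X n) (X n) - ddG u v (X n)" using ddG_lin[OF u XW v XW, of 1 n "-1" n] by simp
			have 2: "ddG u (?y n) v = ddG u (X n) v - ddG u v v" using ddG_lin[OF u XW v v, of 1 n "-1"] by simp
			have "ddG u (X n) (X n) - ddG u v v = ddG u (?y n) (X n) + ddG u (?y n) v"
				using 1 2 ddG_sym[of u v "X n"] by simp
			then show ?thesis using ddG_bound[OF u order_refl yW XW, of n n] ddG_bound[OF u order_refl yW v, of n] by (simp add: abs_le_iff)
		qed
		then show "\<forall>\<^sub>F n in sequentially. norm (ddG u (X n) (X n) - ddG u v v) \<le> ?K * ?d n * D (X n) + ?K * ?d n * D v" by simp
	qed
	then have "(\<lambda>n. ddG u (X n) (X n)) \<longlonglongrightarrow> ddG u v v" by (rule LIM_zero_cancel)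
	then show ?thesis
	proof (rule LIMSEQ_le[rotated])
		show "(\<lambda>n. c * (D (X n))\<^sup>2) \<longlonglongrightarrow> c * (D v)\<^sup>2" by (intro tendsto_intros lD)
	qed (use co X(1) in auto)
qed

end

text \<open>Links an energy \<open>F\<close> obtained by continuous extension with its explicit
  lattice sum \<open>E.G\<close>.\<close>

locale mesh_energy = defect A S Rdef rcut \<Lambda> \<T> St + E: energy_net \<Lambda> St V dV ddV K Lc KL
	for A :: "real^'d^'d" and S Rdef rcut \<Lambda> \<T> St V dV ddV K Lc KL +
	fixes F :: "'d vfun => real"
	assumes F_eq: "u \<in> Wd \<Lambda> St ==> F u = E.G u"
begin

text \<open>The second variation in the hypothesis is some form \<open>B\<close>; after the change
  from \<open>W_norm\<close> to \<open>Dn\<close>, uniqueness identifies it with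
  \<open>E.ddG\<close>.\<close>

lemma strongly_stableD:
	assumes "strongly_stable \<T> \<Lambda> F u"
	shows "u \<in> N.W" "!!v. v \<in> N.W ==> E.dG u v = 0" "\<exists>c>0. \<forall>v\<in>N.W. c * (N.D v)\<^sup>2 \<le> E.ddG u v v"
proof -
	obtain C :: real where C: "0 < C" "!!u. u \<in> W_12 \<T> \<Lambda> ==> u \<in> Wd \<Lambda> St \<and> Dn \<Lambda> St u \<le> C * W_norm \<T> \<Lambda> u" by (rule Dn_le_W_norm) blast
	obtain C' :: real where C': "0 < C'" "!!u. u \<in> Wd \<Lambda> St ==> u \<in> W_12 \<T> \<Lambda> \<and> W_norm \<T> \<Lambda> u \<le> C' * Dn \<Lambda> St u" by (rule W_norm_le_Dn) blast
	interpret w: seminormed "W_12 \<T> \<Lambda>" "W_norm \<T> \<Lambda>" by (rule seminormed_W12)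
	obtain B c where u: "u \<in> W_12 \<T> \<Lambda>" and F1: "has_first_variation (W_12 \<T> \<Lambda>) (W_norm \<T> \<Lambda>) F u zf"
		and F2: "has_second_variation (W_12 \<T> \<Lambda>) (W_norm \<T> \<Lambda>) F u B"
		and c: "0 < c" "!!v. v \<in> W_c \<T> \<Lambda> ==> c * (W_norm \<T> \<Lambda> v)\<^sup>2 \<le> B v v"
		using assms unfolding strongly_stable_def by blast
	show uW: "u \<in> N.W" using u by (simp add: W_12_eq)
	have le: "W_norm \<T> \<Lambda> v \<le> C' * N.D v" if "v \<in> W_12 \<T> \<Lambda>" for v using C'(2) that W_12_eq by blast
	have G1: "has_first_variation N.W N.D E.G u zf"
		using N.sn.has_first_variation_cong[OF w.has_first_variation_equiv[OF F1 C'(1) le, unfolded W_12_eq] F_eq[symmetric] uW refl] .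
	show "E.dG u v = 0" if "v \<in> N.W" for v
		using N.sn.first_variation_unique[OF E.G_first_variation[OF uW] G1 that] .
	have G2: "has_second_variation N.W N.D E.G u B"
		using N.sn.has_second_variation_cong[OF w.has_second_variation_equiv[OF F2 C'(1) le u, unfolded W_12_eq] F_eq[symmetric]] N.sn.p0 by blast
	have B: "B v w = E.ddG u v w" if v: "v \<in> N.W" and w: "w \<in> N.W" for v w
		using G2 uW E.G_first_variation E.dG_derivative[OF uW] E.ddG_scale[OF uW] v w
		by (rule N.sn.second_variation_unique)
	have "c / C\<^sup>2 * (N.D v)\<^sup>2 \<le> E.ddG u v v" if v: "v \<in> Wdc \<Lambda> St" for v
	proof -
		have vW: "v \<in> N.W" using v Wdc_subset_Wd by blast
		have "(N.D v)\<^sup>2 \<le> (C * W_norm \<T> \<Lambda> v)\<^sup>2" using C(2) vW W_12_eq N.sn.p0 by (intro power_mono) auto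
		then have "c / C\<^sup>2 * (N.D v)\<^sup>2 \<le> c / C\<^sup>2 * (C * W_norm \<T> \<Lambda> v)\<^sup>2" using c(1) C(1) by (intro mult_left_mono) auto
		also have "\<dots> = c * (W_norm \<T> \<Lambda> v)\<^sup>2" using C(1) by (simp add: power_mult_distrib)
		also have "\<dots> \<le> B v v" using c(2) v W_c_eq by blast
		finally show ?thesis using B[OF vW vW] by simp
	qed
	then have "\<forall>v\<in>N.W. c / C\<^sup>2 * (N.D v)\<^sup>2 \<le> E.ddG u v v"
		using E.coercive_dense[OF uW _ Wdc_subset_Wd] Wdc_dense by blast
	then show "\<exists>c>0. \<forall>v\<in>N.W. c * (N.D v)\<^sup>2 \<le> E.ddG u v v"
		using c(1) C(1) by (intro exI[of _ "c / C\<^sup>2"]) simp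
qed

lemma strongly_stableI:
	assumes u: "u \<in> N.W" and d: "!!v. v \<in> N.W ==> E.dG u v = 0"
		and c: "0 < c" "!!v. v \<in> N.W ==> c * (N.D v)\<^sup>2 \<le> E.ddG u v v"
	shows "strongly_stable \<T> \<Lambda> F u"
proof -
	obtain C :: real where C: "0 < C" "!!u. u \<in> W_12 \<T> \<Lambda> ==> u \<in> Wd \<Lambda> St \<and> Dn \<Lambda> St u \<le> C * W_norm \<T> \<Lambda> u" by (rule Dn_le_W_norm) blast
	obtain C' :: real where C': "0 < C'" "!!u. u \<in> Wd \<Lambda> St ==> u \<in> W_12 \<T> \<Lambda> \<and> W_norm \<T> \<Lambda> u \<le> C' * Dn \<Lambda> St u" by (rule W_norm_le_Dn) blast
	have le: "N.D v \<le> C * W_norm \<T> \<Lambda> v" if "v \<in> N.W" for v using C(2) that W_12_eq by blast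
	have F1: "has_first_variation N.W N.D F u zf"
		using N.sn.has_first_variation_cong[OF E.G_first_variation[OF u] F_eq u d[symmetric]] .
	have F2: "has_second_variation N.W N.D F u (E.ddG u)"
		using N.sn.has_second_variation_cong[OF E.G_second_variation[OF u] F_eq] .
	have "has_first_variation N.W (W_norm \<T> \<Lambda>) F u zf"
		using N.sn.has_first_variation_equiv[OF F1 C(1) le] .
	moreover have "has_second_variation N.W (W_norm \<T> \<Lambda>) F u (E.ddG u)"
		using N.sn.has_second_variation_equiv[OF F2 C(1) le u] W_norm_nonneg by blast
	moreover have "c / C'\<^sup>2 * (W_norm \<T> \<Lambda> v)\<^sup>2 \<le> E.ddG u v v" if v: "v \<in> W_c \<T> \<Lambda>" for v
	proof -
		have vW: "v \<in> N.W" using v W_c_eq Wdc_subset_Wd by blast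
		have "(W_norm \<T> \<Lambda> v)\<^sup>2 \<le> (C' * N.D v)\<^sup>2" using C'(2)[OF vW] W_norm_nonneg by (intro power_mono) auto
		then have "c / C'\<^sup>2 * (W_norm \<T> \<Lambda> v)\<^sup>2 \<le> c / C'\<^sup>2 * (C' * N.D v)\<^sup>2" using c(1) C'(1) by (intro mult_left_mono) auto
		also have "\<dots> = c * (N.D v)\<^sup>2" using C'(1) by (simp add: power_mult_distrib)
		also have "\<dots> \<le> E.ddG u v v" by (rule c(2)[OF vW])
		finally show ?thesis .
	qed
	moreover have "0 < c / C'\<^sup>2" using c(1) C'(1) by simp
	ultimately show ?thesis using u unfolding strongly_stable_def W_12_eq by blast
qed

lemma local_minimiserI:
	assumes u: "u \<in> N.W" and r: "0 < r" "!!v. v \<in> N.W ==> N.D (v .- u) < r ==> E.G u \<le> E.G v"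
	shows "local_minimiser \<T> \<Lambda> F u"
proof -
	obtain C :: real where C: "0 < C" "!!u. u \<in> W_12 \<T> \<Lambda> ==> u \<in> Wd \<Lambda> St \<and> Dn \<Lambda> St u \<le> C * W_norm \<T> \<Lambda> u" by (rule Dn_le_W_norm) blast
	have "F u \<le> F v" if v: "v \<in> W_12 \<T> \<Lambda>" and d: "W_norm \<T> \<Lambda> (v .- u) < r / C" for v
	proof -
		have vW: "v \<in> N.W" using v W_12_eq by blast
		have "(v .- u) \<in> N.W" using vW u by (rule Wd_diff)
		then have "N.D (v .- u) \<le> C * W_norm \<T> \<Lambda> (v .- u)" using C(2) W_12_eq by blast
		also have "\<dots> < r" using d C(1) by (simp add: field_simps)
		finally show ?thesis using r(2)[OF vW] F_eq u vW by simp
	qed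
	moreover have "0 < r / C" using r(1) C(1) by simp
	ultimately show ?thesis using u unfolding local_minimiser_def W_12_eq by blast
qed

end

section \<open>The defect energy and its linearised counterparts\<close>

locale defect_model = defect A S Rdef rcut \<Lambda> \<T> St
	for A :: "real^'d^'d" and S Rdef rcut \<Lambda> \<T> St +
	fixes V :: "real^'d => 'd vfun => real" and Vhom :: "'d vfun => real" and K :: "real => real"
	assumes dim2: "2 \<le> CARD('d)" and K0: "0 \<le> K M"
		and ok_core: "l \<in> \<Lambda> ==> norm l < Rdef ==> site_ok (St l) K (V l) (dir_deriv (V l)) (dder (V l))"
		and ok_hom: "site_ok S K Vhom (dir_deriv Vhom) (dder Vhom)"
		and V_zero: "l \<in> \<Lambda> ==> V l zf = 0"
		and V_hom: "l \<in> \<Lambda> ==> Rdef \<le> norm l ==> g \<in> stsp S ==> V l g = Vhom g"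
begin

text \<open>Outside the core \<open>V l\<close> is known to agree with \<open>Vhom\<close> on the
  stencil space only; taking \<open>Vhom\<close> itself makes the derivatives equal as
  functions.\<close>

definition Vd :: "real^'d => 'd vfun => real" where "Vd l = (if Rdef \<le> norm l then Vhom else V l)"

text \<open>The choice \<Omega> = \<Lambda> gives the original energy, so the original and the
  linearised problems belong to one family and share \<open>K\<close>, \<open>Lc\<close> and
  \<open>KL\<close>.\<close>

definition Vo :: "(real^'d) set => real^'d => 'd vfun => real" where
	"Vo \<Omega> l = (if l \<in> \<Omega> then Vd l else linearised_potential Vhom)"

definition dVo :: "(real^'d) set => real^'d => 'd vfun => 'd vfun => real" where
	"dVo \<Omega> l = (if l \<in> \<Omega> then dir_deriv (Vd l) else (\<lambda>g h. dir_deriv Vhom zf h + dder Vhom zf g h))"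

definition ddVo :: "(real^'d) set => real^'d => 'd vfun => 'd vfun => 'd vfun => real" where
	"ddVo \<Omega> l = (if l \<in> \<Omega> then dder (Vd l) else (\<lambda>g. dder Vhom zf))"

definition pre :: "real^'d => 'd vfun => real" where "pre l = dir_deriv (Vd l) zf"

text \<open>The sum of \<open>pre l (Du l)\<close> over all sites, rewritten by \<open>telescope\<close> as a finite sum: in this
	form it makes sense for every \<open>u\<close> of finite energy.\<close>

definition Lc :: "'d vfun => real" where
	"Lc u = (\<Sum>l\<in>core\<Lambda>. pre l (stencil_diff (St l) u l)) - (\<Sum>l\<in>coreL. pre x0 (sdL (patch u) l))"

lemma ok_Vd: "l \<in> \<Lambda> ==> site_ok (St l) K (Vd l) (dir_deriv (Vd l)) (dder (Vd l))"
	using ok_core[of l] ok_hom St_hom[of l] by (cases "Rdef \<le> norm l") (simp_all add: Vd_def)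

lemma pre_far: "Rdef \<le> norm l ==> pre l = dir_deriv Vhom zf" by (simp add: pre_def Vd_def)

lemma pre_form: "l \<in> \<Lambda> ==> form1 (St l) (pre l)"
	unfolding pre_def by (rule site_okD(1)[OF ok_Vd stencil_space_zero])

lemma pre_x0: "form1 S (pre x0)" using pre_form[OF x0(3)] far_St[OF x0(3,2)] by simp

lemma Vhom_zero: "Vhom zf = 0"
	using V_zero[OF x0(3)] V_hom[OF x0(3), of "\<lambda>_. 0"] x0(2) R1 by simp

lemma hom_at_zero: "form1 S (dir_deriv Vhom zf)" "form2 S (dder Vhom zf)"
	using site_okD(1,2)[OF ok_hom stencil_space_zero] by auto

lemma dder_hom_zero: "h \<in> stsp S ==> dder Vhom zf zf h = 0"
	by (rule form1_zero[OF form2_left[OF hom_at_zero(2)]])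

lemma Lc_lin: "Lc (lcomb a u b v) = a * Lc u + b * Lc v"
proof -
	have 1: "(\<Sum>l\<in>core\<Lambda>. pre l (stencil_diff (St l) (lcomb a u b v) l))
			= a * (\<Sum>l\<in>core\<Lambda>. pre l (stencil_diff (St l) u l)) + b * (\<Sum>l\<in>core\<Lambda>. pre l (stencil_diff (St l) v l))"
		unfolding sum_distrib_left sum.distrib[symmetric] stencil_diff_lin
		by (intro sum.cong refl form1D[OF pre_form]) auto
	have 2: "(\<Sum>l\<in>coreL. pre x0 (sdL (patch (lcomb a u b v)) l))
			= a * (\<Sum>l\<in>coreL. pre x0 (sdL (patch u) l)) + b * (\<Sum>l\<in>coreL. pre x0 (sdL (patch v) l))"
		unfolding sum_distrib_left sum.distrib[symmetric] patch_lin stencil_diff_lin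
		by (intro sum.cong refl form1D[OF pre_x0]) auto
	show ?thesis unfolding Lc_def 1 2 by (simp add: algebra_simps)
qed

lemma form_core_bound:
	assumes "finite X" "!!l. l \<in> X ==> finite (T l) \<and> form1 (T l) (f l)"
	shows "\<exists>C\<ge>0. \<forall>u M. (\<forall>l\<in>X. dn T u l \<le> M) --> \<bar>\<Sum>l\<in>X. f l (stencil_diff (T l) u l)\<bar> \<le> C * M"
proof -
	have "\<forall>l\<in>X. \<exists>C\<ge>0. \<forall>h\<in>stsp (T l). \<bar>f l h\<bar> \<le> C * nrm (T l) h" using form1_bounded assms(2) by blast
	from bchoice[OF this] obtain C where C: "!!l. l \<in> X ==> 0 \<le> C l \<and> (\<forall>h\<in>stsp (T l). \<bar>f l h\<bar> \<le> C l * nrm (T l) h)" by blast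
	have "\<bar>\<Sum>l\<in>X. f l (stencil_diff (T l) u l)\<bar> \<le> (\<Sum>l\<in>X. C l) * M" if u: "\<forall>l\<in>X. dn T u l \<le> M" for u M
	proof -
		have "\<bar>\<Sum>l\<in>X. f l (stencil_diff (T l) u l)\<bar> \<le> (\<Sum>l\<in>X. \<bar>f l (stencil_diff (T l) u l)\<bar>)" by (rule sum_abs)
		also have "\<dots> \<le> (\<Sum>l\<in>X. C l * M)"
		proof (rule sum_mono)
			fix l assume l: "l \<in> X"
			have "\<bar>f l (stencil_diff (T l) u l)\<bar> \<le> C l * dn T u l" unfolding dn_def using C[OF l] by simp
			also have "\<dots> \<le> C l * M" using C[OF l] u l by (intro mult_left_mono) auto
			finally show "\<bar>f l (stencil_diff (T l) u l)\<bar> \<le> C l * M" .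
		qed
		finally show ?thesis by (simp add: sum_distrib_right)
	qed
	moreover have "0 \<le> (\<Sum>l\<in>X. C l)" using C by (intro sum_nonneg) blast
	ultimately show ?thesis by blast
qed

lemma Lc_bound: "\<exists>C\<ge>0. \<forall>u\<in>N.W. \<bar>Lc u\<bar> \<le> C * N.D u"
proof -
	obtain C1 where C1: "0 \<le> C1" "!!u M. (\<forall>l\<in>core\<Lambda>. dn St u l \<le> M) ==> \<bar>\<Sum>l\<in>core\<Lambda>. pre l (stencil_diff (St l) u l)\<bar> \<le> C1 * M"
		using form_core_bound[of core\<Lambda> St pre] fin\<Lambda> fin_St pre_form by blast
	obtain C2 where C2: "0 \<le> C2" "!!u M. (\<forall>l\<in>coreL. dnL u l \<le> M) ==> \<bar>\<Sum>l\<in>coreL. pre x0 (sdL u l)\<bar> \<le> C2 * M"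
		using form_core_bound[of coreL "\<lambda>_. S" "\<lambda>_. pre x0"] fin_ball finS pre_x0 by blast
	obtain C3 where C3: "0 \<le> C3" "!!u. u \<in> N.W ==> patch u \<in> W" "!!u. u \<in> N.W ==> D (patch u) \<le> C3 * N.D u" using patch_W_L by blast
	have "\<bar>Lc u\<bar> \<le> (C1 + C2 * C3) * N.D u" if u: "u \<in> N.W" for u
	proof -
		have "\<bar>\<Sum>l\<in>core\<Lambda>. pre l (stencil_diff (St l) u l)\<bar> \<le> C1 * N.D u" using dn_le_Dn[OF u] by (intro C1(2)) blast
		moreover have "\<bar>\<Sum>l\<in>coreL. pre x0 (sdL (patch u) l)\<bar> \<le> C2 * D (patch u)" using dn_le_Dn[OF C3(2)[OF u]] by (intro C2(2)) blast
		moreover have "C2 * D (patch u) \<le> C2 * (C3 * N.D u)" using C3(3)[OF u] C2(1) by (rule mult_left_mono)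
		ultimately show ?thesis unfolding Lc_def by (simp add: algebra_simps)
	qed
	then show ?thesis using C1(1) C2(1) C3(1) by (intro exI[of _ "C1 + C2 * C3"]) auto
qed

definition KL :: real where "KL = (SOME C. 0 \<le> C \<and> (\<forall>u\<in>N.W. \<bar>Lc u\<bar> \<le> C * N.D u))"

lemma KL: "0 \<le> KL" "u \<in> N.W ==> \<bar>Lc u\<bar> \<le> KL * N.D u"
proof -
	have "0 \<le> KL \<and> (\<forall>u\<in>N.W. \<bar>Lc u\<bar> \<le> KL * N.D u)" unfolding KL_def using Lc_bound by (rule someI_ex)
	then show "0 \<le> KL" "u \<in> N.W ==> \<bar>Lc u\<bar> \<le> KL * N.D u" by auto
qed

lemma outside: "ball 0 Rdef \<inter> \<Lambda> \<subseteq> \<Omega> ==> l \<in> \<Lambda> ==> l \<notin> \<Omega> ==> Rdef \<le> norm l \<and> St l = S"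
	using St_hom[of l] by (force simp: not_less)

text \<open>Linearisation at 0 keeps the first derivative there, so the linear parts do not depend
  on \<Omega> and one \<open>Lc\<close> serves all the energies.\<close>

lemma dVo_zero:
	assumes "ball 0 Rdef \<inter> \<Lambda> \<subseteq> \<Omega>" "l \<in> \<Lambda>" "h \<in> stsp (St l)"
	shows "dVo \<Omega> l zf h = pre l h"
	using outside[OF assms(1,2)] assms(3) dder_hom_zero[of h] by (auto simp: dVo_def pre_far) (simp add: pre_def)

lemma energy_net_Vo:
	assumes \<Omega>: "ball 0 Rdef \<inter> \<Lambda> \<subseteq> \<Omega>"
	shows "energy_net \<Lambda> St (Vo \<Omega>) (dVo \<Omega>) (ddVo \<Omega>) K Lc KL"
proof unfold_locales
	show "site_ok (St l) K (Vo \<Omega> l) (dVo \<Omega> l) (ddVo \<Omega> l)" if l: "l \<in> \<Lambda>" for l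
	proof (cases "l \<in> \<Omega>")
		case True
		then show ?thesis using ok_Vd[OF l] by (simp add: Vo_def dVo_def ddVo_def)
	next
		case False
		then show ?thesis using outside[OF \<Omega> l False] site_ok_linearised[OF ok_hom K0] by (simp add: Vo_def dVo_def ddVo_def)
	qed
	show "Vo \<Omega> l zf = 0" if l: "l \<in> \<Lambda>" for l
	proof -
		have "linearised_potential Vhom zf = 0"
			using form1_zero[OF hom_at_zero(1)] dder_hom_zero[OF stencil_space_zero]
			by (simp add: linearised_potential_def Vhom_zero dder_def[abs_def])
		then show ?thesis using V_zero[OF l] Vhom_zero by (simp add: Vo_def Vd_def)
	qed
qed (use K0 Lc_lin KL in auto)

text \<open>Beyond radius \<open>R1\<close> the site terms of \<open>u\<close> on \<Lambda> and of
  \<open>patch u\<close> on the Bravais lattice coincide. Subtracting the latter sum, which is 0 by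
  \<open>telescope\<close>, leaves the two core sums of \<open>Lc\<close>.\<close>

lemma Lc_sum:
	assumes u: "u \<in> Wdc \<Lambda> St"
	shows "(\<lambda>l. pre l (stencil_diff (St l) u l)) summable_on \<Lambda>" "(\<Sum>\<^sub>\<infinity>l\<in>\<Lambda>. pre l (stencil_diff (St l) u l)) = Lc u"
proof -
	let ?h = "\<lambda>l. pre l (stencil_diff (St l) u l)" and ?g = "\<lambda>l. pre x0 (sdL (patch u) l)"
	have z: "?h l = 0" if "l \<in> \<Lambda>" "dn St u l = 0" for l
	proof -
		have "\<forall>\<rho>\<in>St l. u (l + \<rho>) - u l = 0"
			using that fin_St[OF that(1)] unfolding dn_alt by (simp add: L2_set_eq_0_iff)
		then have "stencil_diff (St l) u l = zf" by (auto simp: stencil_diff_def)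
		then show ?thesis using form1_zero[OF pre_form[OF that(1)]] by simp
	qed
	have zL: "?g l = 0" if "dnL (patch u) l = 0" for l
	proof -
		have "\<forall>\<rho>\<in>S. patch u (l + \<rho>) - patch u l = 0" using that finS unfolding dn_alt by (simp add: L2_set_eq_0_iff)
		then have "sdL (patch u) l = zf" by (auto simp: stencil_diff_def)
		then show ?thesis using form1_zero[OF pre_x0] by simp
	qed
	have fin1: "finite {l\<in>\<Lambda>. ?h l \<noteq> 0}"
		by (rule finite_subset[of _ "{l\<in>\<Lambda>. dn St u l \<noteq> 0}"]) (use z u in \<open>auto simp: Wdc_def\<close>)
	have fin2: "finite {l\<in>L. ?g l \<noteq> 0}"
		by (rule finite_subset[of _ "{l\<in>L. dnL (patch u) l \<noteq> 0}"]) (use zL patch_Wdc[OF u] in \<open>auto simp: Wdc_def\<close>)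
	show s: "?h summable_on \<Lambda>" using fin1 by (rule finite_nonzero_values_imp_summable_on)
	have s2: "?g summable_on L" using fin2 by (rule finite_nonzero_values_imp_summable_on)
	have e1: "(\<Sum>\<^sub>\<infinity>l\<in>\<Lambda>. ?h l) = (\<Sum>l\<in>core\<Lambda>. ?h l) + (\<Sum>\<^sub>\<infinity>l\<in>\<Lambda> - core\<Lambda>. ?h l)"
		by (rule infsum_split_finite[OF s fin\<Lambda> Int_lower1])
	have e2: "(\<Sum>\<^sub>\<infinity>l\<in>L. ?g l) = (\<Sum>l\<in>coreL. ?g l) + (\<Sum>\<^sub>\<infinity>l\<in>L - coreL. ?g l)"
		by (rule infsum_split_finite[OF s2 fin_ball Int_lower1])
	have e3: "(\<Sum>\<^sub>\<infinity>l\<in>L - coreL. ?g l) = (\<Sum>\<^sub>\<infinity>l\<in>\<Lambda> - core\<Lambda>. ?h l)"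
	proof (rule infsum_cong_neutral)
		fix l assume l: "l \<in> (L - coreL) \<inter> (\<Lambda> - core\<Lambda>)"
		then have far: "l \<in> \<Lambda>" "R1 \<le> norm l" by auto
		then show "?g l = ?h l" using x0(2) R1 by (simp add: sd_patch far_St pre_far)
	qed (use far_sets(3) in auto)
	have "(\<Sum>\<^sub>\<infinity>l\<in>L. ?g l) = 0" by (rule telescope[OF dim2 patch_Wdc[OF u] pre_x0])
	then show "(\<Sum>\<^sub>\<infinity>l\<in>\<Lambda>. ?h l) = Lc u" unfolding Lc_def using e1 e2 e3 by linarith
qed

text \<open>On \<open>Wdc\<close> the linear parts are summable with sum \<open>Lc u\<close>, so
  they cancel in \<open>G\<close>; as \<open>G\<close> is continuous, it is the extension.\<close>

lemma energy_lin_eq: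
	assumes \<Omega>: "ball 0 Rdef \<inter> \<Lambda> \<subseteq> \<Omega>" "\<Omega> \<subseteq> \<Lambda>" and u: "u \<in> N.W"
	shows "energy_lin \<T> \<Lambda> St V Vhom \<Omega> u = energy_net.G \<Lambda> St (Vo \<Omega>) (dVo \<Omega>) Lc u"
proof -
	interpret E: energy_net \<Lambda> St "Vo \<Omega>" "dVo \<Omega>" "ddVo \<Omega>" K Lc KL by (rule energy_net_Vo[OF \<Omega>(1)])
	have "E.G u = energy_lin_c \<Lambda> St V Vhom \<Omega> u" if u: "u \<in> Wdc \<Lambda> St" for u
	proof -
		let ?h = "\<lambda>l. pre l (E.sd u l)" and ?V = "\<lambda>l. Vo \<Omega> l (E.sd u l)"
		have uW: "u \<in> N.W" using u Wdc_subset_Wd by blast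
		have eq: "Vo \<Omega> l (E.sd u l) - dVo \<Omega> l zf (E.sd u l) = ?V l - ?h l" if "l \<in> \<Lambda>" for l
			using dVo_zero[OF \<Omega>(1) that] by simp
		have s1: "(?V .- ?h) summable_on \<Lambda>" using E.V_summable[OF uW] by (subst summable_on_cong[OF eq[symmetric]])
		have sV: "?V summable_on \<Lambda>" using summable_on_add[OF s1 Lc_sum(1)[OF u]] by simp
		have "E.G u = (\<Sum>\<^sub>\<infinity>l\<in>\<Lambda>. ?V l - ?h l) + (\<Sum>\<^sub>\<infinity>l\<in>\<Lambda>. ?h l)"
			unfolding E.G_def Lc_sum(2)[OF u] using infsum_cong[OF eq] by simp
		also have "\<dots> = (\<Sum>\<^sub>\<infinity>l\<in>\<Lambda>. ?V l)" using infsum_add[OF s1 Lc_sum(1)[OF u]] by simp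
		also have "\<dots> = (\<Sum>\<^sub>\<infinity>l\<in>\<Omega> \<union> (\<Lambda> - \<Omega>). ?V l)" using \<Omega>(2) by (simp add: Un_absorb1)
		also have "\<dots> = (\<Sum>\<^sub>\<infinity>l\<in>\<Omega>. ?V l) + (\<Sum>\<^sub>\<infinity>l\<in>\<Lambda> - \<Omega>. ?V l)"
			by (rule infsum_Un_disjoint) (use sV \<Omega>(2) in \<open>auto intro: summable_on_subset_banach\<close>)
		also have "(\<Sum>\<^sub>\<infinity>l\<in>\<Omega>. ?V l) = (\<Sum>\<^sub>\<infinity>l\<in>\<Omega>. V l (stencil_diff (St l) u l))"
		proof (rule infsum_cong)
			fix l assume l: "l \<in> \<Omega>"
			then have l': "l \<in> \<Lambda>" using \<Omega>(2) by blast
			show "?V l = V l (stencil_diff (St l) u l)"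
				using l V_hom[OF l', of "stencil_diff (St l) u l"] St_hom[OF l'] by (simp add: Vo_def Vd_def)
		qed
		also have "(\<Sum>\<^sub>\<infinity>l\<in>\<Lambda> - \<Omega>. ?V l) = (\<Sum>\<^sub>\<infinity>l\<in>\<Lambda> - \<Omega>. linearised_potential Vhom (stencil_diff (St l) u l))"
			by (rule infsum_cong) (simp add: Vo_def)
		finally show ?thesis by (simp add: energy_lin_c_def)
	qed
	then show ?thesis unfolding energy_lin_def by (intro continuous_extension_eq E.G_continuous u)
qed

lemma energy_eq: "energy \<T> \<Lambda> St V = energy_lin \<T> \<Lambda> St V Vhom \<Lambda>"
proof -
	have "energy_c \<Lambda> St V = energy_lin_c \<Lambda> St V Vhom \<Lambda>" by (rule ext) (simp add: energy_c_def energy_lin_c_def)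
	then show ?thesis by (simp add: energy_def energy_lin_def)
qed

lemma mesh_energy_Vo:
	assumes "ball 0 Rdef \<inter> \<Lambda> \<subseteq> \<Omega>" "\<Omega> \<subseteq> \<Lambda>"
	shows "mesh_energy A S Rdef rcut \<Lambda> \<T> St (Vo \<Omega>) (dVo \<Omega>) (ddVo \<Omega>) K Lc KL (energy_lin \<T> \<Lambda> St V Vhom \<Omega>)"
proof -
	interpret E: energy_net \<Lambda> St "Vo \<Omega>" "dVo \<Omega>" "ddVo \<Omega>" K Lc KL by (rule energy_net_Vo[OF assms(1)])
	show ?thesis by unfold_locales (rule energy_lin_eq[OF assms])
qed

end

section \<open>Decay of the equilibrium\<close>

context defect_model
begin

sublocale E0: energy_net \<Lambda> St "Vo \<Lambda>" "dVo \<Lambda>" "ddVo \<Lambda>" K Lc KL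
	by (rule energy_net_Vo) blast

abbreviation "Q \<equiv> dder Vhom zf"

lemma far_Vo: "l \<in> \<Lambda> ==> Rdef \<le> norm l ==> dVo \<Lambda> l = dir_deriv Vhom \<and> ddVo \<Lambda> l = dder Vhom"
	by (simp add: dVo_def ddVo_def Vd_def)

lemma hom_taylor:
	assumes "h \<in> stsp S" "k \<in> stsp S" "l \<in> stsp S" "nrm S h \<le> M"
	shows "\<bar>dir_deriv Vhom h k - dir_deriv Vhom zf k - Q h k\<bar> \<le> K M * (nrm S h)\<^sup>2 * nrm S k"
		"\<bar>dder Vhom h k l - Q k l\<bar> \<le> K M * nrm S h * nrm S k * nrm S l"
		"\<bar>Q k l\<bar> \<le> K 0 * nrm S k * nrm S l"
proof -
	have M: "nrm S zf \<le> M" using assms(4) nrm_nonneg[of S h] by (simp only: nrm_zero)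
	show "\<bar>dir_deriv Vhom h k - dir_deriv Vhom zf k - Q h k\<bar> \<le> K M * (nrm S h)\<^sup>2 * nrm S k"
		using site_okD(4)[OF ok_hom stencil_space_zero assms(1,2) M assms(4)] by simp
	show "\<bar>dder Vhom h k l - Q k l\<bar> \<le> K M * nrm S h * nrm S k * nrm S l"
		using site_okD(6)[OF ok_hom stencil_space_zero assms(1-3) M assms(4)] by simp
	show "\<bar>Q k l\<bar> \<le> K 0 * nrm S k * nrm S l"
		using site_okD(5)[OF ok_hom stencil_space_zero assms(2,3), of 0] by simp
qed

lemma patch_patch: "patch (patch v) = patch v"
	using x0(2) R1 by (auto simp: patch_def)

lemma patch_finite:
	assumes X: "finite X" "X \<subseteq> \<Lambda>"
	shows "\<exists>F C. finite F \<and> F \<subseteq> L \<and> 0 \<le> C \<and> (\<forall>v. \<forall>l\<in>X. dn St (patch v) l \<le> C * (\<Sum>l\<in>F. dnL v l))"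
proof -
	obtain F C where F: "finite F" "F \<subseteq> L" "0 \<le> C" "!!v l. l \<in> core\<Lambda> ==> dn St (patch v) l \<le> C * (\<Sum>l\<in>F. dnL v l)"
		using patch_core_\<Lambda> by blast
	let ?F = "F \<union> (X - core\<Lambda>)"
	have fF: "finite ?F" using F X by simp
	have "dn St (patch v) l \<le> (C + 1) * (\<Sum>l\<in>?F. dnL v l)" if l: "l \<in> X" for v l
	proof (cases "l \<in> core\<Lambda>")
		case True
		have "C * (\<Sum>l\<in>F. dnL v l) \<le> (C + 1) * (\<Sum>l\<in>?F. dnL v l)"
			using F fF by (intro mult_mono sum_mono2 sum_nonneg) auto
		then show ?thesis using F(4)[OF True, of v] by linarith
	next
		case False
		then have far: "l \<in> \<Lambda>" "R1 \<le> norm l" using l X by auto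
		have "dn St (patch v) l = dnL v l" using far by (simp add: dn_far dnL_patch)
		also have "\<dots> \<le> (\<Sum>l\<in>?F. dnL v l)" using l False fF by (intro member_le_sum) auto
		also have "\<dots> \<le> (C + 1) * (\<Sum>l\<in>?F. dnL v l)" using F(3) mult_right_mono[of 1 "C + 1" "\<Sum>l\<in>?F. dnL v l"] by (simp add: sum_nonneg)
		finally show ?thesis .
	qed
	then show ?thesis using fF F X far_sets(2) by (intro exI[of _ ?F] exI[of _ "C + 1"]) auto
qed

end

locale stable_defect = defect_model A S Rdef rcut \<Lambda> \<T> St V Vhom K
	for A :: "real^'d^'d" and S Rdef rcut \<Lambda> \<T> St V Vhom K +
	fixes ub :: "'d vfun" and c :: real
	assumes ub: "ub \<in> Wd \<Lambda> St" and crit: "v \<in> Wd \<Lambda> St ==> E0.dG ub v = 0" and c0: "0 < c"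
		and stab: "v \<in> Wd \<Lambda> St ==> c * (Dn \<Lambda> St v)\<^sup>2 \<le> E0.ddG ub v v"
begin

abbreviation "M0 \<equiv> Dn \<Lambda> St ub"

lemma M0: "l \<in> \<Lambda> ==> dn St ub l \<le> M0" by (rule dn_le_Dn[OF ub])

lemma Dn_finite_sum:
	assumes "finite U" "U \<subseteq> X" "!!l. l \<in> X - U ==> dn T w l = 0"
	shows "(Dn X T w)\<^sup>2 = (\<Sum>l\<in>U. (dn T w l)\<^sup>2)"
proof -
	have "(Dn X T w)\<^sup>2 = (\<Sum>\<^sub>\<infinity>l\<in>U. (dn T w l)\<^sup>2)" unfolding Dn_def n2_sq
		using assms(2,3) by (intro infsum_cong_neutral) auto
	then show ?thesis using assms(1) by simp
qed

text \<open>Far from the defect the Hessian at the equilibrium is close to that of the homogeneous lattice,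
	so translating a test function to infinity transfers the coercivity.\<close>

lemma hom_coercive:
	assumes v: "v \<in> Fs"
	shows "c / 2 * (D v)\<^sup>2 \<le> HB Q v v"
proof -
	\<comment> \<open>Where \<open>dn St ub\<close> is at most \<eta>, replacing the Hessian at the
	  equilibrium by \<open>Q\<close> costs at most c/2 of the coercivity constant.\<close>
	define \<eta> where "\<eta> = c / (2 * (K M0 + 1))"
	have \<eta>: "0 < \<eta>" "K M0 * \<eta> \<le> c / 2"
	proof -
		have "K M0 * \<eta> \<le> (K M0 + 1) * \<eta>" using c0 K0[of M0] by (intro mult_right_mono) (auto simp: \<eta>_def)
		also have "\<dots> = c / 2" unfolding \<eta>_def using K0[of M0] by (simp add: field_simps)
		finally show "K M0 * \<eta> \<le> c / 2" .
	qed (use c0 K0[of M0] in \<open>simp add: \<eta>_def\<close>)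
	have l2ub: "l2 \<Lambda> (dn St ub)" using ub by (simp add: Wd_def)
	obtain F where F: "finite F" "F \<subseteq> \<Lambda>" "n2 (\<Lambda> - F) (dn St ub) < \<eta>" using l2_tail[OF l2ub \<eta>(1)] by blast
	let ?B = "F \<union> {l\<in>L. v l \<noteq> 0} \<union> {l\<in>L. sdL v l \<noteq> zf}"
	define r where "r = (\<Sum>l\<in>?B. norm l)"
	have fB: "finite ?B" using F v Fs_fin[OF v] by (simp add: Fs_def)
	have r: "norm l \<le> r" if "l \<in> ?B" for l unfolding r_def using that by (intro member_le_sum fB) auto
	have r0: "0 \<le> r" unfolding r_def by (simp add: sum_nonneg)
	\<comment> \<open>Far enough for the translate of \<open>v\<close> to vanish near the core and at
	  \<open>x0\<close>, and for its nonzero stencils to avoid \<open>F\<close>. Vanishing at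
	  \<open>x0\<close> makes \<open>patch\<close> fill the core with 0.\<close>
	obtain a where a: "a \<in> L" "2 * r + R1 + rcut + norm x0 + 1 \<le> norm a" using far_exists by blast
	define va where "va = (\<lambda>x. v (x - a))"
	have vaF: "va \<in> Fs" unfolding va_def by (rule Fs_shift[OF a(1) v])
	then have vaW: "va \<in> W" using Fs_W by blast
	define w where "w = patch va"
	have wW: "w \<in> N.W" unfolding w_def using patch_W_\<Lambda> vaW by blast
	have va0: "va x = 0" if "x \<in> L" "norm x < R1 + rcut + norm x0 + 1" for x
	proof (rule ccontr)
		assume "va x \<noteq> 0"
		then have "norm (x - a) \<le> r" using that L_diff a(1) by (intro r) (simp add: va_def)
		then show False using norm_triangle_ineq3[of a x] a(2) r0 that(2) by (simp add: norm_minus_commute)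
	qed
	let ?U = "{l\<in>L. sdL va l \<noteq> zf}"
	have fU: "finite ?U" by (rule Fs_fin[OF vaF])
	have sdva: "sdL va l = sdL v (l - a)" for l using sdL_shift[of v "- a" l] by (simp add: va_def)
	have Ufar: "l \<in> L" "l \<in> \<Lambda>" "R1 \<le> norm l" "Rdef \<le> norm l" "l \<notin> F" if l: "l \<in> ?U" for l
	proof -
		have "norm (l - a) \<le> r" using l L_diff a(1) by (intro r) (simp add: sdva)
		then have b: "r + R1 + rcut + norm x0 + 1 \<le> norm l" using norm_triangle_ineq3[of a l] a(2) by (simp add: norm_minus_commute)
		show "l \<in> L" using l by blast
		show "R1 \<le> norm l" using b r0 rcut norm_ge_zero[of x0] by linarith
		then show "Rdef \<le> norm l" using R1 by linarith
		then show "l \<in> \<Lambda>" using l far_\<Lambda> by blast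
		show "l \<notin> F" using b r[of l] R1 rcut norm_ge_zero[of x0] by force
	qed
	have sdw: "stencil_diff (St l) w l = (if l \<in> ?U then sdL va l else zf)" if l: "l \<in> \<Lambda>" for l
	proof (cases "R1 \<le> norm l")
		case True
		then have "l \<in> L" using far_L[OF l] R1 by simp
		then show ?thesis using True l by (simp add: far_St w_def sd_patch)
	next
		case False
		have wz: "w x = 0" if "x \<in> \<Lambda>" "norm x < R1 + rcut" for x
			unfolding w_def patch_in using that far_L[OF that(1)] x0(1) rcut R1 norm_ge_zero[of x0] by (intro va0) (auto simp del: norm_ge_zero)
		have "w (l + \<rho>) = 0" if "\<rho> \<in> St l" for \<rho>
		proof (rule wz)
			show "l + \<rho> \<in> \<Lambda>" using St_\<Lambda> l that by blast
			show "norm (l + \<rho>) < R1 + rcut" using norm_triangle_ineq[of l \<rho>] St_norm[OF l that] False by linarith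
		qed
		moreover have "w l = 0" using wz[OF l] False rcut by simp
		ultimately have "stencil_diff (St l) w l = zf" by (intro ext) (simp add: stencil_diff_def)
		moreover have "l \<notin> ?U" using Ufar(3)[of l] False by blast
		ultimately show ?thesis by (simp only: if_False)
	qed
	have UL: "?U \<subseteq> \<Lambda>" using Ufar(2) by blast
	have dw: "dn St w l = dnL va l" if l: "l \<in> ?U" for l
		using sdw[OF Ufar(2)[OF l]] l far_St[OF Ufar(2)[OF l] Ufar(3)[OF l]] by (simp add: dn_def)
	have "(N.D w)\<^sup>2 = (\<Sum>l\<in>?U. (dn St w l)\<^sup>2)"
		by (rule Dn_finite_sum[OF fU UL]) (simp add: dn_def sdw)
	also have "\<dots> = (\<Sum>l\<in>?U. (dnL va l)\<^sup>2)" using dw by (intro sum.cong) auto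
	also have Dva: "\<dots> = (D v)\<^sup>2"
	proof -
		have "(\<Sum>l\<in>?U. (dnL va l)\<^sup>2) = (D va)\<^sup>2"
			by (rule Dn_finite_sum[symmetric, OF fU]) (auto simp: dn_def)
		moreover have "D va = D v" using W_shift(2)[of "- a" v] L_diff[OF L_zero a(1)] subsetD[OF Fs_W v] by (simp add: va_def)
		ultimately show ?thesis by simp
	qed
	finally have Dw: "(N.D w)\<^sup>2 = (D v)\<^sup>2" .
	have "HB Q v v = HB Q va va" using HB_shift[of "- a" Q v v] L_diff[OF L_zero a(1)] by (simp add: va_def)
	also have "\<dots> = (\<Sum>\<^sub>\<infinity>l\<in>?U. Q (sdL va l) (sdL va l))"
		unfolding HB_def by (intro infsum_cong_neutral) (auto simp: dder_hom_zero)
	finally have HB: "HB Q v v = (\<Sum>l\<in>?U. Q (sdL va l) (sdL va l))" using fU by simp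
	have "E0.ddG ub w w = (\<Sum>\<^sub>\<infinity>l\<in>?U. ddVo \<Lambda> l (E0.sd ub l) (E0.sd w l) (E0.sd w l))"
		unfolding E0.ddG_def
	proof (rule infsum_cong_neutral)
		fix l assume l: "l \<in> \<Lambda> - ?U"
		then have l': "l \<in> \<Lambda>" "l \<notin> ?U" by blast+
		have z: "E0.sd w l = zf" unfolding sdw[OF l'(1)] using l'(2) by (simp only: if_False)
		have "form2 (St l) (ddVo \<Lambda> l (E0.sd ub l))" by (rule site_okD(2)[OF E0.ok[OF l'(1)] stencil_diff_in])
		then have "form1 (St l) (ddVo \<Lambda> l (E0.sd ub l) zf)" unfolding form2_def by simp
		then show "ddVo \<Lambda> l (E0.sd ub l) (E0.sd w l) (E0.sd w l) = 0" unfolding z by (rule form1_zero)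
	qed (use UL in auto)
	also have "\<dots> = (\<Sum>l\<in>?U. ddVo \<Lambda> l (E0.sd ub l) (E0.sd w l) (E0.sd w l))" using fU by simp
	also have "\<dots> \<le> (\<Sum>l\<in>?U. Q (sdL va l) (sdL va l) + c / 2 * (dnL va l)\<^sup>2)"
	proof (rule sum_mono)
		fix l assume l: "l \<in> ?U"
		note f = Ufar[OF l]
		have "dn St ub l \<le> n2 (\<Lambda> - F) (dn St ub)" using abs_le_n2[OF l2_subset(1)[OF l2ub], of "\<Lambda> - F" l] f by auto
		then have small: "dnL ub l \<le> \<eta>" using F(3) dn_far[OF f(2,3)] by simp
		have "nrm S (sdL ub l) \<le> M0" using M0[OF f(2)] dn_far[OF f(2,3), of ub] by (simp add: dn_def)
		then have "\<bar>dder Vhom (sdL ub l) (sdL va l) (sdL va l) - Q (sdL va l) (sdL va l)\<bar> \<le> K M0 * nrm S (sdL ub l) * nrm S (sdL va l) * nrm S (sdL va l)"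
			by (intro hom_taylor(2)) auto
		also have "\<dots> = (K M0 * dnL ub l) * (dnL va l)\<^sup>2" by (simp add: dn_def power2_eq_square mult_ac)
		also have "\<dots> \<le> (K M0 * \<eta>) * (dnL va l)\<^sup>2" using small K0 by (intro mult_right_mono mult_left_mono) auto
		also have "\<dots> \<le> c / 2 * (dnL va l)\<^sup>2" using \<eta>(2) by (rule mult_right_mono) simp
		finally have "dder Vhom (sdL ub l) (sdL va l) (sdL va l) \<le> Q (sdL va l) (sdL va l) + c / 2 * (dnL va l)\<^sup>2" by linarith
		then show "ddVo \<Lambda> l (E0.sd ub l) (E0.sd w l) (E0.sd w l) \<le> Q (sdL va l) (sdL va l) + c / 2 * (dnL va l)\<^sup>2"
			using sdw[OF f(2)] l far_Vo[OF f(2,4)] far_St[OF f(2,3)] by simp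
	qed
	also have "\<dots> = HB Q v v + c / 2 * (D v)\<^sup>2" unfolding HB Dva[symmetric] by (simp add: sum.distrib sum_distrib_left)
	finally show ?thesis using stab[OF wW] unfolding Dw by (simp add: field_simps)
qed

sublocale hom_form A S Q "K 0" "c / 2"
proof unfold_locales
	show "form2 S Q" by (rule hom_at_zero(2))
	show "0 \<le> K 0" by (rule K0)
	show "\<bar>Q g h\<bar> \<le> K 0 * nrm S g * nrm S h" if "g \<in> stsp S" "h \<in> stsp S" for g h
		using hom_taylor(3)[OF stencil_space_zero that order_refl] .
	show "0 < c / 2" using c0 by simp
qed (rule hom_coercive)

definition u' :: "'d vfun" where "u' = patch ub"

lemma u'_W: "u' \<in> W" unfolding u'_def using patch_W_L ub by blast

lemma u'_far: "R1 \<le> norm l ==> sdL u' l = sdL ub l" "l \<in> \<Lambda> ==> R1 \<le> norm l ==> dnL u' l = dn St ub l"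
	unfolding u'_def by (auto simp: sd_patch dn_far dnL_patch)

definition err :: "'d vfun => real^'d => real" where
	"err v l = dir_deriv Vhom (sdL u' l) (sdL v l) - dir_deriv Vhom zf (sdL v l) - Q (sdL u' l) (sdL v l)"

lemma err_bound:
	assumes l: "l \<in> L" "R1 \<le> norm l"
	shows "\<bar>err v l\<bar> \<le> K M0 * (dnL u' l)\<^sup>2 * dnL v l"
proof -
	have "l \<in> \<Lambda>" using l far_\<Lambda> R1 by simp
	then have "nrm S (sdL u' l) \<le> M0" using M0[of l] u'_far(2)[of l] l(2) by (simp add: dn_def)
	then show ?thesis unfolding err_def dn_def by (intro hom_taylor(1)[OF _ _ stencil_space_zero]) auto
qed

lemma err_summable:
	assumes v: "v \<in> W"
	shows "err v summable_on (L - coreL)"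
proof (rule n2_product(1))
	show "l2 (L - coreL) (dnL u')" "l2 (L - coreL) (dnL v)" using u'_W v l2_subset(1)[of L] by (auto simp: Wd_def)
	show "0 \<le> K M0 * D u'" using K0 by (simp add: sn.p0)
	fix l assume l: "l \<in> L - coreL"
	have "\<bar>err v l\<bar> \<le> K M0 * (dnL u' l)\<^sup>2 * dnL v l" using l by (intro err_bound) auto
	also have "\<dots> = K M0 * dnL u' l * dnL u' l * dnL v l" by (simp add: power2_eq_square)
	also have "\<dots> \<le> K M0 * D u' * dnL u' l * dnL v l" using l dn_le_Dn[OF u'_W, of l] K0 by (intro mult_right_mono mult_left_mono) auto
	finally show "\<bar>err v l\<bar> \<le> K M0 * D u' * \<bar>dnL u' l\<bar> * \<bar>dnL v l\<bar>" by simp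
qed

text \<open>Test the equilibrium equation with \<open>patch v\<close>. Beyond \<open>R1\<close> it
  is the homogeneous linear equation up to the Taylor remainder \<open>err\<close>; the rest,
  including \<open>Lc\<close>, lives on finitely many sites and is bounded by finitely many stencil
  norms of \<open>v\<close>.\<close>

lemma residual:
	obtains F C where "finite F" "F \<subseteq> L" "0 \<le> C"
		"!!v. v \<in> W ==> \<bar>HB Q u' v\<bar> \<le> C * (\<Sum>l\<in>F. dnL v l) + (\<Sum>\<^sub>\<infinity>l\<in>L - coreL. \<bar>err v l\<bar>)"
proof -
	obtain F0 C0 where F0: "finite F0" "F0 \<subseteq> \<Lambda>" "0 \<le> C0" "!!u l. l \<in> coreL ==> dnL (patch u) l \<le> C0 * (\<Sum>l\<in>F0. dn St u l)"
		using patch_core_L by blast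
	obtain F1 C1 where F1: "finite F1" "F1 \<subseteq> L" "0 \<le> C1" "!!v l. l \<in> core\<Lambda> \<union> F0 ==> dn St (patch v) l \<le> C1 * (\<Sum>l\<in>F1. dnL v l)"
		using patch_finite[of "core\<Lambda> \<union> F0"] F0(1,2) fin\<Lambda> by (metis Int_lower1 Un_least finite_Un)
	obtain C2 where C2: "0 \<le> C2" "!!u M. (\<forall>l\<in>core\<Lambda>. dn St u l \<le> M) ==> \<bar>\<Sum>l\<in>core\<Lambda>. pre l (stencil_diff (St l) u l)\<bar> \<le> C2 * M"
		using form_core_bound[of core\<Lambda> St pre] fin\<Lambda> fin_St pre_form by blast
	obtain C3 where C3: "0 \<le> C3" "!!u M. (\<forall>l\<in>coreL. dnL u l \<le> M) ==> \<bar>\<Sum>l\<in>coreL. pre x0 (sdL u l)\<bar> \<le> C3 * M"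
		using form_core_bound[of coreL "\<lambda>_. S" "\<lambda>_. pre x0"] fin_ball finS pre_x0 by blast
	let ?k0 = "K M0 * M0 + K M0"
	let ?F = "F1 \<union> coreL"
	let ?N = "\<lambda>v. \<Sum>l\<in>?F. dnL v l"
	define C where "C = K 0 * D u' + real (card core\<Lambda>) * (?k0 * M0 * C1) + C2 * C1 + C3 * (C0 * (real (card F0) * C1))"
	have M00: "0 \<le> M0" by (rule N.sn.p0)
	have k0: "0 \<le> ?k0" using K0 M00 by simp
	have fF: "finite ?F" using F1(1) fin_ball by blast
	have main: "\<bar>HB Q u' v\<bar> \<le> C * ?N v + (\<Sum>\<^sub>\<infinity>l\<in>L - coreL. \<bar>err v l\<bar>)" if v: "v \<in> W" for v
	proof -
		define p where "p = patch v"
		have pW: "p \<in> N.W" unfolding p_def using patch_W_\<Lambda> v by blast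
		have N0: "0 \<le> ?N v" by (simp add: sum_nonneg)
		have p: "dn St p l \<le> C1 * ?N v" if "l \<in> core\<Lambda> \<union> F0" for l
		proof -
			have "dn St p l \<le> C1 * (\<Sum>l\<in>F1. dnL v l)" unfolding p_def by (rule F1(4)[OF that])
			also have "\<dots> \<le> C1 * ?N v" using fF F1(3) by (intro mult_left_mono sum_mono2) auto
			finally show ?thesis .
		qed
		have pp: "dnL p l \<le> C0 * (real (card F0) * (C1 * ?N v))" if "l \<in> coreL" for l
		proof -
			have "dnL p l \<le> C0 * (\<Sum>l\<in>F0. dn St p l)" using F0(4)[OF that, of p] by (simp add: p_def patch_patch)
			also have "\<dots> \<le> C0 * (real (card F0) * (C1 * ?N v))" using p F0(3) by (intro mult_left_mono sum_bounded_above) auto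
			finally show ?thesis .
		qed
		let ?h = "\<lambda>l. dVo \<Lambda> l (E0.sd ub l) (E0.sd p l) - dVo \<Lambda> l zf (E0.sd p l)"
		let ?q = "\<lambda>l. Q (sdL u' l) (sdL v l)"
		have sh: "?h summable_on \<Lambda>" by (rule E0.dV_summable[OF ub pW])
		have sq: "?q summable_on L" by (rule HB_summable[OF u'_W v])
		have e1: "(\<Sum>\<^sub>\<infinity>l\<in>\<Lambda>. ?h l) = (\<Sum>l\<in>core\<Lambda>. ?h l) + (\<Sum>\<^sub>\<infinity>l\<in>\<Lambda> - core\<Lambda>. ?h l)"
			by (rule infsum_split_finite[OF sh fin\<Lambda> Int_lower1])
		have e2: "HB Q u' v = (\<Sum>l\<in>coreL. ?q l) + (\<Sum>\<^sub>\<infinity>l\<in>L - coreL. ?q l)"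
			unfolding HB_def by (rule infsum_split_finite[OF sq fin_ball Int_lower1])
		have sqf: "?q summable_on (L - coreL)" using sq by (rule summable_on_subset_banach) blast
		have "(\<Sum>\<^sub>\<infinity>l\<in>\<Lambda> - core\<Lambda>. ?h l) = (\<Sum>\<^sub>\<infinity>l\<in>L - coreL. ?q l + err v l)"
		proof (rule infsum_cong_neutral)
			fix l assume l: "l \<in> (\<Lambda> - core\<Lambda>) \<inter> (L - coreL)"
			then have f: "l \<in> \<Lambda>" "R1 \<le> norm l" "Rdef \<le> norm l" using R1 by auto
			show "?h l = ?q l + err v l"
				using far_Vo[OF f(1,3)] far_St[OF f(1,2)] u'_far(1)[OF f(2)] sd_patch[OF f(2), of v] by (simp add: err_def p_def)
		qed (use far_sets(3) in auto)
		also have "\<dots> = (\<Sum>\<^sub>\<infinity>l\<in>L - coreL. ?q l) + (\<Sum>\<^sub>\<infinity>l\<in>L - coreL. err v l)"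
			by (rule infsum_add[OF sqf err_summable[OF v]])
		finally have e3: "(\<Sum>\<^sub>\<infinity>l\<in>\<Lambda> - core\<Lambda>. ?h l) = (\<Sum>\<^sub>\<infinity>l\<in>L - coreL. ?q l) + (\<Sum>\<^sub>\<infinity>l\<in>L - coreL. err v l)" .
		have "(\<Sum>\<^sub>\<infinity>l\<in>\<Lambda>. ?h l) + Lc p = 0" using crit[OF pW] unfolding E0.dG_def .
		then have eq: "HB Q u' v = (\<Sum>l\<in>coreL. ?q l) - (\<Sum>l\<in>core\<Lambda>. ?h l) - Lc p - (\<Sum>\<^sub>\<infinity>l\<in>L - coreL. err v l)"
			using e1 e2 e3 by linarith
		have b1: "\<bar>\<Sum>l\<in>coreL. ?q l\<bar> \<le> K 0 * D u' * ?N v"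
		proof -
			have "\<bar>\<Sum>l\<in>coreL. ?q l\<bar> \<le> (\<Sum>l\<in>coreL. \<bar>?q l\<bar>)" by (rule sum_abs)
			also have "\<dots> \<le> (\<Sum>l\<in>coreL. K 0 * D u' * dnL v l)"
			proof (rule sum_mono)
				fix l assume l: "l \<in> coreL"
				have "\<bar>?q l\<bar> \<le> K 0 * dnL u' l * dnL v l" using HB_term_bound[of u' l v] by simp
				also have "\<dots> \<le> K 0 * D u' * dnL v l" using l dn_le_Dn[OF u'_W, of l] K0 by (intro mult_right_mono mult_left_mono) auto
				finally show "\<bar>?q l\<bar> \<le> K 0 * D u' * dnL v l" .
			qed
			also have "\<dots> = K 0 * D u' * (\<Sum>l\<in>coreL. dnL v l)" by (simp add: sum_distrib_left)
			also have "\<dots> \<le> K 0 * D u' * ?N v" using fF K0 sn.p0 by (intro mult_left_mono sum_mono2) auto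
			finally show ?thesis .
		qed
		have b2: "\<bar>\<Sum>l\<in>core\<Lambda>. ?h l\<bar> \<le> real (card core\<Lambda>) * (?k0 * M0 * (C1 * ?N v))"
		proof -
			have "\<bar>\<Sum>l\<in>core\<Lambda>. ?h l\<bar> \<le> (\<Sum>l\<in>core\<Lambda>. \<bar>?h l\<bar>)" by (rule sum_abs)
			also have "\<dots> \<le> real (card core\<Lambda>) * (?k0 * M0 * (C1 * ?N v))"
			proof (rule sum_bounded_above)
				fix l assume l: "l \<in> core\<Lambda>"
				have "\<bar>?h l\<bar> \<le> ?k0 * \<bar>dn St ub l\<bar> * \<bar>dn St p l\<bar>" using l by (intro E0.dV_bd[OF _ ub order_refl]) blast
				also have "\<dots> \<le> ?k0 * M0 * (C1 * ?N v)"
					using l p[of l] M0[of l] k0 M00 by (intro mult_mono mult_nonneg_nonneg) auto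
				finally show "\<bar>?h l\<bar> \<le> ?k0 * M0 * (C1 * ?N v)" .
			qed
			finally show ?thesis .
		qed
		have b3: "\<bar>Lc p\<bar> \<le> C2 * (C1 * ?N v) + C3 * (C0 * (real (card F0) * (C1 * ?N v)))"
		proof -
			have "\<bar>\<Sum>l\<in>core\<Lambda>. pre l (stencil_diff (St l) p l)\<bar> \<le> C2 * (C1 * ?N v)" by (rule C2(2)) (use p in blast)
			moreover have "\<bar>\<Sum>l\<in>coreL. pre x0 (sdL p l)\<bar> \<le> C3 * (C0 * (real (card F0) * (C1 * ?N v)))" by (rule C3(2)) (use pp in blast)
			moreover have "patch p = p" by (simp add: p_def patch_patch)
			ultimately show ?thesis unfolding Lc_def by simp
		qed
		have sa: "(\<lambda>l. \<bar>err v l\<bar>) summable_on (L - coreL)"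
			using err_summable[OF v] summable_on_iff_abs_summable_on_real by fastforce
		have b4: "\<bar>\<Sum>\<^sub>\<infinity>l\<in>L - coreL. err v l\<bar> \<le> (\<Sum>\<^sub>\<infinity>l\<in>L - coreL. \<bar>err v l\<bar>)"
			using norm_infsum_bound[of "err v" "L - coreL"] sa by simp
		have "C * ?N v = K 0 * D u' * ?N v + real (card core\<Lambda>) * (?k0 * M0 * (C1 * ?N v)) + (C2 * (C1 * ?N v) + C3 * (C0 * (real (card F0) * (C1 * ?N v))))"
			by (simp add: C_def algebra_simps)
		then show ?thesis unfolding eq using b1 b2 b3 b4 by linarith
	qed
	have "0 \<le> C" unfolding C_def using K0 M00 sn.p0 k0 F0(3) F1(3) C2(1) C3(1) by (intro add_nonneg_nonneg mult_nonneg_nonneg) auto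
	moreover have "?F \<subseteq> L" using F1(2) by blast
	ultimately show thesis using that[OF fF _ _ main] by blast
qed

end

context stable_defect
begin

text \<open>Testing with the kernel at \<open>l\<close> expresses a component of a difference of
  \<open>u'\<close> as \<open>HB Q u' w\<close>. The sum over \<open>err\<close> is split at radius
  r/2: inside, the kernel gradient is O(r^(-d)) since |m - l| \<ge> r/2; outside, one factor of
  \<open>u'\<close> is at most \<open>b\<close>, and Cauchy-Schwarz gives the tail of
  \<open>u'\<close> times the norm of the kernel.\<close>

lemma decay_step:
	obtains C1 C2 r1 where "0 \<le> C1" "0 \<le> C2" "1 \<le> r1"
		"!!r b l. r1 \<le> r ==> 0 \<le> b ==> \<forall>m\<in>L. r / 2 \<le> norm m --> dnL u' m \<le> b ==> l \<in> L ==> r \<le> norm l ==>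
			 dnL u' l \<le> C1 / r ^ CARD('d) + C2 * n2 (L - ball 0 (r / 2)) (dnL u') * b"
proof -
	let ?n = "CARD('d)"
	obtain F C where F: "finite F" "F \<subseteq> L" "0 \<le> C"
		"!!v. v \<in> W ==> \<bar>HB Q u' v\<bar> \<le> C * (\<Sum>l\<in>F. dnL v l) + (\<Sum>\<^sub>\<infinity>l\<in>L - coreL. \<bar>err v l\<bar>)"
		by (rule residual) (rule that, assumption+)
	obtain Ck where Ck: "0 \<le> Ck" "!!l \<sigma> j. l \<in> L ==> \<sigma> \<in> S ==>
		\<exists>w\<in>W. (\<forall>\<phi>\<in>W. HB Q w \<phi> = (\<phi> (l + \<sigma>) - \<phi> l) $ j) \<and> D w \<le> Ck \<and> (\<forall>m\<in>L. dnL w m \<le> Ck / (1 + norm (m - l)) ^ ?n)"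
		by (rule kernel) (rule that, assumption+)
	define rF where "rF = (\<Sum>m\<in>F. norm m)"
	have rF: "norm m \<le> rF" if "m \<in> F" for m unfolding rF_def using that F(1) by (intro member_le_sum) auto
	define B where "B = Ck * 2 ^ ?n"
	have B0: "0 \<le> B" using Ck(1) by (simp add: B_def)
	define C1 where "C1 = real (card S) * (real ?n * (C * (real (card F) * B) + K M0 * B * (D u' * D u')))"
	define C2 where "C2 = real (card S) * (real ?n * (K M0 * Ck))"
	have main: "dnL u' l \<le> C1 / r ^ ?n + C2 * n2 (L - ball 0 (r / 2)) (dnL u') * b"
		if r: "max 1 (2 * rF) \<le> r" and b0: "0 \<le> b" and b: "\<forall>m\<in>L. r / 2 \<le> norm m --> dnL u' m \<le> b" and l: "l \<in> L" "r \<le> norm l" for r b l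
	proof -
		let ?\<epsilon> = "n2 (L - ball 0 (r / 2)) (dnL u')"
		define E where "E = C * (real (card F) * (B / r ^ ?n)) + (K M0 * (B / r ^ ?n) * (D u' * D u') + K M0 * b * ?\<epsilon> * Ck)"
		have r1: "1 \<le> r" "2 * rF \<le> r" using r by auto
		have comp: "\<bar>(u' (l + \<sigma>) - u' l) $ j\<bar> \<le> E" if \<sigma>: "\<sigma> \<in> S" for \<sigma> j
		proof -
			obtain w where w: "w \<in> W" "!!\<phi>. \<phi> \<in> W ==> HB Q w \<phi> = (\<phi> (l + \<sigma>) - \<phi> l) $ j" "D w \<le> Ck"
					"!!m. m \<in> L ==> dnL w m \<le> Ck / (1 + norm (m - l)) ^ ?n"
				using Ck(2)[OF l(1) \<sigma>, of j] by blast
			have near: "dnL w m \<le> B / r ^ ?n" if m: "m \<in> L" "norm m \<le> r / 2" for m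
			proof -
				have "r / 2 \<le> 1 + norm (m - l)" using norm_triangle_ineq3[of l m] m(2) l(2) by (simp add: norm_minus_commute)
				then have "(r / 2) ^ ?n \<le> (1 + norm (m - l)) ^ ?n" using r1 by (intro power_mono) auto
				then have "Ck / (1 + norm (m - l)) ^ ?n \<le> Ck / (r / 2) ^ ?n" using Ck(1) r1 by (intro divide_left_mono mult_pos_pos) (auto intro!: zero_less_power add_pos_nonneg)
				also have "\<dots> = B / r ^ ?n" by (simp add: B_def power_divide)
				finally show ?thesis using w(4)[OF m(1)] by linarith
			qed
			have p1: "C * (\<Sum>m\<in>F. dnL w m) \<le> C * (real (card F) * (B / r ^ ?n))"
			proof (intro mult_left_mono sum_bounded_above F(3))
				fix m assume m: "m \<in> F"
				show "dnL w m \<le> B / r ^ ?n" using m F(2) rF[OF m] r1 by (intro near) auto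
			qed
			let ?X1 = "{m\<in>L - coreL. norm m < r / 2}" and ?X2 = "{m\<in>L - coreL. r / 2 \<le> norm m}"
			have lu: "l2 X (dnL u')" "n2 X (dnL u') \<le> D u'" if "X \<subseteq> L" for X
				using l2_subset[of L "dnL u'" X] u'_W that by (auto simp: Wd_def Dn_def)
			have lw: "l2 X (dnL w)" "n2 X (dnL w) \<le> D w" if "X \<subseteq> L" for X
				using l2_subset[of L "dnL w" X] w(1) that by (auto simp: Wd_def Dn_def)
			have sub: "?X1 \<subseteq> L" "?X2 \<subseteq> L" by blast+
			have eb: "\<bar>err w m\<bar> \<le> K M0 * (dnL u' m)\<^sup>2 * dnL w m" if "m \<in> L - coreL" for m using that by (intro err_bound) auto
			have e1: "\<bar>err w m\<bar> \<le> (K M0 * (B / r ^ ?n)) * \<bar>dnL u' m\<bar> * \<bar>dnL u' m\<bar>" if m: "m \<in> ?X1" for m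
			proof -
				have "K M0 * (dnL u' m)\<^sup>2 * dnL w m \<le> K M0 * (dnL u' m)\<^sup>2 * (B / r ^ ?n)" using m K0 by (intro mult_left_mono near) auto
				then show ?thesis using eb[of m] m by (simp add: power2_eq_square mult_ac)
			qed
			have e2: "\<bar>err w m\<bar> \<le> (K M0 * b) * \<bar>dnL u' m\<bar> * \<bar>dnL w m\<bar>" if m: "m \<in> ?X2" for m
			proof -
				have "K M0 * dnL u' m * dnL w m * dnL u' m \<le> K M0 * dnL u' m * dnL w m * b" using m b K0 by (intro mult_left_mono) auto
				then show ?thesis using eb[of m] m by (simp add: power2_eq_square mult_ac)
			qed
			have c1: "0 \<le> K M0 * (B / r ^ ?n)" using K0 B0 r1 by simp
			have c2: "0 \<le> K M0 * b" using K0 b0 by simp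
			note t1 = n2_product[OF lu(1)[OF sub(1)] lu(1)[OF sub(1)] c1 e1]
			note t2 = n2_product[OF lu(1)[OF sub(2)] lw(1)[OF sub(2)] c2 e2]
			have "(\<Sum>\<^sub>\<infinity>m\<in>?X1. \<bar>err w m\<bar>) \<le> K M0 * (B / r ^ ?n) * n2 ?X1 (dnL u') * n2 ?X1 (dnL u')" by (rule t1(4))
			also have "\<dots> = K M0 * (B / r ^ ?n) * (n2 ?X1 (dnL u') * n2 ?X1 (dnL u'))" by (simp only: mult.assoc)
			also have "\<dots> \<le> K M0 * (B / r ^ ?n) * (D u' * D u')"
				by (rule mult_left_mono[OF mult_mono[OF lu(2)[OF sub(1)] lu(2)[OF sub(1)]] c1]) (rule sn.p0 n2_nonneg)+
			finally have q1: "(\<Sum>\<^sub>\<infinity>m\<in>?X1. \<bar>err w m\<bar>) \<le> K M0 * (B / r ^ ?n) * (D u' * D u')" .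
			have "n2 ?X2 (dnL u') \<le> ?\<epsilon>" by (rule l2_subset(2)[OF lu(1)]) auto
			moreover have "n2 ?X2 (dnL w) \<le> Ck" using lw(2)[OF sub(2)] w(3) by linarith
			ultimately have "K M0 * b * (n2 ?X2 (dnL u') * n2 ?X2 (dnL w)) \<le> K M0 * b * (?\<epsilon> * Ck)"
				by (intro mult_left_mono[OF mult_mono c2] n2_nonneg)
			then have q2: "(\<Sum>\<^sub>\<infinity>m\<in>?X2. \<bar>err w m\<bar>) \<le> K M0 * b * ?\<epsilon> * Ck" using t2(4) by (simp add: mult.assoc)
			have "(\<Sum>\<^sub>\<infinity>m\<in>?X1 \<union> ?X2. \<bar>err w m\<bar>) = (\<Sum>\<^sub>\<infinity>m\<in>?X1. \<bar>err w m\<bar>) + (\<Sum>\<^sub>\<infinity>m\<in>?X2. \<bar>err w m\<bar>)"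
				by (rule infsum_Un_disjoint[OF t1(2) t2(2)]) auto
			moreover have "?X1 \<union> ?X2 = L - coreL" by auto
			ultimately have p2: "(\<Sum>\<^sub>\<infinity>m\<in>L - coreL. \<bar>err w m\<bar>) \<le> K M0 * (B / r ^ ?n) * (D u' * D u') + K M0 * b * ?\<epsilon> * Ck"
				using q1 q2 by simp
			have "(u' (l + \<sigma>) - u' l) $ j = HB Q u' w" using w(2)[OF u'_W] HB_sym[of w u'] by simp
			then show ?thesis using F(4)[OF w(1)] p1 p2 unfolding E_def by linarith
		qed
		have "dnL u' l \<le> (\<Sum>\<sigma>\<in>S. norm (u' (l + \<sigma>) - u' l))" unfolding dn_alt by (rule L2_set_le_sum) simp
		also have "\<dots> \<le> real (card S) * (real ?n * E)"
		proof (rule sum_bounded_above)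
			fix \<sigma> assume \<sigma>: "\<sigma> \<in> S"
			have "norm (u' (l + \<sigma>) - u' l) \<le> (\<Sum>j\<in>UNIV. \<bar>(u' (l + \<sigma>) - u' l) $ j\<bar>)" by (rule norm_le_l1_cart)
			also have "\<dots> \<le> real ?n * E" using comp[OF \<sigma>] by (rule sum_bounded_above)
			finally show "norm (u' (l + \<sigma>) - u' l) \<le> real ?n * E" .
		qed
		also have "\<dots> = C1 / r ^ ?n + C2 * ?\<epsilon> * b"
		proof -
			have "E = (C * (real (card F) * B) + K M0 * B * (D u' * D u')) / r ^ ?n + (K M0 * Ck) * ?\<epsilon> * b"
				unfolding E_def by (simp add: add_divide_distrib algebra_simps)
			then show ?thesis unfolding C1_def C2_def by (simp add: algebra_simps)
		qed
		finally show ?thesis .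
	qed
	have "0 \<le> C1" unfolding C1_def using F(3) B0 K0 sn.p0 by (intro mult_nonneg_nonneg add_nonneg_nonneg) auto
	moreover have "0 \<le> C2" unfolding C2_def using Ck(1) K0 by (intro mult_nonneg_nonneg) auto
	ultimately show thesis
	proof (rule that)
		show "1 \<le> max 1 (2 * rF)" by simp
		show "dnL u' l \<le> C1 / r ^ ?n + C2 * n2 (L - ball 0 (r / 2)) (dnL u') * b"
			if "max 1 (2 * rF) \<le> r" "0 \<le> b" "\<forall>m\<in>L. r / 2 \<le> norm m --> dnL u' m \<le> b" "l \<in> L" "r \<le> norm l" for r b l
			using that by (rule main)
	qed
qed

lemma decay:
	obtains Cd r0 where "0 \<le> Cd" "1 \<le> r0" "R1 \<le> r0" "!!l. l \<in> \<Lambda> ==> r0 \<le> norm l ==> dn St ub l \<le> Cd / norm l ^ CARD('d)"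
proof -
	let ?n = "CARD('d)"
	obtain C1 C2 r1 where C: "0 \<le> C1" "0 \<le> C2" "1 \<le> r1"
		"!!r b l. r1 \<le> r ==> 0 \<le> b ==> \<forall>m\<in>L. r / 2 \<le> norm m --> dnL u' m \<le> b ==> l \<in> L ==> r \<le> norm l ==>
			 dnL u' l \<le> C1 / r ^ ?n + C2 * n2 (L - ball 0 (r / 2)) (dnL u') * b"
		by (rule decay_step) (rule that, assumption+)
	\<comment> \<open>Passing from radius r/2 to r costs 2^d, so this choice leaves a factor of at most
	  1/2 in front of the previous bound.\<close>
	define \<epsilon> where "\<epsilon> = 1 / (2 * 2 ^ ?n * (C2 + 1))"
	have \<epsilon>: "0 < \<epsilon>" using C(2) by (simp add: \<epsilon>_def)
	have C2\<epsilon>: "C2 * \<epsilon> * 2 ^ ?n \<le> 1 / 2"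
	proof -
		have "C2 * \<epsilon> * 2 ^ ?n = C2 / (C2 + 1) / 2" by (simp add: \<epsilon>_def)
		also have "\<dots> \<le> 1 / 2" using C(2) by simp
		finally show ?thesis .
	qed
	have l2u: "l2 L (dnL u')" using u'_W by (simp add: Wd_def)
	obtain F where F: "finite F" "F \<subseteq> L" "n2 (L - F) (dnL u') < \<epsilon>" using l2_tail[OF l2u \<epsilon>] by blast
	define s where "s = (\<Sum>m\<in>F. norm m) + 1"
	have s: "norm m < s" if "m \<in> F" for m
		unfolding s_def using member_le_sum[OF that _ F(1), of norm] by simp
	define r0 where "r0 = max r1 (max s R1)"
	have r0: "1 \<le> r0" "r1 \<le> r0" "s \<le> r0" "R1 \<le> r0" using C(3) by (auto simp: r0_def)
	have tail: "n2 (L - ball 0 r) (dnL u') \<le> \<epsilon>" if "r0 \<le> r" for r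
	proof -
		have "n2 (L - ball 0 r) (dnL u') \<le> n2 (L - F) (dnL u')"
		proof (rule l2_subset(2))
			show "l2 (L - F) (dnL u')" using l2_subset(1)[OF l2u] by blast
			show "L - ball 0 r \<subseteq> L - F" using s r0 that by force
		qed
		then show ?thesis using F(3) by linarith
	qed
	\<comment> \<open>Large enough for the trivial bound \<open>D u'\<close> at radius
	  \<open>r0\<close>, and for \<open>C1\<close> to fit into the half left by the
	  contraction.\<close>
	define a where "a = D u' * r0 ^ ?n + 2 * C1"
	have a: "0 \<le> a" "C1 \<le> a / 2" "D u' \<le> a / r0 ^ ?n"
	proof -
		have 1: "0 \<le> D u' * r0 ^ ?n" using sn.p0 r0 by simp
		then show "0 \<le> a" "C1 \<le> a / 2" using C(1) by (auto simp: a_def)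
		have "D u' = D u' * r0 ^ ?n / r0 ^ ?n" using r0 by simp
		also have "\<dots> \<le> a / r0 ^ ?n" using C(1) r0 by (intro divide_right_mono) (auto simp: a_def)
		finally show "D u' \<le> a / r0 ^ ?n" .
	qed
	have B: "\<forall>m\<in>L. 2 ^ k * r0 \<le> norm m --> dnL u' m \<le> a / (2 ^ k * r0) ^ ?n" for k
	proof (induction k)
		case 0
		then show ?case using a(3) dn_le_Dn[OF u'_W] by fastforce
	next
		case (Suc k)
		let ?r = "2 ^ Suc k * r0" and ?b = "a / (2 ^ k * r0) ^ ?n"
		have half: "?r / 2 = 2 ^ k * r0" by simp
		have rr: "r0 \<le> 2 ^ k * r0" "r0 \<le> ?r" using r0 mult_right_mono[of 1 "2 ^ k" r0] mult_right_mono[of 1 "2 ^ Suc k" r0]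
			one_le_power[of "2::real" k] one_le_power[of "2::real" "Suc k"] by auto
		have b0: "0 \<le> ?b" using a(1) r0 by simp
		have beq: "?b = 2 ^ ?n * (a / ?r ^ ?n)" by (simp add: power_mult_distrib)
		show ?case
		proof (intro ballI impI)
			fix l assume l: "l \<in> L" "?r \<le> norm l"
			have "dnL u' l \<le> C1 / ?r ^ ?n + C2 * n2 (L - ball 0 (?r / 2)) (dnL u') * ?b"
			proof (rule C(4)[OF _ b0 _ l])
				show "r1 \<le> ?r" using r0 rr by linarith
				show "\<forall>m\<in>L. ?r / 2 \<le> norm m --> dnL u' m \<le> ?b" unfolding half by (rule Suc)
			qed
			also have "C2 * n2 (L - ball 0 (?r / 2)) (dnL u') * ?b \<le> C2 * \<epsilon> * ?b"
				unfolding half using tail[OF rr(1)] C(2) b0 by (intro mult_right_mono mult_left_mono) auto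
			also have "\<dots> = (C2 * \<epsilon> * 2 ^ ?n) * (a / ?r ^ ?n)" unfolding beq by (simp only: mult.assoc)
			also have "\<dots> \<le> 1 / 2 * (a / ?r ^ ?n)" using a(1) r0 by (intro mult_right_mono C2\<epsilon>) auto
			also have "C1 / ?r ^ ?n + 1 / 2 * (a / ?r ^ ?n) = (C1 + a / 2) / ?r ^ ?n" by (simp add: add_divide_distrib)
			also have "\<dots> \<le> a / ?r ^ ?n" using a(2) r0 by (intro divide_right_mono) auto
			finally show "dnL u' l \<le> a / ?r ^ ?n" by simp
		qed
	qed
	have main: "dn St ub l \<le> (a * 2 ^ ?n) / norm l ^ ?n" if l: "l \<in> \<Lambda>" "r0 \<le> norm l" for l
	proof -
		have lL: "l \<in> L" using far_L[OF l(1)] l(2) r0 R1 by linarith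
		\<comment> \<open>The least such \<open>k\<close> puts \<open>norm l\<close> between two
		  consecutive dyadic radii, at the cost of another factor 2^d.\<close>
		let ?P = "\<lambda>k. norm l < 2 ^ k * r0"
		obtain k where "norm l / r0 < 2 ^ k" using real_arch_pow[of 2 "norm l / r0"] by auto
		then have ex: "?P k" using r0 by (simp add: field_simps)
		define k' where "k' = (LEAST k. ?P k)"
		have k': "?P k'" unfolding k'_def using ex by (rule LeastI)
		then have "k' \<noteq> 0" using l(2) by (intro notI) simp
		then obtain j where j: "k' = Suc j" using not0_implies_Suc by blast
		then have "\<not> ?P j" unfolding k'_def using not_less_Least[of j ?P] by simp
		then have lo: "2 ^ j * r0 \<le> norm l" by simp
		have hi: "norm l / 2 \<le> 2 ^ j * r0" using k' unfolding j by simp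
		have nl: "0 < norm l" using l(2) r0 by linarith
		have "dn St ub l = dnL u' l" using l r0 by (intro u'_far(2)[symmetric]) auto
		also have "\<dots> \<le> a / (2 ^ j * r0) ^ ?n" using B lL lo by blast
		also have "\<dots> \<le> a / (norm l / 2) ^ ?n" using hi a(1) nl r0 by (intro divide_left_mono power_mono mult_pos_pos zero_less_power) auto
		also have "\<dots> = (a * 2 ^ ?n) / norm l ^ ?n" by (simp add: power_divide)
		finally show ?thesis .
	qed
	have "0 \<le> a * 2 ^ ?n" using a(1) by simp
	then show thesis using r0(1,4) main by (rule that)
qed

section \<open>The linearised problems\<close>

text \<open>\<open>perturbed_minimiser\<close> is applied at \<open>ub\<close> to the linearised
  energy: the residual is at most a multiple of R^(-3d/2), and half of \<open>c\<close> survives the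
  linearisation of the Hessian outside \<Omega>.\<close>

lemma linearised_solutions:
	"\<exists>C>0. \<exists>R0>0. \<forall>R \<Omega>. R \<ge> R0 \<and> ball 0 R \<inter> \<Lambda> \<subseteq> \<Omega> \<and> \<Omega> \<subseteq> \<Lambda> -->
		(\<exists>u. local_minimiser \<T> \<Lambda> (energy_lin \<T> \<Lambda> St V Vhom \<Omega>) u \<and>
				 strongly_stable \<T> \<Lambda> (energy_lin \<T> \<Lambda> St V Vhom \<Omega>) u \<and>
				 L2_norm (\<lambda>x. grad \<T> \<Lambda> u x - grad \<T> \<Lambda> ub x) \<le> C * R powr (- 3 * real CARD('d) / 2) \<and>
				 \<bar>energy \<T> \<Lambda> St V u - energy \<T> \<Lambda> St V ub\<bar> \<le> C * R powr (- 2 * real CARD('d)))"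
proof -
	let ?n = "CARD('d)"
	obtain Cd r0 where dec: "0 \<le> Cd" "1 \<le> r0" "R1 \<le> r0" "!!l. l \<in> \<Lambda> ==> r0 \<le> norm l ==> dn St ub l \<le> Cd / norm l ^ ?n"
		by (rule decay) (rule that, assumption+)
	obtain Ct where Ct: "0 \<le> Ct" "\<forall>R K f. 1 \<le> R --> 0 \<le> K --> (\<forall>l\<in>L - ball 0 R. \<bar>f l\<bar> \<le> K / norm l ^ ?n) -->
		 l2 (L - ball 0 R) f \<and> (n2 (L - ball 0 R) f)\<^sup>2 \<le> Ct * K\<^sup>2 / R ^ ?n"
	proof (rule tail_sum)
		fix C assume C: "0 \<le> C" and *: "!!R K f. 1 \<le> R ==> 0 \<le> K ==> (!!l. l \<in> L - ball 0 R ==> \<bar>f l\<bar> \<le> K / norm l ^ ?n) ==>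
		 l2 (L - ball 0 R) f \<and> (n2 (L - ball 0 R) f)\<^sup>2 \<le> C * K\<^sup>2 / R ^ ?n"
		show thesis
		proof (rule that[OF C], intro allI impI)
			fix R K :: real and f assume "1 \<le> R" "0 \<le> K" "\<forall>l\<in>L - ball 0 R. \<bar>f l\<bar> \<le> K / norm l ^ ?n"
			then show "l2 (L - ball 0 R) f \<and> (n2 (L - ball 0 R) f)\<^sup>2 \<le> C * K\<^sup>2 / R ^ ?n" by (intro *) auto
		qed
	qed
	obtain Cw :: real where Cw: "0 < Cw" "!!u. u \<in> Wd \<Lambda> St ==> u \<in> W_12 \<T> \<Lambda> \<and> W_norm \<T> \<Lambda> u \<le> Cw * Dn \<Lambda> St u" by (rule W_norm_le_Dn) blast
	define M where "M = M0 + 2"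
	have M00: "0 \<le> M0" by (rule N.sn.p0)
	define \<tau>1 where "\<tau>1 = K M0 * (sqrt Ct * Cd\<^sup>2)"
	have \<tau>10: "0 \<le> \<tau>1" using K0 Ct(1) by (simp add: \<tau>1_def)
	\<comment> \<open>The radius for \<open>perturbed_minimiser\<close>, with c/2 in the role of its
	  constant; it depends neither on \<open>R\<close> nor on \<Omega>.\<close>
	define \<rho> where "\<rho> = min 1 (c / 2 / (10 * (K M + 1)))"
	have \<rho>: "0 < \<rho>" "\<rho> \<le> 1" "10 * (K M * \<rho>) \<le> c / 2"
	proof -
		show "0 < \<rho>" "\<rho> \<le> 1" using c0 K0[of M] by (auto simp: \<rho>_def)
		have "10 * (K M * \<rho>) \<le> 10 * ((K M + 1) * (c / 2 / (10 * (K M + 1))))"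
			using K0[of M] \<open>0 < \<rho>\<close> by (intro mult_left_mono mult_mono) (auto simp: \<rho>_def)
		also have "\<dots> = c / 2" using K0[of M] by (simp add: field_simps)
		finally show "10 * (K M * \<rho>) \<le> c / 2" .
	qed
	\<comment> \<open>The summands ensure, in turn, that 1 \<le> R, that the decay estimate applies,
	  that the Hessian loses at most c/2, and that 4 \<tau> < (c/2) \<rho> for \<tau> = \<tau>1
	  R^(-3d/2).\<close>
	define R0 where "R0 = 1 + r0 + 2 * (K M0 * Cd) / c + 8 * \<tau>1 / (c * \<rho>)"
	define \<kappa> where "\<kappa> = 8 * \<tau>1 / c"
	have \<kappa>0: "0 \<le> \<kappa>" using \<tau>10 c0 by (simp add: \<kappa>_def)
	\<comment> \<open>The first summand serves the gradient error, the second the energy error;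
	  \<kappa> is the factor 4/(c/2) of the distance bound times \<tau>1.\<close>
	define C where "C = Cw * \<kappa> + 2 * (K M * \<kappa>\<^sup>2) + 1"
	have Cpos: "0 < C" using Cw(1) \<kappa>0 K0[of M] by (simp add: C_def add_nonneg_pos)
	have pos: "0 \<le> 2 * (K M0 * Cd) / c" "0 \<le> 8 * \<tau>1 / (c * \<rho>)" using K0 dec(1) c0 \<tau>10 \<rho>(1) by simp_all
	have R0pos: "0 < R0" using dec(2) pos by (simp add: R0_def)
	have "\<exists>u. local_minimiser \<T> \<Lambda> (energy_lin \<T> \<Lambda> St V Vhom \<Omega>) u \<and>
				 strongly_stable \<T> \<Lambda> (energy_lin \<T> \<Lambda> St V Vhom \<Omega>) u \<and>
				 L2_norm (\<lambda>x. grad \<T> \<Lambda> u x - grad \<T> \<Lambda> ub x) \<le> C * R powr (- 3 * real ?n / 2) \<and>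
				 \<bar>energy \<T> \<Lambda> St V u - energy \<T> \<Lambda> St V ub\<bar> \<le> C * R powr (- 2 * real ?n)"
		if R: "R0 \<le> R" and \<Omega>: "ball 0 R \<inter> \<Lambda> \<subseteq> \<Omega>" "\<Omega> \<subseteq> \<Lambda>" for R \<Omega>
	proof -
		have R1': "1 \<le> R" "r0 \<le> R" "2 * (K M0 * Cd) / c \<le> R" "8 * \<tau>1 / (c * \<rho>) < R"
			using R pos dec(2) by (auto simp: R0_def)
		have RR: "Rdef \<le> R" "R1 \<le> R" using dec(3) R1 R1'(2) by linarith+
		then have \<Omega>d: "ball 0 Rdef \<inter> \<Lambda> \<subseteq> \<Omega>" using \<Omega>(1) subset_ball[OF RR(1), of 0] by blast
		interpret ME: mesh_energy A S Rdef rcut \<Lambda> \<T> St "Vo \<Omega>" "dVo \<Omega>" "ddVo \<Omega>" K Lc KL "energy_lin \<T> \<Lambda> St V Vhom \<Omega>"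
			by (rule mesh_energy_Vo[OF \<Omega>d \<Omega>(2)])
		have out: "R \<le> norm l" "Rdef \<le> norm l" "St l = S" "dVo \<Omega> l = (\<lambda>g h. dir_deriv Vhom zf h + Q g h)"
				"ddVo \<Omega> l = (\<lambda>g. Q)" "dn St ub l \<le> Cd / norm l ^ ?n" if l: "l \<in> \<Lambda>" "l \<notin> \<Omega>" for l
		proof -
			have "l \<notin> ball 0 R" using l \<Omega>(1) by blast
			then show 1: "R \<le> norm l" by simp
			then show "Rdef \<le> norm l" using RR by linarith
			then show "St l = S" using St_hom l by blast
			show "dVo \<Omega> l = (\<lambda>g h. dir_deriv Vhom zf h + Q g h)" "ddVo \<Omega> l = (\<lambda>g. Q)" using l by (auto simp: dVo_def ddVo_def)
			show "dn St ub l \<le> Cd / norm l ^ ?n" using dec(4)[OF l(1)] 1 R1'(2) by linarith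
		qed
		have ins: "dVo \<Omega> l = dVo \<Lambda> l" "ddVo \<Omega> l = ddVo \<Lambda> l" if "l \<in> \<Omega>" for l
			using that \<Omega>(2) by (auto simp: dVo_def ddVo_def)
		have nub: "nrm S (stencil_diff S ub l) \<le> M0" if "l \<in> \<Lambda>" "l \<notin> \<Omega>" for l
			using M0[OF that(1)] out(3)[OF that] by (simp add: dn_def)
		define q where "q = R powr (- 3 * real ?n / 2)"
		have q0: "0 \<le> q" by (simp add: q_def)
		have qq: "q\<^sup>2 = R powr (- 3 * real ?n)" unfolding q_def power2_eq_square powr_add[symmetric] by simp
		have qq': "q\<^sup>2 = 1 / (R ^ ?n * R ^ ?n * R ^ ?n)"
		proof -
			have "q\<^sup>2 = R powr - real (?n + ?n + ?n)" unfolding qq by (intro arg_cong[where f="\<lambda>t. R powr t"]) simp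
			also have "\<dots> = inverse (R ^ (?n + ?n + ?n))" using R1'(1) by (simp only: powr_minus powr_realpow)
			finally show ?thesis by (simp only: power_add inverse_eq_divide)
		qed
		\<comment> \<open>The energy error will be of order q^2 = R^(-3d), which is below R^(-2d).\<close>
		have q2n: "q\<^sup>2 \<le> R powr (- 2 * real ?n)" unfolding qq using R1'(1) by (intro powr_mono) auto
		have q1: "q \<le> 1 / R"
		proof -
			have "q \<le> R powr (- 1)" unfolding q_def using R1'(1) dim2 by (intro powr_mono) auto
			also have "\<dots> = 1 / R" using R1'(1) by (simp add: powr_minus divide_inverse)
			finally show ?thesis .
		qed
		\<comment> \<open>This weight bounds the residual site by site. One factor R^(-d) is taken out of
		  |l|^(-2d), so that \<open>tail_sum\<close> applies to the remaining |l|^(-d) and the l2 norm is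
		  of order R^(-d) R^(-d/2).\<close>
		define f where "f l = (if l \<in> \<Omega> then 0 else (dn St ub l)\<^sup>2)" for l
		have f: "l2 \<Lambda> f" "n2 \<Lambda> f \<le> sqrt Ct * Cd\<^sup>2 * q"
		proof -
			have "l2 (L - ball 0 R) f \<and> (n2 (L - ball 0 R) f)\<^sup>2 \<le> Ct * (Cd\<^sup>2 / R ^ ?n)\<^sup>2 / R ^ ?n"
			proof (rule Ct(2)[rule_format, OF R1'(1)])
				show "0 \<le> Cd\<^sup>2 / R ^ ?n" using R1'(1) by simp
				fix l assume l: "l \<in> L - ball 0 R"
				then have nl: "R \<le> norm l" by simp
				have lL: "l \<in> \<Lambda>" using far_\<Lambda> l nl RR(1) by auto
				have d: "dn St ub l \<le> Cd / norm l ^ ?n" using dec(4)[OF lL] nl R1'(2) by linarith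
				have "\<bar>f l\<bar> \<le> (dn St ub l)\<^sup>2" by (simp add: f_def)
				also have "\<dots> \<le> (Cd / norm l ^ ?n)\<^sup>2" using d by (intro power_mono) auto
				also have "\<dots> = Cd\<^sup>2 / norm l ^ ?n / norm l ^ ?n" by (simp add: power2_eq_square)
				also have "\<dots> \<le> Cd\<^sup>2 / R ^ ?n / norm l ^ ?n"
					using nl R1'(1) by (intro divide_right_mono divide_left_mono power_mono mult_pos_pos zero_less_power) auto
				finally show "\<bar>f l\<bar> \<le> Cd\<^sup>2 / R ^ ?n / norm l ^ ?n" .
			qed
			then have L: "l2 (L - ball 0 R) f" "(n2 (L - ball 0 R) f)\<^sup>2 \<le> Ct * (Cd\<^sup>2 / R ^ ?n)\<^sup>2 / R ^ ?n" by auto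
			have z1: "f l = 0" if "l \<in> \<Lambda> - (L - ball 0 R)" for l
			proof (cases "l \<in> ball 0 R")
				case True
				then show ?thesis using that \<Omega>(1) by (auto simp: f_def)
			next
				case False
				then show ?thesis using that far_L[of l] RR(1) by (auto simp: not_less)
			qed
			have z2: "l \<in> \<Lambda>" if "l \<in> L - ball 0 R" for l using that far_\<Lambda>[of l] RR(1) by auto
			show "l2 \<Lambda> f"
				using L(1) unfolding l2_def by (rule iffD1[OF summable_on_cong_neutral, rotated -1]) (use z1 z2 in auto)
			have "n2 \<Lambda> f = n2 (L - ball 0 R) f"
				unfolding n2_def by (intro arg_cong[where f=sqrt] infsum_cong_neutral) (use z1 z2 in auto)
			moreover have "n2 (L - ball 0 R) f \<le> sqrt Ct * Cd\<^sup>2 * q"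
			proof (rule power2_le_imp_le)
				have "Ct * (Cd\<^sup>2 / R ^ ?n)\<^sup>2 / R ^ ?n = (sqrt Ct * Cd\<^sup>2 * q)\<^sup>2"
					unfolding power_mult_distrib qq' using Ct(1) by (simp add: power2_eq_square)
				then show "(n2 (L - ball 0 R) f)\<^sup>2 \<le> (sqrt Ct * Cd\<^sup>2 * q)\<^sup>2" using L(2) by simp
				show "0 \<le> sqrt Ct * Cd\<^sup>2 * q" using Ct(1) q0 by simp
			qed
			ultimately show "n2 \<Lambda> f \<le> sqrt Ct * Cd\<^sup>2 * q" by simp
		qed
		\<comment> \<open>Subtracting \<open>E0.dG ub v = 0\<close> removes \<open>Lc\<close> and all
		  sites in \<Omega>; what remains is the Taylor remainder of \<open>Vhom\<close> at the other
		  sites.\<close>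
		have force: "\<bar>ME.E.dG ub v\<bar> \<le> (\<tau>1 * q) * N.D v" if v: "v \<in> N.W" for v
		proof -
			let ?a = "\<lambda>l. dVo \<Omega> l (E0.sd ub l) (E0.sd v l) - dVo \<Omega> l zf (E0.sd v l)"
			let ?b = "\<lambda>l. dVo \<Lambda> l (E0.sd ub l) (E0.sd v l) - dVo \<Lambda> l zf (E0.sd v l)"
			have sa: "?a summable_on \<Lambda>" "?b summable_on \<Lambda>" using ME.E.dV_summable[OF ub v] E0.dV_summable[OF ub v] by auto
			have "ME.E.dG ub v = ME.E.dG ub v - E0.dG ub v" using crit[OF v] by simp
			also have "\<dots> = (\<Sum>\<^sub>\<infinity>l\<in>\<Lambda>. ?a l - ?b l)" unfolding infsum_diff_real(2)[OF sa] ME.E.dG_def E0.dG_def by simp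
			finally have eq: "ME.E.dG ub v = (\<Sum>\<^sub>\<infinity>l\<in>\<Lambda>. ?a l - ?b l)" .
			have l2v: "l2 \<Lambda> (dn St v)" using v by (simp add: Wd_def)
			have "\<bar>\<Sum>\<^sub>\<infinity>l\<in>\<Lambda>. ?a l - ?b l\<bar> \<le> K M0 * n2 \<Lambda> f * n2 \<Lambda> (dn St v)"
			proof (rule n2_product(3)[OF f(1) l2v K0])
				fix l assume l: "l \<in> \<Lambda>"
				show "\<bar>?a l - ?b l\<bar> \<le> K M0 * \<bar>f l\<bar> * \<bar>dn St v l\<bar>"
				proof (cases "l \<in> \<Omega>")
					case True
					then show ?thesis using ins[OF True] by (simp add: f_def)
				next
					case False
					note o = out[OF l False]
					let ?x = "dir_deriv Vhom (sdL ub l) (sdL v l) - dir_deriv Vhom zf (sdL v l) - Q (sdL ub l) (sdL v l)"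
					have eq: "?a l - ?b l = - ?x"
						using o(3-4) far_Vo[OF l o(2)] dder_hom_zero[of "sdL v l"] by simp
					have fl: "\<bar>f l\<bar> = (nrm S (sdL ub l))\<^sup>2" "\<bar>dn St v l\<bar> = nrm S (sdL v l)" using False o(3) by (simp_all add: f_def dn_def)
					have "\<bar>?x\<bar> \<le> K M0 * (nrm S (sdL ub l))\<^sup>2 * nrm S (sdL v l)"
						using nub[OF l False] by (intro hom_taylor(1)[OF _ _ stencil_space_zero]) auto
					then show ?thesis unfolding eq fl abs_minus_cancel .
				qed
			qed
			also have "\<dots> \<le> K M0 * (sqrt Ct * Cd\<^sup>2 * q) * n2 \<Lambda> (dn St v)"
				using f(2) K0 by (intro mult_right_mono mult_left_mono) auto
			also have "\<dots> = (\<tau>1 * q) * N.D v" by (simp add: \<tau>1_def Dn_def)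
			finally show ?thesis unfolding eq .
		qed
		\<comment> \<open>The perturbation of the Hessian only has to be small, so the decay of the
		  stencil norm is used in the cruder form \<open>Cd / R\<close>.\<close>
		have hess: "c / 2 * (N.D v)\<^sup>2 \<le> ME.E.ddG ub v v" if v: "v \<in> N.W" for v
		proof -
			let ?a = "\<lambda>l. ddVo \<Omega> l (E0.sd ub l) (E0.sd v l) (E0.sd v l)"
			let ?b = "\<lambda>l. ddVo \<Lambda> l (E0.sd ub l) (E0.sd v l) (E0.sd v l)"
			let ?k = "K M0 * (Cd / R)"
			have sa: "?a summable_on \<Lambda>" "?b summable_on \<Lambda>" using ME.E.ddV_summable[OF ub v v] E0.ddV_summable[OF ub v v] by auto
			have eq: "ME.E.ddG ub v v - E0.ddG ub v v = (\<Sum>\<^sub>\<infinity>l\<in>\<Lambda>. ?a l - ?b l)" unfolding infsum_diff_real(2)[OF sa] ME.E.ddG_def E0.ddG_def by simp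
			have l2v: "l2 \<Lambda> (dn St v)" using v by (simp add: Wd_def)
			have k0: "0 \<le> ?k" using K0 dec(1) R1'(1) by simp
			have "\<bar>\<Sum>\<^sub>\<infinity>l\<in>\<Lambda>. ?a l - ?b l\<bar> \<le> ?k * n2 \<Lambda> (dn St v) * n2 \<Lambda> (dn St v)"
			proof (rule n2_product(3)[OF l2v l2v k0])
				fix l assume l: "l \<in> \<Lambda>"
				show "\<bar>?a l - ?b l\<bar> \<le> ?k * \<bar>dn St v l\<bar> * \<bar>dn St v l\<bar>"
				proof (cases "l \<in> \<Omega>")
					case True
					then have "?a l - ?b l = 0" using ins[OF True] by simp
					then show ?thesis using mult_nonneg_nonneg[OF mult_nonneg_nonneg[OF k0 abs_ge_zero] abs_ge_zero] by (simp only: abs_zero)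
				next
					case False
					note o = out[OF l False]
					have "R \<le> norm l ^ ?n" using o(1) R1'(1) power_increasing[of 1 ?n "norm l"] dim2 by simp
					then have "Cd / norm l ^ ?n \<le> Cd / R" using dec(1) R1'(1) by (intro divide_left_mono mult_pos_pos) auto
					then have d: "nrm S (sdL ub l) \<le> Cd / R" using o(3,6) by (simp add: dn_def)
					let ?x = "dder Vhom (sdL ub l) (sdL v l) (sdL v l) - Q (sdL v l) (sdL v l)"
					have eq: "?a l - ?b l = - ?x" using o(3,5) far_Vo[OF l o(2)] by simp
					have dv: "\<bar>dn St v l\<bar> = nrm S (sdL v l)" using o(3) by (simp add: dn_def)
					have "\<bar>?x\<bar> \<le> K M0 * nrm S (sdL ub l) * nrm S (sdL v l) * nrm S (sdL v l)"
						using nub[OF l False] by (intro hom_taylor(2)) auto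
					also have "\<dots> \<le> ?k * nrm S (sdL v l) * nrm S (sdL v l)"
						using d K0 by (intro mult_right_mono mult_left_mono) auto
					finally show ?thesis unfolding eq dv abs_minus_cancel .
				qed
			qed
			also have "\<dots> = ?k * (N.D v)\<^sup>2" by (simp add: Dn_def power2_eq_square)
			also have "\<dots> \<le> c / 2 * (N.D v)\<^sup>2"
			proof (rule mult_right_mono)
				show "?k \<le> c / 2" using R1'(1,3) c0 by (simp add: field_simps)
			qed simp
			finally have "E0.ddG ub v v - c / 2 * (N.D v)\<^sup>2 \<le> ME.E.ddG ub v v" using eq by linarith
			moreover have "c * (N.D v)\<^sup>2 - c / 2 * (N.D v)\<^sup>2 = c / 2 * (N.D v)\<^sup>2" by (simp add: field_simps)
			ultimately show ?thesis using stab[OF v] by linarith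
		qed
		have small: "4 * (\<tau>1 * q) < c / 2 * \<rho>"
		proof -
			have "4 * (\<tau>1 * q) \<le> 4 * (\<tau>1 * (1 / R))" using q1 \<tau>10 by (intro mult_left_mono) auto
			also have "\<dots> < c / 2 * \<rho>" using R1'(1,4) c0 \<rho>(1) by (simp add: field_simps)
			finally show ?thesis .
		qed
		have \<tau>q: "0 \<le> \<tau>1 * q" using \<tau>10 q0 by simp
		have c2: "0 < c / 2" using c0 by simp
		obtain u where u: "u \<in> N.W" "N.D (u .- ub) \<le> 4 * (\<tau>1 * q) / (c / 2)"
			and min: "\<exists>s>0. \<forall>v\<in>N.W. N.D (v .- u) < s --> ME.E.G u \<le> ME.E.G v"
			and crit_u: "\<forall>v\<in>N.W. ME.E.dG u v = 0" and stab_u: "\<forall>v\<in>N.W. c / 2 / 2 * (N.D v)\<^sup>2 \<le> ME.E.ddG u v v"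
			using ME.E.perturbed_minimiser[OF ub c2 hess M_def \<rho> force \<tau>q small] by blast
		define v where "v = (u .- ub)"
		have vW: "v \<in> N.W" unfolding v_def using u(1) ub by (rule Wd_diff)
		have Dv0: "0 \<le> N.D v" by (rule N.sn.p0)
		have Dv: "N.D v \<le> \<kappa> * q" using u(2) by (simp add: v_def \<kappa>_def)
		have "4 * (\<tau>1 * q) / (c / 2) < \<rho>" using small c0 by (simp add: field_simps)
		then have Dv1: "N.D v \<le> 1" using u(2) \<rho>(2) unfolding v_def by linarith
		have "local_minimiser \<T> \<Lambda> (energy_lin \<T> \<Lambda> St V Vhom \<Omega>) u"
			using min ME.local_minimiserI[OF u(1)] by blast
		moreover have "strongly_stable \<T> \<Lambda> (energy_lin \<T> \<Lambda> St V Vhom \<Omega>) u"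
			using ME.strongly_stableI[OF u(1), of "c / 2 / 2"] crit_u stab_u c0 by simp
		moreover have "L2_norm (\<lambda>x. grad \<T> \<Lambda> u x - grad \<T> \<Lambda> ub x) \<le> C * q"
		proof -
			have "L2_norm (\<lambda>x. grad \<T> \<Lambda> u x - grad \<T> \<Lambda> ub x) = W_norm \<T> \<Lambda> v" unfolding v_def by (rule W_norm_diff)
			also have "\<dots> \<le> Cw * N.D v" using Cw(2)[OF vW] by blast
			also have "\<dots> \<le> Cw * (\<kappa> * q)" using Dv Cw(1) by (intro mult_left_mono) auto
			also have "\<dots> = (Cw * \<kappa>) * q" by simp
			also have "\<dots> \<le> C * q" using q0 K0[of M] by (intro mult_right_mono) (auto simp: C_def)
			finally show ?thesis .
		qed
		moreover have "\<bar>energy \<T> \<Lambda> St V u - energy \<T> \<Lambda> St V ub\<bar> \<le> C * R powr (- 2 * real ?n)"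
		proof -
			have en: "energy \<T> \<Lambda> St V y = E0.G y" if "y \<in> N.W" for y
				unfolding energy_eq by (rule energy_lin_eq[OF _ order_refl that]) blast
			have uv: "(ub .+ v) = u" by (simp add: v_def)
			have "\<bar>E0.G u - E0.G ub - E0.dG ub v - E0.ddG ub v v / 2\<bar> \<le> K M * N.D v * N.D v * N.D v"
				using E0.G_taylor[OF ub vW, of M] Dv1 M00 unfolding uv by (simp add: M_def)
			moreover have "\<bar>E0.ddG ub v v\<bar> \<le> K M * N.D v * N.D v" by (rule E0.ddG_bound[OF ub _ vW vW]) (simp add: M_def)
			moreover have "E0.dG ub v = 0" by (rule crit[OF vW])
			moreover have "K M * N.D v * N.D v * N.D v \<le> K M * N.D v * N.D v * 1"
				using Dv1 Dv0 K0 by (intro mult_left_mono mult_nonneg_nonneg) auto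
			ultimately have "\<bar>E0.G u - E0.G ub\<bar> \<le> 2 * (K M * (N.D v)\<^sup>2)" unfolding power2_eq_square mult.assoc by linarith
			also have "\<dots> \<le> 2 * (K M * (\<kappa> * q)\<^sup>2)" using Dv Dv0 K0 by (intro mult_left_mono power_mono) auto
			also have "\<dots> = 2 * (K M * \<kappa>\<^sup>2) * q\<^sup>2" by (simp add: power_mult_distrib)
			also have "\<dots> \<le> C * q\<^sup>2" using Cw(1) \<kappa>0 by (intro mult_right_mono) (auto simp: C_def)
			also have "\<dots> \<le> C * R powr (- 2 * real ?n)" using q2n Cpos by (intro mult_left_mono) auto
			finally show ?thesis using en[OF u(1)] en[OF ub] by simp
		qed
		ultimately show ?thesis unfolding q_def by blast
	qed
	then show ?thesis using Cpos R0pos by blast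
qed

end

lemma C_k_cong:
	assumes "C_k k S f" "!!g. g \<in> stsp S ==> f' g = f g"
	shows "C_k k S (f' :: 'd::finite vfun => real)"
	using assms
proof (induction k arbitrary: f f')
	case 0
	have "continuous_on (stsp S) f' = continuous_on (stsp S) f" using 0(2) by (rule continuous_on_cong[OF refl])
	then show ?case using 0(1) by simp
next
	case (Suc k)
	have c: "continuous_on (stsp S) f' = continuous_on (stsp S) f" using Suc.prems(2) by (rule continuous_on_cong[OF refl])
	have l: "(\<lambda>t. f' (along g t h)) = (\<lambda>t. f (along g t h))" if "g \<in> stsp S" "h \<in> stsp S" for g h
		using Suc.prems(2) that by simp
	have "C_k k S (\<lambda>g. dir_deriv f' g h)" if h: "h \<in> stsp S" for h
	proof (rule Suc.IH)
		show "C_k k S (\<lambda>g. dir_deriv f g h)" using Suc.prems(1) h by simp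
		show "dir_deriv f' g h = dir_deriv f g h" if "g \<in> stsp S" for g unfolding dir_deriv_def l[OF that h] ..
	qed
	then show ?case using Suc.prems(1) c l by simp
qed

theorem theorem2p9:
  fixes A :: "real^'d^'d"
    and Rdef rcut :: real
    and \<Lambda> :: "(real^'d) set"
    and \<T> :: "(real^'d) set set"
    and St :: "real^'d \<Rightarrow> (real^'d) set"
    and Shom :: "(real^'d) set"
    and V :: "real^'d \<Rightarrow> (real^'d \<Rightarrow> real^'d) \<Rightarrow> real"
    and Vhom :: "(real^'d \<Rightarrow> real^'d) \<Rightarrow> real"
    and k :: nat
    and ubar :: "real^'d \<Rightarrow> real^'d"
  assumes dim: "CARD('d) \<in> {2, 3}"
    and A: "invertible A"
    and Rdef: "Rdef > 0"
    and config: "reference_configuration A Rdef \<Lambda>"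
    and mesh: "regular_partition \<T> \<Lambda>"
    and mesh_hom: "homogeneous_outside A Rdef \<T>"
    and rcut: "rcut > 0"
    and stencil: "\<forall>l\<in>\<Lambda>. St l \<subseteq> (ball 0 rcut \<inter> (\<lambda>x. x - l) ` \<Lambda>) - {0}"
    and stencil_edges: "\<forall>l \<rho>. (\<exists>T\<in>\<T>. closed_segment l (l + \<rho>) edge_of T) \<longrightarrow> \<rho> \<in> St l"
    and k: "k \<ge> 4"
    and V_Ck: "\<forall>l\<in>\<Lambda>. C_k k (St l) (V l)"
    and V_zero: "\<forall>l\<in>\<Lambda>. V l (\<lambda>_. 0) = 0"
    and St_hom: "\<forall>l\<in>\<Lambda>. norm l \<ge> Rdef \<longrightarrow> St l = Shom"
    and V_hom: "\<forall>l\<in>\<Lambda>. norm l \<ge> Rdef \<longrightarrow> (\<forall>g\<in>stencil_space Shom. V l g = Vhom g)"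
    and Shom_sym: "uminus ` Shom = Shom"
    and Vhom_sym: "\<forall>g\<in>stencil_space Shom. Vhom (\<lambda>\<rho>. - g (- \<rho>)) = Vhom g"
    and Shom_basis: "\<forall>n. A *v axis n 1 \<in> Shom"
    and ubar: "strongly_stable \<T> \<Lambda> (energy \<T> \<Lambda> St V) ubar"
  shows "\<exists>C>0. \<exists>R0>0. \<forall>R \<Omega>. R \<ge> R0 \<and> ball 0 R \<inter> \<Lambda> \<subseteq> \<Omega> \<and> \<Omega> \<subseteq> \<Lambda> \<longrightarrow>
    (\<exists>u. local_minimiser \<T> \<Lambda> (energy_lin \<T> \<Lambda> St V Vhom \<Omega>) u \<and>
         strongly_stable \<T> \<Lambda> (energy_lin \<T> \<Lambda> St V Vhom \<Omega>) u \<and>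
         L2_norm (\<lambda>x. grad \<T> \<Lambda> u x - grad \<T> \<Lambda> ubar x) \<le> C * R powr (- 3 * real CARD('d) / 2) \<and>
         \<bar>energy \<T> \<Lambda> St V u - energy \<T> \<Lambda> St V ubar\<bar> \<le> C * R powr (- 2 * real CARD('d)))"
proof -
	let ?L = "bravais_lattice A"
	\<comment> \<open>Facts about the lattice are needed to show that \<open>Shom\<close> is a finite
	  subset of it; until then the basis vectors serve as stencil.\<close>
	interpret B: hom_lattice A "range (\<lambda>n. A *v axis n 1)"
	proof
		show "range (\<lambda>n. A *v axis n 1) \<subseteq> ?L"
		proof (rule image_subsetI)
			fix n :: 'd
			have "\<forall>i. (axis n 1 :: real^'d) $ i \<in> \<int>" by (simp add: axis_def)
			then show "A *v axis n 1 \<in> ?L" unfolding bravais_lattice_def by blast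
		qed
	qed (use A in auto)
	have far: "l \<in> \<Lambda> \<longleftrightarrow> l \<in> ?L" if "Rdef \<le> norm l" for l
	proof -
		have "l \<notin> ball 0 Rdef" using that by simp
		moreover have "l \<in> \<Lambda> - ball 0 Rdef \<longleftrightarrow> l \<in> ?L - ball 0 Rdef" using config unfolding reference_configuration_def by metis
		ultimately show ?thesis by blast
	qed
	\<comment> \<open>The stencil at a site beyond \<open>Rdef + rcut\<close> is \<open>Shom\<close>,
	  and its neighbours are still lattice points; their differences from \<open>y\<close> are
	  therefore lattice vectors.\<close>
	obtain y where y: "y \<in> ?L" "Rdef + rcut \<le> norm y" using B.far_exists by blast
	have yR: "Rdef \<le> norm y" using y(2) rcut by linarith
	have y\<Lambda>: "y \<in> \<Lambda>" using far[OF yR] y(1) by blast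
	have Sy: "St y = Shom" using St_hom y\<Lambda> yR by blast
	have Sball: "Shom \<subseteq> ball 0 rcut \<inter> (\<lambda>x. x - y) ` \<Lambda>" using stencil y\<Lambda> Sy by blast
	have SL: "Shom \<subseteq> ?L"
	proof
		fix \<rho> assume "\<rho> \<in> Shom"
		then have "\<rho> \<in> (\<lambda>x. x - y) ` \<Lambda>" and n\<rho>: "norm \<rho> < rcut" using Sball by auto
		then obtain x where x: "\<rho> = x - y" "x \<in> \<Lambda>" by blast
		then have "Rdef \<le> norm x" using norm_triangle_ineq4[of x \<rho>] y(2) n\<rho> x(1) by simp
		then show "\<rho> \<in> ?L" unfolding x(1) using B.L_diff far x(2) y(1) by blast
	qed
	have Sfin: "finite Shom" by (rule finite_subset[OF _ B.fin_ball[of 0 rcut]]) (use SL Sball in blast)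
	interpret defect A Shom Rdef rcut \<Lambda> \<T> St
	proof
		show "T \<in> \<T> ==> closed_segment l (l + \<rho>) edge_of T ==> \<rho> \<in> St l" for T l \<rho> using stencil_edges by blast
	qed (use A Sfin SL Shom_basis Rdef config mesh rcut stencil St_hom in auto)
	have C3: "C_k 3 (St l) (V l)" if "l \<in> \<Lambda>" for l
	proof (rule C_k_mono)
		show "C_k k (St l) (V l)" using V_Ck that by blast
	qed (use k in simp)
	\<comment> \<open>\<open>Vhom\<close> inherits its regularity from a far site, where it agrees with
	  \<open>V y\<close> on the stencil space.\<close>
	have "C_k 3 Shom (V y)" using C3[OF y\<Lambda>] Sy by simp
	moreover have "Vhom g = V y g" if "g \<in> stsp Shom" for g using V_hom y\<Lambda> yR that by simp
	ultimately have "C_k 3 Shom Vhom" by (rule C_k_cong)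
	then obtain Kh where Kh: "!!M. 0 \<le> Kh M" "site_ok Shom Kh Vhom (dir_deriv Vhom) (dder Vhom)"
		using site_ok_exists[OF Sfin] by blast
	have "\<forall>l\<in>\<Lambda> \<inter> ball 0 Rdef. \<exists>K. (\<forall>M. 0 \<le> K M) \<and> site_ok (St l) K (V l) (dir_deriv (V l)) (dder (V l))"
		using site_ok_exists fin_St C3 by blast
	from bchoice[OF this] obtain Kc where Kc: "!!l M. l \<in> \<Lambda> \<inter> ball 0 Rdef ==> 0 \<le> Kc l M"
		"!!l. l \<in> \<Lambda> \<inter> ball 0 Rdef ==> site_ok (St l) (Kc l) (V l) (dir_deriv (V l)) (dder (V l))" by blast
	\<comment> \<open>The core has finitely many sites with nonnegative constants, so their sum
	  together with \<open>Kh\<close> dominates each of them.\<close>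
	define K where "K M = Kh M + (\<Sum>l\<in>\<Lambda> \<inter> ball 0 Rdef. Kc l M)" for M
	have s0: "0 \<le> (\<Sum>l\<in>\<Lambda> \<inter> ball 0 Rdef. Kc l M)" for M using Kc(1) by (rule sum_nonneg)
	interpret defect_model A Shom Rdef rcut \<Lambda> \<T> St V Vhom K
	proof
		show "2 \<le> CARD('d)" using dim by auto
		show "0 \<le> K M" for M unfolding K_def using Kh(1)[of M] s0[of M] by linarith
		show "site_ok (St l) K (V l) (dir_deriv (V l)) (dder (V l))" if l: "l \<in> \<Lambda>" "norm l < Rdef" for l
		proof (rule site_ok_mono)
			have l': "l \<in> \<Lambda> \<inter> ball 0 Rdef" using l by simp
			show "site_ok (St l) (Kc l) (V l) (dir_deriv (V l)) (dder (V l))" by (rule Kc(2)[OF l'])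
			show "Kc l M \<le> K M" for M
				unfolding K_def using member_le_sum[OF l', of "\<lambda>l. Kc l M"] Kc(1) fin\<Lambda> Kh(1)[of M] by force
		qed
		show "site_ok Shom K Vhom (dir_deriv Vhom) (dder Vhom)"
			by (rule site_ok_mono[OF Kh(2)]) (use s0 in \<open>simp add: K_def\<close>)
	qed (use V_zero V_hom in auto)
	have sub: "ball 0 Rdef \<inter> \<Lambda> \<subseteq> \<Lambda>" by blast
	interpret ME: mesh_energy A Shom Rdef rcut \<Lambda> \<T> St "Vo \<Lambda>" "dVo \<Lambda>" "ddVo \<Lambda>" K Lc KL "energy_lin \<T> \<Lambda> St V Vhom \<Lambda>"
		by (rule mesh_energy_Vo[OF sub order_refl])
	note st = ME.strongly_stableD[OF ubar[unfolded energy_eq]]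
	obtain c where c: "0 < c" "!!v. v \<in> N.W ==> c * (N.D v)\<^sup>2 \<le> E0.ddG ubar v v" using st(3) by blast
	interpret stable_defect A Shom Rdef rcut \<Lambda> \<T> St V Vhom K ubar c
		by unfold_locales (use st(1,2) c in auto)
	show ?thesis by (rule linearised_solutions)
qed

end
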